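(* Suppose that Artin algebras $A$ and $B$ are symmetric separably equivalent, with the equivalence defined by bimodules ${}_AP_B$ and ${}_BQ_A$. If the $A$-$A$-bimodule ${}_AP\otimes_BQ_A$ is centrally projective over $A$ and the $B$-$B$-bimodule ${}_BQ\otimes_AP_B$ is centrally projective over $B$, then $\mathrm{repdim}(A)=\mathrm{repdim}(B)$.
   Context: An Artin algebra is an algebra over a commutative Artin ring $k$ that is finitely generated as a $k$-module; $D$ denotes the usual duality for Artin algebras. For a (bi)module $X$, $\mathrm{add}(X)$ denotes the class of direct summands of direct sums of finitely many copies of $X$. The representation dimension of an Artin algebra $A$ is $$\mathrm{repdim}(A):=\inf\{\mathrm{gldim}(\mathrm{End}_A(M))\mid M={}_AA\oplus D(A_A)\oplus X,\ X \text{ a finitely generated left } A\text{-module}\},$$ where $\mathrm{gldim}$ is the global dimension. An $R$-$R$-bimodule $N$ is centrally projective over a ring $R$ if ${}_RN_R\in\mathrm{add}({}_RR_R)$. Let $R$ and $S$ be rings with identity. $R$ separably divides $S$ if there are bimodules ${}_RP_S$ and ${}_SQ_R$, finitely generated and projective as one-sided modules (on both sides), and a split epimorphism $\nu:{}_RP\otimes_SQ_R\to{}_RR_R$ of $R$-$R$-bimodules. $R$ symmetric separably divides $S$ if, in addition, the functors $F:={}_RP\otimes_S-$ from all left $S$-modules to all left $R$-modules and $G:={}_SQ\otimes_R-$ from all left $R$-modules to all left $S$-modules form an adjoint pair $(F,G)$, with $\nu$ the counit of the adjunction. $R$ and $S$ are symmetric separably equivalent (defined by ${}_RP_S$ and ${}_SQ_R$)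 if $R$ symmetric separably divides $S$ with split epimorphism $\nu:{}_RP\otimes_SQ_R\to{}_RR_R$ and adjoint pair $(F,G)$, and, with the same bimodules, $S$ symmetric separably divides $R$ with a split epimorphism $\mu:{}_SQ\otimes_RP_S\to{}_SS_S$ of $S$-$S$-bimodules and adjoint pair $(G,F)$ (with counit $\mu$). *)

theory Defs
  imports
    "HOL-Algebra.Module"
    "HOL-Algebra.QuotRing"
    "HOL-Algebra.Free_Abelian_Groups"
    "HOL-Library.Extended_Nat"
    "HOL-Library.Equipollence"
begin

text \<open>
  HOL-Algebra's \<^locale>\<open>module\<close> requires a commutative ring of scalars, so left modules and bimodules
  over arbitrary rings are set up here on the record types of HOL-Algebra.  The ring multiplication
  and unit of a module record carry no meaning for a left module or a bimodule and are left
  undefined.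

  HOL cannot quantify over the modules of all types inside a formula.  Wherever the mathematics
  speaks of all left modules over a ring (global dimension, injectivity, adjoint functors), the
  definitions below range over the left modules whose carrier is a set of elements of a type
  \<open>'u\<close>, passed as an argument \<open>TYPE('u)\<close>.  If \<open>'u\<close> is infinite and the carrier of the ring embeds
  in \<open>'u\<close>, every countably generated module occurs up to isomorphism and the modules that occur have
  free resolutions that occur as well.  This includes the cyclic modules, which determine the global
  dimension (Auslander), and the inclusions of left ideals, which determine injectivity (Baer), so
  that these notions do not depend on the choice of such a type.
\<close>


section \<open>Left modules\<close>

locale left_module = R?: ring R + M?: abelian_group M
  for R :: "('r, 'q) ring_scheme" (structure) and M :: "('r, 'x, 'm) module_scheme" (structure) +
  assumes smult_closed: "\<lbrakk>r \<in> carrier R; x \<in> carrier M\<rbrakk> \<Longrightarrow> r \<odot>\<^bsub>M\<^esub> x \<in> carrier M"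
    and smult_l_distr: "\<lbrakk>r \<in> carrier R; s \<in> carrier R; x \<in> carrier M\<rbrakk>
      \<Longrightarrow> (r \<oplus> s) \<odot>\<^bsub>M\<^esub> x = r \<odot>\<^bsub>M\<^esub> x \<oplus>\<^bsub>M\<^esub> s \<odot>\<^bsub>M\<^esub> x"
    and smult_r_distr: "\<lbrakk>r \<in> carrier R; x \<in> carrier M; y \<in> carrier M\<rbrakk>
      \<Longrightarrow> r \<odot>\<^bsub>M\<^esub> (x \<oplus>\<^bsub>M\<^esub> y) = r \<odot>\<^bsub>M\<^esub> x \<oplus>\<^bsub>M\<^esub> r \<odot>\<^bsub>M\<^esub> y"
    and smult_assoc: "\<lbrakk>r \<in> carrier R; s \<in> carrier R; x \<in> carrier M\<rbrakk>
      \<Longrightarrow> (r \<otimes> s) \<odot>\<^bsub>M\<^esub> x = r \<odot>\<^bsub>M\<^esub> (s \<odot>\<^bsub>M\<^esub> x)"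
    and smult_one: "x \<in> carrier M \<Longrightarrow> \<one> \<odot>\<^bsub>M\<^esub> x = x"

text \<open>Homomorphisms are extensional functions, so that equality of homomorphisms is equality.\<close>

definition lmod_hom ::
  "('r, 'q) ring_scheme \<Rightarrow> ('r, 'x, 'm) module_scheme \<Rightarrow> ('r, 'y, 'n) module_scheme \<Rightarrow> ('x \<Rightarrow> 'y) set"
  where "lmod_hom R M N = {f \<in> carrier M \<rightarrow>\<^sub>E carrier N.
    (\<forall>x\<in>carrier M. \<forall>y\<in>carrier M. f (x \<oplus>\<^bsub>M\<^esub> y) = f x \<oplus>\<^bsub>N\<^esub> f y) \<and>
    (\<forall>r\<in>carrier R. \<forall>x\<in>carrier M. f (r \<odot>\<^bsub>M\<^esub> x) = r \<odot>\<^bsub>N\<^esub> f x)}"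

definition lmod_iso ::
  "('r, 'q) ring_scheme \<Rightarrow> ('r, 'x, 'm) module_scheme \<Rightarrow> ('r, 'y, 'n) module_scheme \<Rightarrow> bool"
  where "lmod_iso R M N \<longleftrightarrow> (\<exists>f\<in>lmod_hom R M N. bij_betw f (carrier M) (carrier N))"

definition lmod_sum ::
  "('r, 'x, 'm) module_scheme \<Rightarrow> ('r, 'y, 'n) module_scheme \<Rightarrow> ('r, 'x \<times> 'y) module"
  where "lmod_sum M N =
    \<lparr>carrier = carrier M \<times> carrier N, monoid.mult = undefined, monoid.one = undefined,
     ring.zero = (\<zero>\<^bsub>M\<^esub>, \<zero>\<^bsub>N\<^esub>),
     add = (\<lambda>u v. (fst u \<oplus>\<^bsub>M\<^esub> fst v, snd u \<oplus>\<^bsub>N\<^esub> snd v)),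
     smult = (\<lambda>r u. (r \<odot>\<^bsub>M\<^esub> fst u, r \<odot>\<^bsub>N\<^esub> snd u))\<rparr>"

definition fin_gen :: "('r, 'q) ring_scheme \<Rightarrow> ('r, 'x, 'm) module_scheme \<Rightarrow> bool"
  where "fin_gen R M \<longleftrightarrow> (\<exists>G. finite G \<and> G \<subseteq> carrier M \<and>
    carrier M = {finsum M (\<lambda>g. c g \<odot>\<^bsub>M\<^esub> g) G | c. c \<in> G \<rightarrow> carrier R})"

definition free_lmod :: "('r, 'q) ring_scheme \<Rightarrow> 'i set \<Rightarrow> ('r, 'i \<Rightarrow> 'r) module"
  where "free_lmod R I =
    \<lparr>carrier = {f \<in> I \<rightarrow>\<^sub>E carrier R. finite {i \<in> I. f i \<noteq> \<zero>\<^bsub>R\<^esub>}},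
     monoid.mult = undefined, monoid.one = undefined,
     ring.zero = (\<lambda>i\<in>I. \<zero>\<^bsub>R\<^esub>),
     add = (\<lambda>f g. \<lambda>i\<in>I. f i \<oplus>\<^bsub>R\<^esub> g i),
     smult = (\<lambda>r f. \<lambda>i\<in>I. r \<otimes>\<^bsub>R\<^esub> f i)\<rparr>"

text \<open>
  Projective means: a direct summand of a free module, up to isomorphism.  Taking the index set in
  the type of \<open>M\<close> and the complement in the type of the free module is no restriction, since the
  carrier of \<open>M\<close> generates \<open>M\<close> and the complement may be taken inside the free module.
\<close>

definition projective :: "('r, 'q) ring_scheme \<Rightarrow> ('r, 'x, 'm) module_scheme \<Rightarrow> bool"
  where "projective R M \<longleftrightarrow> (\<exists>(I :: 'x set) (N :: ('r, 'x \<Rightarrow> 'r) module).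
    left_module R N \<and> lmod_iso R (lmod_sum M N) (free_lmod R I))"

definition injective ::
  "'u itself \<Rightarrow> ('r, 'q) ring_scheme \<Rightarrow> ('r, 'x, 'm) module_scheme \<Rightarrow> bool"
  where "injective U R E \<longleftrightarrow> (\<forall>(X :: ('r, 'u) module) (Y :: ('r, 'u) module).
    left_module R X \<longrightarrow> left_module R Y \<longrightarrow>
    (\<forall>f\<in>lmod_hom R X Y. inj_on f (carrier X) \<longrightarrow>
      (\<forall>g\<in>lmod_hom R X E. \<exists>h\<in>lmod_hom R Y E. \<forall>x\<in>carrier X. h (f x) = g x)))"

definition injective_envelope ::
  "'u itself \<Rightarrow> ('r, 'q) ring_scheme \<Rightarrow> ('r, 'x, 'm) module_scheme \<Rightarrow> ('r, 'y, 'n) module_scheme \<Rightarrow> bool"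
  where "injective_envelope U R M E \<longleftrightarrow> left_module R E \<and> injective U R E \<and>
    (\<exists>j\<in>lmod_hom R M E. inj_on j (carrier M) \<and>
      (\<forall>N. submodule N R E \<longrightarrow> N \<noteq> {\<zero>\<^bsub>E\<^esub>} \<longrightarrow> N \<inter> j ` carrier M \<noteq> {\<zero>\<^bsub>E\<^esub>}))"


section \<open>Global dimension\<close>

definition proj_resolution ::
  "('r, 'q) ring_scheme \<Rightarrow> ('r, 'u) module \<Rightarrow> (nat \<Rightarrow> ('r, 'u) module) \<Rightarrow>
   (nat \<Rightarrow> 'u \<Rightarrow> 'u) \<Rightarrow> ('u \<Rightarrow> 'u) \<Rightarrow> bool"
  where "proj_resolution R M P d e \<longleftrightarrow>
    (\<forall>i. left_module R (P i) \<and> projective R (P i)) \<and>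
    e \<in> lmod_hom R (P 0) M \<and> (\<forall>i. d i \<in> lmod_hom R (P (Suc i)) (P i)) \<and>
    e ` carrier (P 0) = carrier M \<and>
    d 0 ` carrier (P (Suc 0)) = {x \<in> carrier (P 0). e x = \<zero>\<^bsub>M\<^esub>} \<and>
    (\<forall>i. d (Suc i) ` carrier (P (Suc (Suc i))) =
           {x \<in> carrier (P (Suc i)). d i x = \<zero>\<^bsub>P i\<^esub>})"

definition projdim :: "('r, 'q) ring_scheme \<Rightarrow> ('r, 'u) module \<Rightarrow> enat"
  where "projdim R M = Inf {enat n | n. \<exists>P d e. proj_resolution R M P d e \<and>
    (\<forall>i>n. carrier (P i) = {\<zero>\<^bsub>P i\<^esub>})}"

text \<open>This is the left global dimension; for Artin algebras it agrees with the right one.\<close>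

definition gldim :: "'u itself \<Rightarrow> ('r, 'q) ring_scheme \<Rightarrow> enat"
  where "gldim U R = Sup {projdim R M | M :: ('r, 'u) module. left_module R M}"


section \<open>Bimodules\<close>

record ('r, 'x, 's) bimodule = "('r, 'x) module" +
  rsmult :: "'x \<Rightarrow> 's \<Rightarrow> 'x"

definition opp_ring :: "('r, 'q) ring_scheme \<Rightarrow> 'r ring"
  where "opp_ring R =
    \<lparr>carrier = carrier R, monoid.mult = (\<lambda>x y. y \<otimes>\<^bsub>R\<^esub> x), monoid.one = \<one>\<^bsub>R\<^esub>,
     ring.zero = \<zero>\<^bsub>R\<^esub>, add = add R\<rparr>"

text \<open>Right modules over \<open>S\<close> are treated as left modules over the opposite ring.\<close>

definition right_part :: "('r, 'x, 's, 'm) bimodule_scheme \<Rightarrow> ('s, 'x) module"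
  where "right_part P =
    \<lparr>carrier = carrier P, monoid.mult = undefined, monoid.one = undefined,
     ring.zero = \<zero>\<^bsub>P\<^esub>, add = add P, smult = (\<lambda>s p. rsmult P p s)\<rparr>"

definition is_bimodule ::
  "('r, 'q) ring_scheme \<Rightarrow> ('s, 'q2) ring_scheme \<Rightarrow> ('r, 'x, 's, 'm) bimodule_scheme \<Rightarrow> bool"
  where "is_bimodule R S P \<longleftrightarrow>
    left_module R P \<and> left_module (opp_ring S) (right_part P) \<and>
    (\<forall>r\<in>carrier R. \<forall>s\<in>carrier S. \<forall>p\<in>carrier P.
       rsmult P (r \<odot>\<^bsub>P\<^esub> p) s = r \<odot>\<^bsub>P\<^esub> rsmult P p s)"

definition bimod_hom ::
  "('r, 'q) ring_scheme \<Rightarrow> ('s, 'q2) ring_scheme \<Rightarrow> ('r, 'x, 's, 'm) bimodule_scheme \<Rightarrow>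
   ('r, 'y, 's, 'n) bimodule_scheme \<Rightarrow> ('x \<Rightarrow> 'y) set"
  where "bimod_hom R S M N = {f \<in> lmod_hom R M N.
    \<forall>s\<in>carrier S. \<forall>x\<in>carrier M. f (rsmult M x s) = rsmult N (f x) s}"

definition bimod_iso ::
  "('r, 'q) ring_scheme \<Rightarrow> ('s, 'q2) ring_scheme \<Rightarrow> ('r, 'x, 's, 'm) bimodule_scheme \<Rightarrow>
   ('r, 'y, 's, 'n) bimodule_scheme \<Rightarrow> bool"
  where "bimod_iso R S M N \<longleftrightarrow> (\<exists>f\<in>bimod_hom R S M N. bij_betw f (carrier M) (carrier N))"

definition regular_bimod :: "('r, 'q) ring_scheme \<Rightarrow> ('r, 'r, 'r) bimodule"
  where "regular_bimod R =
    \<lparr>carrier = carrier R, monoid.mult = undefined, monoid.one = undefined,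
     ring.zero = \<zero>\<^bsub>R\<^esub>, add = add R, smult = monoid.mult R, rsmult = monoid.mult R\<rparr>"

definition bimod_sum ::
  "('r, 'x, 's, 'm) bimodule_scheme \<Rightarrow> ('r, 'y, 's, 'n) bimodule_scheme \<Rightarrow> ('r, 'x \<times> 'y, 's) bimodule"
  where "bimod_sum M N =
    \<lparr>carrier = carrier M \<times> carrier N, monoid.mult = undefined, monoid.one = undefined,
     ring.zero = (\<zero>\<^bsub>M\<^esub>, \<zero>\<^bsub>N\<^esub>),
     add = (\<lambda>u v. (fst u \<oplus>\<^bsub>M\<^esub> fst v, snd u \<oplus>\<^bsub>N\<^esub> snd v)),
     smult = (\<lambda>r u. (r \<odot>\<^bsub>M\<^esub> fst u, r \<odot>\<^bsub>N\<^esub> snd u)),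
     rsmult = (\<lambda>u s. (rsmult M (fst u) s, rsmult N (snd u) s))\<rparr>"

definition bimod_power ::
  "nat \<Rightarrow> ('r, 'x, 's, 'm) bimodule_scheme \<Rightarrow> ('r, nat \<Rightarrow> 'x, 's) bimodule"
  where "bimod_power n M =
    \<lparr>carrier = {..<n} \<rightarrow>\<^sub>E carrier M, monoid.mult = undefined, monoid.one = undefined,
     ring.zero = (\<lambda>i\<in>{..<n}. \<zero>\<^bsub>M\<^esub>),
     add = (\<lambda>f g. \<lambda>i\<in>{..<n}. f i \<oplus>\<^bsub>M\<^esub> g i),
     smult = (\<lambda>r f. \<lambda>i\<in>{..<n}. r \<odot>\<^bsub>M\<^esub> f i),
     rsmult = (\<lambda>f s. \<lambda>i\<in>{..<n}. rsmult M (f i) s)\<rparr>"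

text \<open>
  \<open>N \<in> add(X)\<close>.  The complement may be taken inside \<open>X\<^sup>n\<close>, so its type is no restriction.
\<close>

definition in_add_bimod ::
  "('r, 'q) ring_scheme \<Rightarrow> ('s, 'q2) ring_scheme \<Rightarrow> ('r, 'x, 's, 'm) bimodule_scheme \<Rightarrow>
   ('r, 'y, 's, 'n) bimodule_scheme \<Rightarrow> bool"
  where "in_add_bimod R S X N \<longleftrightarrow> (\<exists>n (N' :: ('r, nat \<Rightarrow> 'x, 's) bimodule).
    is_bimodule R S N' \<and> bimod_iso R S (bimod_sum N N') (bimod_power n X))"

definition centrally_projective ::
  "('r, 'q) ring_scheme \<Rightarrow> ('r, 'x, 'r, 'm) bimodule_scheme \<Rightarrow> bool"
  where "centrally_projective R N \<longleftrightarrow> in_add_bimod R R (regular_bimod R) N"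


section \<open>Tensor products\<close>

text \<open>
  \<open>P \<otimes>\<^sub>S X\<close> is the free abelian group on pairs modulo the subgroup generated by the relations of
  biadditivity and balancedness; elements of the tensor product are cosets of that subgroup.
\<close>

type_synonym ('p, 'x) tensor = "(('p \<times> 'x) \<Rightarrow>\<^sub>0 int) set"

definition tensor_rels ::
  "('s, 'q) ring_scheme \<Rightarrow> ('r, 'p, 's, 'm) bimodule_scheme \<Rightarrow> ('s, 'x, 'n) module_scheme \<Rightarrow>
   (('p \<times> 'x) \<Rightarrow>\<^sub>0 int) set"
  where "tensor_rels S P X =
    {frag_of (p \<oplus>\<^bsub>P\<^esub> p', x) - frag_of (p, x) - frag_of (p', x) | p p' x.
       p \<in> carrier P \<and> p' \<in> carrier P \<and> x \<in> carrier X} \<union>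
    {frag_of (p, x \<oplus>\<^bsub>X\<^esub> x') - frag_of (p, x) - frag_of (p, x') | p x x'.
       p \<in> carrier P \<and> x \<in> carrier X \<and> x' \<in> carrier X} \<union>
    {frag_of (rsmult P p s, x) - frag_of (p, s \<odot>\<^bsub>X\<^esub> x) | p s x.
       p \<in> carrier P \<and> s \<in> carrier S \<and> x \<in> carrier X}"

definition tensor_null ::
  "('s, 'q) ring_scheme \<Rightarrow> ('r, 'p, 's, 'm) bimodule_scheme \<Rightarrow> ('s, 'x, 'n) module_scheme \<Rightarrow>
   (('p \<times> 'x) \<Rightarrow>\<^sub>0 int) set"
  where "tensor_null S P X =
    generate (free_Abelian_group (carrier P \<times> carrier X)) (tensor_rels S P X)"

definition tensor_group ::
  "('s, 'q) ring_scheme \<Rightarrow> ('r, 'p, 's, 'm) bimodule_scheme \<Rightarrow> ('s, 'x, 'n) module_scheme \<Rightarrow>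
   ('p, 'x) tensor ring"
  where "tensor_group S P X =
    (let T = free_Abelian_group (carrier P \<times> carrier X) Mod tensor_null S P X in
     \<lparr>carrier = carrier T, monoid.mult = undefined, monoid.one = undefined,
      ring.zero = \<one>\<^bsub>T\<^esub>, add = monoid.mult T\<rparr>)"

definition pure_tensor ::
  "('s, 'q) ring_scheme \<Rightarrow> ('r, 'p, 's, 'm) bimodule_scheme \<Rightarrow> ('s, 'x, 'n) module_scheme \<Rightarrow>
   'p \<Rightarrow> 'x \<Rightarrow> ('p, 'x) tensor"
  where "pure_tensor S P X p x =
    tensor_null S P X #>\<^bsub>free_Abelian_group (carrier P \<times> carrier X)\<^esub> frag_of (p, x)"

text \<open>
  The additive map induced by a balanced biadditive map \<open>\<beta>\<close> into \<open>Z\<close>: all representatives of a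
  coset \<open>K\<close> have the same value, which is the element selected by \<^const>\<open>the_elem\<close>.
\<close>

definition tensor_lift ::
  "('z, 'q) ring_scheme \<Rightarrow> ('p \<Rightarrow> 'x \<Rightarrow> 'z) \<Rightarrow> ('p, 'x) tensor \<Rightarrow> 'z"
  where "tensor_lift Z \<beta> K =
    the_elem ((\<lambda>c. finsum Z (\<lambda>t. [Poly_Mapping.lookup c t] \<cdot>\<^bsub>Z\<^esub> \<beta> (fst t) (snd t))
                     (Poly_Mapping.keys c)) ` K)"

definition tensor_lmod ::
  "('s, 'q) ring_scheme \<Rightarrow> ('r, 'p, 's, 'm) bimodule_scheme \<Rightarrow> ('s, 'x, 'n) module_scheme \<Rightarrow>
   ('r, ('p, 'x) tensor) module"
  where "tensor_lmod S P X =
    (let T = tensor_group S P X in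
     \<lparr>carrier = carrier T, monoid.mult = undefined, monoid.one = undefined,
      ring.zero = \<zero>\<^bsub>T\<^esub>, add = add T,
      smult = (\<lambda>r. tensor_lift T (\<lambda>p x. pure_tensor S P X (r \<odot>\<^bsub>P\<^esub> p) x))\<rparr>)"

definition tensor_bimod ::
  "('s, 'q) ring_scheme \<Rightarrow> ('r, 'p, 's, 'm) bimodule_scheme \<Rightarrow> ('s, 'x, 't, 'n) bimodule_scheme \<Rightarrow>
   ('r, ('p, 'x) tensor, 't) bimodule"
  where "tensor_bimod S P Q =
    (let T = tensor_group S P Q in
     \<lparr>carrier = carrier T, monoid.mult = undefined, monoid.one = undefined,
      ring.zero = \<zero>\<^bsub>T\<^esub>, add = add T,
      smult = (\<lambda>r. tensor_lift T (\<lambda>p q. pure_tensor S P Q (r \<odot>\<^bsub>P\<^esub> p) q)),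
      rsmult = (\<lambda>w t. tensor_lift T (\<lambda>p q. pure_tensor S P Q p (rsmult Q q t)) w)\<rparr>)"

text \<open>The action of the functor \<open>P \<otimes>\<^sub>S -\<close> on a homomorphism \<open>g\<close> from \<open>X\<close> to \<open>Y\<close>.\<close>

definition tensor_map ::
  "('s, 'q) ring_scheme \<Rightarrow> ('r, 'p, 's, 'm) bimodule_scheme \<Rightarrow> ('s, 'x, 'n) module_scheme \<Rightarrow>
   ('s, 'y, 'o) module_scheme \<Rightarrow> ('x \<Rightarrow> 'y) \<Rightarrow> ('p, 'x) tensor \<Rightarrow> ('p, 'y) tensor"
  where "tensor_map S P X Y g =
    (\<lambda>w\<in>carrier (tensor_group S P X).
       tensor_lift (tensor_group S P Y) (\<lambda>p x. pure_tensor S P Y p (g x)) w)"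


section \<open>Symmetric separable equivalence\<close>

text \<open>
  The natural map \<open>P \<otimes>\<^sub>S (Q \<otimes>\<^sub>R Y) \<rightarrow> Y\<close>, \<open>p \<otimes> (q \<otimes> y) \<mapsto> \<nu> (p \<otimes> q) y\<close>, i.e. \<open>\<nu> \<otimes>\<^sub>R Y\<close> up to the
  canonical isomorphisms \<open>P \<otimes>\<^sub>S (Q \<otimes>\<^sub>R Y) \<cong> (P \<otimes>\<^sub>S Q) \<otimes>\<^sub>R Y\<close> and \<open>R \<otimes>\<^sub>R Y \<cong> Y\<close>.
\<close>

definition counit_map ::
  "('r, 'q1) ring_scheme \<Rightarrow> ('s, 'q2) ring_scheme \<Rightarrow> ('r, 'p, 's, 'm) bimodule_scheme \<Rightarrow>
   ('s, 'q, 'r, 'n) bimodule_scheme \<Rightarrow> (('p, 'q) tensor \<Rightarrow> 'r) \<Rightarrow> ('r, 'y, 'o) module_scheme \<Rightarrow>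
   ('p, ('q, 'y) tensor) tensor \<Rightarrow> 'y"
  where "counit_map R S P Q \<nu> Y =
    (\<lambda>w\<in>carrier (tensor_group S P (tensor_lmod R Q Y)).
       tensor_lift Y
         (\<lambda>p v. tensor_lift Y (\<lambda>q y. \<nu> (pure_tensor S P Q p q) \<odot>\<^bsub>Y\<^esub> y) v) w)"

text \<open>
  \<open>F = P \<otimes>\<^sub>S -\<close> and \<open>G = Q \<otimes>\<^sub>R -\<close> form an adjoint pair \<open>(F, G)\<close> with counit \<open>\<epsilon>\<close> given by \<open>\<nu>\<close>: there are
  bijections \<open>\<phi> : Hom (F X) Y \<rightarrow> Hom X (G Y)\<close>, natural in both variables.  That \<open>\<epsilon>\<close> is the counit,
  i.e. that \<open>\<phi>\<close> maps \<open>\<epsilon>\<^sub>Y\<close> to the identity of \<open>G Y\<close>, is stated through the usual formula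
  \<open>\<phi>\<^sup>-\<^sup>1 g = \<epsilon>\<^sub>Y \<circ> F g\<close>, as \<open>G Y\<close> itself has another carrier type than \<open>X\<close>.
\<close>

definition adjoint_with_counit ::
  "'u itself \<Rightarrow> ('r, 'q1) ring_scheme \<Rightarrow> ('s, 'q2) ring_scheme \<Rightarrow> ('r, 'p, 's, 'm) bimodule_scheme \<Rightarrow>
   ('s, 'q, 'r, 'n) bimodule_scheme \<Rightarrow> (('p, 'q) tensor \<Rightarrow> 'r) \<Rightarrow> bool"
  where "adjoint_with_counit U R S P Q \<nu> \<longleftrightarrow>
    (\<exists>\<phi> :: ('s, 'u) module \<Rightarrow> ('r, 'u) module \<Rightarrow>
            (('p, 'u) tensor \<Rightarrow> 'u) \<Rightarrow> ('u \<Rightarrow> ('q, 'u) tensor).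
      (\<forall>X Y. left_module S X \<longrightarrow> left_module R Y \<longrightarrow>
        bij_betw (\<phi> X Y) (lmod_hom R (tensor_lmod S P X) Y) (lmod_hom S X (tensor_lmod R Q Y))) \<and>
      (\<forall>X X' Y. left_module S X \<longrightarrow> left_module S X' \<longrightarrow> left_module R Y \<longrightarrow>
        (\<forall>h\<in>lmod_hom S X' X. \<forall>f\<in>lmod_hom R (tensor_lmod S P X) Y.
          \<phi> X' Y (compose (carrier (tensor_lmod S P X')) f (tensor_map S P X' X h)) =
          compose (carrier X') (\<phi> X Y f) h)) \<and>
      (\<forall>X Y Y'. left_module S X \<longrightarrow> left_module R Y \<longrightarrow> left_module R Y' \<longrightarrow>
        (\<forall>h\<in>lmod_hom R Y Y'. \<forall>f\<in>lmod_hom R (tensor_lmod S P X) Y.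
          \<phi> X Y' (compose (carrier (tensor_lmod S P X)) h f) =
          compose (carrier X) (tensor_map R Q Y Y' h) (\<phi> X Y f))) \<and>
      (\<forall>X Y. left_module S X \<longrightarrow> left_module R Y \<longrightarrow>
        (\<forall>g\<in>lmod_hom S X (tensor_lmod R Q Y).
          \<phi> X Y (compose (carrier (tensor_lmod S P X)) (counit_map R S P Q \<nu> Y)
                   (tensor_map S P X (tensor_lmod R Q Y) g)) = g)))"

definition fin_gen_proj_both_sides ::
  "('r, 'q1) ring_scheme \<Rightarrow> ('s, 'q2) ring_scheme \<Rightarrow> ('r, 'p, 's, 'm) bimodule_scheme \<Rightarrow> bool"
  where "fin_gen_proj_both_sides R S P \<longleftrightarrow>
    fin_gen R P \<and> projective R P \<and>
    fin_gen (opp_ring S) (right_part P) \<and> projective (opp_ring S) (right_part P)"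

definition separably_divides_by ::
  "('r, 'q1) ring_scheme \<Rightarrow> ('s, 'q2) ring_scheme \<Rightarrow> ('r, 'p, 's, 'm) bimodule_scheme \<Rightarrow>
   ('s, 'q, 'r, 'n) bimodule_scheme \<Rightarrow> (('p, 'q) tensor \<Rightarrow> 'r) \<Rightarrow> bool"
  where "separably_divides_by R S P Q \<nu> \<longleftrightarrow>
    ring R \<and> ring S \<and> is_bimodule R S P \<and> is_bimodule S R Q \<and>
    fin_gen_proj_both_sides R S P \<and> fin_gen_proj_both_sides S R Q \<and>
    \<nu> \<in> bimod_hom R R (tensor_bimod S P Q) (regular_bimod R) \<and>
    (\<exists>\<sigma>\<in>bimod_hom R R (regular_bimod R) (tensor_bimod S P Q). \<forall>r\<in>carrier R. \<nu> (\<sigma> r) = r)"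

definition symmetric_separably_divides_by ::
  "'u itself \<Rightarrow> ('r, 'q1) ring_scheme \<Rightarrow> ('s, 'q2) ring_scheme \<Rightarrow> ('r, 'p, 's, 'm) bimodule_scheme \<Rightarrow>
   ('s, 'q, 'r, 'n) bimodule_scheme \<Rightarrow> (('p, 'q) tensor \<Rightarrow> 'r) \<Rightarrow> bool"
  where "symmetric_separably_divides_by U R S P Q \<nu> \<longleftrightarrow>
    separably_divides_by R S P Q \<nu> \<and> adjoint_with_counit U R S P Q \<nu>"

definition symmetric_separably_equivalent_by ::
  "'u itself \<Rightarrow> ('r, 'q1) ring_scheme \<Rightarrow> ('s, 'q2) ring_scheme \<Rightarrow> ('r, 'p, 's, 'm) bimodule_scheme \<Rightarrow>
   ('s, 'q, 'r, 'n) bimodule_scheme \<Rightarrow> bool"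
  where "symmetric_separably_equivalent_by U R S P Q \<longleftrightarrow>
    (\<exists>\<nu>. symmetric_separably_divides_by U R S P Q \<nu>) \<and>
    (\<exists>\<mu>. symmetric_separably_divides_by U S R Q P \<mu>)"


section \<open>Artin algebras and representation dimension\<close>

definition artinian_cring :: "('k, 'q) ring_scheme \<Rightarrow> bool"
  where "artinian_cring k \<longleftrightarrow> cring k \<and>
    (\<forall>I :: nat \<Rightarrow> 'k set. (\<forall>n. ideal (I n) k \<and> I (Suc n) \<subseteq> I n) \<longrightarrow> (\<exists>n. \<forall>m\<ge>n. I m = I n))"

text \<open>
  An algebra is a single record: its module structure is the one over the base ring \<open>k\<close>.
  (\<^locale>\<open>algebra\<close> of HOL-Algebra is for commutative algebras only.)
\<close>

definition artin_algebra :: "('k, 'q) ring_scheme \<Rightarrow> ('k, 'a, 'm) module_scheme \<Rightarrow> bool"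
  where "artin_algebra k A \<longleftrightarrow>
    artinian_cring k \<and> ring A \<and> left_module k A \<and>
    (\<forall>c\<in>carrier k. \<forall>x\<in>carrier A. \<forall>y\<in>carrier A.
       (c \<odot>\<^bsub>A\<^esub> x) \<otimes>\<^bsub>A\<^esub> y = c \<odot>\<^bsub>A\<^esub> (x \<otimes>\<^bsub>A\<^esub> y) \<and>
       x \<otimes>\<^bsub>A\<^esub> (c \<odot>\<^bsub>A\<^esub> y) = c \<odot>\<^bsub>A\<^esub> (x \<otimes>\<^bsub>A\<^esub> y)) \<and>
    fin_gen k A"

definition jacobson_rad :: "('k, 'q) ring_scheme \<Rightarrow> 'k set"
  where "jacobson_rad k = {x \<in> carrier k. \<forall>I. maximalideal I k \<longrightarrow> x \<in> I}"

definition quot_lmod :: "('k, 'q) ring_scheme \<Rightarrow> 'k set \<Rightarrow> ('k, 'k set) module"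
  where "quot_lmod k I =
    \<lparr>carrier = carrier (k Quot I), monoid.mult = undefined, monoid.one = undefined,
     ring.zero = \<zero>\<^bsub>k Quot I\<^esub>, add = add (k Quot I),
     smult = (\<lambda>c x. (I +>\<^bsub>k\<^esub> c) \<otimes>\<^bsub>k Quot I\<^esub> x)\<rparr>"

text \<open>
  The usual duality for Artin \<open>k\<close>-algebras is \<open>D = Hom\<^sub>k(-, J)\<close>, where \<open>J\<close> is an injective envelope of
  the \<open>k\<close>-module \<open>k / rad k\<close>.  The envelope is unique only up to isomorphism, so \<open>J\<close> is
  kept as a parameter.
\<close>

definition duality_module ::
  "'u itself \<Rightarrow> ('k, 'q) ring_scheme \<Rightarrow> ('k, 'j, 'n) module_scheme \<Rightarrow> bool"
  where "duality_module U k J \<longleftrightarrow> injective_envelope U k (quot_lmod k (jacobson_rad k)) J"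

text \<open>The left \<open>A\<close>-module \<open>D(A\<^sub>A)\<close>; the right action of \<open>A\<close> on itself gives \<open>(a f)(x) = f(x a)\<close>.\<close>

definition dual_of_algebra ::
  "('k, 'q) ring_scheme \<Rightarrow> ('k, 'j, 'n) module_scheme \<Rightarrow> ('k, 'a, 'm) module_scheme \<Rightarrow>
   ('a, 'a \<Rightarrow> 'j) module"
  where "dual_of_algebra k J A =
    \<lparr>carrier = lmod_hom k A J, monoid.mult = undefined, monoid.one = undefined,
     ring.zero = (\<lambda>x\<in>carrier A. \<zero>\<^bsub>J\<^esub>),
     add = (\<lambda>f g. \<lambda>x\<in>carrier A. f x \<oplus>\<^bsub>J\<^esub> g x),
     smult = (\<lambda>a f. \<lambda>x\<in>carrier A. f (x \<otimes>\<^bsub>A\<^esub> a))\<rparr>"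

text \<open>Endomorphisms are composed as functions: \<open>f g = f \<circ> g\<close>.\<close>

definition End_ring ::
  "('r, 'q) ring_scheme \<Rightarrow> ('r, 'x, 'm) module_scheme \<Rightarrow> ('x \<Rightarrow> 'x) ring"
  where "End_ring R M =
    \<lparr>carrier = lmod_hom R M M, monoid.mult = compose (carrier M),
     monoid.one = (\<lambda>x\<in>carrier M. x), ring.zero = (\<lambda>x\<in>carrier M. \<zero>\<^bsub>M\<^esub>),
     add = (\<lambda>f g. \<lambda>x\<in>carrier M. f x \<oplus>\<^bsub>M\<^esub> g x)\<rparr>"

definition repdim ::
  "'u itself \<Rightarrow> ('k, 'q) ring_scheme \<Rightarrow> ('k, 'j, 'n) module_scheme \<Rightarrow> ('k, 'a, 'm) module_scheme \<Rightarrow>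
   enat"
  where "repdim U k J A =
    Inf {gldim U (End_ring A
           (lmod_sum (regular_bimod A) (lmod_sum (dual_of_algebra k J A) X)))
         | X :: ('a, 'u) module. left_module A X \<and> fin_gen A X}"

end

theory Submission
  imports Defs
begin

text \<open>
  The adjunctions identify \<open>P \<otimes>\<^sub>B -\<close> and \<open>Q \<otimes>\<^sub>A -\<close> with \<open>F = Hom\<^sub>B(Q, -)\<close> and \<open>G = Hom\<^sub>A(P, -)\<close>, which are
  adjoint on both sides.  Central projectivity of \<open>P \<otimes>\<^sub>B Q\<close> and \<open>Q \<otimes>\<^sub>A P\<close> gives \<open>F G Y \<in> add(Y)\<close> and
  \<open>G F X \<in> add(X)\<close>, while the split epimorphism onto \<open>A\<close> makes \<open>Y\<close> a natural direct summand of \<open>F G Y\<close>.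
  Given \<open>M = B \<oplus> D(B) \<oplus> X\<close>, put \<open>N = A \<oplus> D(A) \<oplus> F X\<close>.  As \<open>D(B)\<close> is injective with an essential
  Artinian submodule and \<open>G D(A)\<close> cogenerates it, \<open>D(B) \<in> add(G D(A))\<close> and so
  \<open>F D(B) \<in> add(F G D(A)) \<subseteq> add(D(A))\<close>.  It follows that \<open>F M \<in> add(N)\<close>, and \<open>G N \<in> add(M)\<close> in the same way.

  The bimodules \<open>Hom\<^sub>B(M, G N)\<close> and \<open>Hom\<^sub>B(G N, M)\<close> then relate \<open>End(N)\<close> and \<open>End(M)\<close> just as \<open>P\<close> and
  \<open>Q\<close> relate \<open>A\<close> and \<open>B\<close>: every \<open>End(N)\<close>-module is a direct summand of one that comes
  from \<open>End(M)\<close> along an exact functor that preserves projectives.  Hence \<open>gldim End(N) \<le> gldim End(M)\<close>, so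
  \<open>repdim(A) \<le> repdim(B)\<close>, and equality holds by symmetry.
\<close>

section \<open>Additive maps and homomorphisms\<close>

text \<open>The base rings k and l of A and B may differ and nothing relates their duality modules,
  so no isomorphism between F D(B) and D(A) is at hand; D(A) and D(B) are compared only through
  injectivity and cogeneration. The adjunctions are assumed only for modules with carrier in 'u.
  They are therefore evaluated once, at copies of A, B, P and Q, and yield finite dual bases for the
  pairings given by the two counits. From then on units and counits are explicit finite sums that
  make sense for modules of every type, in particular for the function types of Hom modules.
  Membership in add(X) is recorded as a finite sum of maps through X, so powers of X never appear,
  and direct summands are recorded by a section and a retraction. Naturality of the summand Y of F G
  Y is what survives the passage to endomorphism rings: it allows an endomorphism of G N to be
  turned into one of N in the manner of a relative trace. Projective dimensions are compared through
  syzygies and a Schanuel argument for retracts instead of Ext.\<close>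

definition addhom :: "('x, 'm) ring_scheme \<Rightarrow> ('y, 'n) ring_scheme \<Rightarrow> ('x \<Rightarrow> 'y) \<Rightarrow> bool"
  where "addhom M N f \<longleftrightarrow> f \<in> carrier M \<rightarrow> carrier N \<and>
    (\<forall>x\<in>carrier M. \<forall>y\<in>carrier M. f (x \<oplus>\<^bsub>M\<^esub> y) = f x \<oplus>\<^bsub>N\<^esub> f y)"

lemma addhomI:
  "\<lbrakk>\<And>x. x \<in> carrier M \<Longrightarrow> f x \<in> carrier N;
    \<And>x y. \<lbrakk>x \<in> carrier M; y \<in> carrier M\<rbrakk> \<Longrightarrow> f (x \<oplus>\<^bsub>M\<^esub> y) = f x \<oplus>\<^bsub>N\<^esub> f y\<rbrakk> \<Longrightarrow> addhom M N f"
  by (auto simp: addhom_def)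

lemma addhom_closed: "addhom M N f \<Longrightarrow> x \<in> carrier M \<Longrightarrow> f x \<in> carrier N"
  by (auto simp: addhom_def)

lemma addhom_add:
  "addhom M N f \<Longrightarrow> x \<in> carrier M \<Longrightarrow> y \<in> carrier M \<Longrightarrow> f (x \<oplus>\<^bsub>M\<^esub> y) = f x \<oplus>\<^bsub>N\<^esub> f y"
  by (auto simp: addhom_def)

lemma addhom_zero:
  assumes "abelian_group M" "abelian_group N" "addhom M N f"
  shows "f \<zero>\<^bsub>M\<^esub> = \<zero>\<^bsub>N\<^esub>"
proof -
  interpret M: abelian_group M by fact
  interpret N: abelian_group N by fact
  have "f \<zero>\<^bsub>M\<^esub> \<oplus>\<^bsub>N\<^esub> f \<zero>\<^bsub>M\<^esub> = f \<zero>\<^bsub>M\<^esub>"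
    using addhom_add[OF assms(3), of "\<zero>\<^bsub>M\<^esub>" "\<zero>\<^bsub>M\<^esub>"] by simp
  then show ?thesis
    using addhom_closed[OF assms(3)] N.add.l_cancel_one M.zero_closed by metis
qed

lemma addhom_neg:
  assumes "abelian_group M" "abelian_group N" "addhom M N f" "x \<in> carrier M"
  shows "f (\<ominus>\<^bsub>M\<^esub> x) = \<ominus>\<^bsub>N\<^esub> f x"
proof -
  interpret M: abelian_group M by fact
  interpret N: abelian_group N by fact
  have "f x \<oplus>\<^bsub>N\<^esub> f (\<ominus>\<^bsub>M\<^esub> x) = \<zero>\<^bsub>N\<^esub>"
    using addhom_add[OF assms(3), of x "\<ominus>\<^bsub>M\<^esub> x"] addhom_zero[OF assms(1-3)] assms(4)
    by (simp add: M.r_neg)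
  then show ?thesis
    using addhom_closed[OF assms(3)] assms(4)
    by (metis M.a_inv_closed N.a_comm N.minus_equality)
qed

lemma addhom_minus:
  assumes "abelian_group M" "abelian_group N" "addhom M N f" "x \<in> carrier M" "y \<in> carrier M"
  shows "f (x \<ominus>\<^bsub>M\<^esub> y) = f x \<ominus>\<^bsub>N\<^esub> f y"
proof -
  interpret M: abelian_group M by fact
  interpret N: abelian_group N by fact
  show ?thesis
    using assms(4,5) by (simp add: a_minus_def addhom_add[OF assms(3)] addhom_neg[OF assms(1-3)])
qed

lemma addhom_finsum:
  assumes "abelian_group M" "abelian_group N" "addhom M N f" "g \<in> I \<rightarrow> carrier M"
  shows "f (finsum M g I) = finsum N (\<lambda>i. f (g i)) I"
  using assms(4)
proof (induction I rule: infinite_finite_induct)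
  case (infinite I)
  interpret M: abelian_group M by fact
  interpret N: abelian_group N by fact
  show ?case using infinite addhom_zero[OF assms(1-3)] by simp
next
  case empty
  interpret M: abelian_group M by fact
  interpret N: abelian_group N by fact
  show ?case using addhom_zero[OF assms(1-3)] by simp
next
  case (insert i I)
  interpret M: abelian_group M by fact
  interpret N: abelian_group N by fact
  have fg: "g \<in> I \<rightarrow> carrier M" "g i \<in> carrier M" "(\<lambda>i. f (g i)) \<in> I \<rightarrow> carrier N" "f (g i) \<in> carrier N"
    using insert.prems addhom_closed[OF assms(3)] by auto
  show ?case
    using insert fg by (simp add: addhom_add[OF assms(3)] M.finsum_closed)
qed

lemma addhom_comp: "addhom M N f \<Longrightarrow> addhom N L g \<Longrightarrow> addhom M L (\<lambda>x. g (f x))"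
  by (auto simp: addhom_def Pi_iff)

lemma (in abelian_group) finsum_swap:
  assumes "finite I" "\<And>i j. i \<in> I \<Longrightarrow> j \<in> J \<Longrightarrow> h i j \<in> carrier G"
  shows "finsum G (\<lambda>i. finsum G (\<lambda>j. h i j) J) I = finsum G (\<lambda>j. finsum G (\<lambda>i. h i j) I) J"
  using assms
proof (induction I)
  case empty
  then show ?case by (simp)
next
  case (insert i I)
  have "finsum G (\<lambda>i. finsum G (\<lambda>j. h i j) J) (insert i I)
      = finsum G (\<lambda>j. h i j) J \<oplus> finsum G (\<lambda>i. finsum G (\<lambda>j. h i j) J) I"
    using insert by (intro finsum_insert) (auto intro!: finsum_closed)
  also have "\<dots> = finsum G (\<lambda>j. h i j) J \<oplus> finsum G (\<lambda>j. finsum G (\<lambda>i. h i j) I) J"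
    using insert by auto
  also have "\<dots> = finsum G (\<lambda>j. h i j \<oplus> finsum G (\<lambda>i. h i j) I) J"
    using insert by (intro finsum_addf[symmetric]) (auto intro!: finsum_closed)
  also have "\<dots> = finsum G (\<lambda>j. finsum G (\<lambda>i. h i j) (insert i I)) J"
    using insert by (intro finsum_cong' refl) (auto intro!: finsum_closed)
  finally show ?case .
qed

lemma (in abelian_group) finsum_delta:
  assumes "finite I" "j \<in> I" "\<And>i. i \<in> I \<Longrightarrow> i \<noteq> j \<Longrightarrow> h i = \<zero>" "h j \<in> carrier G"
  shows "finsum G h I = h j"
proof -
  have "finsum G h I = finsum G h {j}"
    using assms by (intro add.finprod_mono_neutral_cong_right) (auto, metis zero_closed)
  then show ?thesis using assms by (simp)
qed

text \<open>Without the extensionality of \<open>lmod_hom\<close>, plain lambda terms count as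
  homomorphisms and compose freely; \<open>restrict_lmod_hom\<close> returns to
  \<open>lmod_hom\<close> where a homomorphism has to be an element of a carrier.\<close>

definition lhom ::
  "('r, 'q) ring_scheme \<Rightarrow> ('r, 'x, 'm) module_scheme \<Rightarrow> ('r, 'y, 'n) module_scheme \<Rightarrow> ('x \<Rightarrow> 'y) \<Rightarrow> bool"
  where "lhom R M N f \<longleftrightarrow> addhom M N f \<and>
    (\<forall>r\<in>carrier R. \<forall>x\<in>carrier M. f (r \<odot>\<^bsub>M\<^esub> x) = r \<odot>\<^bsub>N\<^esub> f x)"

lemma lhomI:
  "\<lbrakk>\<And>x. x \<in> carrier M \<Longrightarrow> f x \<in> carrier N;
    \<And>x y. \<lbrakk>x \<in> carrier M; y \<in> carrier M\<rbrakk> \<Longrightarrow> f (x \<oplus>\<^bsub>M\<^esub> y) = f x \<oplus>\<^bsub>N\<^esub> f y;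
    \<And>r x. \<lbrakk>r \<in> carrier R; x \<in> carrier M\<rbrakk> \<Longrightarrow> f (r \<odot>\<^bsub>M\<^esub> x) = r \<odot>\<^bsub>N\<^esub> f x\<rbrakk> \<Longrightarrow> lhom R M N f"
  by (auto simp: lhom_def addhom_def)

lemma lhom_addhom: "lhom R M N f \<Longrightarrow> addhom M N f"
  by (auto simp: lhom_def)

lemma lhom_closed: "lhom R M N f \<Longrightarrow> x \<in> carrier M \<Longrightarrow> f x \<in> carrier N"
  by (auto simp: lhom_def addhom_def)

lemma lhom_add:
  "lhom R M N f \<Longrightarrow> x \<in> carrier M \<Longrightarrow> y \<in> carrier M \<Longrightarrow> f (x \<oplus>\<^bsub>M\<^esub> y) = f x \<oplus>\<^bsub>N\<^esub> f y"
  by (auto simp: lhom_def addhom_def)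

lemma lhom_smult:
  "lhom R M N f \<Longrightarrow> r \<in> carrier R \<Longrightarrow> x \<in> carrier M \<Longrightarrow> f (r \<odot>\<^bsub>M\<^esub> x) = r \<odot>\<^bsub>N\<^esub> f x"
  by (auto simp: lhom_def)

lemma lhom_comp: "lhom R M N f \<Longrightarrow> lhom R N L g \<Longrightarrow> lhom R M L (\<lambda>x. g (f x))"
  by (auto simp: lhom_def addhom_def Pi_iff)

lemma lhom_cong: "lhom R M N f \<Longrightarrow> (\<And>x. x \<in> carrier M \<Longrightarrow> g x = f x) \<Longrightarrow> left_module R M \<Longrightarrow> lhom R M N g"
proof -
  assume a: "lhom R M N f" "\<And>x. x \<in> carrier M \<Longrightarrow> g x = f x" "left_module R M"
  interpret M: left_module R M by fact
  show ?thesis using a(1,2) by (auto simp: lhom_def addhom_def Pi_iff M.smult_closed)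
qed

lemma lhom_id: "lhom R M M (\<lambda>x. x)"
  by (auto simp: lhom_def addhom_def)

lemma lmod_hom_iff: "f \<in> lmod_hom R M N \<longleftrightarrow> lhom R M N f \<and> f \<in> extensional (carrier M)"
  by (auto simp: lmod_hom_def lhom_def addhom_def PiE_def)

lemma lmod_homD: "f \<in> lmod_hom R M N \<Longrightarrow> lhom R M N f"
  by (simp add: lmod_hom_iff)

lemma restrict_lmod_hom:
  "left_module R M \<Longrightarrow> lhom R M N f \<Longrightarrow> restrict f (carrier M) \<in> lmod_hom R M N"
  unfolding lmod_hom_iff by (auto intro: lhom_cong)

lemma lmod_hom_eqI:
  "\<lbrakk>f \<in> lmod_hom R M N; g \<in> lmod_hom R M N; \<And>x. x \<in> carrier M \<Longrightarrow> f x = g x\<rbrakk> \<Longrightarrow> f = g"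
  unfolding lmod_hom_iff by (auto intro: extensionalityI)

lemma left_module_ag: "left_module R M \<Longrightarrow> abelian_group M"
  by (simp add: left_module_def)

lemma left_module_ring: "left_module R M \<Longrightarrow> ring R"
  by (simp add: left_module_def)

lemma left_moduleI:
  assumes "ring R" "abelian_group M"
    and "\<And>r x. \<lbrakk>r \<in> carrier R; x \<in> carrier M\<rbrakk> \<Longrightarrow> r \<odot>\<^bsub>M\<^esub> x \<in> carrier M"
    and "\<And>r s x. \<lbrakk>r \<in> carrier R; s \<in> carrier R; x \<in> carrier M\<rbrakk>
      \<Longrightarrow> (r \<oplus>\<^bsub>R\<^esub> s) \<odot>\<^bsub>M\<^esub> x = r \<odot>\<^bsub>M\<^esub> x \<oplus>\<^bsub>M\<^esub> s \<odot>\<^bsub>M\<^esub> x"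
    and "\<And>r x y. \<lbrakk>r \<in> carrier R; x \<in> carrier M; y \<in> carrier M\<rbrakk>
      \<Longrightarrow> r \<odot>\<^bsub>M\<^esub> (x \<oplus>\<^bsub>M\<^esub> y) = r \<odot>\<^bsub>M\<^esub> x \<oplus>\<^bsub>M\<^esub> r \<odot>\<^bsub>M\<^esub> y"
    and "\<And>r s x. \<lbrakk>r \<in> carrier R; s \<in> carrier R; x \<in> carrier M\<rbrakk>
      \<Longrightarrow> (r \<otimes>\<^bsub>R\<^esub> s) \<odot>\<^bsub>M\<^esub> x = r \<odot>\<^bsub>M\<^esub> (s \<odot>\<^bsub>M\<^esub> x)"
    and "\<And>x. x \<in> carrier M \<Longrightarrow> \<one>\<^bsub>R\<^esub> \<odot>\<^bsub>M\<^esub> x = x"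
  shows "left_module R M"
  using assms by (simp add: left_module_def left_module_axioms_def)

context left_module
begin

lemma smult_addhom: "r \<in> carrier R \<Longrightarrow> addhom M M (\<lambda>x. r \<odot>\<^bsub>M\<^esub> x)"
  by (auto simp: addhom_def smult_closed smult_r_distr)

lemma smult_addhom_l: "x \<in> carrier M \<Longrightarrow> addhom R M (\<lambda>r. r \<odot>\<^bsub>M\<^esub> x)"
  by (auto simp: addhom_def smult_closed smult_l_distr)

lemma M_ag: "abelian_group M" ..
lemma R_ag: "abelian_group R" ..

lemma smult_r_null [simp]: "r \<in> carrier R \<Longrightarrow> r \<odot>\<^bsub>M\<^esub> \<zero>\<^bsub>M\<^esub> = \<zero>\<^bsub>M\<^esub>"
  using addhom_zero[OF M_ag M_ag smult_addhom] .

lemma smult_l_null [simp]: "x \<in> carrier M \<Longrightarrow> \<zero> \<odot>\<^bsub>M\<^esub> x = \<zero>\<^bsub>M\<^esub>"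
  using addhom_zero[OF R_ag M_ag smult_addhom_l] .

lemma smult_l_minus: "r \<in> carrier R \<Longrightarrow> x \<in> carrier M \<Longrightarrow> (\<ominus> r) \<odot>\<^bsub>M\<^esub> x = \<ominus>\<^bsub>M\<^esub> (r \<odot>\<^bsub>M\<^esub> x)"
  using addhom_neg[OF R_ag M_ag smult_addhom_l] .

lemma smult_r_minus: "r \<in> carrier R \<Longrightarrow> x \<in> carrier M \<Longrightarrow> r \<odot>\<^bsub>M\<^esub> (\<ominus>\<^bsub>M\<^esub> x) = \<ominus>\<^bsub>M\<^esub> (r \<odot>\<^bsub>M\<^esub> x)"
  using addhom_neg[OF M_ag M_ag smult_addhom] .

lemma smult_finsum_r:
  "r \<in> carrier R \<Longrightarrow> g \<in> I \<rightarrow> carrier M \<Longrightarrow> r \<odot>\<^bsub>M\<^esub> finsum M g I = finsum M (\<lambda>i. r \<odot>\<^bsub>M\<^esub> g i) I"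
  using addhom_finsum[OF M_ag M_ag smult_addhom] .

lemma smult_finsum_l:
  "x \<in> carrier M \<Longrightarrow> g \<in> I \<rightarrow> carrier R \<Longrightarrow> finsum R g I \<odot>\<^bsub>M\<^esub> x = finsum M (\<lambda>i. g i \<odot>\<^bsub>M\<^esub> x) I"
  using addhom_finsum[OF R_ag M_ag smult_addhom_l] .

end

lemma lhom_zero: "\<lbrakk>left_module R M; left_module R N; lhom R M N f\<rbrakk> \<Longrightarrow> f \<zero>\<^bsub>M\<^esub> = \<zero>\<^bsub>N\<^esub>"
  by (blast intro: addhom_zero left_module_ag lhom_addhom)

lemma lhom_finsum:
  "\<lbrakk>left_module R M; left_module R N; lhom R M N f; g \<in> I \<rightarrow> carrier M\<rbrakk>
    \<Longrightarrow> f (finsum M g I) = finsum N (\<lambda>i. f (g i)) I"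
  by (rule addhom_finsum[OF left_module_ag left_module_ag lhom_addhom])

lemma lhom_neg:
  "\<lbrakk>left_module R M; left_module R N; lhom R M N f; x \<in> carrier M\<rbrakk> \<Longrightarrow> f (\<ominus>\<^bsub>M\<^esub> x) = \<ominus>\<^bsub>N\<^esub> f x"
  by (rule addhom_neg[OF left_module_ag left_module_ag lhom_addhom])

lemma lhom_minus:
  "\<lbrakk>left_module R M; left_module R N; lhom R M N f; x \<in> carrier M; y \<in> carrier M\<rbrakk>
    \<Longrightarrow> f (x \<ominus>\<^bsub>M\<^esub> y) = f x \<ominus>\<^bsub>N\<^esub> f y"
  by (rule addhom_minus[OF left_module_ag left_module_ag lhom_addhom])

lemma lhom_const_zero:
  "left_module R M \<Longrightarrow> left_module R N \<Longrightarrow> lhom R M N (\<lambda>x. \<zero>\<^bsub>N\<^esub>)"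
proof -
  assume "left_module R N"
  then interpret N: left_module R N .
  show ?thesis by (rule lhomI) auto
qed

lemma lhom_plus:
  assumes "left_module R M" "left_module R N" "lhom R M N f" "lhom R M N g"
  shows "lhom R M N (\<lambda>x. f x \<oplus>\<^bsub>N\<^esub> g x)"
proof -
  interpret N: left_module R N by fact
  note c = lhom_closed[OF assms(3)] lhom_closed[OF assms(4)]
  show ?thesis
    by (rule lhomI)
      (auto simp: c lhom_add[OF assms(3)] lhom_add[OF assms(4)] lhom_smult[OF assms(3)]
         lhom_smult[OF assms(4)] N.smult_r_distr N.a_ac)
qed

lemma lhom_uminus:
  assumes "left_module R M" "left_module R N" "lhom R M N f"
  shows "lhom R M N (\<lambda>x. \<ominus>\<^bsub>N\<^esub> f x)"
proof -
  interpret N: left_module R N by fact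
  note c = lhom_closed[OF assms(3)]
  show ?thesis
    by (rule lhomI)
      (auto simp: c lhom_add[OF assms(3)] lhom_smult[OF assms(3)] N.smult_r_minus N.minus_add)
qed

lemma lhom_finsum_fun:
  assumes "left_module R M" "left_module R N" "\<And>i. i \<in> I \<Longrightarrow> lhom R M N (h i)"
  shows "lhom R M N (\<lambda>x. finsum N (\<lambda>i. h i x) I)"
  using assms(3)
proof (induction I rule: infinite_finite_induct)
  case (infinite I)
  interpret N: left_module R N by fact
  show ?case using lhom_const_zero[OF assms(1,2)] infinite by simp
next
  case empty
  interpret N: left_module R N by fact
  show ?case using lhom_const_zero[OF assms(1,2)] by simp
next
  case (insert i I)
  interpret N: left_module R N by fact
  have "lhom R M N (\<lambda>x. h i x \<oplus>\<^bsub>N\<^esub> finsum N (\<lambda>i. h i x) I)"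
    using insert by (intro lhom_plus assms(1,2)) auto
  then show ?case
  proof (rule lhom_cong[OF _ _ assms(1)])
    fix x assume "x \<in> carrier M"
    then show "finsum N (\<lambda>i. h i x) (insert i I) = h i x \<oplus>\<^bsub>N\<^esub> finsum N (\<lambda>i. h i x) I"
    proof (intro N.finsum_insert insert.hyps)
      show "(\<lambda>i. h i x) \<in> I \<rightarrow> carrier N" "h i x \<in> carrier N"
        using lhom_closed[OF insert.prems \<open>x \<in> carrier M\<close>] by auto
    qed
  qed
qed

lemma lhom_inverse:
  assumes "left_module R M" "lhom R M N f" "bij_betw f (carrier M) (carrier N)"
  shows "lhom R N M (inv_into (carrier M) f)"
proof (rule lhomI)
  interpret M: left_module R M by fact
  have c: "inv_into (carrier M) f x \<in> carrier M" if "x \<in> carrier N" for x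
    using that assms(3) by (metis bij_betw_def inv_into_into)
  have f: "f (inv_into (carrier M) f x) = x" if "x \<in> carrier N" for x
    using that assms(3) by (simp add: bij_betw_inv_into_right)
  have u: "inv_into (carrier M) f x = y" if "y \<in> carrier M" "f y = x" for x y
    using that assms(3) by (metis bij_betw_inv_into_left)
  show "inv_into (carrier M) f x \<in> carrier M" if "x \<in> carrier N" for x by (rule c[OF that])
  show "inv_into (carrier M) f (x \<oplus>\<^bsub>N\<^esub> y) = inv_into (carrier M) f x \<oplus>\<^bsub>M\<^esub> inv_into (carrier M) f y"
    if "x \<in> carrier N" "y \<in> carrier N" for x y
    using that by (intro u) (auto simp: c f lhom_add[OF assms(2)])
  show "inv_into (carrier M) f (r \<odot>\<^bsub>N\<^esub> y) = r \<odot>\<^bsub>M\<^esub> inv_into (carrier M) f y"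
    if "r \<in> carrier R" "y \<in> carrier N" for r y
    using that by (intro u) (auto simp: c f lhom_smult[OF assms(2)] M.smult_closed)
qed

section \<open>Submodules and direct sums\<close>

text \<open>A submodule is kept as a bare carrier set, so that kernels, images, intersections and
  chains remain sets in one ambient module; \<open>left_module_lsub\<close> turns such a set into a
  module.\<close>

definition lsub :: "('r, 'q) ring_scheme \<Rightarrow> ('r, 'x, 'm) module_scheme \<Rightarrow> 'x set \<Rightarrow> bool"
  where "lsub R M S \<longleftrightarrow> S \<subseteq> carrier M \<and> \<zero>\<^bsub>M\<^esub> \<in> S \<and> (\<forall>x\<in>S. \<forall>y\<in>S. x \<oplus>\<^bsub>M\<^esub> y \<in> S) \<and>
    (\<forall>r\<in>carrier R. \<forall>x\<in>S. r \<odot>\<^bsub>M\<^esub> x \<in> S)"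

lemma lsubI:
  "\<lbrakk>S \<subseteq> carrier M; \<zero>\<^bsub>M\<^esub> \<in> S; \<And>x y. x \<in> S \<Longrightarrow> y \<in> S \<Longrightarrow> x \<oplus>\<^bsub>M\<^esub> y \<in> S;
    \<And>r x. r \<in> carrier R \<Longrightarrow> x \<in> S \<Longrightarrow> r \<odot>\<^bsub>M\<^esub> x \<in> S\<rbrakk> \<Longrightarrow> lsub R M S"
  by (auto simp: lsub_def)

lemma lsub_subset: "lsub R M S \<Longrightarrow> x \<in> S \<Longrightarrow> x \<in> carrier M"
  and lsub_zero: "lsub R M S \<Longrightarrow> \<zero>\<^bsub>M\<^esub> \<in> S"
  and lsub_add: "lsub R M S \<Longrightarrow> x \<in> S \<Longrightarrow> y \<in> S \<Longrightarrow> x \<oplus>\<^bsub>M\<^esub> y \<in> S"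
  and lsub_smult: "lsub R M S \<Longrightarrow> r \<in> carrier R \<Longrightarrow> x \<in> S \<Longrightarrow> r \<odot>\<^bsub>M\<^esub> x \<in> S"
  by (auto simp: lsub_def)

lemma lsub_neg:
  assumes "left_module R M" "lsub R M S" "x \<in> S"
  shows "\<ominus>\<^bsub>M\<^esub> x \<in> S"
proof -
  interpret M: left_module R M by fact
  have "\<ominus>\<^bsub>M\<^esub> x = (\<ominus>\<^bsub>R\<^esub> \<one>\<^bsub>R\<^esub>) \<odot>\<^bsub>M\<^esub> x"
    using lsub_subset[OF assms(2,3)] by (simp add: M.smult_l_minus M.smult_one)
  then show ?thesis using assms lsub_smult by (metis M.R.a_inv_closed M.R.one_closed)
qed

lemma lsub_minus:
  assumes "left_module R M" "lsub R M S" "x \<in> S" "y \<in> S"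
  shows "x \<ominus>\<^bsub>M\<^esub> y \<in> S"
  unfolding a_minus_def using assms by (meson lsub_add lsub_neg)

lemma left_module_lsub:
  assumes "left_module R M" "lsub R M S"
  shows "left_module R (M\<lparr>carrier := S\<rparr>)"
proof (rule left_moduleI)
  interpret M: left_module R M by fact
  note s = lsub_subset[OF assms(2)] lsub_zero[OF assms(2)] lsub_add[OF assms(2)] lsub_smult[OF assms(2)]
  show "ring R" ..
  show "abelian_group (M\<lparr>carrier := S\<rparr>)"
  proof (rule abelian_groupI)
    fix x assume "x \<in> carrier (M\<lparr>carrier := S\<rparr>)"
    then show "\<exists>y\<in>carrier (M\<lparr>carrier := S\<rparr>). y \<oplus>\<^bsub>M\<lparr>carrier := S\<rparr>\<^esub> x = \<zero>\<^bsub>M\<lparr>carrier := S\<rparr>\<^esub>"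
      using s lsub_neg[OF assms] by (intro bexI[of _ "\<ominus>\<^bsub>M\<^esub> x"]) (auto simp: M.l_neg)
  qed (auto simp: s M.a_assoc intro: M.a_comm)
qed (use assms in \<open>auto simp: lsub_def left_module_def left_module_axioms_def subset_iff\<close>)

lemma lhom_incl: "lsub R M S \<Longrightarrow> lhom R (M\<lparr>carrier := S\<rparr>) M (\<lambda>x. x)"
  by (auto simp: lhom_def addhom_def lsub_def)

lemma finsum_lsub:
  assumes "left_module R M" "lsub R M S" "g \<in> I \<rightarrow> S"
  shows "finsum (M\<lparr>carrier := S\<rparr>) g I = finsum M g I"
  using lhom_finsum[OF left_module_lsub[OF assms(1,2)] assms(1) lhom_incl[OF assms(2)], of g I] assms(3)
  by simp

lemma lsub_ker:
  assumes "left_module R M" "left_module R N" "lhom R M N f"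
  shows "lsub R M {x \<in> carrier M. f x = \<zero>\<^bsub>N\<^esub>}"
proof -
  interpret M: left_module R M by fact
  interpret N: left_module R N by fact
  show ?thesis
    by (rule lsubI) (auto simp: lhom_add[OF assms(3)] lhom_smult[OF assms(3)] lhom_zero[OF assms] M.smult_closed)
qed

lemma lsub_image:
  assumes "left_module R M" "left_module R N" "lhom R M N f" "lsub R M S"
  shows "lsub R N (f ` S)"
proof -
  interpret M: left_module R M by fact
  interpret N: left_module R N by fact
  note s = lsub_subset[OF assms(4)] lsub_zero[OF assms(4)] lsub_add[OF assms(4)] lsub_smult[OF assms(4)]
  show ?thesis
  proof (rule lsubI)
    show "f ` S \<subseteq> carrier N" using s lhom_closed[OF assms(3)] by auto
    show "\<zero>\<^bsub>N\<^esub> \<in> f ` S" using s lhom_zero[OF assms(1-3)] by (metis imageI)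
    show "x \<oplus>\<^bsub>N\<^esub> y \<in> f ` S" if "x \<in> f ` S" "y \<in> f ` S" for x y
      using that s by (auto simp: lhom_add[OF assms(3), symmetric])
    show "r \<odot>\<^bsub>N\<^esub> x \<in> f ` S" if "r \<in> carrier R" "x \<in> f ` S" for x r
      using that s by (auto simp: lhom_smult[OF assms(3), symmetric])
  qed
qed

lemma lsub_vimage:
  assumes "left_module R M" "left_module R N" "lhom R M N f" "lsub R M S" "lsub R N V"
  shows "lsub R M {x \<in> S. f x \<in> V}"
proof -
  interpret M: left_module R M by fact
  note s = lsub_subset[OF assms(4)] lsub_zero[OF assms(4)] lsub_add[OF assms(4)] lsub_smult[OF assms(4)]
  show ?thesis
    using assms(5)
    by (intro lsubI) (auto simp: s lhom_add[OF assms(3)] lhom_smult[OF assms(3)] lhom_zero[OF assms(1-3)]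
        lsub_zero lsub_add lsub_smult)
qed

lemma lsub_carrier: "left_module R M \<Longrightarrow> lsub R M (carrier M)"
proof -
  assume "left_module R M"
  then interpret M: left_module R M .
  show ?thesis by (rule lsubI) (auto simp: M.smult_closed)
qed

lemma lsub_null: "left_module R M \<Longrightarrow> lsub R M {\<zero>\<^bsub>M\<^esub>}"
proof -
  assume "left_module R M"
  then interpret M: left_module R M .
  show ?thesis by (rule lsubI) auto
qed

lemma lsub_Int: "lsub R M S \<Longrightarrow> lsub R M T \<Longrightarrow> lsub R M (S \<inter> T)"
  by (auto simp: lsub_def)

lemma left_module_lmod_sum:
  assumes "left_module R M" "left_module R N"
  shows "left_module R (lmod_sum M N)"
proof (rule left_moduleI)
  interpret M: left_module R M by fact
  interpret N: left_module R N by fact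
  show "ring R" ..
  show "abelian_group (lmod_sum M N)"
  proof (rule abelian_groupI)
    fix x assume "x \<in> carrier (lmod_sum M N)"
    then show "\<exists>y\<in>carrier (lmod_sum M N). y \<oplus>\<^bsub>lmod_sum M N\<^esub> x = \<zero>\<^bsub>lmod_sum M N\<^esub>"
      by (intro bexI[of _ "(\<ominus>\<^bsub>M\<^esub> fst x, \<ominus>\<^bsub>N\<^esub> snd x)"]) (auto simp: lmod_sum_def M.l_neg N.l_neg)
  qed (auto simp: lmod_sum_def M.a_assoc N.a_assoc intro: M.a_comm N.a_comm)
qed (use assms in \<open>auto simp: lmod_sum_def left_module_def left_module_axioms_def\<close>)

lemma lhom_sum_maps:
  assumes "left_module R M" "left_module R N"
  shows "lhom R (lmod_sum M N) M fst" "lhom R (lmod_sum M N) N snd"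
    "lhom R M (lmod_sum M N) (\<lambda>x. (x, \<zero>\<^bsub>N\<^esub>))" "lhom R N (lmod_sum M N) (\<lambda>x. (\<zero>\<^bsub>M\<^esub>, x))"
proof -
  interpret M: left_module R M by fact
  interpret N: left_module R N by fact
  show "lhom R (lmod_sum M N) M fst" "lhom R (lmod_sum M N) N snd"
    "lhom R M (lmod_sum M N) (\<lambda>x. (x, \<zero>\<^bsub>N\<^esub>))" "lhom R N (lmod_sum M N) (\<lambda>x. (\<zero>\<^bsub>M\<^esub>, x))"
    by (auto intro!: lhomI simp: lmod_sum_def)
qed

text \<open>Structure is transported along an injection of the carrier. Every passage of a module
  into the fixed type over which global dimension, injectivity and adjunctions quantify rests on
  this.\<close>

lemma lmod_transport:
  fixes M :: "('r, 'x, 'm) module_scheme"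
  assumes "left_module R M" "inj_on f (carrier M)"
  obtains N :: "('r, 'y) module" and g where "left_module R N" "carrier N = f ` carrier M"
    "lhom R M N f" "lhom R N M g"
    "\<And>x. x \<in> carrier M \<Longrightarrow> g (f x) = x" "\<And>y. y \<in> carrier N \<Longrightarrow> f (g y) = y"
proof -
  interpret M: left_module R M by fact
  define g where "g = inv_into (carrier M) f"
  have gf: "g (f x) = x" if "x \<in> carrier M" for x
    using that assms(2) by (simp add: g_def)
  define N :: "('r, 'y) module" where "N = \<lparr>carrier = f ` carrier M, monoid.mult = undefined,
    monoid.one = undefined, ring.zero = f \<zero>\<^bsub>M\<^esub>, add = (\<lambda>x y. f (g x \<oplus>\<^bsub>M\<^esub> g y)),
    smult = (\<lambda>r x. f (r \<odot>\<^bsub>M\<^esub> g x))\<rparr>"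
  have lm: "left_module R N"
  proof (rule left_moduleI)
    show "ring R" ..
    show "abelian_group N"
    proof (rule abelian_groupI)
      fix x assume "x \<in> carrier N"
      then show "\<exists>y\<in>carrier N. y \<oplus>\<^bsub>N\<^esub> x = \<zero>\<^bsub>N\<^esub>"
        by (intro bexI[of _ "f (\<ominus>\<^bsub>M\<^esub> g x)"]) (auto simp: N_def gf M.l_neg)
    next
      fix x y assume "x \<in> carrier N" "y \<in> carrier N"
      then show "x \<oplus>\<^bsub>N\<^esub> y = y \<oplus>\<^bsub>N\<^esub> x" by (auto simp: N_def gf M.a_comm)
    qed (auto simp: N_def gf M.a_assoc)
  qed (auto simp: N_def gf M.smult_closed M.smult_l_distr M.smult_r_distr M.smult_assoc M.smult_one)
  show thesis
  proof (rule that[OF lm])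
    show "lhom R M N f" by (rule lhomI) (auto simp: N_def gf)
    show "lhom R N M g" by (rule lhomI) (auto simp: N_def gf M.smult_closed)
  qed (auto simp: N_def gf)
qed

lemma regular_simps [simp]:
  "carrier (regular_bimod R) = carrier R" "add (regular_bimod R) = add R"
  "\<zero>\<^bsub>regular_bimod R\<^esub> = \<zero>\<^bsub>R\<^esub>" "smult (regular_bimod R) = monoid.mult R"
  "rsmult (regular_bimod R) = monoid.mult R"
  by (auto simp: regular_bimod_def)

lemma left_module_regular: "ring R \<Longrightarrow> left_module R (regular_bimod R)"
proof -
  assume "ring R"
  then interpret R: ring R .
  show ?thesis
  proof (rule left_moduleI)
    show "abelian_group (regular_bimod R)"
    proof (rule abelian_groupI)
      fix x assume "x \<in> carrier (regular_bimod R)"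
      then show "\<exists>y\<in>carrier (regular_bimod R). y \<oplus>\<^bsub>regular_bimod R\<^esub> x = \<zero>\<^bsub>regular_bimod R\<^esub>"
        by (intro bexI[of _ "\<ominus>\<^bsub>R\<^esub> x"]) (auto simp: R.l_neg)
    qed (auto simp: R.a_assoc intro: R.a_comm)
  qed (auto simp: R.l_distr R.r_distr R.m_assoc \<open>ring R\<close>)
qed

lemma finsum_regular: "finsum (regular_bimod R) f I = finsum R f I"
  by (simp add: finsum_def finprod_def)

section \<open>Endomorphism rings and groups of homomorphisms\<close>

lemma End_ring_simps [simp]:
  "carrier (End_ring R M) = lmod_hom R M M" "monoid.mult (End_ring R M) = compose (carrier M)"
  "\<one>\<^bsub>End_ring R M\<^esub> = (\<lambda>x\<in>carrier M. x)" "\<zero>\<^bsub>End_ring R M\<^esub> = (\<lambda>x\<in>carrier M. \<zero>\<^bsub>M\<^esub>)"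
  "add (End_ring R M) = (\<lambda>f g. \<lambda>x\<in>carrier M. f x \<oplus>\<^bsub>M\<^esub> g x)"
  by (auto simp: End_ring_def)

lemma abelian_group_cong:
  assumes "abelian_group M" and eq: "carrier N = carrier M" "add N = add M" "\<zero>\<^bsub>N\<^esub> = \<zero>\<^bsub>M\<^esub>"
  shows "abelian_group N"
proof -
  interpret M: abelian_group M by fact
  have "\<exists>y\<in>carrier N. y \<oplus>\<^bsub>N\<^esub> x = \<zero>\<^bsub>N\<^esub>" if "x \<in> carrier N" for x
    using M.l_neg that eq by (intro bexI[of _ "\<ominus>\<^bsub>M\<^esub> x"]) auto
  then show ?thesis by (intro abelian_groupI) (simp_all add: eq M.a_ac)
qed

lemma ring_opp:
  assumes "ring R"
  shows "ring (opp_ring R)"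
proof -
  interpret ring R by fact
  show ?thesis
  proof (rule ringI)
    show "abelian_group (opp_ring R)"
      by (rule abelian_group_cong[OF abelian_group_axioms]) (auto simp: opp_ring_def)
    show "monoid (opp_ring R)"
      by (rule monoidI) (auto simp: opp_ring_def m_assoc)
  qed (auto simp: opp_ring_def l_distr r_distr)
qed

lemma lmod_hom_closed: "f \<in> lmod_hom R M N \<Longrightarrow> x \<in> carrier M \<Longrightarrow> f x \<in> carrier N"
  by (meson lhom_closed lmod_homD)

text \<open>Only three fields of \<open>H\<close> are prescribed, so that one proof serves
  endomorphism rings, Hom modules, and both sides of Hom bimodules.\<close>

lemma abelian_group_lmod_hom:
  assumes lm: "left_module R M" "left_module R L"
    and H: "carrier H = lmod_hom R M L" "add H = (\<lambda>f g. \<lambda>x\<in>carrier M. f x \<oplus>\<^bsub>L\<^esub> g x)" "\<zero>\<^bsub>H\<^esub> = (\<lambda>x\<in>carrier M. \<zero>\<^bsub>L\<^esub>)"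
  shows "abelian_group H"
proof (rule abelian_groupI, unfold H)
  interpret L: left_module R L by fact
  note c = lmod_hom_closed[of _ R M L]
  have xe: "restrict f (carrier M) = f" if "f \<in> lmod_hom R M L" for f
    using that by (simp add: lmod_hom_iff extensional_restrict)
  show "(\<lambda>x\<in>carrier M. \<zero>\<^bsub>L\<^esub>) \<in> lmod_hom R M L" by (rule restrict_lmod_hom[OF lm(1) lhom_const_zero[OF lm]])
  fix f assume f: "f \<in> lmod_hom R M L"
  then have "(\<lambda>x\<in>carrier M. \<ominus>\<^bsub>L\<^esub> f x) \<in> lmod_hom R M L" by (intro restrict_lmod_hom lhom_uminus lm lmod_homD)
  then show "\<exists>g\<in>lmod_hom R M L. (\<lambda>x\<in>carrier M. g x \<oplus>\<^bsub>L\<^esub> f x) = (\<lambda>x\<in>carrier M. \<zero>\<^bsub>L\<^esub>)"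
    using f by (intro bexI[of _ "\<lambda>x\<in>carrier M. \<ominus>\<^bsub>L\<^esub> f x"]) (auto simp: L.l_neg c intro!: restrict_ext)
  show "(\<lambda>x\<in>carrier M. (\<lambda>x\<in>carrier M. \<zero>\<^bsub>L\<^esub>) x \<oplus>\<^bsub>L\<^esub> f x) = f" using f xe by (auto simp: c cong: restrict_cong)
  fix g assume g: "g \<in> lmod_hom R M L"
  show "(\<lambda>x\<in>carrier M. f x \<oplus>\<^bsub>L\<^esub> g x) \<in> lmod_hom R M L"
    using f g by (intro restrict_lmod_hom lhom_plus lm lmod_homD)
  show "(\<lambda>x\<in>carrier M. f x \<oplus>\<^bsub>L\<^esub> g x) = (\<lambda>x\<in>carrier M. g x \<oplus>\<^bsub>L\<^esub> f x)"
    using f g by (auto simp: c intro!: restrict_ext L.a_comm)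
  fix h assume h: "h \<in> lmod_hom R M L"
  show "(\<lambda>x\<in>carrier M. (\<lambda>x\<in>carrier M. f x \<oplus>\<^bsub>L\<^esub> g x) x \<oplus>\<^bsub>L\<^esub> h x) =
      (\<lambda>x\<in>carrier M. f x \<oplus>\<^bsub>L\<^esub> (\<lambda>x\<in>carrier M. g x \<oplus>\<^bsub>L\<^esub> h x) x)"
    using f g h by (auto simp: c L.a_assoc intro!: restrict_ext)
qed

lemma ring_End_ring:
  assumes "left_module R M"
  shows "ring (End_ring R M)"
proof -
  interpret M: left_module R M by fact
  have c: "f x \<in> carrier M" if "f \<in> lmod_hom R M M" "x \<in> carrier M" for f x
    using that by (meson lhom_closed lmod_homD)
  have ext: "\<And>f. f \<in> lmod_hom R M M \<Longrightarrow> restrict f (carrier M) = f"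
    unfolding lmod_hom_iff by (simp add: extensional_restrict)
  have cm: "compose (carrier M) f g \<in> lmod_hom R M M"
    if "f \<in> lmod_hom R M M" "g \<in> lmod_hom R M M" for f g
    unfolding compose_def
    using that assms by (intro restrict_lmod_hom lhom_comp[of R M M g M f]) (auto simp: lmod_hom_iff)
  have one: "(\<lambda>x\<in>carrier M. x) \<in> lmod_hom R M M"
    using assms by (intro restrict_lmod_hom lhom_id)
  show ?thesis
  proof (rule ringI)
    show "abelian_group (End_ring R M)" by (rule abelian_group_lmod_hom[OF assms assms]) simp_all
    show "monoid (End_ring R M)"
    proof (rule monoidI)
      fix f g h assume "f \<in> carrier (End_ring R M)" "g \<in> carrier (End_ring R M)" "h \<in> carrier (End_ring R M)"
      then show "f \<otimes>\<^bsub>End_ring R M\<^esub> g \<otimes>\<^bsub>End_ring R M\<^esub> h = f \<otimes>\<^bsub>End_ring R M\<^esub> (g \<otimes>\<^bsub>End_ring R M\<^esub> h)"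
        by (auto simp: compose_def c intro!: restrict_ext)
    qed (auto simp: cm one, auto simp: compose_def c ext cong: restrict_cong)
    fix f g h assume fgh: "f \<in> carrier (End_ring R M)" "g \<in> carrier (End_ring R M)" "h \<in> carrier (End_ring R M)"
    show "(f \<oplus>\<^bsub>End_ring R M\<^esub> g) \<otimes>\<^bsub>End_ring R M\<^esub> h =
        f \<otimes>\<^bsub>End_ring R M\<^esub> h \<oplus>\<^bsub>End_ring R M\<^esub> g \<otimes>\<^bsub>End_ring R M\<^esub> h"
      using fgh by (auto simp: compose_def c intro!: restrict_ext)
    show "h \<otimes>\<^bsub>End_ring R M\<^esub> (f \<oplus>\<^bsub>End_ring R M\<^esub> g) =
        h \<otimes>\<^bsub>End_ring R M\<^esub> f \<oplus>\<^bsub>End_ring R M\<^esub> h \<otimes>\<^bsub>End_ring R M\<^esub> g"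
      using fgh by (auto simp: compose_def c lhom_add[OF lmod_homD] intro!: restrict_ext)
  qed
qed

lemma finsum_End_apply:
  assumes "left_module R M" "g \<in> I \<rightarrow> lmod_hom R M M" "x \<in> carrier M"
  shows "finsum (End_ring R M) g I x = finsum M (\<lambda>i. g i x) I"
proof -
  interpret E: ring "End_ring R M" by (rule ring_End_ring[OF assms(1)])
  have "addhom (End_ring R M) M (\<lambda>f. f x)"
    using assms(3) lhom_closed[OF lmod_homD] by (auto intro!: addhomI)
  from addhom_finsum[OF E.is_abelian_group left_module_ag[OF assms(1)] this, of g I] assms(2)
  show ?thesis by simp
qed

section \<open>Projective modules\<close>

text \<open>The dual basis lemma as a definition of projectivity. The index type is free here,
  whereas \<open>projective\<close> ties it to the element type;
  \<open>projective_dual_basis\<close> and \<open>dual_basis_projective\<close> connect the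
  two.\<close>

definition dual_basis ::
  "('r, 'q) ring_scheme \<Rightarrow> ('r, 'x, 'm) module_scheme \<Rightarrow> 'i set \<Rightarrow> ('i \<Rightarrow> 'x \<Rightarrow> 'r) \<Rightarrow> ('i \<Rightarrow> 'x) \<Rightarrow> bool"
  where "dual_basis R M I f x \<longleftrightarrow>
    (\<forall>i\<in>I. lhom R M (regular_bimod R) (f i) \<and> x i \<in> carrier M) \<and>
    (\<forall>m\<in>carrier M. finite {i \<in> I. f i m \<noteq> \<zero>\<^bsub>R\<^esub>} \<and>
       finsum M (\<lambda>i. f i m \<odot>\<^bsub>M\<^esub> x i) {i \<in> I. f i m \<noteq> \<zero>\<^bsub>R\<^esub>} = m)"

text \<open>\<open>finsum\<close> over an infinite set is zero by convention, so a finitely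
  supported combination over an infinite index set is summed over its support.\<close>

definition supp_sum ::
  "('r, 'q) ring_scheme \<Rightarrow> ('r, 'x, 'm) module_scheme \<Rightarrow> 'i set \<Rightarrow> ('i \<Rightarrow> 'r) \<Rightarrow> ('i \<Rightarrow> 'x) \<Rightarrow> 'x"
  where "supp_sum R M I c x = finsum M (\<lambda>i. c i \<odot>\<^bsub>M\<^esub> x i) {i \<in> I. c i \<noteq> \<zero>\<^bsub>R\<^esub>}"

lemma supp_sum_eq:
  assumes "left_module R M" "finite T" "T \<subseteq> I" "\<And>i. i \<in> I - T \<Longrightarrow> c i = \<zero>\<^bsub>R\<^esub>"
    and "\<And>i. i \<in> I \<Longrightarrow> c i \<in> carrier R" "\<And>i. i \<in> I \<Longrightarrow> x i \<in> carrier M"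
  shows "supp_sum R M I c x = finsum M (\<lambda>i. c i \<odot>\<^bsub>M\<^esub> x i) T"
proof -
  interpret M: left_module R M by fact
  show ?thesis
    unfolding supp_sum_def
    using assms(2-6) by (intro M.add.finprod_mono_neutral_cong_left) (auto simp: M.smult_closed)
qed

lemma dual_basis_iff:
  "dual_basis R M I f x \<longleftrightarrow> (\<forall>i\<in>I. lhom R M (regular_bimod R) (f i) \<and> x i \<in> carrier M) \<and>
    (\<forall>m\<in>carrier M. finite {i \<in> I. f i m \<noteq> \<zero>\<^bsub>R\<^esub>} \<and> supp_sum R M I (\<lambda>i. f i m) x = m)"
  by (simp add: dual_basis_def supp_sum_def)

lemma lhom_supp_sum:
  assumes "left_module R M" "left_module R Y" "\<And>i. i \<in> I \<Longrightarrow> lhom R M (regular_bimod R) (f i)"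
    and fin: "\<And>m. m \<in> carrier M \<Longrightarrow> finite {i \<in> I. f i m \<noteq> \<zero>\<^bsub>R\<^esub>}"
    and y: "\<And>i. i \<in> I \<Longrightarrow> y i \<in> carrier Y"
  shows "lhom R M Y (\<lambda>m. supp_sum R Y I (\<lambda>i. f i m) y)"
proof (rule lhomI)
  interpret M: left_module R M by fact
  interpret Y: left_module R Y by fact
  have c: "f i m \<in> carrier R" if "i \<in> I" "m \<in> carrier M" for i m
    using lhom_closed[OF assms(3)[OF that(1)] that(2)] by simp
  let ?S = "\<lambda>m. {i \<in> I. f i m \<noteq> \<zero>\<^bsub>R\<^esub>}"
  show "supp_sum R Y I (\<lambda>i. f i m) y \<in> carrier Y" if "m \<in> carrier M" for m
    unfolding supp_sum_def using that c y by (intro Y.finsum_closed) (auto simp: Y.smult_closed)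
  show "supp_sum R Y I (\<lambda>i. f i (m \<oplus>\<^bsub>M\<^esub> n)) y =
      supp_sum R Y I (\<lambda>i. f i m) y \<oplus>\<^bsub>Y\<^esub> supp_sum R Y I (\<lambda>i. f i n) y"
    if mn: "m \<in> carrier M" "n \<in> carrier M" for m n
  proof -
    have a: "f i (m \<oplus>\<^bsub>M\<^esub> n) = f i m \<oplus>\<^bsub>R\<^esub> f i n" if "i \<in> I" for i
      using lhom_add[OF assms(3)[OF that] mn] by simp
    \<comment> \<open>The supports at m, n and m + n differ; the union of the first two contains the
      third, and all three sums are taken over it.\<close>
    have T: "finite (?S m \<union> ?S n)" "?S m \<union> ?S n \<subseteq> I" using fin mn by auto
    have "supp_sum R Y I (\<lambda>i. f i (m \<oplus>\<^bsub>M\<^esub> n)) y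
        = finsum Y (\<lambda>i. f i (m \<oplus>\<^bsub>M\<^esub> n) \<odot>\<^bsub>Y\<^esub> y i) (?S m \<union> ?S n)"
      using mn c y T by (intro supp_sum_eq[OF assms(2)]) (auto simp: a)
    also have "\<dots> = finsum Y (\<lambda>i. f i m \<odot>\<^bsub>Y\<^esub> y i \<oplus>\<^bsub>Y\<^esub> f i n \<odot>\<^bsub>Y\<^esub> y i) (?S m \<union> ?S n)"
      using mn c y by (intro Y.finsum_cong') (auto simp: a Y.smult_l_distr Y.smult_closed)
    also have "\<dots> = finsum Y (\<lambda>i. f i m \<odot>\<^bsub>Y\<^esub> y i) (?S m \<union> ?S n) \<oplus>\<^bsub>Y\<^esub>
        finsum Y (\<lambda>i. f i n \<odot>\<^bsub>Y\<^esub> y i) (?S m \<union> ?S n)"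
      using mn c y by (intro Y.finsum_addf) (auto simp: Y.smult_closed)
    also have "finsum Y (\<lambda>i. f i m \<odot>\<^bsub>Y\<^esub> y i) (?S m \<union> ?S n) = supp_sum R Y I (\<lambda>i. f i m) y"
      using mn c y T by (intro supp_sum_eq[OF assms(2), symmetric]) auto
    also have "finsum Y (\<lambda>i. f i n \<odot>\<^bsub>Y\<^esub> y i) (?S m \<union> ?S n) = supp_sum R Y I (\<lambda>i. f i n) y"
      using mn c y T by (intro supp_sum_eq[OF assms(2), symmetric]) auto
    finally show ?thesis .
  qed
  show "supp_sum R Y I (\<lambda>i. f i (r \<odot>\<^bsub>M\<^esub> m)) y = r \<odot>\<^bsub>Y\<^esub> supp_sum R Y I (\<lambda>i. f i m) y"
    if rm: "r \<in> carrier R" "m \<in> carrier M" for r m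
  proof -
    have a: "f i (r \<odot>\<^bsub>M\<^esub> m) = r \<otimes>\<^bsub>R\<^esub> f i m" if "i \<in> I" for i
      using lhom_smult[OF assms(3)[OF that] rm] by simp
    have "supp_sum R Y I (\<lambda>i. f i (r \<odot>\<^bsub>M\<^esub> m)) y = finsum Y (\<lambda>i. f i (r \<odot>\<^bsub>M\<^esub> m) \<odot>\<^bsub>Y\<^esub> y i) (?S m)"
      using rm c y fin by (intro supp_sum_eq[OF assms(2)]) (auto simp: a)
    also have "\<dots> = finsum Y (\<lambda>i. r \<odot>\<^bsub>Y\<^esub> (f i m \<odot>\<^bsub>Y\<^esub> y i)) (?S m)"
      using rm c y by (intro Y.finsum_cong') (auto simp: a Y.smult_assoc Y.smult_closed)
    also have "\<dots> = r \<odot>\<^bsub>Y\<^esub> supp_sum R Y I (\<lambda>i. f i m) y"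
      unfolding supp_sum_def
      using rm c y by (intro Y.smult_finsum_r[symmetric]) (auto simp: Y.smult_closed)
    finally show ?thesis .
  qed
qed

lemma lhom_of_supp_sum:
  assumes "left_module R M" "left_module R N" "lhom R M N h"
    "\<And>i. i \<in> I \<Longrightarrow> c i \<in> carrier R" "\<And>i. i \<in> I \<Longrightarrow> x i \<in> carrier M"
  shows "h (supp_sum R M I c x) = supp_sum R N I c (\<lambda>i. h (x i))"
proof -
  interpret M: left_module R M by fact
  interpret N: left_module R N by fact
  show ?thesis unfolding supp_sum_def
    using assms(4,5) lhom_closed[OF assms(3)]
    by (subst lhom_finsum[OF assms(1-3)])
      (auto intro!: N.finsum_cong' simp: M.smult_closed N.smult_closed lhom_smult[OF assms(3)])
qed

lemma supp_sum_cong: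
  assumes "left_module R M" "\<And>i. i \<in> I \<Longrightarrow> c i \<in> carrier R" "\<And>i. i \<in> I \<Longrightarrow> x i \<in> carrier M"
    "\<And>i. i \<in> I \<Longrightarrow> x i = y i"
  shows "supp_sum R M I c x = supp_sum R M I c y"
proof -
  interpret M: left_module R M by fact
  show ?thesis unfolding supp_sum_def
    using assms(2-4) by (intro M.finsum_cong') (auto simp: M.smult_closed)
qed

text \<open>Choose a preimage under e of h at each generator and combine these preimages with the
  coordinates of m. Applying e to the combination gives h of the dual basis expansion of m.\<close>

lemma dual_basis_lift:
  assumes db: "dual_basis R M I f x" and lm: "left_module R M" "left_module R Y" "left_module R Z"
    and e: "lhom R Y Z e" and h: "lhom R M Z h" and sub: "h ` carrier M \<subseteq> e ` carrier Y"
  shows "\<exists>g. lhom R M Y g \<and> (\<forall>m\<in>carrier M. e (g m) = h m)"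
proof -
  have x: "x i \<in> carrier M" and f: "lhom R M (regular_bimod R) (f i)" if "i \<in> I" for i
    using db that by (auto simp: dual_basis_iff)
  have "\<forall>i\<in>I. \<exists>y\<in>carrier Y. e y = h (x i)" using sub x by (metis image_iff image_subset_iff)
  then obtain y where y: "\<And>i. i \<in> I \<Longrightarrow> y i \<in> carrier Y" "\<And>i. i \<in> I \<Longrightarrow> e (y i) = h (x i)" by metis
  have c: "f i m \<in> carrier R" if "i \<in> I" "m \<in> carrier M" for i m
    using lhom_closed[OF f[OF that(1)] that(2)] by simp
  show ?thesis
  proof (intro exI conjI ballI)
    show "lhom R M Y (\<lambda>m. supp_sum R Y I (\<lambda>i. f i m) y)"
      using db by (intro lhom_supp_sum lm f y) (auto simp: dual_basis_iff)
    fix m assume m: "m \<in> carrier M"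
    have "e (supp_sum R Y I (\<lambda>i. f i m) y) = supp_sum R Z I (\<lambda>i. f i m) (\<lambda>i. e (y i))"
      using c m y by (intro lhom_of_supp_sum lm e) auto
    also have "\<dots> = supp_sum R Z I (\<lambda>i. f i m) (\<lambda>i. h (x i))"
      using c m y lhom_closed[OF e] by (intro supp_sum_cong lm) (auto simp flip: y(2))
    also have "\<dots> = h (supp_sum R M I (\<lambda>i. f i m) x)"
      using c m x by (intro lhom_of_supp_sum[symmetric] lm h) auto
    also have "\<dots> = h m" using db m by (simp add: dual_basis_iff)
    finally show "e (supp_sum R Y I (\<lambda>i. f i m) y) = h m" .
  qed
qed

text \<open>A direct summand without a chosen complement. The section and the retraction are
  arguments, so that they can be composed and carried along functors.\<close>

definition retr ::
  "('r, 'q) ring_scheme \<Rightarrow> ('r, 'x, 'm) module_scheme \<Rightarrow> ('r, 'y, 'n) module_scheme \<Rightarrow>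
   ('x \<Rightarrow> 'y) \<Rightarrow> ('y \<Rightarrow> 'x) \<Rightarrow> bool"
  where "retr R M C i p \<longleftrightarrow> lhom R M C i \<and> lhom R C M p \<and> (\<forall>m\<in>carrier M. p (i m) = m)"

lemma retr_trans: "retr R M N i p \<Longrightarrow> retr R N L j q \<Longrightarrow> retr R M L (\<lambda>x. j (i x)) (\<lambda>x. p (q x))"
  unfolding retr_def by (auto intro: lhom_comp simp: lhom_closed)

lemma dual_basis_retr:
  assumes "dual_basis R C I f x" "left_module R C" "left_module R M" "retr R M C j p"
  shows "dual_basis R M I (\<lambda>i m. f i (j m)) (\<lambda>i. p (x i))"
proof -
  have j: "lhom R M C j" and p: "lhom R C M p" and pj: "\<And>m. m \<in> carrier M \<Longrightarrow> p (j m) = m"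
    using assms(4) by (auto simp: retr_def)
  have x: "x i \<in> carrier C" and f: "lhom R C (regular_bimod R) (f i)" if "i \<in> I" for i
    using assms(1) that by (auto simp: dual_basis_iff)
  have c: "f i m \<in> carrier R" if "i \<in> I" "m \<in> carrier C" for i m
    using lhom_closed[OF f[OF that(1)] that(2)] by simp
  show ?thesis
    unfolding dual_basis_iff
  proof (intro conjI ballI)
    fix m assume m: "m \<in> carrier M"
    then have jm: "j m \<in> carrier C" using lhom_closed[OF j] by simp
    show "finite {i \<in> I. f i (j m) \<noteq> \<zero>\<^bsub>R\<^esub>}" using assms(1) jm by (simp add: dual_basis_iff)
    have "supp_sum R M I (\<lambda>i. f i (j m)) (\<lambda>i. p (x i)) = p (supp_sum R C I (\<lambda>i. f i (j m)) x)"
      using x c jm by (intro lhom_of_supp_sum[symmetric] assms p) auto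
    also have "\<dots> = m" using assms(1) jm m pj by (simp add: dual_basis_iff)
    finally show "supp_sum R M I (\<lambda>i. f i (j m)) (\<lambda>i. p (x i)) = m" .
  qed (auto intro: lhom_comp[OF j] f lhom_closed[OF p] x)
qed

section \<open>Free modules and the equivalence of projectivity with the existence of a dual
  basis\<close>

lemma free_lmod_simps:
  "\<zero>\<^bsub>free_lmod R I\<^esub> = (\<lambda>i\<in>I. \<zero>\<^bsub>R\<^esub>)" "add (free_lmod R I) = (\<lambda>f g. \<lambda>i\<in>I. f i \<oplus>\<^bsub>R\<^esub> g i)"
  "smult (free_lmod R I) = (\<lambda>r f. \<lambda>i\<in>I. r \<otimes>\<^bsub>R\<^esub> f i)"
  by (auto simp: free_lmod_def)

lemma carrier_free_lmod:
  "f \<in> carrier (free_lmod R I) \<longleftrightarrow>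
    f \<in> extensional I \<and> (\<forall>i\<in>I. f i \<in> carrier R) \<and> finite {i \<in> I. f i \<noteq> \<zero>\<^bsub>R\<^esub>}"
  by (auto simp: free_lmod_def PiE_def Pi_def)

lemma left_module_free:
  assumes "ring R"
  shows "left_module R (free_lmod R I)"
proof -
  interpret R: ring R by fact
  have supp: "finite {i \<in> I. restrict h I i \<noteq> \<zero>\<^bsub>R\<^esub>}"
    if "finite S" "\<And>i. i \<in> I \<Longrightarrow> i \<notin> S \<Longrightarrow> h i = \<zero>\<^bsub>R\<^esub>" for h S
    by (rule finite_subset[OF _ that(1)]) (use that(2) in auto)
  have pl: "(\<lambda>i\<in>I. f i \<oplus>\<^bsub>R\<^esub> g i) \<in> carrier (free_lmod R I)"
    if "f \<in> carrier (free_lmod R I)" "g \<in> carrier (free_lmod R I)" for f g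
    using that supp[of "{i \<in> I. f i \<noteq> \<zero>\<^bsub>R\<^esub>} \<union> {i \<in> I. g i \<noteq> \<zero>\<^bsub>R\<^esub>}" "\<lambda>i. f i \<oplus>\<^bsub>R\<^esub> g i"]
    unfolding carrier_free_lmod by auto
  have sm: "(\<lambda>i\<in>I. r \<otimes>\<^bsub>R\<^esub> f i) \<in> carrier (free_lmod R I)"
    if "f \<in> carrier (free_lmod R I)" "r \<in> carrier R" for f r
    using that supp[of "{i \<in> I. f i \<noteq> \<zero>\<^bsub>R\<^esub>}" "\<lambda>i. r \<otimes>\<^bsub>R\<^esub> f i"]
    unfolding carrier_free_lmod by auto
  have ng: "(\<lambda>i\<in>I. \<ominus>\<^bsub>R\<^esub> f i) \<in> carrier (free_lmod R I)"
    if "f \<in> carrier (free_lmod R I)" for f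
    using that supp[of "{i \<in> I. f i \<noteq> \<zero>\<^bsub>R\<^esub>}" "\<lambda>i. \<ominus>\<^bsub>R\<^esub> f i"]
    unfolding carrier_free_lmod by auto
  have ze: "(\<lambda>i\<in>I. \<zero>\<^bsub>R\<^esub>) \<in> carrier (free_lmod R I)"
    using supp[of "{}" "\<lambda>i. \<zero>\<^bsub>R\<^esub>"] unfolding carrier_free_lmod by auto
  have c: "f i \<in> carrier R" if "f \<in> carrier (free_lmod R I)" "i \<in> I" for f i
    using that unfolding carrier_free_lmod by auto
  have x: "restrict f I = f" if "f \<in> carrier (free_lmod R I)" for f
    using that unfolding carrier_free_lmod by (auto simp: extensional_restrict)
  note [simp] = free_lmod_simps
  show ?thesis
  proof (rule left_moduleI)
    show "abelian_group (free_lmod R I)"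
    proof (rule abelian_groupI)
      fix f assume f: "f \<in> carrier (free_lmod R I)"
      show "\<exists>y\<in>carrier (free_lmod R I). y \<oplus>\<^bsub>free_lmod R I\<^esub> f = \<zero>\<^bsub>free_lmod R I\<^esub>"
        by (rule bexI[OF _ ng[OF f]]) (use c[OF f] in \<open>auto simp: R.l_neg intro!: restrict_ext\<close>)
      show "\<zero>\<^bsub>free_lmod R I\<^esub> \<oplus>\<^bsub>free_lmod R I\<^esub> f = f"
        using c[OF f] x[OF f] by (auto cong: restrict_cong)
      fix g assume g: "g \<in> carrier (free_lmod R I)"
      show "f \<oplus>\<^bsub>free_lmod R I\<^esub> g = g \<oplus>\<^bsub>free_lmod R I\<^esub> f"
        using c[OF f] c[OF g] by (auto intro!: restrict_ext R.a_comm)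
    qed (auto simp: pl ze c R.a_assoc intro!: restrict_ext)
  next
    fix f assume f: "f \<in> carrier (free_lmod R I)"
    show "\<one>\<^bsub>R\<^esub> \<odot>\<^bsub>free_lmod R I\<^esub> f = f"
      using c[OF f] x[OF f] by (auto cong: restrict_cong)
  qed (auto simp: assms sm c R.m_assoc R.l_distr R.r_distr intro!: restrict_ext)
qed

lemma dual_basis_free:
  assumes "ring R"
  shows "dual_basis R (free_lmod R I) I (\<lambda>i g. g i) (\<lambda>i. \<lambda>j\<in>I. if j = i then \<one>\<^bsub>R\<^esub> else \<zero>\<^bsub>R\<^esub>)"
  unfolding dual_basis_def
proof (intro conjI ballI)
  interpret R: ring R by fact
  interpret F: left_module R "free_lmod R I" by (rule left_module_free[OF assms])
  let ?d = "\<lambda>i. \<lambda>j\<in>I. if j = i then \<one>\<^bsub>R\<^esub> else \<zero>\<^bsub>R\<^esub>"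
  have ev: "lhom R (free_lmod R I) (regular_bimod R) (\<lambda>g. g i)" if "i \<in> I" for i
    using that by (auto intro!: lhomI simp: carrier_free_lmod free_lmod_simps)
  show "lhom R (free_lmod R I) (regular_bimod R) (\<lambda>g. g i)" if "i \<in> I" for i by (rule ev[OF that])
  have d: "?d i \<in> carrier (free_lmod R I)" if "i \<in> I" for i
  proof -
    have "finite {ia \<in> I. ?d i ia \<noteq> \<zero>\<^bsub>R\<^esub>}" by (rule finite_subset[of _ "{i}"]) auto
    then show ?thesis by (auto simp: carrier_free_lmod)
  qed
  show "?d i \<in> carrier (free_lmod R I)" if "i \<in> I" for i by (rule d[OF that])
  fix g assume g: "g \<in> carrier (free_lmod R I)"
  let ?S = "{i \<in> I. g i \<noteq> \<zero>\<^bsub>R\<^esub>}"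
  show fS: "finite ?S" using g by (simp add: carrier_free_lmod)
  have gc: "g i \<in> carrier R" if "i \<in> I" for i using g that by (auto simp: carrier_free_lmod)
  let ?s = "finsum (free_lmod R I) (\<lambda>i. g i \<odot>\<^bsub>free_lmod R I\<^esub> ?d i) ?S"
  have sc: "?s \<in> carrier (free_lmod R I)"
    using d gc by (intro F.finsum_closed) (auto simp: F.smult_closed)
  show "?s = g"
  proof (rule extensionalityI[of _ I])
    fix j assume j: "j \<in> I"
    have "?s j = finsum (regular_bimod R) (\<lambda>i. (g i \<odot>\<^bsub>free_lmod R I\<^esub> ?d i) j) ?S"
      using d gc by (intro lhom_finsum[OF F.left_module_axioms left_module_regular[OF assms] ev[OF j]])
        (auto simp: F.smult_closed)
    also have "\<dots> = finsum R (\<lambda>i. if j = i then g i else \<zero>\<^bsub>R\<^esub>) ?S"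
      unfolding finsum_regular
      using j gc by (intro R.finsum_cong') (auto simp: free_lmod_simps)
    also have "\<dots> = g j"
    proof (cases "j \<in> ?S")
      case True
      then show ?thesis using fS gc by (subst R.finsum_delta[of _ j]) auto
    next
      case False
      then have "finsum R (\<lambda>i. if j = i then g i else \<zero>\<^bsub>R\<^esub>) ?S = finsum R (\<lambda>i. \<zero>\<^bsub>R\<^esub>) ?S"
        using gc by (intro R.finsum_cong') auto
      then show ?thesis using False j by simp
    qed
    finally show "?s j = g j" .
  qed (use sc g in \<open>simp_all only: carrier_free_lmod\<close>)
qed

lemma projective_dual_basis:
  fixes M :: "('r, 'x, 'm) module_scheme"
  assumes "projective R M" "left_module R M"
  shows "\<exists>(I :: 'x set) f x. dual_basis R M I f x"
proof -
  obtain I :: "'x set" and N :: "('r, 'x \<Rightarrow> 'r) module" and h where N: "left_module R N" and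
    h: "h \<in> lmod_hom R (lmod_sum M N) (free_lmod R I)"
      "bij_betw h (carrier (lmod_sum M N)) (carrier (free_lmod R I))"
    using assms(1) unfolding projective_def lmod_iso_def by auto
  note s = left_module_lmod_sum[OF assms(2) N] and R = left_module_ring[OF assms(2)]
  have "retr R (lmod_sum M N) (free_lmod R I) h (inv_into (carrier (lmod_sum M N)) h)"
    unfolding retr_def using h lhom_inverse[OF s lmod_homD[OF h(1)] h(2)] lmod_homD[OF h(1)]
    by (auto simp: bij_betw_inv_into_left)
  moreover have "retr R M (lmod_sum M N) (\<lambda>x. (x, \<zero>\<^bsub>N\<^esub>)) fst"
    unfolding retr_def using lhom_sum_maps[OF assms(2) N] by auto
  ultimately have r: "retr R M (free_lmod R I) (\<lambda>x. h (x, \<zero>\<^bsub>N\<^esub>))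
      (\<lambda>x. fst (inv_into (carrier (lmod_sum M N)) h x))"
    by (rule retr_trans[rotated])
  show ?thesis
    by (rule exI, rule exI, rule exI,
        rule dual_basis_retr[OF dual_basis_free[OF R] left_module_free[OF R] assms(2) r])
qed

text \<open>\<open>projective\<close> asks for an index set in the element type of M, so the free
  module on all elements of M is used. The dual basis splits its canonical map onto M, and the
  kernel of that map is the complement.\<close>

lemma dual_basis_projective:
  fixes M :: "('r, 'x, 'm) module_scheme"
  assumes "dual_basis R M I f x" "left_module R M"
  shows "projective R M"
proof -
  interpret M: left_module R M by fact
  let ?F = "free_lmod R (carrier M)"
  define p where "p = (\<lambda>g. supp_sum R M (carrier M) (\<lambda>i. g i) (\<lambda>i. i))"
  interpret F: left_module R ?F by (rule left_module_free) unfold_locales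
  have db: "dual_basis R ?F (carrier M) (\<lambda>i g. g i) (\<lambda>i. \<lambda>j\<in>carrier M. if j = i then \<one>\<^bsub>R\<^esub> else \<zero>\<^bsub>R\<^esub>)"
    by (rule dual_basis_free) unfold_locales
  have p: "lhom R ?F M p"
    unfolding p_def using db
    by (intro lhom_supp_sum F.left_module_axioms assms(2)) (auto simp: dual_basis_iff)
  have surj: "carrier M \<subseteq> p ` carrier ?F"
  proof
    fix m assume m: "m \<in> carrier M"
    let ?g = "\<lambda>j\<in>carrier M. if j = m then \<one>\<^bsub>R\<^esub> else \<zero>\<^bsub>R\<^esub>"
    have g: "?g \<in> carrier ?F" using db m by (auto simp: dual_basis_iff)
    have "p ?g = finsum M (\<lambda>i. ?g i \<odot>\<^bsub>M\<^esub> i) {m}"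
      unfolding p_def using m by (intro supp_sum_eq assms(2)) auto
    also have "\<dots> = m" using m by (simp add: M.smult_one M.finsum_insert)
    finally show "m \<in> p ` carrier ?F" using g by (metis imageI)
  qed
  obtain s where s: "lhom R M ?F s" "\<And>m. m \<in> carrier M \<Longrightarrow> p (s m) = m"
    using dual_basis_lift[OF assms(1) assms(2) F.left_module_axioms assms(2) p lhom_id] surj by auto
  let ?N = "?F\<lparr>carrier := {g \<in> carrier ?F. p g = \<zero>\<^bsub>M\<^esub>}\<rparr>"
  have k: "lsub R ?F {g \<in> carrier ?F. p g = \<zero>\<^bsub>M\<^esub>}"
    by (rule lsub_ker[OF F.left_module_axioms assms(2) p])
  have N: "left_module R ?N" by (rule left_module_lsub[OF F.left_module_axioms k])
  note sm = lhom_sum_maps[OF assms(2) N]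
  have S: "left_module R (lmod_sum M ?N)" by (rule left_module_lmod_sum[OF assms(2) N])
  let ?h = "\<lambda>u. s (fst u) \<oplus>\<^bsub>?F\<^esub> snd u"
  have h: "lhom R (lmod_sum M ?N) ?F ?h"
    by (intro lhom_plus S F.left_module_axioms lhom_comp[OF sm(1) s(1)] lhom_comp[OF sm(2) lhom_incl[OF k]])
  have pm: "p (g \<ominus>\<^bsub>?F\<^esub> s (p g)) = \<zero>\<^bsub>M\<^esub>" if "g \<in> carrier ?F" for g
    using that lhom_closed[OF p] lhom_closed[OF s(1)] s(2)
    by (simp add: lhom_minus[OF F.left_module_axioms assms(2) p], simp add: M.r_neg a_minus_def)
  have "bij_betw ?h (carrier (lmod_sum M ?N)) (carrier ?F)"
  proof (rule bij_betw_byWitness[where f' = "\<lambda>g. (p g, g \<ominus>\<^bsub>?F\<^esub> s (p g))"])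
    have ph: "p (s m \<oplus>\<^bsub>?F\<^esub> n) = m" if "m \<in> carrier M" "n \<in> carrier ?F" "p n = \<zero>\<^bsub>M\<^esub>" for m n
      using that by (simp add: lhom_add[OF p] lhom_closed[OF s(1)] s(2))
    show "\<forall>u\<in>carrier (lmod_sum M ?N). (p (?h u), ?h u \<ominus>\<^bsub>?F\<^esub> s (p (?h u))) = u"
    proof
      fix u assume "u \<in> carrier (lmod_sum M ?N)"
      then have u: "fst u \<in> carrier M" "snd u \<in> carrier ?F" "p (snd u) = \<zero>\<^bsub>M\<^esub>"
        by (auto simp: lmod_sum_def)
      have "s (fst u) \<oplus>\<^bsub>?F\<^esub> snd u \<ominus>\<^bsub>?F\<^esub> s (fst u) = snd u"
        using u lhom_closed[OF s(1)] F.M.a_comm[of "s (fst u)" "snd u"]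
        by (simp add: a_minus_def F.M.a_assoc F.M.r_neg)
      then show "(p (?h u), ?h u \<ominus>\<^bsub>?F\<^esub> s (p (?h u))) = u"
        using u by (simp add: ph prod_eq_iff)
    qed
    show "\<forall>g\<in>carrier ?F. ?h (p g, g \<ominus>\<^bsub>?F\<^esub> s (p g)) = g"
    proof
      fix g assume g: "g \<in> carrier ?F"
      then have "s (p g) \<in> carrier ?F" using lhom_closed[OF p] lhom_closed[OF s(1)] by simp
      then show "?h (p g, g \<ominus>\<^bsub>?F\<^esub> s (p g)) = g"
        using g by (simp add: a_minus_def F.M.a_lcomm[of _ g] F.M.r_neg)
    qed
    show "?h ` carrier (lmod_sum M ?N) \<subseteq> carrier ?F" using lhom_closed[OF h] by auto
    show "(\<lambda>g. (p g, g \<ominus>\<^bsub>?F\<^esub> s (p g))) ` carrier ?F \<subseteq> carrier (lmod_sum M ?N)"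
      using pm lhom_closed[OF p] lhom_closed[OF s(1)] by (auto simp: lmod_sum_def)
  qed
  then have "bij_betw (restrict ?h (carrier (lmod_sum M ?N))) (carrier (lmod_sum M ?N)) (carrier ?F)"
    by (subst bij_betw_restrict_eq)
  then have "lmod_iso R (lmod_sum M ?N) ?F"
    unfolding lmod_iso_def using restrict_lmod_hom[OF S h] by blast
  then show ?thesis unfolding projective_def using N by blast
qed

lemma projective_retr:
  fixes C :: "('r, 'y, 'n) module_scheme"
  assumes "projective R C" "left_module R C" "left_module R M" "retr R M C i p"
  shows "projective R M"
proof -
  obtain I :: "'y set" and f x where "dual_basis R C I f x" using projective_dual_basis[OF assms(1,2)] by blast
  from dual_basis_projective[OF dual_basis_retr[OF this assms(2-4)] assms(3)] show ?thesis .
qed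

lemma projective_lift:
  fixes M :: "('r, 'x, 'm) module_scheme"
  assumes "projective R M" "left_module R M" "left_module R Y" "left_module R Z"
    and "lhom R Y Z e" "lhom R M Z h" "h ` carrier M \<subseteq> e ` carrier Y"
  shows "\<exists>g. lhom R M Y g \<and> (\<forall>m\<in>carrier M. e (g m) = h m)"
proof -
  obtain I :: "'x set" and f x where "dual_basis R M I f x" using projective_dual_basis[OF assms(1,2)] by blast
  from dual_basis_lift[OF this assms(2-7)] show ?thesis .
qed

lemma projective_zero:
  assumes "left_module R M" "carrier M = {\<zero>\<^bsub>M\<^esub>}"
  shows "projective R M"
proof -
  interpret M: left_module R M by fact
  have "dual_basis R M ({} :: nat set) f x" for f x
    using assms(2) by (simp add: dual_basis_def)
  then show ?thesis using dual_basis_projective assms(1) by blast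
qed

lemma free_cover:
  assumes M: "left_module R M"
  obtains e where "lhom R (free_lmod R (carrier M)) M e" "e ` carrier (free_lmod R (carrier M)) = carrier M"
proof -
  interpret M: left_module R M by fact
  let ?L = "free_lmod R (carrier M)" and ?b = "\<lambda>x. \<lambda>j\<in>carrier M. if j = x then \<one>\<^bsub>R\<^esub> else \<zero>\<^bsub>R\<^esub>"
  note rR = left_module_ring[OF M]
  note L = left_module_free[OF rR, of "carrier M"] and db = dual_basis_free[OF rR, of "carrier M"]
  define e where "e = (\<lambda>g. supp_sum R M (carrier M) g (\<lambda>x. x))"
  have e: "lhom R ?L M e"
    unfolding e_def by (rule lhom_supp_sum[OF L M]) (use db in \<open>auto simp: dual_basis_def\<close>)
  have eb: "e (?b x) = x" if x: "x \<in> carrier M" for x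
  proof -
    have "e (?b x) = finsum M (\<lambda>i. ?b x i \<odot>\<^bsub>M\<^esub> i) {x}"
      unfolding e_def by (rule supp_sum_eq[OF M]) (use x in auto)
    also have "\<dots> = ?b x x \<odot>\<^bsub>M\<^esub> x" by (rule M.finsum_delta) (use x M.smult_one[OF x] in simp_all)
    finally show ?thesis using M.smult_one[OF x] x by simp
  qed
  have bL: "?b x \<in> carrier ?L" if "x \<in> carrier M" for x using db that by (simp add: dual_basis_def)
  have "e ` carrier ?L = carrier M"
  proof
    show "e ` carrier ?L \<subseteq> carrier M" using lhom_closed[OF e] by blast
    show "carrier M \<subseteq> e ` carrier ?L"
    proof
      fix x assume x: "x \<in> carrier M"
      show "x \<in> e ` carrier ?L" by (rule image_eqI) (rule eb[OF x, symmetric], rule bL[OF x])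
    qed
  qed
  then show thesis by (rule that[OF e])
qed

lemma projective_section:
  assumes "left_module R M" "lhom R M (free_lmod R I) s" "lhom R (free_lmod R I) M e"
    and "\<And>x. x \<in> carrier M \<Longrightarrow> e (s x) = x"
  shows "projective R M"
proof (rule projective_retr)
  note rR = left_module_ring[OF assms(1)]
  show L: "left_module R (free_lmod R I)" by (rule left_module_free[OF rR])
  show "projective R (free_lmod R I)" by (rule dual_basis_projective[OF dual_basis_free[OF rR] L])
  show "retr R M (free_lmod R I) s e" using assms(2-4) by (simp add: retr_def)
qed (rule assms(1))

text \<open>Dual bases of M and N have unrelated index types. Instead of joining them, the two
  injections into the sum are lifted through the free cover of the sum, and the lifts add up to a
  section.\<close>

lemma projective_sum:
  fixes M :: "('r, 'x, 'm) module_scheme" and N :: "('r, 'y, 'n) module_scheme"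
  assumes M: "projective R M" "left_module R M" and N: "projective R N" "left_module R N"
  shows "projective R (lmod_sum M N)"
proof -
  interpret M: left_module R M by fact
  interpret N: left_module R N by fact
  let ?S = "lmod_sum M N"
  note S = left_module_lmod_sum[OF M(2) N(2)] and sm = lhom_sum_maps[OF M(2) N(2)]
  note L = left_module_free[OF left_module_ring[OF S], of "carrier ?S"]
  obtain e where e: "lhom R (free_lmod R (carrier ?S)) ?S e" "e ` carrier (free_lmod R (carrier ?S)) = carrier ?S"
    by (rule free_cover[OF S])
  have im: "(\<lambda>x. (x, \<zero>\<^bsub>N\<^esub>)) ` carrier M \<subseteq> carrier ?S" "(\<lambda>x. (\<zero>\<^bsub>M\<^esub>, x)) ` carrier N \<subseteq> carrier ?S"
    by (auto simp: lmod_sum_def)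
  obtain f where f: "lhom R M (free_lmod R (carrier ?S)) f" "\<And>x. x \<in> carrier M \<Longrightarrow> e (f x) = (x, \<zero>\<^bsub>N\<^esub>)"
    using projective_lift[OF M L S e(1) sm(3)] im(1) e(2) by auto
  obtain g where g: "lhom R N (free_lmod R (carrier ?S)) g" "\<And>x. x \<in> carrier N \<Longrightarrow> e (g x) = (\<zero>\<^bsub>M\<^esub>, x)"
    using projective_lift[OF N L S e(1) sm(4)] im(2) e(2) by auto
  show ?thesis
  proof (rule projective_section[OF S lhom_plus[OF S L lhom_comp[OF sm(1) f(1)] lhom_comp[OF sm(2) g(1)]] e(1)])
    fix u assume "u \<in> carrier ?S"
    then have u: "fst u \<in> carrier M" "snd u \<in> carrier N" by (auto simp: lmod_sum_def)
    show "e (f (fst u) \<oplus>\<^bsub>free_lmod R (carrier ?S)\<^esub> g (snd u)) = u"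
      unfolding lhom_add[OF e(1) lhom_closed[OF f(1) u(1)] lhom_closed[OF g(1) u(2)]] f(2)[OF u(1)] g(2)[OF u(2)]
      using u by (simp add: lmod_sum_def)
  qed
qed

section \<open>Projective dimension through iterated kernels\<close>

abbreviation kermod ::
  "('r, 'x, 'm) module_scheme \<Rightarrow> ('r, 'y, 'n) module_scheme \<Rightarrow> ('x \<Rightarrow> 'y) \<Rightarrow> ('r, 'x, 'm) module_scheme"
  where "kermod P M e \<equiv> P\<lparr>carrier := {x \<in> carrier P. e x = \<zero>\<^bsub>M\<^esub>}\<rparr>"

text \<open>An inductive form of \<open>projdim R M \<le> enat n\<close>, by passing to a syzygy. As
  a substructure of \<open>P\<close> the syzygy keeps the type 'u. The choice of \<open>P\<close> is
  existential, and closure under retracts is what makes the recursion robust against it.\<close>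

fun pd_le :: "('r, 'q) ring_scheme \<Rightarrow> nat \<Rightarrow> ('r, 'u) module \<Rightarrow> bool"
  where
    "pd_le R 0 M \<longleftrightarrow> projective R M"
  | "pd_le R (Suc n) M \<longleftrightarrow> (\<exists>(P :: ('r, 'u) module) e. left_module R P \<and> projective R P \<and>
       lhom R P M e \<and> e ` carrier P = carrier M \<and> pd_le R n (kermod P M e))"

lemma left_module_kermod:
  "left_module R P \<Longrightarrow> left_module R M \<Longrightarrow> lhom R P M e \<Longrightarrow> left_module R (kermod P M e)"
  by (rule left_module_lsub[OF _ lsub_ker])

lemma lhom_to_lsub: "lhom R M N f \<Longrightarrow> f ` carrier M \<subseteq> S \<Longrightarrow> lhom R M (N\<lparr>carrier := S\<rparr>) f"
  by (auto simp: lhom_def addhom_def)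

lemma lhom_from_lsub: "lhom R M N f \<Longrightarrow> S \<subseteq> carrier M \<Longrightarrow> lhom R (M\<lparr>carrier := S\<rparr>) N f"
  by (auto simp: lhom_def addhom_def subset_iff)

lemma lepoll_times_self: "infinite (UNIV :: 'u set) \<Longrightarrow> (UNIV :: ('u \<times> 'u) set) \<lesssim> (UNIV :: 'u set)"
  using card_of_Times_same_infinite[of "UNIV :: 'u set"]
  by (metis UNIV_Times_UNIV card_of_ordLeq lepoll_def ordIso_iff_ordLeq)

text \<open>A Schanuel argument. The idempotent i p of C lifts along e to an endomorphism
  \<open>a\<close> of P. It maps the kernel of p e into the kernel of e, and 1 - a maps P into the
  kernel of p e. Hence x \<mapsto> (a x, x) is a section with retraction (u, x) \<mapsto> u + x - a
  x.\<close>

lemma retr_kermod: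
  assumes lm: "left_module R C" "left_module R M" "left_module R P"
    and r: "retr R M C i p" and e: "lhom R P C e" "e ` carrier P = carrier C"
    and proj: "projective R P"
  shows "\<exists>j q. retr R (kermod P M (\<lambda>x. p (e x))) (lmod_sum (kermod P C e) P) j q"
proof -
  interpret C: left_module R C by fact
  interpret M: left_module R M by fact
  interpret P: left_module R P by fact
  have i: "lhom R M C i" and p: "lhom R C M p" and pi: "\<And>m. m \<in> carrier M \<Longrightarrow> p (i m) = m"
    using r by (auto simp: retr_def)
  have pe: "lhom R P M (\<lambda>x. p (e x))" by (rule lhom_comp[OF e(1) p])
  have h: "lhom R P C (\<lambda>x. i (p (e x)))" by (rule lhom_comp[OF pe i])
  obtain a where a: "lhom R P P a" "\<And>x. x \<in> carrier P \<Longrightarrow> e (a x) = i (p (e x))"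
    using projective_lift[OF proj lm(3) lm(3) lm(1) e(1) h] lhom_closed[OF h] e(2)
    by (metis image_subsetI)
  let ?L = "kermod P M (\<lambda>x. p (e x))" and ?K = "kermod P C e"
  have K: "left_module R ?K" and L: "left_module R ?L"
    by (rule left_module_kermod[OF lm(3,1) e(1)], rule left_module_kermod[OF lm(3,2) pe])
  have subK: "lsub R P {x \<in> carrier P. e x = \<zero>\<^bsub>C\<^esub>}" by (rule lsub_ker[OF lm(3,1) e(1)])
  note sm = lhom_sum_maps[OF K lm(3)]
  have ac: "a x \<in> carrier P" if "x \<in> carrier P" for x using lhom_closed[OF a(1) that] .
  define q where "q = (\<lambda>u. fst u \<oplus>\<^bsub>P\<^esub> (snd u \<oplus>\<^bsub>P\<^esub> \<ominus>\<^bsub>P\<^esub> a (snd u)))"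
  have q: "lhom R (lmod_sum ?K P) P q"
    unfolding q_def
    by (intro lhom_plus lhom_uminus left_module_lmod_sum K lm lhom_comp[OF sm(1) lhom_incl[OF subK]] sm(2)
        lhom_comp[OF sm(2) a(1)])
  have "retr R ?L (lmod_sum ?K P) (\<lambda>x. (a x, x)) q"
    unfolding retr_def
  proof (intro conjI ballI)
    have z: "i \<zero>\<^bsub>M\<^esub> = \<zero>\<^bsub>C\<^esub>" by (rule lhom_zero[OF lm(2,1) i])
    show "lhom R ?L (lmod_sum ?K P) (\<lambda>x. (a x, x))"
      by (rule lhomI) (auto simp: lmod_sum_def ac a(2) z lhom_add[OF a(1)] lhom_smult[OF a(1)])
    show "lhom R (lmod_sum ?K P) ?L q"
    proof (rule lhom_to_lsub[OF q], safe)
      fix x y assume "(x, y) \<in> carrier (lmod_sum ?K P)"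
      then have xy: "x \<in> carrier P" "e x = \<zero>\<^bsub>C\<^esub>" "y \<in> carrier P" by (auto simp: lmod_sum_def)
      show "q (x, y) \<in> carrier P" using xy ac by (simp add: q_def)
      have "p (e (a y)) = p (e y)" using xy by (simp add: a(2) pi lhom_closed[OF pe])
      then show "p (e (q (x, y))) = \<zero>\<^bsub>M\<^esub>"
        using xy ac lhom_closed[OF pe] lhom_zero[OF lm(1,2) p]
        by (simp add: q_def lhom_add[OF pe] lhom_neg[OF lm(3,2) pe] M.r_neg)
    qed
    fix m assume "m \<in> carrier ?L"
    then show "q (a m, m) = m"
      using ac by (simp add: q_def P.M.a_lcomm[of "a m" m] P.M.r_neg)
  qed
  then show ?thesis by blast
qed

text \<open>The two claims depend on each other. For a retract of C, \<open>retr_kermod\<close>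
  presents the new syzygy as a retract of an old syzygy plus a projective, which is the second claim
  one step lower. For the second claim, K \<oplus> P is copied into 'u; its syzygy along e \<oplus>
  id is that of K, so the first claim one step lower bounds the copy, and the first claim at the
  same n passes to the retract.\<close>

lemma pd_le_aux:
  fixes R :: "('r, 'q) ring_scheme"
  assumes inf: "infinite (UNIV :: 'u set)"
  shows "(\<forall>(C :: ('r, 'u) module) (M :: ('r, 'u) module) i p. left_module R C \<longrightarrow> left_module R M \<longrightarrow>
      pd_le R n C \<longrightarrow> retr R M C i p \<longrightarrow> pd_le R n M) \<and>
    (\<forall>(K :: ('r, 'u) module) (P :: ('r, 'u) module) (M :: ('r, 'u) module) i p.
      left_module R K \<longrightarrow> left_module R P \<longrightarrow> left_module R M \<longrightarrow>
      pd_le R n K \<longrightarrow> projective R P \<longrightarrow> retr R M (lmod_sum K P) i p \<longrightarrow> pd_le R n M)"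
proof (induction n)
  case 0
  show ?case
    by (auto intro: projective_retr projective_sum left_module_lmod_sum)
next
  case (Suc n)
  obtain \<iota> :: "'u \<times> 'u \<Rightarrow> 'u" where \<iota>: "inj \<iota>"
    using lepoll_times_self[OF inf] unfolding lepoll_def by auto
  have R1: "pd_le R (Suc n) M"
    if lm: "left_module R C" "left_module R M" and pd: "pd_le R (Suc n) C" and r: "retr R M C i p"
    for C M :: "('r, 'u) module" and i p
  proof -
    obtain P :: "('r, 'u) module" and e where P: "left_module R P" "projective R P" "lhom R P C e"
      "e ` carrier P = carrier C" "pd_le R n (kermod P C e)"
      using pd by auto
    have i: "lhom R M C i" and p: "lhom R C M p" and pi: "\<And>m. m \<in> carrier M \<Longrightarrow> p (i m) = m"
      using r by (auto simp: retr_def)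
    have pe: "lhom R P M (\<lambda>x. p (e x))" by (rule lhom_comp[OF P(3) p])
    obtain j q where jq: "retr R (kermod P M (\<lambda>x. p (e x))) (lmod_sum (kermod P C e) P) j q"
      using retr_kermod[OF lm P(1) r P(3,4,2)] by blast
    have "pd_le R n (kermod P M (\<lambda>x. p (e x)))"
      using Suc.IH[THEN conjunct2, rule_format, OF left_module_kermod[OF P(1) lm(1) P(3)] P(1)
          left_module_kermod[OF P(1) lm(2) pe] P(5) P(2) jq] .
    moreover have "(\<lambda>x. p (e x)) ` carrier P = carrier M"
    proof
      show "(\<lambda>x. p (e x)) ` carrier P \<subseteq> carrier M" using lhom_closed[OF pe] by auto
      show "carrier M \<subseteq> (\<lambda>x. p (e x)) ` carrier P"
      proof
        fix m assume m: "m \<in> carrier M"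
        then have "i m \<in> e ` carrier P" using lhom_closed[OF i] P(4) by auto
        then obtain x where "x \<in> carrier P" "e x = i m" by auto
        then show "m \<in> (\<lambda>x. p (e x)) ` carrier P" using pi[OF m] by (metis imageI)
      qed
    qed
    ultimately show ?thesis using P(1,2) pe by auto
  qed
  have "pd_le R (Suc n) M"
    if lm: "left_module R K" "left_module R P" "left_module R M" and pd: "pd_le R (Suc n) K"
      and pr: "projective R P" and r: "retr R M (lmod_sum K P) i p"
    for K P M :: "('r, 'u) module" and i p
  proof -
    obtain P' :: "('r, 'u) module" and e where P': "left_module R P'" "projective R P'" "lhom R P' K e"
      "e ` carrier P' = carrier K" "pd_le R n (kermod P' K e)"
      using pd by auto
    note S = left_module_lmod_sum[OF P'(1) lm(2)] and S' = left_module_lmod_sum[OF lm(1,2)]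
    obtain D :: "('r, 'u) module" and b where D: "left_module R D" "carrier D = \<iota> ` carrier (lmod_sum P' P)"
      "lhom R (lmod_sum P' P) D \<iota>" "lhom R D (lmod_sum P' P) b"
      "\<And>x. x \<in> carrier (lmod_sum P' P) \<Longrightarrow> b (\<iota> x) = x" "\<And>y. y \<in> carrier D \<Longrightarrow> \<iota> (b y) = y"
      using lmod_transport[OF S] inj_on_subset[OF \<iota>] by (metis subset_UNIV)
    obtain T :: "('r, 'u) module" and c where T: "left_module R T" "carrier T = \<iota> ` carrier (lmod_sum K P)"
      "lhom R (lmod_sum K P) T \<iota>" "lhom R T (lmod_sum K P) c"
      "\<And>x. x \<in> carrier (lmod_sum K P) \<Longrightarrow> c (\<iota> x) = x" "\<And>y. y \<in> carrier T \<Longrightarrow> \<iota> (c y) = y"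
      using lmod_transport[OF S'] inj_on_subset[OF \<iota>] by (metis subset_UNIV)
    have pD: "projective R D"
      by (rule projective_retr[OF projective_sum[OF P'(2,1) pr lm(2)] S D(1)]) (use D in \<open>auto simp: retr_def\<close>)
    \<comment> \<open>This is e \<oplus> id, so the kernel is that of e, embedded in the first
      component.\<close>
    define f :: "'u \<times> 'u \<Rightarrow> 'u \<times> 'u" where "f = (\<lambda>u. (e (fst u), snd u))"
    have f: "lhom R (lmod_sum P' P) (lmod_sum K P) f"
      by (rule lhomI) (auto simp: f_def lmod_sum_def lhom_closed[OF P'(3)] lhom_add[OF P'(3)] lhom_smult[OF P'(3)])
    define g where "g = (\<lambda>y. \<iota> (f (b y)))"
    have g: "lhom R D T g" unfolding g_def by (rule lhom_comp[OF lhom_comp[OF D(4) f] T(3)])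
    have gs: "g ` carrier D = carrier T"
    proof
      show "g ` carrier D \<subseteq> carrier T" using lhom_closed[OF g] by auto
      show "carrier T \<subseteq> g ` carrier D"
      proof
        fix t assume t: "t \<in> carrier T"
        then have ct: "c t \<in> carrier (lmod_sum K P)" using lhom_closed[OF T(4)] by auto
        then have "fst (c t) \<in> e ` carrier P'" unfolding P'(4) by (auto simp: lmod_sum_def)
        then obtain x where x: "x \<in> carrier P'" "e x = fst (c t)" by auto
        have xx: "(x, snd (c t)) \<in> carrier (lmod_sum P' P)" using x ct by (auto simp: lmod_sum_def)
        then have "g (\<iota> (x, snd (c t))) = t"
          using x t by (simp add: g_def D(5) f_def T(6))
        then show "t \<in> g ` carrier D" using xx D(2) by (metis imageI)
      qed
    qed
    have zT: "\<zero>\<^bsub>T\<^esub> = \<iota> (\<zero>\<^bsub>K\<^esub>, \<zero>\<^bsub>P\<^esub>)"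
      using lhom_zero[OF S' T(1) T(3)] by (simp add: lmod_sum_def)
    interpret K: left_module R K by fact
    interpret P: left_module R P by fact
    interpret P': left_module R P' by fact
    have ker: "g y = \<zero>\<^bsub>T\<^esub> \<longleftrightarrow> e (fst (b y)) = \<zero>\<^bsub>K\<^esub> \<and> snd (b y) = \<zero>\<^bsub>P\<^esub>" if "y \<in> carrier D" for y
      unfolding g_def zT f_def using inj_eq[OF \<iota>] by auto
    have bc: "fst (b y) \<in> carrier P'" "snd (b y) \<in> carrier P" if "y \<in> carrier D" for y
      using lhom_closed[OF D(4) that] by (auto simp: lmod_sum_def)
    note sm = lhom_sum_maps[OF P'(1) lm(2)]
    have "retr R (kermod D T g) (kermod P' K e) (\<lambda>y. fst (b y)) (\<lambda>x. \<iota> (x, \<zero>\<^bsub>P\<^esub>))"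
      unfolding retr_def
    proof (intro conjI ballI)
      show "lhom R (kermod D T g) (kermod P' K e) (\<lambda>y. fst (b y))"
        by (rule lhom_to_lsub[OF lhom_from_lsub[OF lhom_comp[OF D(4) sm(1)]]]) (auto simp: ker bc)
      show "lhom R (kermod P' K e) (kermod D T g) (\<lambda>x. \<iota> (x, \<zero>\<^bsub>P\<^esub>))"
      proof (rule lhom_to_lsub[OF lhom_from_lsub[OF lhom_comp[OF sm(3) D(3)]]], safe)
        fix x assume "x \<in> carrier (kermod P' K e)"
        then have x: "x \<in> carrier P'" "e x = \<zero>\<^bsub>K\<^esub>" by auto
        then have xx: "(x, \<zero>\<^bsub>P\<^esub>) \<in> carrier (lmod_sum P' P)" by (auto simp: lmod_sum_def)
        then show "\<iota> (x, \<zero>\<^bsub>P\<^esub>) \<in> carrier D" using D(2) by auto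
        then show "g (\<iota> (x, \<zero>\<^bsub>P\<^esub>)) = \<zero>\<^bsub>T\<^esub>" using x xx by (simp add: ker D(5))
      qed
      fix y assume "y \<in> carrier (kermod D T g)"
      then have "y \<in> carrier D" "snd (b y) = \<zero>\<^bsub>P\<^esub>" using ker by auto
      then show "\<iota> (fst (b y), \<zero>\<^bsub>P\<^esub>) = y" using D(6) by (metis prod.collapse)
    qed
    then have "pd_le R n (kermod D T g)"
      using Suc.IH[THEN conjunct1, rule_format, OF left_module_kermod[OF P'(1) lm(1) P'(3)]
          left_module_kermod[OF D(1) T(1) g] P'(5)] by blast
    then have T': "pd_le R (Suc n) T" using D(1) pD g gs by auto
    have "retr R (lmod_sum K P) T \<iota> c" using T by (auto simp: retr_def)
    then show ?thesis using R1[OF T(1) lm(3) T' retr_trans[OF r]] by blast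
  qed
  with R1 show ?case by blast
qed

lemma pd_le_retr:
  fixes C M :: "('r, 'u) module"
  assumes "infinite (UNIV :: 'u set)" "left_module R C" "left_module R M" "pd_le R n C" "retr R M C i p"
  shows "pd_le R n M"
  using pd_le_aux[OF assms(1), of R n] assms(2-) by blast

lemma lhom_inj:
  assumes "left_module R M" "left_module R N" "lhom R M N f"
    "\<And>x. x \<in> carrier M \<Longrightarrow> f x = \<zero>\<^bsub>N\<^esub> \<Longrightarrow> x = \<zero>\<^bsub>M\<^esub>"
  shows "inj_on f (carrier M)"
proof (rule inj_onI)
  interpret M: left_module R M by fact
  interpret N: left_module R N by fact
  fix x y assume xy: "x \<in> carrier M" "y \<in> carrier M" "f x = f y"
  then have "f (x \<ominus>\<^bsub>M\<^esub> y) = \<zero>\<^bsub>N\<^esub>"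
    using lhom_closed[OF assms(3)] by (simp add: lhom_minus[OF assms(1-3)], simp add: N.r_neg a_minus_def)
  then have "x \<ominus>\<^bsub>M\<^esub> y = \<zero>\<^bsub>M\<^esub>" using xy assms(4) by simp
  moreover have "x = (x \<ominus>\<^bsub>M\<^esub> y) \<oplus>\<^bsub>M\<^esub> y" using xy by (simp add: a_minus_def M.a_assoc M.l_neg)
  ultimately show "x = y" using xy by simp
qed

text \<open>Dropping the first term of a resolution resolves the first syzygy, because the image of
  \<open>d 0\<close> is the kernel of \<open>e\<close>. At n = 0 the vanishing of all later terms
  makes \<open>e\<close> injective, so M is a retract of the projective \<open>P 0\<close>.\<close>

lemma pd_le_of_resolution:
  fixes M :: "('r, 'u) module"
  assumes "proj_resolution R M P d e" "left_module R M" "\<forall>i>n. carrier (P i) = {\<zero>\<^bsub>P i\<^esub>}"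
  shows "pd_le R n M"
  using assms
proof (induction n arbitrary: M P d e)
  case 0
  have lm: "left_module R (P i)" and pr: "projective R (P i)" for i
    using 0(1) by (auto simp: proj_resolution_def)
  have e: "lhom R (P 0) M e" and d: "lhom R (P (Suc 0)) (P 0) (d 0)"
    and im: "e ` carrier (P 0) = carrier M"
    and ker: "d 0 ` carrier (P (Suc 0)) = {x \<in> carrier (P 0). e x = \<zero>\<^bsub>M\<^esub>}"
    using 0(1) by (auto simp: proj_resolution_def lmod_hom_iff)
  have "{x \<in> carrier (P 0). e x = \<zero>\<^bsub>M\<^esub>} = {\<zero>\<^bsub>P 0\<^esub>}"
    using 0(3) ker lhom_zero[OF lm lm d] by (metis image_empty image_insert zero_less_Suc)
  then have "inj_on e (carrier (P 0))"
    by (intro lhom_inj[OF lm 0(2) e]) blast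
  then have bij: "bij_betw e (carrier (P 0)) (carrier M)" using im by (simp add: bij_betw_def)
  have "retr R M (P 0) (inv_into (carrier (P 0)) e) e"
    using lhom_inverse[OF lm e bij] e bij by (auto simp: retr_def bij_betw_inv_into_right)
  then show ?case using projective_retr[OF pr lm 0(2)] by simp
next
  case (Suc n)
  have lm: "left_module R (P i)" and pr: "projective R (P i)" for i
    using Suc.prems(1) by (auto simp: proj_resolution_def)
  have e: "lhom R (P 0) M e" and d: "d 0 \<in> lmod_hom R (P (Suc 0)) (P 0)"
    and im: "e ` carrier (P 0) = carrier M"
    and ker: "d 0 ` carrier (P (Suc 0)) = {x \<in> carrier (P 0). e x = \<zero>\<^bsub>M\<^esub>}"
    using Suc.prems(1) by (auto simp: proj_resolution_def lmod_hom_iff)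
  have "proj_resolution R (kermod (P 0) M e) (\<lambda>i. P (Suc i)) (\<lambda>i. d (Suc i)) (d 0)"
    using Suc.prems(1) d ker unfolding proj_resolution_def
    by (auto simp: lmod_hom_iff lhom_to_lsub)
  then have "pd_le R n (kermod (P 0) M e)"
    using Suc.prems(3) by (intro Suc.IH left_module_kermod lm Suc.prems(2) e) auto
  then show ?case using lm pr e im by auto
qed

text \<open>Splicing: P is put in front of a resolution of the kernel, whose augmentation becomes
  the first differential. For n = 0 the zero submodule of M fills the positive degrees.\<close>

lemma resolution_of_pd_le:
  fixes M :: "('r, 'u) module"
  assumes "pd_le R n M" "left_module R M"
  shows "\<exists>P d e. proj_resolution R M P d e \<and> (\<forall>i>n. carrier (P i) = {\<zero>\<^bsub>P i\<^esub>})"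
  using assms
proof (induction n arbitrary: M)
  case 0
  interpret M: left_module R M by fact
  define Z where "Z = M\<lparr>carrier := {\<zero>\<^bsub>M\<^esub>}\<rparr>"
  have Z: "left_module R Z" unfolding Z_def by (rule left_module_lsub[OF 0(2) lsub_null[OF 0(2)]])
  have pZ: "projective R Z" by (rule projective_zero[OF Z]) (simp add: Z_def)
  let ?P = "\<lambda>i::nat. if i = 0 then M else Z"
  have lm: "left_module R (?P i)" for i using 0(2) Z by simp
  have z: "lhom R (?P (Suc i)) (?P i) (\<lambda>x. \<zero>\<^bsub>M\<^esub>)" for i
    using lhom_const_zero[OF lm lm, of "Suc i" i] by (simp add: Z_def split: if_splits)
  have zz: "\<zero>\<^bsub>Z\<^esub> = \<zero>\<^bsub>M\<^esub>" "carrier Z = {\<zero>\<^bsub>M\<^esub>}" by (auto simp: Z_def)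
  have "proj_resolution R M ?P (\<lambda>i. \<lambda>x\<in>carrier (?P (Suc i)). \<zero>\<^bsub>M\<^esub>) (\<lambda>x\<in>carrier (?P 0). x)"
    unfolding proj_resolution_def
  proof (intro conjI allI)
    show "left_module R (?P i)" "projective R (?P i)" for i using 0 pZ Z by auto
    show "(\<lambda>x\<in>carrier (?P 0). x) \<in> lmod_hom R (?P 0) M"
      using restrict_lmod_hom[OF 0(2) lhom_id] by simp
    show "(\<lambda>x\<in>carrier (?P (Suc i)). \<zero>\<^bsub>M\<^esub>) \<in> lmod_hom R (?P (Suc i)) (?P i)" for i
      by (rule restrict_lmod_hom[OF lm z])
  qed (auto simp: zz)
  moreover have "\<forall>i>0. carrier (?P i) = {\<zero>\<^bsub>?P i\<^esub>}" by (simp add: zz)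
  ultimately show ?case by blast
next
  case (Suc n)
  obtain P :: "('r, 'u) module" and e where P: "left_module R P" "projective R P" "lhom R P M e"
    "e ` carrier P = carrier M" "pd_le R n (kermod P M e)"
    using Suc.prems(1) by auto
  note K = left_module_kermod[OF P(1) Suc.prems(2) P(3)]
  obtain P' d' e' where r: "proj_resolution R (kermod P M e) P' d' e'" "\<forall>i>n. carrier (P' i) = {\<zero>\<^bsub>P' i\<^esub>}"
    using Suc.IH[OF P(5) K] by blast
  have lm: "left_module R (P' i)" and pr: "projective R (P' i)" and d': "d' i \<in> lmod_hom R (P' (Suc i)) (P' i)"
    for i using r(1) by (auto simp: proj_resolution_def)
  have e': "lhom R (P' 0) (kermod P M e) e'" "e' \<in> extensional (carrier (P' 0))"
    using r(1) by (auto simp: proj_resolution_def lmod_hom_iff)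
  have e'': "lhom R (P' 0) P e'"
    using lhom_comp[OF e'(1) lhom_incl[OF lsub_ker[OF P(1) Suc.prems(2) P(3)]]] .
  let ?P = "\<lambda>i. case i of 0 \<Rightarrow> P | Suc j \<Rightarrow> P' j"
  let ?d = "\<lambda>i. case i of 0 \<Rightarrow> e' | Suc j \<Rightarrow> d' j"
  have "proj_resolution R M ?P ?d (restrict e (carrier P))"
    unfolding proj_resolution_def
  proof (intro conjI allI)
    show "left_module R (?P i)" "projective R (?P i)" for i using P lm pr by (auto split: nat.split)
    show "restrict e (carrier P) \<in> lmod_hom R (?P 0) M" using restrict_lmod_hom[OF P(1,3)] by simp
    show "?d i \<in> lmod_hom R (?P (Suc i)) (?P i)" for i
      using d' e'' e' by (auto split: nat.split simp: lmod_hom_iff)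
    show "restrict e (carrier P) ` carrier (?P 0) = carrier M" using P(4) by simp
    show "?d 0 ` carrier (?P (Suc 0)) = {x \<in> carrier (?P 0). restrict e (carrier P) x = \<zero>\<^bsub>M\<^esub>}"
      using r(1) by (auto simp: proj_resolution_def)
    show "?d (Suc i) ` carrier (?P (Suc (Suc i))) = {x \<in> carrier (?P (Suc i)). ?d i x = \<zero>\<^bsub>?P i\<^esub>}" for i
      using r(1) by (auto simp: proj_resolution_def split: nat.split)
  qed
  moreover have "\<forall>i>Suc n. carrier (?P i) = {\<zero>\<^bsub>?P i\<^esub>}" using r(2) by (auto split: nat.split)
  ultimately show ?case by blast
qed

lemma projdim_le_iff:
  fixes M :: "('r, 'u) module"
  assumes "left_module R M"
  shows "projdim R M \<le> enat n \<longleftrightarrow> pd_le R n M"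
proof
  let ?S = "{enat n | n. \<exists>P d e. proj_resolution R M P d e \<and> (\<forall>i>n. carrier (P i) = {\<zero>\<^bsub>P i\<^esub>})}"
  assume "projdim R M \<le> enat n"
  then have le: "Inf ?S \<le> enat n" by (simp add: projdim_def)
  have "?S \<noteq> {}"
  proof
    assume e: "?S = {}"
    show False using le unfolding e by (simp add: top_enat_def)
  qed
  \<comment> \<open>The infimum of a nonempty set in \<open>enat\<close> is attained, so it comes
    with an actual resolution.\<close>
  then have "Inf ?S \<in> ?S" unfolding Inf_enat_def by (metis (no_types, lifting) LeastI_ex ex_in_conv)
  then obtain m P d e where m: "Inf ?S = enat m" "proj_resolution R M P d e"
    "\<forall>i>m. carrier (P i) = {\<zero>\<^bsub>P i\<^esub>}" by blast
  then have "m \<le> n" using le by simp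
  then show "pd_le R n M" using m by (intro pd_le_of_resolution[OF m(2) assms]) auto
next
  assume "pd_le R n M"
  then show "projdim R M \<le> enat n"
    unfolding projdim_def using resolution_of_pd_le[OF _ assms] by (auto intro: Inf_lower)
qed

section \<open>Finite sums of maps factoring through a module\<close>

text \<open>These are the maps that factor through some power of X, written as finite sums of
  composites through X itself. The rules only compare values on the carrier, since the maps are not
  extensional.\<close>

inductive fac ::
  "('r, 'q) ring_scheme \<Rightarrow> ('r, 'x, 'm) module_scheme \<Rightarrow> ('r, 'y, 'n) module_scheme \<Rightarrow>
   ('r, 'z, 'o) module_scheme \<Rightarrow> ('y \<Rightarrow> 'z) \<Rightarrow> bool"
  for R X Y Z where
    fac_zero: "(\<And>y. y \<in> carrier Y \<Longrightarrow> h y = \<zero>\<^bsub>Z\<^esub>) \<Longrightarrow> fac R X Y Z h"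
  | fac_add: "fac R X Y Z h \<Longrightarrow> lhom R Y X f \<Longrightarrow> lhom R X Z g \<Longrightarrow>
      (\<And>y. y \<in> carrier Y \<Longrightarrow> h' y = h y \<oplus>\<^bsub>Z\<^esub> g (f y)) \<Longrightarrow> fac R X Y Z h'"

text \<open>The identity of Y factors through a power of X, which says that Y is a direct summand of
  that power: Y \<in> add(X).\<close>

definition in_add ::
  "('r, 'q) ring_scheme \<Rightarrow> ('r, 'x, 'm) module_scheme \<Rightarrow> ('r, 'y, 'n) module_scheme \<Rightarrow> bool"
  where "in_add R X Y \<longleftrightarrow> fac R X Y Y (\<lambda>y. y)"

lemma fac_cong: "fac R X Y Z h \<Longrightarrow> (\<And>y. y \<in> carrier Y \<Longrightarrow> h' y = h y) \<Longrightarrow> fac R X Y Z h'"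
proof (induction arbitrary: h' rule: fac.induct)
  case (fac_zero h)
  then show ?case by (auto intro: fac.fac_zero)
next
  case (fac_add h f g h1)
  show ?case by (rule fac.fac_add[OF fac_add.hyps(1-3)]) (simp add: fac_add.prems fac_add.hyps(4))
qed

lemma fac_lhom:
  assumes "left_module R Y" "left_module R Z" "fac R X Y Z h"
  shows "lhom R Y Z h"
  using assms(3)
proof induction
  case (fac_zero h)
  then show ?case using lhom_cong[OF lhom_const_zero[OF assms(1,2)] _ assms(1)] by auto
next
  case (fac_add h f g h')
  show ?case
    using lhom_cong[OF lhom_plus[OF assms(1,2) fac_add.IH lhom_comp[OF fac_add.hyps(2,3)]] _ assms(1)]
      fac_add.hyps(4) by auto
qed

lemma fac_comp:
  assumes "left_module R Z" "lhom R Y X f" "lhom R X Z g"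
  shows "fac R X Y Z (\<lambda>y. g (f y))"
proof -
  interpret Z: left_module R Z by fact
  show ?thesis
    by (rule fac_add[OF fac_zero[of _ "\<lambda>_. \<zero>\<^bsub>Z\<^esub>"] assms(2,3)])
      (auto simp: lhom_closed[OF assms(2)] lhom_closed[OF assms(3)])
qed

lemma fac_plus:
  assumes lm: "left_module R Y" "left_module R Z" and h: "fac R X Y Z h" and k: "fac R X Y Z k"
  shows "fac R X Y Z (\<lambda>y. h y \<oplus>\<^bsub>Z\<^esub> k y)"
  using k
proof induction
  case (fac_zero k)
  interpret Z: left_module R Z by fact
  show ?case
    by (rule fac_cong[OF h]) (use fac_zero fac_lhom[OF lm h] in \<open>auto simp: lhom_closed\<close>)
next
  case (fac_add k f g k')
  interpret Z: left_module R Z by fact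
  show ?case
  proof (rule fac.fac_add[OF fac_add.IH fac_add.hyps(2,3)])
    fix y assume y: "y \<in> carrier Y"
    have "h y \<in> carrier Z" "k y \<in> carrier Z" "g (f y) \<in> carrier Z"
      using y lhom_closed[OF fac_lhom[OF lm h]] lhom_closed[OF fac_lhom[OF lm fac_add.hyps(1)]]
        lhom_closed[OF lhom_comp[OF fac_add.hyps(2,3)]] by auto
    then show "h y \<oplus>\<^bsub>Z\<^esub> k' y = h y \<oplus>\<^bsub>Z\<^esub> k y \<oplus>\<^bsub>Z\<^esub> g (f y)"
      using fac_add.hyps(4)[OF y] by (simp add: Z.a_assoc)
  qed
qed

lemma fac_pre:
  assumes "left_module R Z" "fac R X Y Z h" "lhom R W Y e"
  shows "fac R X W Z (\<lambda>w. h (e w))"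
  using assms(2)
proof induction
  case (fac_zero h)
  then show ?case by (auto intro!: fac.fac_zero simp: lhom_closed[OF assms(3)])
next
  case (fac_add h f g h')
  show ?case
    by (rule fac.fac_add[OF fac_add.IH lhom_comp[OF assms(3) fac_add.hyps(2)] fac_add.hyps(3)])
      (simp add: fac_add.hyps(4) lhom_closed[OF assms(3)])
qed

lemma fac_post:
  assumes "left_module R Y" "left_module R Z" "left_module R W" "fac R X Y Z h" "lhom R Z W e"
  shows "fac R X Y W (\<lambda>y. e (h y))"
  using assms(4)
proof induction
  case (fac_zero h)
  then show ?case by (auto intro!: fac.fac_zero simp: lhom_zero[OF assms(2,3,5)])
next
  case (fac_add h f g h')
  show ?case
    by (rule fac.fac_add[OF fac_add.IH fac_add.hyps(2) lhom_comp[OF fac_add.hyps(3) assms(5)]])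
      (simp add: fac_add.hyps(4) lhom_add[OF assms(5)] lhom_closed[OF fac_lhom[OF assms(1,2) fac_add.hyps(1)]]
        lhom_closed[OF lhom_comp[OF fac_add.hyps(2,3)]])
qed

lemma fac_finsum:
  assumes "left_module R Y" "left_module R Z"
    and "\<And>i. i \<in> I \<Longrightarrow> lhom R Y X (f i)" "\<And>i. i \<in> I \<Longrightarrow> lhom R X Z (g i)"
  shows "fac R X Y Z (\<lambda>y. finsum Z (\<lambda>i. g i (f i y)) I)"
  using assms(3,4)
proof (induction I rule: infinite_finite_induct)
  case (infinite I)
  interpret Z: left_module R Z by fact
  show ?case by (rule fac_zero) (simp add: infinite)
next
  case empty
  interpret Z: left_module R Z by fact
  show ?case by (rule fac_zero) simp
next
  case (insert i I)
  interpret Z: left_module R Z by fact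
  have "fac R X Y Z (\<lambda>y. finsum Z (\<lambda>i. g i (f i y)) I \<oplus>\<^bsub>Z\<^esub> g i (f i y))"
    using insert by (intro fac_plus assms(1,2) fac_comp) auto
  then show ?case
  proof (rule fac_cong)
    fix y assume y: "y \<in> carrier Y"
    then have c: "g j (f j y) \<in> carrier Z" if "j \<in> insert i I" for j
      using lhom_closed[OF lhom_comp[OF insert.prems(1,2)]] that by auto
    then have "finsum Z (\<lambda>i. g i (f i y)) (insert i I) = g i (f i y) \<oplus>\<^bsub>Z\<^esub> finsum Z (\<lambda>i. g i (f i y)) I"
      using insert.hyps by (intro Z.finsum_insert) auto
    moreover have "finsum Z (\<lambda>i. g i (f i y)) I \<in> carrier Z" using c by (intro Z.finsum_closed) auto
    ultimately show "finsum Z (\<lambda>i. g i (f i y)) (insert i I) =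
        finsum Z (\<lambda>i. g i (f i y)) I \<oplus>\<^bsub>Z\<^esub> g i (f i y)"
      using c by (simp add: Z.a_comm)
  qed
qed

text \<open>The indexed form of \<open>fac\<close>, for the places where the individual maps become
  dual bases.\<close>

lemma fac_finite:
  assumes "left_module R Y" "left_module R Z" "fac R X Y Z h"
  shows "\<exists>(n::nat) f g. (\<forall>i<n. lhom R Y X (f i) \<and> lhom R X Z (g i)) \<and>
    (\<forall>y\<in>carrier Y. finsum Z (\<lambda>i. g i (f i y)) {..<n} = h y)"
  using assms(3)
proof induction
  case (fac_zero h)
  interpret Z: left_module R Z by fact
  show ?case by (intro exI[of _ 0]) (simp add: fac_zero)
next
  case (fac_add h f g h')
  interpret Z: left_module R Z by fact
  obtain n :: nat and F G where nFG: "\<forall>i<n. lhom R Y X (F i) \<and> lhom R X Z (G i)"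
    "\<forall>y\<in>carrier Y. finsum Z (\<lambda>i. G i (F i y)) {..<n} = h y"
    using fac_add.IH by blast
  let ?F = "F(n := f)" and ?G = "G(n := g)"
  show ?case
  proof (intro exI conjI allI ballI impI)
    fix y assume y: "y \<in> carrier Y"
    have c: "G i (F i y) \<in> carrier Z" if "i < n" for i
      using nFG(1) that lhom_closed[OF _ y] lhom_closed by metis
    have cg: "g (f y) \<in> carrier Z" using lhom_closed[OF lhom_comp[OF fac_add.hyps(2,3)] y] .
    have "finsum Z (\<lambda>i. ?G i (?F i y)) {..<Suc n} = g (f y) \<oplus>\<^bsub>Z\<^esub> finsum Z (\<lambda>i. ?G i (?F i y)) {..<n}"
      using c cg by (simp add: lessThan_Suc)
    also have "finsum Z (\<lambda>i. ?G i (?F i y)) {..<n} = h y"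
      using nFG(2) y c by (subst Z.finsum_cong'[of _ "{..<n}" "\<lambda>i. G i (F i y)"]) auto
    also have "g (f y) \<oplus>\<^bsub>Z\<^esub> h y = h' y"
      using fac_add.hyps(4)[OF y] cg lhom_closed[OF fac_lhom[OF assms(1,2) fac_add.hyps(1)] y]
      by (simp add: Z.a_comm)
    finally show "finsum Z (\<lambda>i. ?G i (?F i y)) {..<Suc n} = h' y" .
  qed (use nFG(1) fac_add.hyps in \<open>auto simp: less_Suc_eq\<close>)
qed

lemma in_add_retr:
  assumes "left_module R Y" "left_module R C" "in_add R X C" "retr R Y C i p"
  shows "in_add R X Y"
proof -
  have i: "lhom R Y C i" and p: "lhom R C Y p" and pi: "\<And>y. y \<in> carrier Y \<Longrightarrow> p (i y) = y"
    using assms(4) by (auto simp: retr_def)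
  have "fac R X Y Y (\<lambda>y. p (i y))"
    using fac_pre[OF assms(1) fac_post[OF assms(2,2,1) _ p] i] assms(3) unfolding in_add_def by blast
  then show ?thesis unfolding in_add_def by (rule fac_cong) (simp add: pi)
qed

lemma retr_in_add:
  assumes "left_module R Y" "retr R Y X i p"
  shows "in_add R X Y"
proof -
  have i: "lhom R Y X i" and p: "lhom R X Y p" and pi: "\<And>y. y \<in> carrier Y \<Longrightarrow> p (i y) = y"
    using assms(2) by (auto simp: retr_def)
  show ?thesis unfolding in_add_def
    by (rule fac_cong[OF fac_comp[OF assms(1) i p]]) (simp add: pi)
qed

lemma fac_trans:
  assumes "left_module R X" "left_module R Y" "left_module R Z" "left_module R W"
    and "in_add R X Y" "fac R Y Z W h"
  shows "fac R X Z W h"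
  using assms(6)
proof induction
  case (fac_zero h)
  then show ?case by (rule fac.fac_zero)
next
  case (fac_add h f g h')
  have "fac R X Z W (\<lambda>y. g (f y))"
    using fac_pre[OF assms(4) fac_post[OF assms(2,2,4) _ fac_add.hyps(3)] fac_add.hyps(2)] assms(5)
    unfolding in_add_def by blast
  from fac_plus[OF assms(3,4) fac_add.IH this] show ?case by (rule fac_cong) (simp add: fac_add.hyps(4))
qed

lemma in_add_trans:
  assumes "left_module R X" "left_module R Y" "left_module R Z" "in_add R X Y" "in_add R Y Z"
  shows "in_add R X Z"
  unfolding in_add_def by (rule fac_trans[OF assms(1-3) assms(3,4) assms(5)[unfolded in_add_def]])

section \<open>Hom functors\<close>

lemma bimodule_left: "is_bimodule R S P \<Longrightarrow> left_module R P"
  by (simp add: is_bimodule_def)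

lemma bimodule_right: "is_bimodule R S P \<Longrightarrow> left_module (opp_ring S) (right_part P)"
  by (simp add: is_bimodule_def)

lemma
  assumes "is_bimodule R S P"
  shows rsmult_closed: "p \<in> carrier P \<Longrightarrow> s \<in> carrier S \<Longrightarrow> rsmult P p s \<in> carrier P"
    and rsmult_add_l: "p \<in> carrier P \<Longrightarrow> p' \<in> carrier P \<Longrightarrow> s \<in> carrier S \<Longrightarrow>
      rsmult P (p \<oplus>\<^bsub>P\<^esub> p') s = rsmult P p s \<oplus>\<^bsub>P\<^esub> rsmult P p' s"
    and rsmult_add_r: "p \<in> carrier P \<Longrightarrow> s \<in> carrier S \<Longrightarrow> s' \<in> carrier S \<Longrightarrow>
      rsmult P p (s \<oplus>\<^bsub>S\<^esub> s') = rsmult P p s \<oplus>\<^bsub>P\<^esub> rsmult P p s'"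
    and rsmult_assoc: "p \<in> carrier P \<Longrightarrow> s \<in> carrier S \<Longrightarrow> s' \<in> carrier S \<Longrightarrow>
      rsmult P (rsmult P p s) s' = rsmult P p (s \<otimes>\<^bsub>S\<^esub> s')"
    and rsmult_one: "p \<in> carrier P \<Longrightarrow> rsmult P p \<one>\<^bsub>S\<^esub> = p"
proof -
  interpret right: left_module "opp_ring S" "right_part P" by (rule bimodule_right[OF assms])
  have [simp]: "carrier (right_part P) = carrier P" "add (right_part P) = add P"
    "smult (right_part P) = (\<lambda>s p. rsmult P p s)" "carrier (opp_ring S) = carrier S"
    "add (opp_ring S) = add S" "\<one>\<^bsub>opp_ring S\<^esub> = \<one>\<^bsub>S\<^esub>" "\<And>x y. x \<otimes>\<^bsub>opp_ring S\<^esub> y = y \<otimes>\<^bsub>S\<^esub> x"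
    by (auto simp: opp_ring_def right_part_def)
  show "p \<in> carrier P \<Longrightarrow> s \<in> carrier S \<Longrightarrow> rsmult P p s \<in> carrier P"
    using right.smult_closed[of s p] by simp
  show "p \<in> carrier P \<Longrightarrow> p' \<in> carrier P \<Longrightarrow> s \<in> carrier S \<Longrightarrow>
      rsmult P (p \<oplus>\<^bsub>P\<^esub> p') s = rsmult P p s \<oplus>\<^bsub>P\<^esub> rsmult P p' s"
    using right.smult_r_distr[of s p p'] by simp
  show "p \<in> carrier P \<Longrightarrow> s \<in> carrier S \<Longrightarrow> s' \<in> carrier S \<Longrightarrow>
      rsmult P p (s \<oplus>\<^bsub>S\<^esub> s') = rsmult P p s \<oplus>\<^bsub>P\<^esub> rsmult P p s'"
    using right.smult_l_distr[of s s' p] by simp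
  show "p \<in> carrier P \<Longrightarrow> s \<in> carrier S \<Longrightarrow> s' \<in> carrier S \<Longrightarrow>
      rsmult P (rsmult P p s) s' = rsmult P p (s \<otimes>\<^bsub>S\<^esub> s')"
    using right.smult_assoc[of s' s p] by simp
  show "p \<in> carrier P \<Longrightarrow> rsmult P p \<one>\<^bsub>S\<^esub> = p"
    using right.smult_one[of p] by simp
qed

lemma rsmult_smult:
  "is_bimodule R S P \<Longrightarrow> r \<in> carrier R \<Longrightarrow> s \<in> carrier S \<Longrightarrow> p \<in> carrier P \<Longrightarrow>
    rsmult P (r \<odot>\<^bsub>P\<^esub> p) s = r \<odot>\<^bsub>P\<^esub> rsmult P p s"
  by (simp add: is_bimodule_def)

lemmas bimod_rules = rsmult_closed rsmult_add_l rsmult_add_r rsmult_assoc rsmult_one rsmult_smult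

definition hom_mod ::
  "('r, 'q) ring_scheme \<Rightarrow> ('r, 'p, 's, 'm) bimodule_scheme \<Rightarrow> ('r, 'y, 'n) module_scheme \<Rightarrow>
   ('s, 'p \<Rightarrow> 'y) module"
  where "hom_mod R P Y =
    \<lparr>carrier = lmod_hom R P Y, monoid.mult = undefined, monoid.one = undefined,
     ring.zero = (\<lambda>p\<in>carrier P. \<zero>\<^bsub>Y\<^esub>),
     add = (\<lambda>f g. \<lambda>p\<in>carrier P. f p \<oplus>\<^bsub>Y\<^esub> g p),
     smult = (\<lambda>s f. \<lambda>p\<in>carrier P. f (rsmult P p s))\<rparr>"

lemma hom_mod_simps [simp]:
  "carrier (hom_mod R P Y) = lmod_hom R P Y" "\<zero>\<^bsub>hom_mod R P Y\<^esub> = (\<lambda>p\<in>carrier P. \<zero>\<^bsub>Y\<^esub>)"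
  "f \<oplus>\<^bsub>hom_mod R P Y\<^esub> g = (\<lambda>p\<in>carrier P. f p \<oplus>\<^bsub>Y\<^esub> g p)"
  "s \<odot>\<^bsub>hom_mod R P Y\<^esub> f = (\<lambda>p\<in>carrier P. f (rsmult P p s))"
  by (auto simp: hom_mod_def)

lemma left_module_hom_mod:
  assumes "is_bimodule R S P" "ring S" "left_module R Y"
  shows "left_module S (hom_mod R P Y)"
proof -
  interpret S: ring S by fact
  interpret Y: left_module R Y by fact
  note P = bimodule_left[OF assms(1)]
  interpret P: left_module R P by (rule P)
  note rs = bimod_rules[OF assms(1)]
  have xe: "restrict f (carrier P) = f" if "f \<in> lmod_hom R P Y" for f
    using that by (simp add: lmod_hom_iff extensional_restrict)
  have rsl: "lhom R P P (\<lambda>p. rsmult P p s)" if "s \<in> carrier S" for s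
    using that by (intro lhomI) (auto simp: rs)
  have sm: "(\<lambda>p\<in>carrier P. f (rsmult P p s)) \<in> lmod_hom R P Y" if "f \<in> lmod_hom R P Y" "s \<in> carrier S" for f s
    using that by (intro restrict_lmod_hom P lhom_comp[OF rsl lmod_homD])
  show ?thesis
  proof (rule left_moduleI)
    show "abelian_group (hom_mod R P Y)" by (rule abelian_group_lmod_hom[OF P assms(3)]) (simp_all add: fun_eq_iff)
  next
    fix f assume f: "f \<in> carrier (hom_mod R P Y)"
    show "\<one>\<^bsub>S\<^esub> \<odot>\<^bsub>hom_mod R P Y\<^esub> f = f"
      using f xe by (auto simp: rs cong: restrict_cong)
    fix s assume s: "s \<in> carrier S"
    show "s \<odot>\<^bsub>hom_mod R P Y\<^esub> f \<in> carrier (hom_mod R P Y)" using sm s f by simp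
    show "s \<odot>\<^bsub>hom_mod R P Y\<^esub> (f \<oplus>\<^bsub>hom_mod R P Y\<^esub> g) =
        s \<odot>\<^bsub>hom_mod R P Y\<^esub> f \<oplus>\<^bsub>hom_mod R P Y\<^esub> s \<odot>\<^bsub>hom_mod R P Y\<^esub> g"
      if "g \<in> carrier (hom_mod R P Y)" for g
      using s by (auto simp: rs intro!: restrict_ext)
    fix s' assume s': "s' \<in> carrier S"
    show "(s \<oplus>\<^bsub>S\<^esub> s') \<odot>\<^bsub>hom_mod R P Y\<^esub> f = s \<odot>\<^bsub>hom_mod R P Y\<^esub> f \<oplus>\<^bsub>hom_mod R P Y\<^esub> s' \<odot>\<^bsub>hom_mod R P Y\<^esub> f"
      using s s' f by (auto simp: rs lhom_add[OF lmod_homD] intro!: restrict_ext)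
    show "(s \<otimes>\<^bsub>S\<^esub> s') \<odot>\<^bsub>hom_mod R P Y\<^esub> f = s \<odot>\<^bsub>hom_mod R P Y\<^esub> (s' \<odot>\<^bsub>hom_mod R P Y\<^esub> f)"
      using s s' by (auto simp: rs intro!: restrict_ext)
  qed (rule assms(2))
qed

definition hmap :: "('r, 'p, 's, 'm) bimodule_scheme \<Rightarrow> ('y \<Rightarrow> 'z) \<Rightarrow> ('p \<Rightarrow> 'y) \<Rightarrow> 'p \<Rightarrow> 'z"
  where "hmap P h f = (\<lambda>p\<in>carrier P. h (f p))"

lemma hmap_apply [simp]: "p \<in> carrier P \<Longrightarrow> hmap P h f p = h (f p)"
  by (simp add: hmap_def)

lemma hmap_closed:
  "is_bimodule R S P \<Longrightarrow> lhom R Y Z h \<Longrightarrow> f \<in> lmod_hom R P Y \<Longrightarrow> hmap P h f \<in> lmod_hom R P Z"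
  unfolding hmap_def by (rule restrict_lmod_hom[OF bimodule_left lhom_comp[OF lmod_homD]])

lemma lhom_hmap:
  assumes "is_bimodule R S P" "lhom R Y Z h"
  shows "lhom S (hom_mod R P Y) (hom_mod R P Z) (hmap P h)"
proof (rule lhomI)
  note rs = bimod_rules[OF assms(1)]
  interpret P: left_module R P by (rule bimodule_left[OF assms(1)])
  fix f assume f: "f \<in> carrier (hom_mod R P Y)"
  show "hmap P h f \<in> carrier (hom_mod R P Z)" using hmap_closed[OF assms] f by simp
  show "hmap P h (f \<oplus>\<^bsub>hom_mod R P Y\<^esub> g) = hmap P h f \<oplus>\<^bsub>hom_mod R P Z\<^esub> hmap P h g"
    if "g \<in> carrier (hom_mod R P Y)" for g
    using f that by (auto simp: hmap_def lhom_add[OF assms(2)] lmod_hom_closed intro!: restrict_ext)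
  show "hmap P h (s \<odot>\<^bsub>hom_mod R P Y\<^esub> f) = s \<odot>\<^bsub>hom_mod R P Z\<^esub> hmap P h f" if "s \<in> carrier S" for s
    using f that by (auto simp: hmap_def rs intro!: restrict_ext)
qed

lemma hmap_cong: "(\<And>y. y \<in> carrier Y \<Longrightarrow> h y = k y) \<Longrightarrow> f \<in> lmod_hom R P Y \<Longrightarrow> hmap P h f = hmap P k f"
  unfolding hmap_def by (auto intro!: restrict_ext simp: lmod_hom_closed)

text \<open>Hom(P, -) is additive, so it carries a finite sum of factorisations to one; hence it
  maps add(X) into the additive closure of Hom(P, X).\<close>

lemma fac_hom_mod:
  assumes "is_bimodule R S P" "ring S" "left_module R Y" "left_module R Z" "fac R X Y Z h"
  shows "fac S (hom_mod R P X) (hom_mod R P Y) (hom_mod R P Z) (hmap P h)"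
  using assms(5)
proof induction
  case (fac_zero h)
  then show ?case
    by (auto intro!: fac.fac_zero restrict_ext simp: hmap_def lmod_hom_closed)
next
  case (fac_add h f g h')
  show ?case
  proof (rule fac.fac_add[OF fac_add.IH lhom_hmap[OF assms(1) fac_add.hyps(2)] lhom_hmap[OF assms(1) fac_add.hyps(3)]])
    fix y assume "y \<in> carrier (hom_mod R P Y)"
    then show "hmap P h' y = hmap P h y \<oplus>\<^bsub>hom_mod R P Z\<^esub> hmap P g (hmap P f y)"
      by (auto simp: hmap_def fac_add.hyps(4) lmod_hom_closed intro!: restrict_ext)
  qed
qed

lemma in_add_hom_mod:
  assumes "is_bimodule R S P" "ring S" "left_module R Y" "in_add R X Y"
  shows "in_add S (hom_mod R P X) (hom_mod R P Y)"
proof -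
  have "fac S (hom_mod R P X) (hom_mod R P Y) (hom_mod R P Y) (hmap P (\<lambda>y. y))"
    using fac_hom_mod[OF assms(1-3) assms(3)] assms(4) unfolding in_add_def by blast
  then show ?thesis unfolding in_add_def
    by (rule fac_cong) (auto simp: hmap_def lmod_hom_iff extensional_restrict)
qed

lemma finsum_hom_mod_apply:
  assumes "is_bimodule R S P" "ring S" "left_module R Y" "\<And>i. i \<in> I \<Longrightarrow> f i \<in> lmod_hom R P Y" "p \<in> carrier P"
  shows "finsum (hom_mod R P Y) f I p = finsum Y (\<lambda>i. f i p) I"
proof -
  have "addhom (hom_mod R P Y) Y (\<lambda>f. f p)"
    using assms(5) by (intro addhomI) (auto simp: lmod_hom_closed)
  from addhom_finsum[OF left_module_ag[OF left_module_hom_mod[OF assms(1-3)]] left_module_ag[OF assms(3)] this, of f I]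
  show ?thesis using assms(4) by auto
qed

section \<open>Dual pairs of bimodules\<close>

text \<open>
  The pairing and the dual bases express that \<open>Hom\<^sub>R(U, -)\<close>, which is isomorphic to \<open>V \<otimes>\<^sub>R -\<close>,
  is left adjoint to \<open>Hom\<^sub>S(V, -)\<close>, which is isomorphic to \<open>U \<otimes>\<^sub>S -\<close> if \<open>U\<close> is in turn the dual of \<open>V\<close>.
\<close>

locale dual_pair = R?: ring R + S?: ring S
  for R :: "('r, 'a) ring_scheme" (structure) and S :: "('s, 'b) ring_scheme" (structure) +
  fixes U :: "('r, 'u, 's, 'm) bimodule_scheme" and V :: "('s, 'v, 'r, 'n) bimodule_scheme"
    and b :: "'u \<Rightarrow> 'v \<Rightarrow> 'r" and m :: nat and u :: "nat \<Rightarrow> 'u" and v :: "nat \<Rightarrow> 'v"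
  assumes U: "is_bimodule R S U" and V: "is_bimodule S R V"
    and b_closed: "\<lbrakk>x \<in> carrier U; y \<in> carrier V\<rbrakk> \<Longrightarrow> b x y \<in> carrier R"
    and b_add_l: "\<lbrakk>x \<in> carrier U; x' \<in> carrier U; y \<in> carrier V\<rbrakk> \<Longrightarrow> b (x \<oplus>\<^bsub>U\<^esub> x') y = b x y \<oplus>\<^bsub>R\<^esub> b x' y"
    and b_add_r: "\<lbrakk>x \<in> carrier U; y \<in> carrier V; y' \<in> carrier V\<rbrakk> \<Longrightarrow> b x (y \<oplus>\<^bsub>V\<^esub> y') = b x y \<oplus>\<^bsub>R\<^esub> b x y'"
    and b_smult: "\<lbrakk>r \<in> carrier R; x \<in> carrier U; y \<in> carrier V\<rbrakk> \<Longrightarrow> b (r \<odot>\<^bsub>U\<^esub> x) y = r \<otimes>\<^bsub>R\<^esub> b x y"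
    and b_rsmult: "\<lbrakk>r \<in> carrier R; x \<in> carrier U; y \<in> carrier V\<rbrakk> \<Longrightarrow> b x (rsmult V y r) = b x y \<otimes>\<^bsub>R\<^esub> r"
    and b_balanced: "\<lbrakk>s \<in> carrier S; x \<in> carrier U; y \<in> carrier V\<rbrakk> \<Longrightarrow> b (rsmult U x s) y = b x (s \<odot>\<^bsub>V\<^esub> y)"
    and u_closed: "i < m \<Longrightarrow> u i \<in> carrier U" and v_closed: "i < m \<Longrightarrow> v i \<in> carrier V"
    and u_expand: "x \<in> carrier U \<Longrightarrow> finsum U (\<lambda>i. b x (v i) \<odot>\<^bsub>U\<^esub> u i) {..<m} = x"
    and v_expand: "y \<in> carrier V \<Longrightarrow> finsum V (\<lambda>i. rsmult V (v i) (b (u i) y)) {..<m} = y"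
begin

lemma U_left: "left_module R U" using bimodule_left[OF U] .
lemma V_left: "left_module S V" using bimodule_left[OF V] .

lemma left_module_F: "left_module R X \<Longrightarrow> left_module S (hom_mod R U X)"
  by (rule left_module_hom_mod[OF U S.ring_axioms])

lemma left_module_G: "left_module S Y \<Longrightarrow> left_module R (hom_mod S V Y)"
  by (rule left_module_hom_mod[OF V R.ring_axioms])

text \<open>Read Hom_R(U, X) as V \<otimes> X, where y \<otimes> x is the map w \<mapsto> b(w, y) x.
  Then this is the unit x \<mapsto> (y \<mapsto> y \<otimes> x) of the tensor-Hom
  adjunction.\<close>

definition unit :: "('r, 'x, 'o) module_scheme \<Rightarrow> 'x \<Rightarrow> 'v \<Rightarrow> 'u \<Rightarrow> 'x"
  where "unit X x = (\<lambda>y\<in>carrier V. \<lambda>w\<in>carrier U. b w y \<odot>\<^bsub>X\<^esub> x)"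

text \<open>In the same reading \<Phi> is the tensor \<Sum> v_j \<otimes> \<Phi>(u_j), and
  evaluation of Hom_S(V, Y) at V sends it to this sum.\<close>

definition counit :: "('s, 'y, 'o) module_scheme \<Rightarrow> ('u \<Rightarrow> 'v \<Rightarrow> 'y) \<Rightarrow> 'y"
  where "counit Y \<Phi> = finsum Y (\<lambda>j. \<Phi> (u j) (v j)) {..<m}"

lemma unit_inner:
  assumes "left_module R X" "x \<in> carrier X" "y \<in> carrier V"
  shows "(\<lambda>w\<in>carrier U. b w y \<odot>\<^bsub>X\<^esub> x) \<in> lmod_hom R U X"
proof -
  interpret X: left_module R X by fact
  show ?thesis
    using assms(2,3)
    by (intro restrict_lmod_hom U_left lhomI)
      (auto simp: b_closed b_add_l b_smult X.smult_closed X.smult_l_distr X.smult_assoc)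
qed

lemma unit_closed:
  assumes "left_module R X" "x \<in> carrier X"
  shows "unit X x \<in> lmod_hom S V (hom_mod R U X)"
proof -
  interpret X: left_module R X by fact
  show ?thesis
    unfolding unit_def
    using assms(2) unit_inner[OF assms]
    by (intro restrict_lmod_hom V_left lhomI)
      (auto simp: b_closed b_add_r b_balanced rsmult_closed[OF U] X.smult_l_distr intro!: restrict_ext)
qed

lemma lhom_unit:
  assumes "left_module R X"
  shows "lhom R X (hom_mod S V (hom_mod R U X)) (unit X)"
proof -
  interpret X: left_module R X by fact
  show ?thesis
    using unit_closed[OF assms]
    by (intro lhomI) (auto simp: unit_def b_closed b_rsmult rsmult_closed[OF V] X.smult_r_distr X.smult_assoc
        intro!: restrict_ext)
qed

text \<open>The sum of the \<open>v\<^sub>j \<otimes> u\<^sub>j\<close> is central.\<close>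

lemma sum_central:
  assumes Y: "left_module S Y" and \<Phi>: "\<Phi> \<in> lmod_hom R U (hom_mod S V Y)" and s: "s \<in> carrier S"
  shows "finsum Y (\<lambda>j. \<Phi> (u j) (s \<odot>\<^bsub>V\<^esub> v j)) {..<m} = finsum Y (\<lambda>j. \<Phi> (rsmult U (u j) s) (v j)) {..<m}"
proof -
  interpret Y: left_module S Y by fact
  interpret V: left_module S V by (rule V_left)
  interpret U: left_module R U by (rule U_left)
  have \<Phi>c: "\<Phi> x \<in> lmod_hom S V Y" if "x \<in> carrier U" for x using lmod_hom_closed[OF \<Phi> that] by simp
  have c: "\<Phi> x y \<in> carrier Y" if "x \<in> carrier U" "y \<in> carrier V" for x y using lmod_hom_closed[OF \<Phi>c[OF that(1)] that(2)] .
  have sm: "\<Phi> (r \<odot>\<^bsub>U\<^esub> x) y = \<Phi> x (rsmult V y r)" if "r \<in> carrier R" "x \<in> carrier U" "y \<in> carrier V" for r x y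
    using lhom_smult[OF lmod_homD[OF \<Phi>] that(1,2)] that(3) by simp
  note cl = u_closed v_closed b_closed rsmult_closed[OF U] rsmult_closed[OF V] U.smult_closed V.smult_closed c s
  \<comment> \<open>Expand s v_j in the v_i, move the coefficients b(u_i, s v_j) to the side of U by
    R-linearity of \<Phi>, and exchange the sums. As b(u_i, s v_j) = b(u_i s, v_j), the sum over j
    is then the expansion of u_i s.\<close>
  have "finsum Y (\<lambda>j. \<Phi> (u j) (s \<odot>\<^bsub>V\<^esub> v j)) {..<m} =
      finsum Y (\<lambda>j. finsum Y (\<lambda>i. \<Phi> (b (u i) (s \<odot>\<^bsub>V\<^esub> v j) \<odot>\<^bsub>U\<^esub> u j) (v i)) {..<m}) {..<m}"
  proof (intro Y.M.finsum_cong' refl)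
    fix j assume "j \<in> {..<m}"
    then have j: "j < m" by simp
    have "\<Phi> (u j) (s \<odot>\<^bsub>V\<^esub> v j) = \<Phi> (u j) (finsum V (\<lambda>i. rsmult V (v i) (b (u i) (s \<odot>\<^bsub>V\<^esub> v j))) {..<m})"
      using j by (simp add: v_expand cl)
    also have "\<dots> = finsum Y (\<lambda>i. \<Phi> (u j) (rsmult V (v i) (b (u i) (s \<odot>\<^bsub>V\<^esub> v j)))) {..<m}"
      using j cl by (intro lhom_finsum[OF V_left Y lmod_homD[OF \<Phi>c]]) auto
    also have "\<dots> = finsum Y (\<lambda>i. \<Phi> (b (u i) (s \<odot>\<^bsub>V\<^esub> v j) \<odot>\<^bsub>U\<^esub> u j) (v i)) {..<m}"
      using j by (intro Y.M.finsum_cong' refl) (auto simp: sm cl)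
    finally show "\<Phi> (u j) (s \<odot>\<^bsub>V\<^esub> v j) = finsum Y (\<lambda>i. \<Phi> (b (u i) (s \<odot>\<^bsub>V\<^esub> v j) \<odot>\<^bsub>U\<^esub> u j) (v i)) {..<m}" .
  qed (auto intro!: Y.M.finsum_closed simp: cl)
  also have "\<dots> = finsum Y (\<lambda>i. finsum Y (\<lambda>j. \<Phi> (b (u i) (s \<odot>\<^bsub>V\<^esub> v j) \<odot>\<^bsub>U\<^esub> u j) (v i)) {..<m}) {..<m}"
    by (intro Y.M.finsum_swap) (auto simp: cl)
  also have "\<dots> = finsum Y (\<lambda>j. \<Phi> (rsmult U (u j) s) (v j)) {..<m}"
  proof (intro Y.M.finsum_cong' refl)
    fix i assume "i \<in> {..<m}"
    then have i: "i < m" by simp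
    have ev: "addhom U Y (\<lambda>x. \<Phi> x (v i))"
      using i lhom_add[OF lmod_homD[OF \<Phi>]] by (intro addhomI) (auto simp: cl)
    have "\<Phi> (rsmult U (u i) s) (v i) = \<Phi> (finsum U (\<lambda>j. b (rsmult U (u i) s) (v j) \<odot>\<^bsub>U\<^esub> u j) {..<m}) (v i)"
      using i by (simp add: u_expand cl)
    also have "\<dots> = finsum Y (\<lambda>j. \<Phi> (b (rsmult U (u i) s) (v j) \<odot>\<^bsub>U\<^esub> u j) (v i)) {..<m}"
      using i cl by (intro addhom_finsum[OF U.M_ag Y.M_ag ev]) auto
    also have "\<dots> = finsum Y (\<lambda>j. \<Phi> (b (u i) (s \<odot>\<^bsub>V\<^esub> v j) \<odot>\<^bsub>U\<^esub> u j) (v i)) {..<m}"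
      using i by (intro Y.M.finsum_cong' refl) (auto simp: b_balanced cl)
    finally show "finsum Y (\<lambda>j. \<Phi> (b (u i) (s \<odot>\<^bsub>V\<^esub> v j) \<odot>\<^bsub>U\<^esub> u j) (v i)) {..<m} = \<Phi> (rsmult U (u i) s) (v i)" ..
  qed (auto simp: cl)
  finally show ?thesis .
qed

text \<open>The scalar s acts on \<Phi> through the argument in U. Centrality of \<Sum> v_j
  \<otimes> u_j moves it to the argument in V, where the values of \<Phi> are S-linear.\<close>

lemma lhom_counit:
  assumes "left_module S Y"
  shows "lhom S (hom_mod R U (hom_mod S V Y)) Y (counit Y)"
proof (rule lhomI)
  interpret Y: left_module S Y by fact
  have c: "\<Phi> (u j) (v j) \<in> carrier Y" if "\<Phi> \<in> lmod_hom R U (hom_mod S V Y)" "j < m" for \<Phi> j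
    using lmod_hom_closed[OF that(1) u_closed[OF that(2)]] lmod_hom_closed v_closed[OF that(2)] by fastforce
  fix \<Phi> assume \<Phi>: "\<Phi> \<in> carrier (hom_mod R U (hom_mod S V Y))"
  show "counit Y \<Phi> \<in> carrier Y"
    unfolding counit_def using c \<Phi> by (auto intro: Y.M.finsum_closed)
  show "counit Y (\<Phi> \<oplus>\<^bsub>hom_mod R U (hom_mod S V Y)\<^esub> \<Psi>) = counit Y \<Phi> \<oplus>\<^bsub>Y\<^esub> counit Y \<Psi>"
    if "\<Psi> \<in> carrier (hom_mod R U (hom_mod S V Y))" for \<Psi>
  proof -
    have "counit Y (\<Phi> \<oplus>\<^bsub>hom_mod R U (hom_mod S V Y)\<^esub> \<Psi>) =
        finsum Y (\<lambda>j. \<Phi> (u j) (v j) \<oplus>\<^bsub>Y\<^esub> \<Psi> (u j) (v j)) {..<m}"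
      unfolding counit_def using c \<Phi> that by (intro Y.M.finsum_cong' refl) (auto simp: u_closed v_closed)
    also have "\<dots> = counit Y \<Phi> \<oplus>\<^bsub>Y\<^esub> counit Y \<Psi>"
      unfolding counit_def using c \<Phi> that by (intro Y.M.finsum_addf) auto
    finally show ?thesis .
  qed
  show "counit Y (s \<odot>\<^bsub>hom_mod R U (hom_mod S V Y)\<^esub> \<Phi>) = s \<odot>\<^bsub>Y\<^esub> counit Y \<Phi>" if s: "s \<in> carrier S" for s
  proof -
    have \<Phi>': "\<Phi> \<in> lmod_hom R U (hom_mod S V Y)" using \<Phi> by simp
    have \<Phi>c: "\<Phi> x \<in> lmod_hom S V Y" if "x \<in> carrier U" for x using lmod_hom_closed[OF \<Phi>' that] by simp
    have cc: "\<Phi> x y \<in> carrier Y" if "x \<in> carrier U" "y \<in> carrier V" for x y using lmod_hom_closed[OF \<Phi>c[OF that(1)] that(2)] .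
    have "counit Y (s \<odot>\<^bsub>hom_mod R U (hom_mod S V Y)\<^esub> \<Phi>) = finsum Y (\<lambda>j. \<Phi> (rsmult U (u j) s) (v j)) {..<m}"
      unfolding counit_def using cc s by (intro Y.M.finsum_cong' refl) (auto simp: u_closed v_closed rsmult_closed[OF U])
    also have "\<dots> = finsum Y (\<lambda>j. \<Phi> (u j) (s \<odot>\<^bsub>V\<^esub> v j)) {..<m}"
      by (rule sum_central[OF assms \<Phi>' s, symmetric])
    also have "\<dots> = finsum Y (\<lambda>j. s \<odot>\<^bsub>Y\<^esub> \<Phi> (u j) (v j)) {..<m}"
      using s lhom_smult[OF lmod_homD[OF \<Phi>c]] cc
      by (intro Y.M.finsum_cong' refl) (auto simp: u_closed v_closed Y.smult_closed)
    also have "\<dots> = s \<odot>\<^bsub>Y\<^esub> counit Y \<Phi>"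
      unfolding counit_def using s cc by (intro Y.smult_finsum_r[symmetric]) (auto simp: u_closed v_closed)
    finally show ?thesis .
  qed
qed

lemma unit_natural:
  assumes "left_module R X" "left_module R X'" "lhom R X X' h" "x \<in> carrier X"
  shows "hmap V (hmap U h) (unit X x) = unit X' (h x)"
  unfolding unit_def hmap_def
proof (rule restrict_ext)
  fix y assume y: "y \<in> carrier V"
  then show "(\<lambda>p\<in>carrier U. h ((\<lambda>y\<in>carrier V. \<lambda>w\<in>carrier U. b w y \<odot>\<^bsub>X\<^esub> x) y p)) =
      (\<lambda>w\<in>carrier U. b w y \<odot>\<^bsub>X'\<^esub> h x)"
    using assms(4) by (simp add: lhom_smult[OF assms(3)] b_closed cong: restrict_cong)
qed

lemma counit_natural:
  assumes "left_module S Y" "left_module S Y'" "lhom S Y Y' h" "\<Phi> \<in> lmod_hom R U (hom_mod S V Y)"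
  shows "counit Y' (hmap U (hmap V h) \<Phi>) = h (counit Y \<Phi>)"
proof -
  interpret Y': left_module S Y' by fact
  have c: "\<Phi> (u j) (v j) \<in> carrier Y" if "j < m" for j
    using lmod_hom_closed[OF assms(4) u_closed[OF that]] lmod_hom_closed v_closed[OF that] by fastforce
  show ?thesis unfolding counit_def
    using c lhom_closed[OF assms(3)]
    by (subst lhom_finsum[OF assms(1-3)]) (auto intro!: Y'.M.finsum_cong' simp: u_closed v_closed)
qed

text \<open>A triangle identity. Evaluated at y it reads \<psi>(\<Sum> v_j b(u_j, y)) = \<psi>(y),
  which is the expansion in the v_j.\<close>

lemma triangle:
  assumes "left_module S Y" "\<psi> \<in> lmod_hom S V Y"
  shows "hmap V (counit Y) (unit (hom_mod S V Y) \<psi>) = \<psi>"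
proof (rule extensionalityI[of _ "carrier V"])
  interpret Y: left_module S Y by fact
  show "\<psi> \<in> extensional (carrier V)" using assms(2) by (simp add: lmod_hom_iff)
  show "hmap V (counit Y) (unit (hom_mod S V Y) \<psi>) \<in> extensional (carrier V)" by (simp add: hmap_def)
  fix y assume y: "y \<in> carrier V"
  note p = lmod_hom_closed[OF assms(2)]
  have "hmap V (counit Y) (unit (hom_mod S V Y) \<psi>) y =
      finsum Y (\<lambda>j. \<psi> (rsmult V (v j) (b (u j) y))) {..<m}"
    unfolding counit_def using y p
    by (simp, intro Y.M.finsum_cong' refl) (auto simp: unit_def counit_def u_closed v_closed b_closed rsmult_closed[OF V])
  also have "\<dots> = \<psi> y"
    using y v_expand[OF y] u_closed v_closed b_closed rsmult_closed[OF V]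
    by (subst lhom_finsum[OF V_left assms(1) lmod_homD[OF assms(2)], symmetric]) auto
  finally show "hmap V (counit Y) (unit (hom_mod S V Y) \<psi>) y = \<psi> y" .
qed

end

section \<open>Cardinality of modules of homomorphisms\<close>

lemma inj_tuples:
  assumes "infinite (UNIV :: 'u set)"
  shows "\<exists>\<iota> :: (nat \<Rightarrow> 'u) \<Rightarrow> 'u. inj_on \<iota> ({..<m} \<rightarrow>\<^sub>E UNIV)"
proof (induction m)
  case 0
  then show ?case by auto
next
  case (Suc m)
  then obtain \<iota> :: "(nat \<Rightarrow> 'u) \<Rightarrow> 'u" where \<iota>: "inj_on \<iota> ({..<m} \<rightarrow>\<^sub>E UNIV)" by auto
  obtain c :: "'u \<times> 'u \<Rightarrow> 'u" where c: "inj c"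
    using lepoll_times_self[OF assms] unfolding lepoll_def by auto
  have "inj_on (\<lambda>x. c (\<iota> (restrict x {..<m}), x m)) ({..<Suc m} \<rightarrow>\<^sub>E UNIV)"
  proof (rule inj_onI)
    fix x y :: "nat \<Rightarrow> 'u"
    assume xy: "x \<in> {..<Suc m} \<rightarrow>\<^sub>E UNIV" "y \<in> {..<Suc m} \<rightarrow>\<^sub>E UNIV"
      "c (\<iota> (restrict x {..<m}), x m) = c (\<iota> (restrict y {..<m}), y m)"
    then have "\<iota> (restrict x {..<m}) = \<iota> (restrict y {..<m})" "x m = y m" using inj_eq[OF c] by auto
    then have "restrict x {..<m} = restrict y {..<m}" using inj_onD[OF \<iota>] by auto
    then have "x i = y i" if "i < m" for i using that by (metis lessThan_iff restrict_apply')
    then have "x i = y i" if "i < Suc m" for i using that \<open>x m = y m\<close> by (metis less_Suc_eq)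
    then show "x = y" using xy(1,2) by (intro extensionalityI[of _ "{..<Suc m}"]) (auto simp: PiE_def)
  qed
  then show ?case by blast
qed


text \<open>A homomorphism determined by its values at m elements is coded by an m-tuple, and an
  infinite type absorbs m-tuples.\<close>

lemma lepoll_lmod_hom:
  assumes inf: "infinite (UNIV :: 'w set)" and X: "carrier X \<lesssim> (UNIV :: 'w set)"
    and u: "\<And>j. j < (m::nat) \<Longrightarrow> u j \<in> carrier M"
    and det: "\<And>\<phi> \<psi>. \<lbrakk>\<phi> \<in> lmod_hom R M X; \<psi> \<in> lmod_hom R M X; \<And>j. j < m \<Longrightarrow> \<phi> (u j) = \<psi> (u j)\<rbrakk> \<Longrightarrow> \<phi> = \<psi>"
  shows "lmod_hom R M X \<lesssim> (UNIV :: 'w set)"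
proof -
  obtain r where r: "inj_on (r :: _ \<Rightarrow> 'w) (carrier X)" using X unfolding lepoll_def by blast
  obtain \<iota> :: "(nat \<Rightarrow> 'w) \<Rightarrow> 'w" where \<iota>: "inj_on \<iota> ({..<m} \<rightarrow>\<^sub>E UNIV)" using inj_tuples[OF inf] by blast
  have "inj_on (\<lambda>\<phi>. \<iota> (\<lambda>j\<in>{..<m}. r (\<phi> (u j)))) (lmod_hom R M X)"
  proof (rule inj_onI)
    fix \<phi> \<psi> assume p: "\<phi> \<in> lmod_hom R M X" "\<psi> \<in> lmod_hom R M X"
    assume e: "\<iota> (\<lambda>j\<in>{..<m}. r (\<phi> (u j))) = \<iota> (\<lambda>j\<in>{..<m}. r (\<psi> (u j)))"
    have eq: "(\<lambda>j\<in>{..<m}. r (\<phi> (u j))) = (\<lambda>j\<in>{..<m}. r (\<psi> (u j)))"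
      by (rule inj_onD[OF \<iota>, OF e]) auto
    show "\<phi> = \<psi>"
    proof (rule det[OF p])
      fix j assume j: "j < m"
      then have "r (\<phi> (u j)) = r (\<psi> (u j))" using fun_cong[OF eq, of j] by simp
      then show "\<phi> (u j) = \<psi> (u j)"
        by (rule inj_onD[OF r]) (rule lmod_hom_closed[OF p(1) u[OF j]], rule lmod_hom_closed[OF p(2) u[OF j]])
    qed
  qed
  then show ?thesis unfolding lepoll_def by blast
qed


section \<open>Split dual pairs\<close>

lemma hmap_plus:
  assumes "is_bimodule R S P" "f \<in> lmod_hom R P Y"
    "\<And>y. y \<in> carrier Y \<Longrightarrow> h y = k y \<oplus>\<^bsub>Z\<^esub> l y"
  shows "hmap P h f = hmap P k f \<oplus>\<^bsub>hom_mod R P Z\<^esub> hmap P l f"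
  using lmod_hom_closed[OF assms(2)] assms(3) by (auto simp: hmap_def intro!: restrict_ext)

lemma hmap_comp: "hmap P h (hmap P k f) = hmap P (\<lambda>y. h (k y)) f"
  by (auto simp: hmap_def intro!: restrict_ext)

lemma hmap_id: "f \<in> lmod_hom R P Y \<Longrightarrow> (\<And>y. y \<in> carrier Y \<Longrightarrow> h y = y) \<Longrightarrow> hmap P h f = f"
proof -
  assume f: "f \<in> lmod_hom R P Y" and h: "\<And>y. y \<in> carrier Y \<Longrightarrow> h y = y"
  show ?thesis
  proof (rule extensionalityI[of _ "carrier P"])
    show "f \<in> extensional (carrier P)" using f by (simp add: lmod_hom_iff)
  qed (use h lmod_hom_closed[OF f] in \<open>auto simp: hmap_def\<close>)
qed

lemma hmap_finsum:
  assumes "is_bimodule R S P" "ring S" "left_module R Y" "left_module R Z" "f \<in> lmod_hom R P Y"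
    "\<And>i. i \<in> I \<Longrightarrow> lhom R Y Z (h i)"
  shows "finsum (hom_mod R P Z) (\<lambda>i. hmap P (h i) f) I = hmap P (\<lambda>y. finsum Z (\<lambda>i. h i y) I) f"
proof (rule extensionalityI[of _ "carrier P"])
  have c: "hmap P (h i) f \<in> lmod_hom R P Z" if "i \<in> I" for i
    using hmap_closed[OF assms(1) assms(6)[OF that] assms(5)] .
  interpret H: left_module S "hom_mod R P Z" by (rule left_module_hom_mod[OF assms(1,2,4)])
  interpret Z: left_module R Z by fact
  have "finsum (hom_mod R P Z) (\<lambda>i. hmap P (h i) f) I \<in> carrier (hom_mod R P Z)"
    using c by (intro H.M.finsum_closed) auto
  then show "finsum (hom_mod R P Z) (\<lambda>i. hmap P (h i) f) I \<in> extensional (carrier P)"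
    by (simp add: lmod_hom_iff)
  show "hmap P (\<lambda>y. finsum Z (\<lambda>i. h i y) I) f \<in> extensional (carrier P)" by (simp add: hmap_def)
  fix p assume p: "p \<in> carrier P"
  show "finsum (hom_mod R P Z) (\<lambda>i. hmap P (h i) f) I p = hmap P (\<lambda>y. finsum Z (\<lambda>i. h i y) I) f p"
    using p c lhom_closed[OF assms(6)] lmod_hom_closed[OF assms(5)]
    by (subst finsum_hom_mod_apply[OF assms(1,2,4)]) (auto intro!: Z.M.finsum_cong')
qed

text \<open>
  A homomorphism \<open>\<pi> : V \<otimes>\<^sub>R U \<rightarrow> S\<close> of \<open>S\<close>-\<open>S\<close>-bimodules induces a natural map from \<open>Y\<close> to
  \<open>Hom\<^sub>R(U, Hom\<^sub>S(V, Y))\<close>.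
\<close>

locale paired_dual_pair = dual_pair R S U V b m u v
  for R :: "('r, 'a) ring_scheme" (structure) and S :: "('s, 'b) ring_scheme" (structure)
    and U :: "('r, 'u, 's, 'm) bimodule_scheme" and V :: "('s, 'v, 'r, 'n) bimodule_scheme"
    and b m u v +
  fixes \<pi> :: "'v \<Rightarrow> 'u \<Rightarrow> 's"
  assumes \<pi>_closed: "\<lbrakk>y \<in> carrier V; x \<in> carrier U\<rbrakk> \<Longrightarrow> \<pi> y x \<in> carrier S"
    and \<pi>_add_l: "\<lbrakk>y \<in> carrier V; y' \<in> carrier V; x \<in> carrier U\<rbrakk> \<Longrightarrow> \<pi> (y \<oplus>\<^bsub>V\<^esub> y') x = \<pi> y x \<oplus>\<^bsub>S\<^esub> \<pi> y' x"
    and \<pi>_add_r: "\<lbrakk>y \<in> carrier V; x \<in> carrier U; x' \<in> carrier U\<rbrakk> \<Longrightarrow> \<pi> y (x \<oplus>\<^bsub>U\<^esub> x') = \<pi> y x \<oplus>\<^bsub>S\<^esub> \<pi> y x'"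
    and \<pi>_smult: "\<lbrakk>s \<in> carrier S; y \<in> carrier V; x \<in> carrier U\<rbrakk> \<Longrightarrow> \<pi> (s \<odot>\<^bsub>V\<^esub> y) x = s \<otimes>\<^bsub>S\<^esub> \<pi> y x"
    and \<pi>_rsmult: "\<lbrakk>s \<in> carrier S; y \<in> carrier V; x \<in> carrier U\<rbrakk> \<Longrightarrow> \<pi> y (rsmult U x s) = \<pi> y x \<otimes>\<^bsub>S\<^esub> s"
    and \<pi>_balanced: "\<lbrakk>r \<in> carrier R; y \<in> carrier V; x \<in> carrier U\<rbrakk> \<Longrightarrow> \<pi> (rsmult V y r) x = \<pi> y (r \<odot>\<^bsub>U\<^esub> x)"
begin

definition sect :: "('s, 'y, 'o) module_scheme \<Rightarrow> 'y \<Rightarrow> 'u \<Rightarrow> 'v \<Rightarrow> 'y"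
  where "sect Y y = (\<lambda>w\<in>carrier U. \<lambda>z\<in>carrier V. \<pi> z w \<odot>\<^bsub>Y\<^esub> y)"

lemma sect_closed:
  assumes "left_module S Y" "y \<in> carrier Y"
  shows "sect Y y \<in> lmod_hom R U (hom_mod S V Y)"
proof -
  interpret Y: left_module S Y by fact
  have "(\<lambda>z\<in>carrier V. \<pi> z w \<odot>\<^bsub>Y\<^esub> y) \<in> lmod_hom S V Y" if "w \<in> carrier U" for w
    using that assms(2)
    by (intro restrict_lmod_hom V_left lhomI)
      (auto simp: \<pi>_closed \<pi>_add_l \<pi>_smult Y.smult_closed Y.smult_l_distr Y.smult_assoc)
  then show ?thesis
    unfolding sect_def using assms(2)
    by (intro restrict_lmod_hom U_left lhomI)
      (auto simp: \<pi>_closed \<pi>_add_r \<pi>_balanced rsmult_closed[OF V] Y.smult_l_distr intro!: restrict_ext)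
qed

lemma lhom_sect:
  assumes "left_module S Y"
  shows "lhom S Y (hom_mod R U (hom_mod S V Y)) (sect Y)"
proof -
  interpret Y: left_module S Y by fact
  show ?thesis
    using sect_closed[OF assms]
    by (intro lhomI) (auto simp: sect_def \<pi>_closed \<pi>_rsmult rsmult_closed[OF U] Y.smult_r_distr Y.smult_assoc
        intro!: restrict_ext)
qed

lemma sect_natural:
  assumes "lhom S Y Y' h" "y \<in> carrier Y"
  shows "hmap U (hmap V h) (sect Y y) = sect Y' (h y)"
  unfolding sect_def hmap_def
proof (rule restrict_ext)
  fix w assume w: "w \<in> carrier U"
  then show "(\<lambda>p\<in>carrier V. h ((\<lambda>w\<in>carrier U. \<lambda>z\<in>carrier V. \<pi> z w \<odot>\<^bsub>Y\<^esub> y) w p)) =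
      (\<lambda>z\<in>carrier V. \<pi> z w \<odot>\<^bsub>Y'\<^esub> h y)"
    using assms(2) by (simp add: lhom_smult[OF assms(1)] \<pi>_closed cong: restrict_cong)
qed

end

text \<open>The equation says that \<pi> sends the central element \<Sum> v_j \<otimes> u_j to 1. By
  \<open>counit_sect\<close> this makes \<open>sect\<close> a section of the counit, so that every Y
  is a natural summand of Hom_R(U, Hom_S(V, Y)).\<close>

locale split_dual_pair = paired_dual_pair R S U V b m u v \<pi>
  for R :: "('r, 'a) ring_scheme" (structure) and S :: "('s, 'b) ring_scheme" (structure)
    and U :: "('r, 'u, 's, 'm) bimodule_scheme" and V :: "('s, 'v, 'r, 'n) bimodule_scheme"
    and b m u v and \<pi> :: "'v \<Rightarrow> 'u \<Rightarrow> 's" +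
  assumes \<pi>_one: "finsum S (\<lambda>j. \<pi> (v j) (u j)) {..<m} = \<one>\<^bsub>S\<^esub>"
begin

lemma counit_sect:
  assumes "left_module S Y" "y \<in> carrier Y"
  shows "counit Y (sect Y y) = y"
proof -
  interpret Y: left_module S Y by fact
  have "counit Y (sect Y y) = finsum Y (\<lambda>j. \<pi> (v j) (u j) \<odot>\<^bsub>Y\<^esub> y) {..<m}"
    unfolding counit_def using assms(2)
    by (intro Y.M.finsum_cong' refl) (auto simp: sect_def u_closed v_closed \<pi>_closed Y.smult_closed)
  also have "\<dots> = y"
    using assms(2) \<pi>_one by (subst Y.smult_finsum_l[symmetric]) (auto simp: u_closed v_closed \<pi>_closed Y.smult_one)
  finally show ?thesis .
qed

end

section \<open>Additive closures under the Hom functors\<close>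

lemma in_add_hom_mod_sum:
  assumes P: "is_bimodule R S P" and S: "ring S" and Y: "left_module R Y" and Z: "left_module R Z"
    and C: "left_module S C" "in_add S C (hom_mod R P Y)" "in_add S C (hom_mod R P Z)"
  shows "in_add S C (hom_mod R P (lmod_sum Y Z))"
proof -
  note YZ = left_module_lmod_sum[OF Y Z] and sm = lhom_sum_maps[OF Y Z]
  interpret Y: left_module R Y by fact
  interpret Z: left_module R Z by fact
  note lY = left_module_hom_mod[OF P S Y] and lZ = left_module_hom_mod[OF P S Z]
    and lYZ = left_module_hom_mod[OF P S YZ]
  let ?H = "hom_mod R P (lmod_sum Y Z)"
  have "fac S C ?H ?H (\<lambda>f. hmap P (\<lambda>y. (y, \<zero>\<^bsub>Z\<^esub>)) (hmap P fst f))"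
    using fac_pre[OF lYZ fac_post[OF lY lY lYZ _ lhom_hmap[OF P sm(3)]] lhom_hmap[OF P sm(1)]] C(2)
    unfolding in_add_def by blast
  moreover have "fac S C ?H ?H (\<lambda>f. hmap P (\<lambda>z. (\<zero>\<^bsub>Y\<^esub>, z)) (hmap P snd f))"
    using fac_pre[OF lYZ fac_post[OF lZ lZ lYZ _ lhom_hmap[OF P sm(4)]] lhom_hmap[OF P sm(2)]] C(3)
    unfolding in_add_def by blast
  ultimately show ?thesis
    unfolding in_add_def
  proof (rule fac_cong[OF fac_plus[OF lYZ lYZ]])
    fix f assume "f \<in> carrier ?H"
    then have f: "f \<in> lmod_hom R P (lmod_sum Y Z)" by simp
    show "f = hmap P (\<lambda>y. (y, \<zero>\<^bsub>Z\<^esub>)) (hmap P fst f) \<oplus>\<^bsub>?H\<^esub> hmap P (\<lambda>z. (\<zero>\<^bsub>Y\<^esub>, z)) (hmap P snd f)"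
    proof (rule extensionalityI[of _ "carrier P"])
      fix p assume p: "p \<in> carrier P"
      then have "f p \<in> carrier (lmod_sum Y Z)" by (rule lmod_hom_closed[OF f])
      then show "f p = (hmap P (\<lambda>y. (y, \<zero>\<^bsub>Z\<^esub>)) (hmap P fst f) \<oplus>\<^bsub>?H\<^esub> hmap P (\<lambda>z. (\<zero>\<^bsub>Y\<^esub>, z)) (hmap P snd f)) p"
        using p by (auto simp: lmod_sum_def)
    qed (use f in \<open>auto simp: lmod_hom_iff\<close>)
  qed
qed

section \<open>Finitely generated modules\<close>

lemma lsub_finsum:
  assumes "left_module R M" "lsub R M S" "g \<in> I \<rightarrow> S"
  shows "finsum M g I \<in> S"
proof -
  interpret S: left_module R "M\<lparr>carrier := S\<rparr>" by (rule left_module_lsub[OF assms(1,2)])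
  show ?thesis using S.M.finsum_closed[of g I] finsum_lsub[OF assms] assms(3) by simp
qed

text \<open>Generation is rephrased as the absence of a proper submodule containing X, the form in
  which preimages of submodules can be used in place of linear combinations.\<close>

lemma fin_gen_iff:
  assumes "left_module R M"
  shows "fin_gen R M \<longleftrightarrow> (\<exists>X. finite X \<and> X \<subseteq> carrier M \<and> (\<forall>S. lsub R M S \<longrightarrow> X \<subseteq> S \<longrightarrow> S = carrier M))"
proof
  interpret M: left_module R M by fact
  assume "fin_gen R M"
  then obtain X where X: "finite X" "X \<subseteq> carrier M"
    "carrier M = {finsum M (\<lambda>g. c g \<odot>\<^bsub>M\<^esub> g) X | c. c \<in> X \<rightarrow> carrier R}"
    unfolding fin_gen_def by blast
  have "S = carrier M" if S: "lsub R M S" "X \<subseteq> S" for S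
  proof
    show "S \<subseteq> carrier M" using S by (auto simp: lsub_def)
    show "carrier M \<subseteq> S"
    proof
      fix x assume "x \<in> carrier M"
      then obtain c where c: "c \<in> X \<rightarrow> carrier R" "x = finsum M (\<lambda>g. c g \<odot>\<^bsub>M\<^esub> g) X" using X(3) by blast
      have "(\<lambda>g. c g \<odot>\<^bsub>M\<^esub> g) \<in> X \<rightarrow> S" using c(1) S lsub_smult[OF S(1)] by auto
      then show "x \<in> S" unfolding c(2) by (rule lsub_finsum[OF assms S(1)])
    qed
  qed
  then show "\<exists>X. finite X \<and> X \<subseteq> carrier M \<and> (\<forall>S. lsub R M S \<longrightarrow> X \<subseteq> S \<longrightarrow> S = carrier M)"
    using X by blast
next
  interpret M: left_module R M by fact
  assume "\<exists>X. finite X \<and> X \<subseteq> carrier M \<and> (\<forall>S. lsub R M S \<longrightarrow> X \<subseteq> S \<longrightarrow> S = carrier M)"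
  then obtain X where X: "finite X" "X \<subseteq> carrier M" "\<And>S. lsub R M S \<Longrightarrow> X \<subseteq> S \<Longrightarrow> S = carrier M" by blast
  let ?S = "{finsum M (\<lambda>g. c g \<odot>\<^bsub>M\<^esub> g) X | c. c \<in> X \<rightarrow> carrier R}"
  have sm: "(\<lambda>g. c g \<odot>\<^bsub>M\<^esub> g) \<in> X \<rightarrow> carrier M" if "c \<in> X \<rightarrow> carrier R" for c
    using that X(2) by (auto simp: M.smult_closed Pi_iff subset_iff)
  have xM: "x \<in> carrier M" if "x \<in> X" for x using X(2) that by auto
  have "lsub R M ?S"
  proof (rule lsubI)
    show "?S \<subseteq> carrier M" using sm by auto
    have "finsum M (\<lambda>g. \<zero>\<^bsub>R\<^esub> \<odot>\<^bsub>M\<^esub> g) X = finsum M (\<lambda>g. \<zero>\<^bsub>M\<^esub>) X"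
      using xM by (intro M.M.finsum_cong') auto
    then have "\<zero>\<^bsub>M\<^esub> = finsum M (\<lambda>g. (\<lambda>_. \<zero>\<^bsub>R\<^esub>) g \<odot>\<^bsub>M\<^esub> g) X" by simp
    then show "\<zero>\<^bsub>M\<^esub> \<in> ?S" by (intro CollectI exI conjI) (assumption, simp)
    show "x \<oplus>\<^bsub>M\<^esub> y \<in> ?S" if xS: "x \<in> ?S" and yS: "y \<in> ?S" for x y
    proof -
      obtain c where c: "c \<in> X \<rightarrow> carrier R" "x = finsum M (\<lambda>g. c g \<odot>\<^bsub>M\<^esub> g) X"
        using xS by blast
      obtain d where d: "d \<in> X \<rightarrow> carrier R" "y = finsum M (\<lambda>g. d g \<odot>\<^bsub>M\<^esub> g) X"
        using yS by blast
      have "x \<oplus>\<^bsub>M\<^esub> y = finsum M (\<lambda>g. c g \<odot>\<^bsub>M\<^esub> g \<oplus>\<^bsub>M\<^esub> d g \<odot>\<^bsub>M\<^esub> g) X"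
        unfolding c d using sm[OF c(1)] sm[OF d(1)] by (rule M.M.finsum_addf[symmetric])
      also have "\<dots> = finsum M (\<lambda>g. (c g \<oplus>\<^bsub>R\<^esub> d g) \<odot>\<^bsub>M\<^esub> g) X"
        using c(1) d(1) xM by (intro M.M.finsum_cong') (auto simp: M.smult_l_distr M.smult_closed Pi_iff)
      finally show ?thesis using c(1) d(1) by (intro CollectI exI[of _ "\<lambda>g. c g \<oplus>\<^bsub>R\<^esub> d g"]) auto
    qed
    show "r \<odot>\<^bsub>M\<^esub> x \<in> ?S" if r: "r \<in> carrier R" and yS: "x \<in> ?S" for r x
    proof -
      obtain c where c: "c \<in> X \<rightarrow> carrier R" "x = finsum M (\<lambda>g. c g \<odot>\<^bsub>M\<^esub> g) X"
        using yS by blast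
      have "r \<odot>\<^bsub>M\<^esub> x = finsum M (\<lambda>g. r \<odot>\<^bsub>M\<^esub> (c g \<odot>\<^bsub>M\<^esub> g)) X"
        unfolding c using sm[OF c(1)] by (rule M.smult_finsum_r[OF r])
      also have "\<dots> = finsum M (\<lambda>g. (r \<otimes>\<^bsub>R\<^esub> c g) \<odot>\<^bsub>M\<^esub> g) X"
        using c(1) r xM by (intro M.M.finsum_cong') (auto simp: M.smult_assoc M.smult_closed Pi_iff)
      finally show ?thesis using c(1) r by (intro CollectI exI[of _ "\<lambda>g. r \<otimes>\<^bsub>R\<^esub> c g"]) auto
    qed
  qed
  moreover have "X \<subseteq> ?S"
  proof
    fix x assume x: "x \<in> X"
    let ?c = "\<lambda>g. if g = x then \<one>\<^bsub>R\<^esub> else \<zero>\<^bsub>R\<^esub>"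
    have "finsum M (\<lambda>g. ?c g \<odot>\<^bsub>M\<^esub> g) X = ?c x \<odot>\<^bsub>M\<^esub> x"
      using x xM X(1) by (intro M.M.finsum_delta) (auto simp: M.smult_closed)
    then have "x = finsum M (\<lambda>g. ?c g \<odot>\<^bsub>M\<^esub> g) X" using xM[OF x] by (simp add: M.smult_one)
    then show "x \<in> ?S" by (intro CollectI exI[of _ ?c]) auto
  qed
  ultimately have "?S = carrier M" by (rule X(3))
  then show "fin_gen R M" unfolding fin_gen_def using X(1,2) by blast
qed

lemma fin_gen_surj:
  assumes "left_module R M" "left_module R N" "lhom R M N f" "f ` carrier M = carrier N" "fin_gen R M"
  shows "fin_gen R N"
proof -
  obtain X where X: "finite X" "X \<subseteq> carrier M" "\<And>S. lsub R M S \<Longrightarrow> X \<subseteq> S \<Longrightarrow> S = carrier M"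
    using assms(5) unfolding fin_gen_iff[OF assms(1)] by blast
  have "S = carrier N" if S: "lsub R N S" "f ` X \<subseteq> S" for S
  proof -
    have "{x \<in> carrier M. f x \<in> S} = carrier M"
      using X(2) S by (intro X(3) lsub_vimage[OF assms(1-3) lsub_carrier[OF assms(1)] S(1)]) auto
    then have "f ` carrier M \<subseteq> S" by blast
    then show ?thesis using assms(4) S(1) by (auto simp: lsub_def)
  qed
  then show ?thesis unfolding fin_gen_iff[OF assms(2)]
    using X(1,2) lhom_closed[OF assms(3)] by (intro exI[of _ "f ` X"]) auto
qed

text \<open>An element is coded by one choice of coefficients for the finitely many generators,
  hence by a finite tuple of scalars. This is what makes P and Q fit into 'u.\<close>

lemma fin_gen_lepoll:
  fixes R :: "('r, 'q) ring_scheme" and M :: "('r, 'x, 'm) module_scheme"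
  assumes "left_module R M" "fin_gen R M" "carrier R \<lesssim> (UNIV :: 'w set)" "infinite (UNIV :: 'w set)"
  shows "carrier M \<lesssim> (UNIV :: 'w set)"
proof -
  interpret M: left_module R M by fact
  obtain X where X: "finite X" "X \<subseteq> carrier M"
    "carrier M = {finsum M (\<lambda>g. c g \<odot>\<^bsub>M\<^esub> g) X | c. c \<in> X \<rightarrow> carrier R}"
    using assms(2) unfolding fin_gen_def by blast
  obtain n and h :: "nat \<Rightarrow> 'x" where h: "X = h ` {i. i < n}"
    using X(1) by (metis finite_imp_nat_seg_image_inj_on)
  obtain r :: "'r \<Rightarrow> 'w" where r: "inj_on r (carrier R)" using assms(3) unfolding lepoll_def by blast
  obtain \<iota> :: "(nat \<Rightarrow> 'w) \<Rightarrow> 'w" where \<iota>: "inj_on \<iota> ({..<n} \<rightarrow>\<^sub>E UNIV)" using inj_tuples[OF assms(4)] by blast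
  define d where "d = (\<lambda>x. SOME c. c \<in> X \<rightarrow> carrier R \<and> x = finsum M (\<lambda>g. c g \<odot>\<^bsub>M\<^esub> g) X)"
  have d: "d x \<in> X \<rightarrow> carrier R \<and> x = finsum M (\<lambda>g. d x g \<odot>\<^bsub>M\<^esub> g) X" if "x \<in> carrier M" for x
    unfolding d_def using that X(3) by (intro someI_ex[of "\<lambda>c. c \<in> X \<rightarrow> carrier R \<and> x = finsum M (\<lambda>g. c g \<odot>\<^bsub>M\<^esub> g) X"]) blast
  have "inj_on (\<lambda>x. \<iota> (\<lambda>i\<in>{..<n}. r (d x (h i)))) (carrier M)"
  proof (rule inj_onI)
    fix x y assume xy: "x \<in> carrier M" "y \<in> carrier M"
      "\<iota> (\<lambda>i\<in>{..<n}. r (d x (h i))) = \<iota> (\<lambda>i\<in>{..<n}. r (d y (h i)))"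
    have eq: "(\<lambda>i\<in>{..<n}. r (d x (h i))) = (\<lambda>i\<in>{..<n}. r (d y (h i)))"
      using inj_onD[OF \<iota>, OF xy(3)] by auto
    have "d x g = d y g" if "g \<in> X" for g
    proof -
      have "g \<in> h ` {i. i < n}" using that h by simp
      then obtain i where i: "i < n" "g = h i" by blast
      have "r (d x g) = r (d y g)" using fun_cong[OF eq, of i] i by simp
      then show ?thesis using inj_onD[OF r] d[OF xy(1)] d[OF xy(2)] that by blast
    qed
    then have "finsum M (\<lambda>g. d x g \<odot>\<^bsub>M\<^esub> g) X = finsum M (\<lambda>g. d y g \<odot>\<^bsub>M\<^esub> g) X"
      using d[OF xy(2)] X(2) by (intro M.M.finsum_cong') (auto intro!: M.smult_closed)
    then show "x = y" using d[OF xy(1)] d[OF xy(2)] by simp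
  qed
  then show ?thesis unfolding lepoll_def by blast
qed

section \<open>Pure tensors inside Hom modules\<close>

context dual_pair
begin

text \<open>The element y \<otimes> x of V \<otimes> X, read in Hom_R(U, X).\<close>

abbreviation tens :: "('r, 'x, 'o) module_scheme \<Rightarrow> 'v \<Rightarrow> 'x \<Rightarrow> 'u \<Rightarrow> 'x"
  where "tens X y x \<equiv> unit X x y"

lemma tens_apply: "y \<in> carrier V \<Longrightarrow> w \<in> carrier U \<Longrightarrow> tens X y x w = b w y \<odot>\<^bsub>X\<^esub> x"
  by (simp add: unit_def)

lemma tens_closed: "left_module R X \<Longrightarrow> x \<in> carrier X \<Longrightarrow> y \<in> carrier V \<Longrightarrow> tens X y x \<in> lmod_hom R U X"
  using lmod_hom_closed[OF unit_closed[of X x], of y] by simp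

text \<open>Writes \<phi> as \<Sum> v_j \<otimes> \<phi>(u_j): every map is a finite sum of pure
  tensors with the fixed first factors v_j. It follows from the expansion of w in the u_j, and it is
  the second triangle identity in disguise.\<close>

lemma tens_expand:
  assumes X: "left_module R X" and \<phi>: "\<phi> \<in> lmod_hom R U X"
  shows "finsum (hom_mod R U X) (\<lambda>j. tens X (v j) (\<phi> (u j))) {..<m} = \<phi>"
proof (rule extensionalityI[of _ "carrier U"])
  interpret X: left_module R X by fact
  interpret FX: left_module S "hom_mod R U X" by (rule left_module_F[OF X])
  note c = lmod_hom_closed[OF \<phi>] u_closed v_closed b_closed X.smult_closed
  have t: "tens X (v j) (\<phi> (u j)) \<in> lmod_hom R U X" if "j < m" for j
    using that by (intro tens_closed X c)
  have "finsum (hom_mod R U X) (\<lambda>j. tens X (v j) (\<phi> (u j))) {..<m} \<in> carrier (hom_mod R U X)"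
    using t by (intro FX.M.finsum_closed) auto
  then show "finsum (hom_mod R U X) (\<lambda>j. tens X (v j) (\<phi> (u j))) {..<m} \<in> extensional (carrier U)"
    by (simp add: lmod_hom_iff)
  show "\<phi> \<in> extensional (carrier U)" using \<phi> by (simp add: lmod_hom_iff)
  fix w assume w: "w \<in> carrier U"
  have "finsum (hom_mod R U X) (\<lambda>j. tens X (v j) (\<phi> (u j))) {..<m} w = finsum X (\<lambda>j. tens X (v j) (\<phi> (u j)) w) {..<m}"
    using t by (intro finsum_hom_mod_apply[OF U S.ring_axioms X _ w]) auto
  also have "\<dots> = finsum X (\<lambda>j. \<phi> (b w (v j) \<odot>\<^bsub>U\<^esub> u j)) {..<m}"
    using w c by (intro X.M.finsum_cong' refl) (auto simp: tens_apply lhom_smult[OF lmod_homD[OF \<phi>]])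
  also have "\<dots> = \<phi> (finsum U (\<lambda>j. b w (v j) \<odot>\<^bsub>U\<^esub> u j) {..<m})"
    using w c left_module.smult_closed[OF U_left]
    by (intro lhom_finsum[OF U_left X lmod_homD[OF \<phi>], symmetric]) auto
  also have "\<dots> = \<phi> w" using u_expand[OF w] by simp
  finally show "finsum (hom_mod R U X) (\<lambda>j. tens X (v j) (\<phi> (u j))) {..<m} w = \<phi> w" .
qed

text \<open>By \<open>tens_expand\<close> a map is determined by its values at the u_j. So the Hom
  module of a module in an infinite type 'w has a copy in 'w, although its own elements are
  functions.\<close>

lemma lepoll_hom_mod:
  assumes X: "left_module R X" "carrier X \<lesssim> (UNIV :: 'w set)" "infinite (UNIV :: 'w set)"
  shows "carrier (hom_mod R U X) \<lesssim> (UNIV :: 'w set)"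
proof -
  interpret FX: left_module S "hom_mod R U X" by (rule left_module_F[OF X(1)])
  have det: "\<phi> = \<psi>" if p: "\<phi> \<in> lmod_hom R U X" "\<psi> \<in> lmod_hom R U X" and eq: "\<And>j. j < m \<Longrightarrow> \<phi> (u j) = \<psi> (u j)" for \<phi> \<psi>
  proof -
    have "finsum (hom_mod R U X) (\<lambda>j. tens X (v j) (\<phi> (u j))) {..<m} =
        finsum (hom_mod R U X) (\<lambda>j. tens X (v j) (\<psi> (u j))) {..<m}"
      using tens_closed[OF X(1) lmod_hom_closed[OF p(2) u_closed] v_closed] eq
      by (intro FX.M.finsum_cong' refl) auto
    then show ?thesis using tens_expand[OF X(1)] p by simp
  qed
  have "lmod_hom R U X \<lesssim> (UNIV :: 'w set)"
    by (rule lepoll_lmod_hom[where u = u and m = m, OF X(3,2)]) (fact u_closed, fact det)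
  then show ?thesis by simp
qed

lemma lhom_tens:
  assumes "left_module R X" "x \<in> carrier X"
  shows "lhom S V (hom_mod R U X) (\<lambda>y. tens X y x)"
  using lmod_homD[OF unit_closed[OF assms]] .

text \<open>The pure tensors of generators of V with generators of X generate, as in any tensor
  product.\<close>

lemma fin_gen_hom_mod:
  assumes X: "left_module R X" "fin_gen R X" and fV: "fin_gen S V"
  shows "fin_gen S (hom_mod R U X)"
proof -
  interpret X: left_module R X by fact
  note lF = left_module_F[OF X(1)]
  obtain Y where Y: "finite Y" "Y \<subseteq> carrier V" "\<And>T. lsub S V T \<Longrightarrow> Y \<subseteq> T \<Longrightarrow> T = carrier V"
    using fV unfolding fin_gen_iff[OF V_left] by blast
  obtain Z where Z: "finite Z" "Z \<subseteq> carrier X" "\<And>T. lsub R X T \<Longrightarrow> Z \<subseteq> T \<Longrightarrow> T = carrier X"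
    using X(2) unfolding fin_gen_iff[OF X(1)] by blast
  let ?G = "(\<lambda>(y, x). tens X y x) ` (Y \<times> Z)"
  have "T = carrier (hom_mod R U X)" if T: "lsub S (hom_mod R U X) T" "?G \<subseteq> T" for T
  proof -
    have 1: "tens X y x \<in> T" if "x \<in> Z" "y \<in> carrier V" for x y
    proof -
      have x: "x \<in> carrier X" using that Z(2) by auto
      have "{y \<in> carrier V. tens X y x \<in> T} = carrier V"
        using Y(2) T(2) that(1)
        by (intro Y(3) lsub_vimage[OF V_left lF lhom_tens[OF X(1) x] lsub_carrier[OF V_left] T(1)]) auto
      then show ?thesis using that(2) by auto
    qed
    \<comment> \<open>Closure under scalars rests on y \<otimes> r x = y r \<otimes> x. It changes
      y, so membership for all y in V has to be secured before x is varied.\<close>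
    have "lsub R X {x \<in> carrier X. \<forall>y\<in>carrier V. tens X y x \<in> T}"
    proof (rule lsubI)
      note lu = lhom_unit[OF X(1)]
      have "unit X \<zero>\<^bsub>X\<^esub> = \<zero>\<^bsub>hom_mod S V (hom_mod R U X)\<^esub>"
        by (rule lhom_zero[OF X(1) left_module_G[OF lF] lu])
      then show "\<zero>\<^bsub>X\<^esub> \<in> {x \<in> carrier X. \<forall>y\<in>carrier V. tens X y x \<in> T}"
        using lsub_zero[OF T(1)] by simp
      show "x \<oplus>\<^bsub>X\<^esub> x' \<in> {x \<in> carrier X. \<forall>y\<in>carrier V. tens X y x \<in> T}"
        if "x \<in> {x \<in> carrier X. \<forall>y\<in>carrier V. tens X y x \<in> T}" "x' \<in> {x \<in> carrier X. \<forall>y\<in>carrier V. tens X y x \<in> T}" for x x'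
        using that lsub_add[OF T(1)] lhom_add[OF lu, of x x'] by auto
      show "r \<odot>\<^bsub>X\<^esub> x \<in> {x \<in> carrier X. \<forall>y\<in>carrier V. tens X y x \<in> T}"
        if "r \<in> carrier R" "x \<in> {x \<in> carrier X. \<forall>y\<in>carrier V. tens X y x \<in> T}" for r x
        using that lhom_smult[OF lu, of r x] by (auto simp: X.smult_closed rsmult_closed[OF V])
    qed auto
    then have 2: "{x \<in> carrier X. \<forall>y\<in>carrier V. tens X y x \<in> T} = carrier X"
      by (rule Z(3)) (use 1 Z(2) in auto)
    have "\<phi> \<in> T" if \<phi>: "\<phi> \<in> lmod_hom R U X" for \<phi>
    proof -
      have "finsum (hom_mod R U X) (\<lambda>j. tens X (v j) (\<phi> (u j))) {..<m} \<in> T"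
        using 2 v_closed lmod_hom_closed[OF \<phi> u_closed] by (intro lsub_finsum[OF lF T(1)]) auto
      then show ?thesis using tens_expand[OF X(1) \<phi>] by simp
    qed
    then show ?thesis using T(1) by (auto simp: lsub_def)
  qed
  then have span: "\<forall>T. lsub S (hom_mod R U X) T \<longrightarrow> ?G \<subseteq> T \<longrightarrow> T = carrier (hom_mod R U X)"
    by (intro allI impI)
  have "?G \<subseteq> carrier (hom_mod R U X)"
    using Y(2) Z(2) tens_closed[OF X(1)] by auto
  then show ?thesis unfolding fin_gen_iff[OF lF]
    using Y(1) Z(1) span by (intro exI[of _ ?G] conjI finite_imageI finite_cartesian_product)
qed

text \<open>The pairing identifies V with the dual Hom_R(U, R) of U; the inverse sends \<phi> to
  \<Sum> v_j \<phi>(u_j). Linearity of that inverse is read off from the bijection.\<close>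

lemma retr_dual:
  "retr S (hom_mod R U (regular_bimod R)) V (\<lambda>\<phi>. finsum V (\<lambda>j. rsmult V (v j) (\<phi> (u j))) {..<m})
    (\<lambda>y. \<lambda>w\<in>carrier U. b w y)"
proof -
  let ?h = "\<lambda>y. \<lambda>w\<in>carrier U. b w y"
  let ?k = "\<lambda>\<phi>. finsum V (\<lambda>j. rsmult V (v j) (\<phi> (u j))) {..<m}"
  interpret V: left_module S V by (rule V_left)
  note reg = left_module_regular[OF R.ring_axioms]
  have hc: "?h y \<in> lmod_hom R U (regular_bimod R)" if "y \<in> carrier V" for y
    using that by (intro restrict_lmod_hom U_left lhomI) (auto simp: b_closed b_add_l b_smult)
  have hl: "lhom S V (hom_mod R U (regular_bimod R)) ?h"
    using hc by (intro lhomI) (auto simp: b_add_r b_balanced rsmult_closed[OF U] intro!: restrict_ext)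
  have kc: "?k \<phi> \<in> carrier V" if "\<phi> \<in> lmod_hom R U (regular_bimod R)" for \<phi>
    using lmod_hom_closed[OF that u_closed] by (intro V.M.finsum_closed) (auto simp: v_closed rsmult_closed[OF V])
  have kh: "?k (?h y) = y" if "y \<in> carrier V" for y
  proof -
    have "?k (?h y) = finsum V (\<lambda>j. rsmult V (v j) (b (u j) y)) {..<m}"
      using that by (intro V.M.finsum_cong' refl) (auto simp: u_closed v_closed b_closed rsmult_closed[OF V])
    then show ?thesis using v_expand[OF that] by simp
  qed
  have hk: "?h (?k \<phi>) = \<phi>" if \<phi>: "\<phi> \<in> lmod_hom R U (regular_bimod R)" for \<phi>
  proof (rule extensionalityI[of _ "carrier U"])
    show "\<phi> \<in> extensional (carrier U)" using \<phi> by (simp add: lmod_hom_iff)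
    fix w assume w: "w \<in> carrier U"
    have \<phi>c: "\<phi> (u j) \<in> carrier R" if "j < m" for j using lmod_hom_closed[OF \<phi> u_closed[OF that]] by simp
    have bl: "addhom V R (b w)" using w by (intro addhomI) (auto simp: b_closed b_add_r)
    have "?h (?k \<phi>) w = finsum R (\<lambda>j. b w (rsmult V (v j) (\<phi> (u j)))) {..<m}"
      using w \<phi>c by (simp, intro addhom_finsum[OF V.M_ag R.is_abelian_group bl]) (auto simp: v_closed rsmult_closed[OF V])
    also have "\<dots> = finsum R (\<lambda>j. \<phi> (b w (v j) \<odot>\<^bsub>U\<^esub> u j)) {..<m}"
      using w \<phi>c by (intro R.finsum_cong' refl)
        (auto simp: b_rsmult v_closed u_closed b_closed lhom_smult[OF lmod_homD[OF \<phi>]])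
    also have "\<dots> = \<phi> (finsum U (\<lambda>j. b w (v j) \<odot>\<^bsub>U\<^esub> u j) {..<m})"
      using w left_module.smult_closed[OF U_left]
      by (subst lhom_finsum[OF U_left reg lmod_homD[OF \<phi>]]) (auto simp: finsum_regular u_closed v_closed b_closed)
    also have "\<dots> = \<phi> w" using u_expand[OF w] by simp
    finally show "?h (?k \<phi>) w = \<phi> w" .
  qed auto
  have "bij_betw ?h (carrier V) (carrier (hom_mod R U (regular_bimod R)))"
    by (rule bij_betw_byWitness[where f' = ?k]) (use hc kc kh hk in \<open>auto simp del: restrict_apply\<close>)
  from lhom_inverse[OF V_left hl this]
  have il: "lhom S (hom_mod R U (regular_bimod R)) V (inv_into (carrier V) ?h)" .
  have "lhom S (hom_mod R U (regular_bimod R)) V ?k"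
  proof (rule lhom_cong[OF il])
    fix \<phi> assume "\<phi> \<in> carrier (hom_mod R U (regular_bimod R))"
    then have \<phi>: "\<phi> \<in> lmod_hom R U (regular_bimod R)" by simp
    have "inj_on ?h (carrier V)" by (rule inj_on_inverseI[of _ ?k]) (rule kh)
    then have "inv_into (carrier V) ?h (?h (?k \<phi>)) = ?k \<phi>" by (rule inv_into_f_f[OF _ kc[OF \<phi>]])
    then show "?k \<phi> = inv_into (carrier V) ?h \<phi>" using hk[OF \<phi>] by simp
  qed (rule left_module_F[OF reg])
  then show ?thesis unfolding retr_def using hl hk by simp
qed

text \<open>The Hom module is V by \<open>retr_dual\<close>, and the opposite dual pair provides V
  with a finite dual basis over S, which exhibits it as a summand of a power of S.\<close>

lemma in_add_regular_dual:
  assumes "dual_pair S R V U a n p q"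
  shows "in_add S (regular_bimod S) (hom_mod R U (regular_bimod R))"
proof -
  interpret D: dual_pair S R V U a n p q by fact
  interpret V: left_module S V by (rule V_left)
  note reg = left_module_regular[OF R.ring_axioms]
  have "fac S (regular_bimod S) V V (\<lambda>y. finsum V (\<lambda>i. a y (q i) \<odot>\<^bsub>V\<^esub> p i) {..<n})"
  proof (rule fac_finsum[OF V_left V_left, where f = "\<lambda>i y. a y (q i)" and g = "\<lambda>i s. s \<odot>\<^bsub>V\<^esub> p i"])
    fix i assume "i \<in> {..<n}"
    then have i: "p i \<in> carrier V" "q i \<in> carrier U" using D.u_closed D.v_closed by auto
    show "lhom S V (regular_bimod S) (\<lambda>y. a y (q i))"
      using i by (intro lhomI) (auto simp: D.b_closed D.b_add_l D.b_smult)
    show "lhom S (regular_bimod S) V (\<lambda>s. s \<odot>\<^bsub>V\<^esub> p i)"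
      using i by (intro lhomI) (auto simp: V.smult_closed V.smult_l_distr V.smult_assoc)
  qed
  then have "in_add S (regular_bimod S) V"
    unfolding in_add_def by (rule fac_cong) (simp add: D.u_expand)
  from in_add_retr[OF left_module_F[OF reg] V_left this retr_dual] show ?thesis .
qed

text \<open>
  This says that \<open>V \<otimes>\<^sub>R U\<close> is centrally projective over \<open>S\<close>: the \<open>\<alpha> r\<close> are the coordinates of an
  embedding into a power of \<open>S\<close>, and \<open>\<tau> r x\<close> is the image of a central element of \<open>V \<otimes>\<^sub>R U\<close> under
  \<open>y \<otimes> w \<mapsto> b x y w\<close>.
\<close>

definition central_add :: "bool"
  where "central_add \<longleftrightarrow> (\<exists>(k::nat) \<tau> \<alpha>.
    (\<forall>r<k. lhom R U U (\<tau> r) \<and> (\<forall>s\<in>carrier S. \<forall>x\<in>carrier U. \<tau> r (rsmult U x s) = rsmult U (\<tau> r x) s) \<and>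
       paired_dual_pair R S U V b m u v (\<alpha> r)) \<and>
    (\<forall>x\<in>carrier U. \<forall>y\<in>carrier V. \<forall>w\<in>carrier U.
       finsum U (\<lambda>r. rsmult U (\<tau> r x) (\<alpha> r y w)) {..<k} = b x y \<odot>\<^bsub>U\<^esub> w))"

text \<open>The double Hom module is Hom_S(V \<otimes> U, Y), and V \<otimes> U is a bimodule
  summand of a power of S. Concretely, \<open>f r\<close> precomposes with \<tau>_r and applies the
  counit, \<open>g r\<close> is the natural map belonging to \<alpha>_r, and
  \<open>central_add\<close> says that the composites sum to the identity.\<close>

lemma in_add_FG:
  assumes ca: "central_add" and Y: "left_module S Y"
  shows "in_add S Y (hom_mod R U (hom_mod S V Y))"
proof -
  obtain k :: nat and \<tau> \<alpha> where \<tau>: "\<And>r. r < k \<Longrightarrow> lhom R U U (\<tau> r)"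
    and \<tau>s: "\<And>r s x. \<lbrakk>r < k; s \<in> carrier S; x \<in> carrier U\<rbrakk> \<Longrightarrow> \<tau> r (rsmult U x s) = rsmult U (\<tau> r x) s"
    and \<alpha>: "\<And>r. r < k \<Longrightarrow> paired_dual_pair R S U V b m u v (\<alpha> r)"
    and eq: "\<And>x y w. \<lbrakk>x \<in> carrier U; y \<in> carrier V; w \<in> carrier U\<rbrakk> \<Longrightarrow>
       finsum U (\<lambda>r. rsmult U (\<tau> r x) (\<alpha> r y w)) {..<k} = b x y \<odot>\<^bsub>U\<^esub> w"
    using ca unfolding central_add_def by blast
  interpret Y: left_module S Y by fact
  interpret U: left_module R U by (rule U_left)
  interpret V: left_module S V by (rule V_left)
  let ?FG = "hom_mod R U (hom_mod S V Y)"
  note lG = left_module_G[OF Y] and lFG = left_module_F[OF left_module_G[OF Y]]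
  interpret FG: left_module S ?FG by (rule lFG)
  have \<tau>c: "\<tau> r x \<in> carrier U" if "r < k" "x \<in> carrier U" for r x using lhom_closed[OF \<tau>] that .
  have pre: "(\<lambda>x\<in>carrier U. \<Phi> (\<tau> r x)) \<in> lmod_hom R U (hom_mod S V Y)"
    if "\<Phi> \<in> lmod_hom R U (hom_mod S V Y)" "r < k" for \<Phi> r
    using that by (intro restrict_lmod_hom U_left lhom_comp[OF \<tau> lmod_homD])
  have prel: "lhom S ?FG ?FG (\<lambda>\<Phi>. \<lambda>x\<in>carrier U. \<Phi> (\<tau> r x))" if "r < k" for r
    using pre[OF _ that] that
    by (intro lhomI) (auto simp: \<tau>c \<tau>s rsmult_closed[OF U] intro!: restrict_ext)
  define f where "f = (\<lambda>r \<Phi>. counit Y (\<lambda>x\<in>carrier U. \<Phi> (\<tau> r x)))"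
  define g where "g = (\<lambda>r y. paired_dual_pair.sect U V (\<alpha> r) Y y)"
  have fl: "lhom S ?FG Y (f r)" if "r < k" for r
    unfolding f_def by (rule lhom_comp[OF prel[OF that] lhom_counit[OF Y]])
  have gl: "lhom S Y ?FG (g r)" if "r < k" for r
    unfolding g_def by (rule paired_dual_pair.lhom_sect[OF \<alpha>[OF that] Y])
  have "fac S Y ?FG ?FG (\<lambda>\<Phi>. finsum ?FG (\<lambda>r. g r (f r \<Phi>)) {..<k})"
    using fl gl by (intro fac_finsum lFG) auto
  then show ?thesis
    unfolding in_add_def
  proof (rule fac_cong)
    fix \<Phi> assume "\<Phi> \<in> carrier ?FG"
    then have \<Phi>: "\<Phi> \<in> lmod_hom R U (hom_mod S V Y)" by simp
    have \<Phi>c: "\<Phi> x \<in> lmod_hom S V Y" if "x \<in> carrier U" for x using lmod_hom_closed[OF \<Phi> that] by simp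
    have c: "\<Phi> x y \<in> carrier Y" if "x \<in> carrier U" "y \<in> carrier V" for x y using lmod_hom_closed[OF \<Phi>c[OF that(1)] that(2)] .
    have fc: "f r \<Phi> \<in> carrier Y" if "r < k" for r using lhom_closed[OF fl[OF that]] \<Phi> by simp
    have gc: "g r (f r \<Phi>) \<in> lmod_hom R U (hom_mod S V Y)" if "r < k" for r
      using lhom_closed[OF gl[OF that] fc[OF that]] by simp
    have gxc: "g r (f r \<Phi>) x \<in> lmod_hom S V Y" if "r < k" "x \<in> carrier U" for r x
      using lmod_hom_closed[OF gc[OF that(1)] that(2)] by simp
    have key: "finsum Y (\<lambda>r. g r (f r \<Phi>) x y) {..<k} = \<Phi> x y" if x: "x \<in> carrier U" and y: "y \<in> carrier V" for x y
    proof -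
      have ac: "\<alpha> r y x \<in> carrier S" if "r < k" for r
        using paired_dual_pair.\<pi>_closed[OF \<alpha>[OF that] y x] .
      note cl = c u_closed v_closed \<tau>c ac rsmult_closed[OF U] rsmult_closed[OF V] V.smult_closed Y.smult_closed x y b_closed U.smult_closed
      have "finsum Y (\<lambda>r. g r (f r \<Phi>) x y) {..<k} =
          finsum Y (\<lambda>r. finsum Y (\<lambda>j. \<Phi> (rsmult U (\<tau> r (u j)) (\<alpha> r y x)) (v j)) {..<m}) {..<k}"
      proof (intro Y.M.finsum_cong' refl)
        show "(\<lambda>r. finsum Y (\<lambda>j. \<Phi> (rsmult U (\<tau> r (u j)) (\<alpha> r y x)) (v j)) {..<m}) \<in> {..<k} \<rightarrow> carrier Y"
          by (auto intro!: Y.M.finsum_closed simp: cl)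
        fix r assume "r \<in> {..<k}"
        then have r: "r < k" by simp
        have "g r (f r \<Phi>) x y = \<alpha> r y x \<odot>\<^bsub>Y\<^esub> f r \<Phi>"
          unfolding g_def paired_dual_pair.sect_def[OF \<alpha>[OF r]] using x y by simp
        \<comment> \<open>S-linearity of \<open>f r\<close> brings the scalar \<alpha>_r(y, x)
          inside, where it acts on \<tau>_r(u_j) from the right. Summed over r, these elements
          become b(u_j, y) x, and R-linearity of \<Phi> moves the coefficient b(u_j, y) onto
          v_j.\<close>
        also have "\<dots> = f r (\<alpha> r y x \<odot>\<^bsub>?FG\<^esub> \<Phi>)"
          using lhom_smult[OF fl[OF r] ac[OF r], of \<Phi>] \<Phi> by simp
        also have "\<dots> = finsum Y (\<lambda>j. \<Phi> (rsmult U (\<tau> r (u j)) (\<alpha> r y x)) (v j)) {..<m}"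
          unfolding f_def counit_def using r
          by (intro Y.M.finsum_cong' refl) (auto simp: cl)
        finally show "g r (f r \<Phi>) x y = finsum Y (\<lambda>j. \<Phi> (rsmult U (\<tau> r (u j)) (\<alpha> r y x)) (v j)) {..<m}" .
      qed
      also have "\<dots> = finsum Y (\<lambda>j. finsum Y (\<lambda>r. \<Phi> (rsmult U (\<tau> r (u j)) (\<alpha> r y x)) (v j)) {..<k}) {..<m}"
        by (intro Y.M.finsum_swap) (auto simp: cl)
      also have "\<dots> = finsum Y (\<lambda>j. \<Phi> x (rsmult V (v j) (b (u j) y))) {..<m}"
      proof (intro Y.M.finsum_cong' refl)
        show "(\<lambda>j. \<Phi> x (rsmult V (v j) (b (u j) y))) \<in> {..<m} \<rightarrow> carrier Y" by (auto simp: cl)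
        fix j assume "j \<in> {..<m}"
        then have j: "j < m" by simp
        have ev: "addhom U Y (\<lambda>x. \<Phi> x (v j))"
          using j lhom_add[OF lmod_homD[OF \<Phi>]] by (intro addhomI) (auto simp: cl)
        have "finsum Y (\<lambda>r. \<Phi> (rsmult U (\<tau> r (u j)) (\<alpha> r y x)) (v j)) {..<k} =
            \<Phi> (finsum U (\<lambda>r. rsmult U (\<tau> r (u j)) (\<alpha> r y x)) {..<k}) (v j)"
          using j by (intro addhom_finsum[OF U.M_ag Y.M_ag ev, symmetric]) (auto simp: cl)
        also have "\<dots> = \<Phi> x (rsmult V (v j) (b (u j) y))"
          using j lhom_smult[OF lmod_homD[OF \<Phi>], of "b (u j) y" x] by (simp add: eq cl)
        finally show "finsum Y (\<lambda>r. \<Phi> (rsmult U (\<tau> r (u j)) (\<alpha> r y x)) (v j)) {..<k} =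
            \<Phi> x (rsmult V (v j) (b (u j) y))" .
      qed
      also have "\<dots> = \<Phi> x (finsum V (\<lambda>j. rsmult V (v j) (b (u j) y)) {..<m})"
        using cl by (intro lhom_finsum[OF V_left Y lmod_homD[OF \<Phi>c[OF x]], symmetric]) auto
      also have "\<dots> = \<Phi> x y" using v_expand[OF y] by simp
      finally show ?thesis .
    qed
    show "\<Phi> = finsum ?FG (\<lambda>r. g r (f r \<Phi>)) {..<k}"
    proof (rule lmod_hom_eqI[OF \<Phi>])
      have "finsum ?FG (\<lambda>r. g r (f r \<Phi>)) {..<k} \<in> carrier ?FG" using gc by (intro FG.M.finsum_closed) auto
      then show fm: "finsum ?FG (\<lambda>r. g r (f r \<Phi>)) {..<k} \<in> lmod_hom R U (hom_mod S V Y)" by simp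
      fix x assume x: "x \<in> carrier U"
      show "\<Phi> x = finsum ?FG (\<lambda>r. g r (f r \<Phi>)) {..<k} x"
      proof (rule lmod_hom_eqI[OF \<Phi>c[OF x]])
        show "finsum ?FG (\<lambda>r. g r (f r \<Phi>)) {..<k} x \<in> lmod_hom S V Y" using lmod_hom_closed[OF fm x] by simp
        fix y assume y: "y \<in> carrier V"
        have "finsum ?FG (\<lambda>r. g r (f r \<Phi>)) {..<k} x y = finsum (hom_mod S V Y) (\<lambda>r. g r (f r \<Phi>) x) {..<k} y"
          using gc by (subst finsum_hom_mod_apply[OF U S.ring_axioms lG _ x]) auto
        also have "\<dots> = finsum Y (\<lambda>r. g r (f r \<Phi>) x y) {..<k}"
          using gxc[OF _ x] by (intro finsum_hom_mod_apply[OF V R.ring_axioms Y _ y]) auto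
        finally show "\<Phi> x y = finsum ?FG (\<lambda>r. g r (f r \<Phi>)) {..<k} x y" using key[OF x y] by simp
      qed
    qed
  qed
qed

end

section \<open>Projective dimension along a dual pair\<close>

lemma transport_retr:
  fixes M :: "('r, 'x, 'm) module_scheme"
  assumes "left_module R M" "carrier M \<lesssim> (UNIV :: 'w set)"
  obtains T :: "('r, 'w) module" and a b where "left_module R T" "retr R M T a b" "retr R T M b a"
proof -
  obtain f :: "'x \<Rightarrow> 'w" where f: "inj_on f (carrier M)" using assms(2) unfolding lepoll_def by blast
  obtain T :: "('r, 'w) module" and g where "left_module R T" "carrier T = f ` carrier M" "lhom R M T f" "lhom R T M g"
    "\<And>x. x \<in> carrier M \<Longrightarrow> g (f x) = x" "\<And>y. y \<in> carrier T \<Longrightarrow> f (g y) = y"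
    using lmod_transport[OF assms(1) f] by metis
  then show thesis using that[of T f g] by (simp add: retr_def)
qed

context dual_pair
begin

text \<open>It suffices to lift the finitely many values \<phi>(u_j) to elements p_j: then \<Sum>
  v_j \<otimes> p_j is mapped to \<Sum> v_j \<otimes> \<phi>(u_j) = \<phi>.\<close>

lemma hmap_surj:
  assumes lm: "left_module R P" "left_module R K" and e: "lhom R P K e" "e ` carrier P = carrier K"
    and \<phi>: "\<phi> \<in> lmod_hom R U K"
  shows "\<exists>\<psi>\<in>lmod_hom R U P. hmap U e \<psi> = \<phi>"
proof -
  interpret F: left_module S "hom_mod R U P" by (rule left_module_F[OF lm(1)])
  interpret FK: left_module S "hom_mod R U K" by (rule left_module_F[OF lm(2)])
  have "\<exists>p. p \<in> carrier P \<and> e p = \<phi> (u j)" if "j < m" for j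
    using lmod_hom_closed[OF \<phi> u_closed[OF that]] e(2) by (metis imageE)
  then obtain p where p: "\<And>j. j < m \<Longrightarrow> p j \<in> carrier P \<and> e (p j) = \<phi> (u j)" by metis
  have t: "tens P (v j) (p j) \<in> lmod_hom R U P" if "j < m" for j
    using tens_closed[OF lm(1)] p[OF that] v_closed[OF that] by blast
  have et: "hmap U e (tens P (v j) (p j)) = tens K (v j) (\<phi> (u j))" if "j < m" for j
    using p[OF that] v_closed[OF that]
    by (auto simp: hmap_def unit_def lhom_smult[OF e(1)] b_closed intro!: restrict_ext)
  have "hmap U e (finsum (hom_mod R U P) (\<lambda>j. tens P (v j) (p j)) {..<m}) =
      finsum (hom_mod R U K) (\<lambda>j. hmap U e (tens P (v j) (p j))) {..<m}"
    by (rule lhom_finsum[OF left_module_F[OF lm(1)] left_module_F[OF lm(2)] lhom_hmap[OF U e(1)]]) (use t in auto)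
  also have "\<dots> = finsum (hom_mod R U K) (\<lambda>j. tens K (v j) (\<phi> (u j))) {..<m}"
    by (rule FK.finsum_cong') (use et tens_closed[OF lm(2) lmod_hom_closed[OF \<phi> u_closed] v_closed] in auto)
  also have "\<dots> = \<phi>" by (rule tens_expand[OF lm(2) \<phi>])
  finally show ?thesis using F.finsum_closed[of "\<lambda>j. tens P (v j) (p j)" "{..<m}"] t by auto
qed

text \<open>
  The functor \<open>Hom\<^sub>R(U, -)\<close> is left adjoint to \<open>Hom\<^sub>S(V, -)\<close>, which is exact if \<open>V\<close> is projective; so it
  preserves projectives.
\<close>

lemma projective_hom_mod:
  fixes P :: "('r, 'x, 'o) module_scheme"
  assumes V: "projective S V" and P: "projective R P" "left_module R P"
  shows "projective S (hom_mod R U P)"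
proof -
  let ?FP = "hom_mod R U P" and ?GFP = "hom_mod S V (hom_mod R U P)"
  note lF = left_module_F[OF P(2)]
  interpret F: left_module S ?FP by (rule lF)
  let ?L = "free_lmod S (carrier ?FP)"
  note L = left_module_free[OF S.ring_axioms, of "carrier ?FP"]
  obtain e where e: "lhom S ?L ?FP e" and es: "e ` carrier ?L = carrier ?FP" by (rule free_cover[OF lF])
  note GL = left_module_G[OF L] and GFP = left_module_G[OF lF]
  \<comment> \<open>Projectivity of V lifts each map V \<rightarrow> F P through the free cover e,
    so the unit of P lands in the image of G e and can itself be lifted by projectivity of
    P.\<close>
  have "unit P ` carrier P \<subseteq> hmap V e ` carrier (hom_mod S V ?L)"
  proof
    fix f assume "f \<in> unit P ` carrier P"
    then have f: "f \<in> lmod_hom S V ?FP" using lhom_closed[OF lhom_unit[OF P(2)]] by auto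
    have "f ` carrier V \<subseteq> e ` carrier ?L" unfolding es using lmod_hom_closed[OF f] by blast
    then obtain g where g: "lhom S V ?L g" "\<And>x. x \<in> carrier V \<Longrightarrow> e (g x) = f x"
      using projective_lift[OF V V_left L lF e lmod_homD[OF f]] by blast
    show "f \<in> hmap V e ` carrier (hom_mod S V ?L)"
    proof (rule image_eqI)
      show r: "restrict g (carrier V) \<in> carrier (hom_mod S V ?L)" using restrict_lmod_hom[OF V_left g(1)] by simp
      show "f = hmap V e (restrict g (carrier V))"
        by (rule lmod_hom_eqI[OF f]) (use hmap_closed[OF dual_pair.V[OF dual_pair_axioms] e] r g(2) in auto)
    qed
  qed
  from projective_lift[OF P(1,2) GL GFP lhom_hmap[OF dual_pair.V[OF dual_pair_axioms] e] lhom_unit[OF P(2)] this]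
  obtain h where h: "lhom R P (hom_mod S V ?L) h" "\<And>x. x \<in> carrier P \<Longrightarrow> hmap V e (h x) = unit P x" by blast
  \<comment> \<open>The transpose of h under the adjunction. As G e after h is the unit, e after
    \<open>?s\<close> is the transpose of the unit, which is the identity by
    \<open>tens_expand\<close>.\<close>
  let ?s = "\<lambda>\<phi>. counit ?L (hmap U h \<phi>)"
  have s: "lhom S ?FP ?L ?s" by (rule lhom_comp[OF lhom_hmap[OF U h(1)] lhom_counit[OF L]])
  have "e (?s \<phi>) = \<phi>" if \<phi>: "\<phi> \<in> carrier ?FP" for \<phi>
  proof -
    have \<phi>': "\<phi> \<in> lmod_hom R U P" using \<phi> by simp
    have "e (?s \<phi>) = counit ?FP (hmap U (hmap V e) (hmap U h \<phi>))"
      by (rule counit_natural[OF L lF e hmap_closed[OF U h(1) \<phi>'], symmetric])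
    also have "hmap U (hmap V e) (hmap U h \<phi>) = hmap U (unit P) \<phi>"
      unfolding hmap_comp by (rule hmap_cong[OF h(2) \<phi>'])
    also have "counit ?FP (hmap U (unit P) \<phi>) = finsum ?FP (\<lambda>j. tens P (v j) (\<phi> (u j))) {..<m}"
      unfolding counit_def
      by (rule F.finsum_cong')
        (use tens_closed[OF P(2) lmod_hom_closed[OF \<phi>' u_closed] v_closed] in \<open>auto simp: u_closed\<close>)
    also have "\<dots> = \<phi>" by (rule tens_expand[OF P(2) \<phi>'])
    finally show ?thesis .
  qed
  then show ?thesis by (rule projective_section[OF lF s e])
qed

text \<open>The functor F = Hom_R(U, -) preserves surjections, kernels and projectives, so it
  carries a syzygy of K to one of F K. The modules F P and F K have function types and are replaced
  by copies in 'w; allowing any retract H of F K lets the induction absorb these copies.\<close>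

lemma pd_le_hom_mod:
  fixes K :: "('r, 'w) module" and H :: "('s, 'w) module"
  assumes inf: "infinite (UNIV :: 'w set)" and V: "projective S V"
  shows "\<lbrakk>pd_le R n K; left_module R K; left_module S H; retr S H (hom_mod R U K) i p\<rbrakk> \<Longrightarrow> pd_le S n H"
proof (induction n arbitrary: K H i p)
  case 0
  then show ?case using projective_retr[OF projective_hom_mod[OF V] left_module_F] by auto
next
  case (Suc n)
  obtain P :: "('r, 'w) module" and e where P: "left_module R P" "projective R P"
    "lhom R P K e" "e ` carrier P = carrier K" "pd_le R n (kermod P K e)"
    using Suc.prems(1) by auto
  note K = Suc.prems(2)
  let ?FP = "hom_mod R U P" and ?FK = "hom_mod R U K"
  note lP = left_module_F[OF P(1)] and lK = left_module_F[OF K]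
  have small: "carrier (hom_mod R U X) \<lesssim> (UNIV :: 'w set)" if "left_module R X" for X :: "('r, 'w) module"
    by (rule lepoll_hom_mod[OF that subset_imp_lepoll[OF subset_UNIV] inf])
  obtain TP :: "('s, 'w) module" and a b where TP: "left_module S TP" "retr S ?FP TP a b" "retr S TP ?FP b a"
    using transport_retr[OF lP small[OF P(1)]] .
  obtain TK :: "('s, 'w) module" and a' b' where TK: "left_module S TK" "retr S ?FK TK a' b'" "retr S TK ?FK b' a'"
    using transport_retr[OF lK small[OF K]] .
  note f = lhom_hmap[OF U P(3)]
  define g where "g = (\<lambda>x. a' (hmap U e (b x)))"
  have a: "lhom S ?FP TP a" and b: "lhom S TP ?FP b"
    and ba: "\<And>x. x \<in> carrier ?FP \<Longrightarrow> b (a x) = x" and ab: "\<And>x. x \<in> carrier TP \<Longrightarrow> a (b x) = x"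
    using TP by (auto simp: retr_def)
  have a': "lhom S ?FK TK a'" and b': "lhom S TK ?FK b'"
    and ba': "\<And>x. x \<in> carrier ?FK \<Longrightarrow> b' (a' x) = x" and ab': "\<And>x. x \<in> carrier TK \<Longrightarrow> a' (b' x) = x"
    using TK by (auto simp: retr_def)
  have g: "lhom S TP TK g" unfolding g_def by (rule lhom_comp[OF lhom_comp[OF b f] a'])
  have gs: "g ` carrier TP = carrier TK"
  proof
    show "g ` carrier TP \<subseteq> carrier TK" using lhom_closed[OF g] by auto
    show "carrier TK \<subseteq> g ` carrier TP"
    proof
      fix t assume t: "t \<in> carrier TK"
      obtain y where y: "y \<in> carrier ?FP" "hmap U e y = b' t"
        using hmap_surj[OF P(1) K P(3,4)] lhom_closed[OF b' t] by auto
      have "g (a y) = t" using t unfolding g_def ba[OF y(1)] y(2) by (rule ab')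
      then show "t \<in> g ` carrier TP" using lhom_closed[OF a y(1)] by (metis imageI)
    qed
  qed
  have kf: "hmap U e (b x) = \<zero>\<^bsub>?FK\<^esub>" if "x \<in> carrier TP" "g x = \<zero>\<^bsub>TK\<^esub>" for x
    using lhom_zero[OF TK(1) lK b'] ba'[OF lhom_closed[OF f lhom_closed[OF b that(1)]]] that(2) unfolding g_def by simp
  have fk: "g (a \<phi>) = \<zero>\<^bsub>TK\<^esub>" if "\<phi> \<in> carrier ?FP" "hmap U e \<phi> = \<zero>\<^bsub>?FK\<^esub>" for \<phi>
    using lhom_zero[OF lK TK(1) a'] that(2) unfolding g_def ba[OF that(1)] by simp
  let ?k = "kermod P K e"
  have lker: "left_module R ?k" by (rule left_module_kermod[OF P(1) K P(3)])
  have k1: "\<phi> \<in> lmod_hom R U ?k" if "\<phi> \<in> carrier ?FP" "hmap U e \<phi> = \<zero>\<^bsub>?FK\<^esub>" for \<phi>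
  proof -
    have "e (\<phi> x) = \<zero>\<^bsub>K\<^esub>" if "x \<in> carrier U" for x
      using fun_cong[OF \<open>hmap U e \<phi> = _\<close>, of x] that by simp
    moreover have l: "lhom R U P \<phi>" "\<phi> \<in> extensional (carrier U)" using that(1) by (simp_all add: lmod_hom_iff)
    ultimately have "\<phi> ` carrier U \<subseteq> {x \<in> carrier P. e x = \<zero>\<^bsub>K\<^esub>}" using lhom_closed[OF l(1)] by blast
    then show ?thesis using lhom_to_lsub[OF l(1)] l(2) by (simp add: lmod_hom_iff)
  qed
  have k2: "\<phi> \<in> carrier ?FP" "hmap U e \<phi> = \<zero>\<^bsub>?FK\<^esub>" if "\<phi> \<in> lmod_hom R U ?k" for \<phi>
    using that lmod_hom_closed[OF that] lhom_comp[OF lmod_homD[OF that] lhom_incl[OF lsub_ker[OF P(1) K P(3)]]]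
    by (auto simp: lmod_hom_iff hmap_def intro!: restrict_ext)
  have "retr S (kermod TP TK g) (hom_mod R U ?k) b a"
    unfolding retr_def
  proof (intro conjI lhomI ballI)
    fix x assume x: "x \<in> carrier (kermod TP TK g)"
    then show "a (b x) = x" by (simp add: ab)
    show "b x \<in> carrier (hom_mod R U ?k)" using x k1[OF lhom_closed[OF b] kf] by simp
    show "b (r \<odot>\<^bsub>kermod TP TK g\<^esub> x) = r \<odot>\<^bsub>hom_mod R U ?k\<^esub> b x" if "r \<in> carrier S" for r
      using x lhom_smult[OF b that] by simp
    show "b (x \<oplus>\<^bsub>kermod TP TK g\<^esub> y) = b x \<oplus>\<^bsub>hom_mod R U ?k\<^esub> b y" if "y \<in> carrier (kermod TP TK g)" for y
      using x lhom_add[OF b] that by simp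
  next
    fix \<phi> assume "\<phi> \<in> carrier (hom_mod R U ?k)"
    then have \<phi>: "\<phi> \<in> lmod_hom R U ?k" by simp
    show "a \<phi> \<in> carrier (kermod TP TK g)" using lhom_closed[OF a k2(1)[OF \<phi>]] fk[OF k2[OF \<phi>]] by simp
    show "a (r \<odot>\<^bsub>hom_mod R U ?k\<^esub> \<phi>) = r \<odot>\<^bsub>kermod TP TK g\<^esub> a \<phi>" if "r \<in> carrier S" for r
      using lhom_smult[OF a that k2(1)[OF \<phi>]] by simp
    show "a (\<phi> \<oplus>\<^bsub>hom_mod R U ?k\<^esub> \<psi>) = a \<phi> \<oplus>\<^bsub>kermod TP TK g\<^esub> a \<psi>" if "\<psi> \<in> carrier (hom_mod R U ?k)" for \<psi>
      using lhom_add[OF a k2(1)[OF \<phi>] k2(1), of \<psi>] that by simp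
  qed
  then have "pd_le S n (kermod TP TK g)"
    by (rule Suc.IH[OF P(5) lker left_module_kermod[OF TP(1) TK(1) g]])
  moreover have "projective S TP" by (rule projective_retr[OF projective_hom_mod[OF V P(2,1)] lP TP(1,3)])
  ultimately have "pd_le S (Suc n) TK" using TP(1) g gs by auto
  then show ?case by (rule pd_le_retr[OF inf TK(1) Suc.prems(3) _ retr_trans[OF Suc.prems(4) TK(2)]])
qed

end

text \<open>Every H is a retract of F G H through \<open>sect\<close> and \<open>counit\<close>, so
  its projective dimension is at most that of G H. The finite dual basis makes V projective, as F
  requires, and bounds the size of G H, so that G H has a copy in 'w.\<close>

lemma (in split_dual_pair) gldim_le:
  assumes inf: "infinite (UNIV :: 'w set)" and db: "dual_basis S V {..<n::nat} c y"
  shows "gldim TYPE('w) S \<le> gldim TYPE('w) R"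
  unfolding gldim_def[of _ S]
proof (rule Sup_least)
  fix d assume "d \<in> {projdim S H |H :: ('s, 'w) module. left_module S H}"
  then obtain H :: "('s, 'w) module" where d: "d = projdim S H" and H: "left_module S H" by blast
  let ?GH = "hom_mod S V H"
  note lGH = left_module_G[OF H]
  have yc: "y l \<in> carrier V" if "l < n" for l using db that by (simp add: dual_basis_def)
  have "lmod_hom S V H \<lesssim> (UNIV :: 'w set)"
  proof (rule lepoll_lmod_hom[OF inf subset_imp_lepoll[OF subset_UNIV] yc])
    fix \<phi> \<psi> assume p: "\<phi> \<in> lmod_hom S V H" "\<psi> \<in> lmod_hom S V H" and eq: "\<And>l. l < n \<Longrightarrow> \<phi> (y l) = \<psi> (y l)"
    show "\<phi> = \<psi>"
    proof (rule lmod_hom_eqI[OF p])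
      fix x assume x: "x \<in> carrier V"
      have s: "supp_sum S V {..<n} (\<lambda>l. c l x) y = x" and cl: "\<And>l. l < n \<Longrightarrow> lhom S V (regular_bimod S) (c l)"
        using db x by (auto simp: dual_basis_iff)
      have cc: "c l x \<in> carrier S" if "l < n" for l using lhom_closed[OF cl[OF that] x] by simp
      have h: "f x = supp_sum S H {..<n} (\<lambda>l. c l x) (\<lambda>l. f (y l))" if "f \<in> lmod_hom S V H" for f
        using lhom_of_supp_sum[OF V_left H lmod_homD[OF that], of "{..<n}" "\<lambda>l. c l x" y] cc yc s by simp
      show "\<phi> x = \<psi> x" unfolding h[OF p(1)] h[OF p(2)]
        by (rule supp_sum_cong[OF H]) (use cc yc lmod_hom_closed[OF p(2)] eq in auto)
    qed
  qed
  then obtain K :: "('r, 'w) module" and a b' where K: "left_module R K" "retr R ?GH K a b'" "retr R K ?GH b' a"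
    using transport_retr[OF lGH] by auto
  have "retr S H (hom_mod R U ?GH) (sect H) (counit H)"
    using lhom_sect[OF H] lhom_counit[OF H] counit_sect[OF H] by (simp add: retr_def)
  moreover have "retr S (hom_mod R U ?GH) (hom_mod R U K) (hmap U a) (hmap U b')"
    unfolding retr_def
  proof (intro conjI ballI lhom_hmap[OF U])
    show "lhom R ?GH K a" "lhom R K ?GH b'" using K(2) by (auto simp: retr_def)
    fix \<Phi> assume \<Phi>: "\<Phi> \<in> carrier (hom_mod R U ?GH)"
    show "hmap U b' (hmap U a \<Phi>) = \<Phi>"
      unfolding hmap_comp by (rule hmap_id[of _ R U ?GH]) (use \<Phi> K(2) in \<open>auto simp: retr_def\<close>)
  qed
  ultimately have r: "retr S H (hom_mod R U K) (\<lambda>x. hmap U a (sect H x)) (\<lambda>x. counit H (hmap U b' x))"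
    by (rule retr_trans)
  show "d \<le> gldim TYPE('w) R"
  proof (cases "gldim TYPE('w) R")
    case (enat k)
    have "projdim R K \<le> gldim TYPE('w) R" unfolding gldim_def using K(1) by (intro Sup_upper) blast
    then have "pd_le R k K" using enat projdim_le_iff[OF K(1)] by simp
    then have "pd_le S k H" by (rule pd_le_hom_mod[OF inf dual_basis_projective[OF db V_left] _ K(1) H r])
    then show ?thesis using enat projdim_le_iff[OF H] d by simp
  qed simp
qed

section \<open>Comparing endomorphism rings\<close>

lemma finsum_lhom_eq:
  assumes "left_module R Y" "left_module R Z" "lhom R Y Z h" "\<And>i. i < m \<Longrightarrow> g i \<in> carrier Y"
    and "finsum Y g {..<m::nat} = y"
  shows "finsum Z (\<lambda>i. h (g i)) {..<m} = h y"
  using lhom_finsum[OF assms(1-3), of g "{..<m}"] assms(4,5) by auto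

text \<open>An unbundled ring homomorphism from E to End_R(L). End(M) acts on M by application, but
  End(N) acts on G N only through \<open>hmap\<close>; this notion covers both.\<close>

definition acts ::
  "('e, 'a) ring_scheme \<Rightarrow> ('r, 'q) ring_scheme \<Rightarrow> ('r, 'x, 'm) module_scheme \<Rightarrow> ('e \<Rightarrow> 'x \<Rightarrow> 'x) \<Rightarrow> bool"
  where "acts E R L a \<longleftrightarrow> (\<forall>e\<in>carrier E. lhom R L L (a e)) \<and>
    (\<forall>e\<in>carrier E. \<forall>e'\<in>carrier E. \<forall>x\<in>carrier L.
      a (e \<oplus>\<^bsub>E\<^esub> e') x = a e x \<oplus>\<^bsub>L\<^esub> a e' x \<and> a (e \<otimes>\<^bsub>E\<^esub> e') x = a e (a e' x)) \<and>
    (\<forall>x\<in>carrier L. a \<one>\<^bsub>E\<^esub> x = x)"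

definition hom_bimod ::
  "('r, 'q) ring_scheme \<Rightarrow> ('r, 'x, 'm) module_scheme \<Rightarrow> ('r, 'y, 'n) module_scheme \<Rightarrow>
   ('e \<Rightarrow> 'y \<Rightarrow> 'y) \<Rightarrow> ('g \<Rightarrow> 'x \<Rightarrow> 'x) \<Rightarrow> ('e, 'x \<Rightarrow> 'y, 'g) bimodule"
  where "hom_bimod R M L a a' =
    \<lparr>carrier = lmod_hom R M L, monoid.mult = undefined, monoid.one = undefined,
     ring.zero = (\<lambda>x\<in>carrier M. \<zero>\<^bsub>L\<^esub>), add = (\<lambda>f g. \<lambda>x\<in>carrier M. f x \<oplus>\<^bsub>L\<^esub> g x),
     smult = (\<lambda>e f. \<lambda>x\<in>carrier M. a e (f x)), rsmult = (\<lambda>f g. \<lambda>x\<in>carrier M. f (a' g x))\<rparr>"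

lemma hom_bimod_simps [simp]:
  "carrier (hom_bimod R M L a a') = lmod_hom R M L"
  "f \<oplus>\<^bsub>hom_bimod R M L a a'\<^esub> g = (\<lambda>x\<in>carrier M. f x \<oplus>\<^bsub>L\<^esub> g x)"
  "e \<odot>\<^bsub>hom_bimod R M L a a'\<^esub> f = (\<lambda>x\<in>carrier M. a e (f x))"
  "rsmult (hom_bimod R M L a a') f d = (\<lambda>x\<in>carrier M. f (a' d x))"
  by (auto simp: hom_bimod_def)

context
  fixes R :: "('r, 'q) ring_scheme" and M :: "('r, 'x, 'm) module_scheme" and L :: "('r, 'y, 'n) module_scheme"
    and E :: "('e, 'a) ring_scheme" and G :: "('g, 'b) ring_scheme" and a a'
  assumes lm: "left_module R M" "left_module R L" and r: "ring E" "ring G"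
    and a: "acts E R L a" and a': "acts G R M a'"
begin

lemma is_bimodule_hom_bimod: "is_bimodule E G (hom_bimod R M L a a')"
proof -
  interpret L: left_module R L by (rule lm)
  interpret M: left_module R M by (rule lm)
  let ?H = "hom_bimod R M L a a'"
  note c = lmod_hom_closed[of _ R M L]
  have al: "lhom R L L (a e)" if "e \<in> carrier E" for e using a that by (simp add: acts_def)
  have al': "lhom R M M (a' d)" if "d \<in> carrier G" for d using a' that by (simp add: acts_def)
  note ac = lhom_closed[OF al] and ac' = lhom_closed[OF al']
  have as: "a (e \<oplus>\<^bsub>E\<^esub> e') x = a e x \<oplus>\<^bsub>L\<^esub> a e' x" "a (e \<otimes>\<^bsub>E\<^esub> e') x = a e (a e' x)" "a \<one>\<^bsub>E\<^esub> x = x"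
    if "e \<in> carrier E" "e' \<in> carrier E" "x \<in> carrier L" for e e' x using a that by (simp_all add: acts_def)
  have as': "a' (e \<oplus>\<^bsub>G\<^esub> e') x = a' e x \<oplus>\<^bsub>M\<^esub> a' e' x" "a' (e \<otimes>\<^bsub>G\<^esub> e') x = a' e (a' e' x)" "a' \<one>\<^bsub>G\<^esub> x = x"
    if "e \<in> carrier G" "e' \<in> carrier G" "x \<in> carrier M" for e e' x using a' that by (simp_all add: acts_def)
  have xe: "restrict f (carrier M) = f" if "f \<in> lmod_hom R M L" for f
    using that by (simp add: lmod_hom_iff extensional_restrict)
  have s: "(\<lambda>x\<in>carrier M. a e (f x)) \<in> lmod_hom R M L" if "e \<in> carrier E" "f \<in> lmod_hom R M L" for e f
    using that by (intro restrict_lmod_hom lm lhom_comp[OF lmod_homD al])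
  have s': "(\<lambda>x\<in>carrier M. f (a' d x)) \<in> lmod_hom R M L" if "d \<in> carrier G" "f \<in> lmod_hom R M L" for d f
    using that by (intro restrict_lmod_hom lm lhom_comp[OF al' lmod_homD])
  note [simp] = right_part_def opp_ring_def
  note oE = monoid.one_closed[OF ring.is_monoid[OF r(1)]] and oG = monoid.one_closed[OF ring.is_monoid[OF r(2)]]
  have one: "a \<one>\<^bsub>E\<^esub> x = x" if "x \<in> carrier L" for x by (rule as(3)[OF oE oE that])
  have one': "a' \<one>\<^bsub>G\<^esub> x = x" if "x \<in> carrier M" for x by (rule as'(3)[OF oG oG that])
  have ag: "abelian_group H" if "carrier H = lmod_hom R M L" "add H = (\<lambda>f g. \<lambda>x\<in>carrier M. f x \<oplus>\<^bsub>L\<^esub> g x)"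
    "\<zero>\<^bsub>H\<^esub> = (\<lambda>x\<in>carrier M. \<zero>\<^bsub>L\<^esub>)" for H :: "('l, 'x \<Rightarrow> 'y, 'o) module_scheme"
    by (rule abelian_group_lmod_hom[OF lm that])
  show ?thesis
    unfolding is_bimodule_def
  proof (intro conjI ballI)
    show "left_module E ?H"
    proof (rule left_moduleI[OF r(1)])
      show "abelian_group ?H" by (rule ag) (simp_all add: hom_bimod_def)
    qed (auto simp: s as c ac lhom_add[OF al] one xe intro!: restrict_ext cong: restrict_cong)
    show "left_module (opp_ring G) (right_part ?H)"
    proof (rule left_moduleI[OF ring_opp[OF r(2)]])
      show "abelian_group (right_part ?H)" by (rule ag) (simp_all add: hom_bimod_def)
    qed (auto simp: hom_bimod_def s' as' c ac' lhom_add[OF lmod_homD] one' xe intro!: restrict_ext cong: restrict_cong)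
  qed (auto simp: ac' intro!: restrict_ext)
qed

lemma finsum_hom_bimod_apply:
  assumes "\<And>i. i \<in> I \<Longrightarrow> f i \<in> lmod_hom R M L" "x \<in> carrier M"
  shows "finsum (hom_bimod R M L a a') f I x = finsum L (\<lambda>i. f i x) I"
proof (rule addhom_finsum[OF left_module_ag[OF bimodule_left[OF is_bimodule_hom_bimod]] left_module_ag[OF lm(2)]])
  show "addhom (hom_bimod R M L a a') L (\<lambda>f. f x)"
    using assms(2) by (intro addhomI) (auto simp: lmod_hom_closed)
qed (use assms(1) in auto)

lemma finsum_hom_bimod_eq:
  assumes f: "\<And>i. i \<in> I \<Longrightarrow> f i \<in> lmod_hom R M L" and g: "g \<in> lmod_hom R M L"
    and "\<And>x. x \<in> carrier M \<Longrightarrow> finsum L (\<lambda>i. f i x) I = g x"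
  shows "finsum (hom_bimod R M L a a') f I = g"
proof (rule lmod_hom_eqI[OF _ g])
  have "finsum (hom_bimod R M L a a') f I \<in> carrier (hom_bimod R M L a a')"
    by (rule abelian_monoid.finsum_closed[OF abelian_group.axioms(1)[OF left_module_ag[OF bimodule_left[OF is_bimodule_hom_bimod]]]])
      (use f in auto)
  then show "finsum (hom_bimod R M L a a') f I \<in> lmod_hom R M L" by simp
  show "finsum (hom_bimod R M L a a') f I x = g x" if "x \<in> carrier M" for x
    using finsum_hom_bimod_apply[of I f x, OF f that] assms(3)[OF that] by simp
qed

end

lemma acts_End: "left_module R M \<Longrightarrow> acts (End_ring R M) R M (\<lambda>g. g)"
  by (auto simp: acts_def compose_eq lmod_homD lmod_hom_closed)

lemma acts_hmap:
  assumes "is_bimodule S R V"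
  shows "acts (End_ring S N) R (hom_mod S V N) (hmap V)"
  unfolding acts_def using assms
  by (auto simp: lhom_hmap lmod_homD lmod_hom_closed hmap_def compose_eq extensional_restrict lmod_hom_iff
      intro!: restrict_ext hmap_id[unfolded hmap_def] cong: restrict_cong)

text \<open>
  With \<open>G = Hom\<^sub>S(V, -)\<close>, the bimodules \<open>Hom\<^sub>R(G N, M)\<close> and \<open>Hom\<^sub>R(M, G N)\<close> relate the endomorphism
  rings of \<open>M\<close> and \<open>N\<close> in the same way in which \<open>U\<close> and \<open>V\<close> relate \<open>R\<close> and \<open>S\<close>.
\<close>

theorem (in split_dual_pair) gldim_End_le:
  fixes M :: "('r, 'x, 'k) module_scheme" and N :: "('s, 'y, 'l) module_scheme"
  assumes inf: "infinite (UNIV :: 'w set)" and M: "left_module R M" and N: "left_module S N"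
    and FM: "in_add S N (hom_mod R U M)" and GN: "in_add R M (hom_mod S V N)"
  shows "gldim TYPE('w) (End_ring S N) \<le> gldim TYPE('w) (End_ring R M)"
proof -
  let ?E = "End_ring S N" and ?G = "End_ring R M" and ?L = "hom_mod S V N" and ?FM = "hom_mod R U M"
  let ?FL = "hom_mod R U ?L"
  note V = dual_pair.V[OF dual_pair_axioms]
  note lL = left_module_G[OF N] and lFM = left_module_F[OF M] and lFL = left_module_F[OF left_module_G[OF N]]
  note rE = ring_End_ring[OF N] and rG = ring_End_ring[OF M]
  interpret M: left_module R M by fact
  interpret N: left_module S N by fact
  interpret L: left_module R ?L by (rule lL)
  interpret FL: left_module S ?FL by (rule lFL)
  interpret FM: left_module S ?FM by (rule lFM)
  \<comment> \<open>\<open>?Y\<close> takes the part of U and \<open>?W\<close> that of V, with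
    End(M) in place of R and End(N) in place of S.\<close>
  let ?Y = "hom_bimod R ?L M (\<lambda>g. g) (hmap V)" and ?W = "hom_bimod R M ?L (hmap V) (\<lambda>g. g)"
  note aG = acts_End[OF M] and aE = acts_hmap[OF V, of N]
  note Ycx = lL M rG rE aG aE and Wcx = M lL rE rG aE aG
  note bY = is_bimodule_hom_bimod[OF Ycx] and bW = is_bimodule_hom_bimod[OF Wcx]
  note mc = lmod_hom_closed[of _ R ?L M] and wc = lmod_hom_closed[of _ R M ?L]
  \<comment> \<open>G N \<in> add(M) writes the identity of G N as a sum of maps through M. These
    maps are the dual bases of the new pair; they are restricted below because elements of the
    bimodules are extensional.\<close>
  obtain m' :: nat and \<alpha>0 \<beta>0 where \<alpha>\<beta>0: "\<forall>i<m'. lhom R ?L M (\<alpha>0 i) \<and> lhom R M ?L (\<beta>0 i)"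
    "\<forall>\<psi>\<in>carrier ?L. finsum ?L (\<lambda>i. \<beta>0 i (\<alpha>0 i \<psi>)) {..<m'} = \<psi>"
    using fac_finite[OF lL lL GN[unfolded in_add_def]] by blast
  define \<alpha> where "\<alpha> i = restrict (\<alpha>0 i) (carrier ?L)" for i
  define \<beta> where "\<beta> i = restrict (\<beta>0 i) (carrier M)" for i
  have \<alpha>: "\<alpha> i \<in> lmod_hom R ?L M" and \<beta>: "\<beta> i \<in> lmod_hom R M ?L" if "i < m'" for i
    unfolding \<alpha>_def \<beta>_def using \<alpha>\<beta>0(1) that by (simp_all add: restrict_lmod_hom lL M del: hom_mod_simps)
  have \<beta>\<alpha>l: "lhom R ?L ?L (\<lambda>z. \<beta> i (\<alpha> i z))" if "i < m'" for i by (rule lhom_comp[OF lmod_homD[OF \<alpha>[OF that]] lmod_homD[OF \<beta>[OF that]]])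
  have \<beta>\<alpha>c: "\<beta> i (\<alpha> i z) \<in> carrier ?L" if "i < m'" "z \<in> carrier ?L" for i z by (rule lhom_closed[OF \<beta>\<alpha>l[OF that(1)] that(2)])
  have \<beta>\<alpha>: "finsum ?L (\<lambda>i. \<beta> i (\<alpha> i z)) {..<m'} = z" if z: "z \<in> carrier ?L" for z
  proof -
    have "finsum ?L (\<lambda>i. \<beta>0 i (\<alpha>0 i z)) {..<m'} = finsum ?L (\<lambda>i. \<beta> i (\<alpha> i z)) {..<m'}"
    proof (rule L.finsum_cong')
      fix i assume "i \<in> {..<m'}"
      then show "\<beta>0 i (\<alpha>0 i z) = \<beta> i (\<alpha> i z)"
        using \<alpha>\<beta>0(1) z lhom_closed[of R ?L M "\<alpha>0 i" z] by (simp add: \<alpha>_def \<beta>_def)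
    qed (use \<beta>\<alpha>c z in auto)
    then show ?thesis using \<alpha>\<beta>0(2) z by simp
  qed
  obtain n :: nat and \<gamma> \<delta> where \<gamma>\<delta>: "\<forall>i<n. lhom S ?FM N (\<gamma> i) \<and> lhom S N ?FM (\<delta> i)"
    "\<forall>\<phi>\<in>carrier ?FM. finsum ?FM (\<lambda>i. \<delta> i (\<gamma> i \<phi>)) {..<n} = \<phi>"
    using fac_finite[OF lFM lFM FM[unfolded in_add_def]] by blast
  have \<gamma>: "lhom S ?FM N (\<gamma> i)" and \<delta>: "lhom S N ?FM (\<delta> i)" if "i < n" for i using \<gamma>\<delta>(1) that by auto
  let ?b = "\<lambda>f w. \<lambda>x\<in>carrier M. f (w x)"
  have b: "?b f w \<in> lmod_hom R M M" if "f \<in> lmod_hom R ?L M" "w \<in> lmod_hom R M ?L" for f w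
    by (rule restrict_lmod_hom[OF M lhom_comp[OF lmod_homD[OF that(2)] lmod_homD[OF that(1)]]])
  have dp: "dual_pair ?G ?E ?Y ?W ?b m' \<alpha> \<beta>"
  proof (intro dual_pair.intro dual_pair_axioms.intro rE rG bY bW)
    fix f assume f: "f \<in> carrier ?Y"
    then have f': "f \<in> lmod_hom R ?L M" by simp
    have c: "(?b f (\<beta> i)) \<odot>\<^bsub>?Y\<^esub> \<alpha> i \<in> lmod_hom R ?L M" if "i < m'" for i
      using left_module.smult_closed[OF bimodule_left[OF bY], of "?b f (\<beta> i)" "\<alpha> i"] b[OF f' \<beta>[OF that]] \<alpha>[OF that] by simp
    show "finsum ?Y (\<lambda>i. ?b f (\<beta> i) \<odot>\<^bsub>?Y\<^esub> \<alpha> i) {..<m'} = f"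
    proof (rule finsum_hom_bimod_eq[OF Ycx _ f'])
      fix z assume z: "z \<in> carrier ?L"
      have "finsum M (\<lambda>i. (?b f (\<beta> i) \<odot>\<^bsub>?Y\<^esub> \<alpha> i) z) {..<m'} = finsum M (\<lambda>i. f (\<beta> i (\<alpha> i z))) {..<m'}"
        by (rule M.finsum_cong') (use z mc[OF \<alpha>] mc[OF f' \<beta>\<alpha>c] in auto)
      also have "\<dots> = f z" by (rule finsum_lhom_eq[OF lL M lmod_homD[OF f'] \<beta>\<alpha>c[OF _ z] \<beta>\<alpha>[OF z]])
      finally show "finsum M (\<lambda>i. (?b f (\<beta> i) \<odot>\<^bsub>?Y\<^esub> \<alpha> i) z) {..<m'} = f z" .
    qed (use c in blast)
  next
    fix w assume w: "w \<in> carrier ?W"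
    then have w': "w \<in> lmod_hom R M ?L" by simp
    have c: "rsmult ?W (\<beta> i) (?b (\<alpha> i) w) \<in> lmod_hom R M ?L" if "i < m'" for i
      using rsmult_closed[OF bW, of "\<beta> i" "?b (\<alpha> i) w"] b[OF \<alpha>[OF that] w'] \<beta>[OF that] by simp
    show "finsum ?W (\<lambda>i. rsmult ?W (\<beta> i) (?b (\<alpha> i) w)) {..<m'} = w"
    proof (rule finsum_hom_bimod_eq[OF Wcx _ w'])
      fix x assume x: "x \<in> carrier M"
      have "finsum ?L (\<lambda>i. rsmult ?W (\<beta> i) (?b (\<alpha> i) w) x) {..<m'} = finsum ?L (\<lambda>i. \<beta> i (\<alpha> i (w x))) {..<m'}"
        by (rule L.finsum_cong') (use x \<beta>\<alpha>c[OF _ wc[OF w' x]] in auto)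
      also have "\<dots> = w x" by (rule \<beta>\<alpha>[OF wc[OF w' x]])
      finally show "finsum ?L (\<lambda>i. rsmult ?W (\<beta> i) (?b (\<alpha> i) w) x) {..<m'} = w x" .
    qed (use c in blast)
  qed (simp_all add: b \<alpha> \<beta> wc lhom_add[OF lmod_homD] hmap_closed[OF V lmod_homD] lmod_hom_closed compose_def
      del: hom_mod_simps cong: restrict_cong)
  \<comment> \<open>A relative trace from End(G N) to End(N): the composite N \<rightarrow> F G N
    \<rightarrow> F G N \<rightarrow> N of the section, F h and the counit. Naturality of section
    and counit makes it linear over End(N) on both sides, and it sends the identity to the identity.
    The pairing \<pi> of the new pair is \<kappa>(w f).\<close>
  define \<kappa> where "\<kappa> = (\<lambda>h. \<lambda>y\<in>carrier N. counit N (hmap U h (sect N y)))"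
  note \<epsilon> = lhom_counit[OF N] and \<sigma>c = sect_closed[OF N]
  have \<kappa>: "\<kappa> h \<in> lmod_hom S N N" if "lhom R ?L ?L h" for h
    unfolding \<kappa>_def by (rule restrict_lmod_hom[OF N lhom_comp[OF lhom_comp[OF lhom_sect[OF N] lhom_hmap[OF U that]] \<epsilon>]])
  have \<kappa>_cong: "\<kappa> h = \<kappa> h'" if "\<And>z. z \<in> carrier ?L \<Longrightarrow> h z = h' z" for h h'
  proof -
    have "hmap U h (sect N y) = hmap U h' (sect N y)" if "y \<in> carrier N" for y
      by (rule hmap_cong[OF _ \<sigma>c[OF that]]) (rule \<open>\<And>z. z \<in> carrier ?L \<Longrightarrow> h z = h' z\<close>)
    then show ?thesis unfolding \<kappa>_def by (simp cong: restrict_cong)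
  qed
  have \<kappa>_add: "\<kappa> h = (\<lambda>y\<in>carrier N. \<kappa> h1 y \<oplus>\<^bsub>N\<^esub> \<kappa> h2 y)"
    if "\<And>z. z \<in> carrier ?L \<Longrightarrow> h z = h1 z \<oplus>\<^bsub>?L\<^esub> h2 z" "lhom R ?L ?L h1" "lhom R ?L ?L h2" for h h1 h2
    unfolding \<kappa>_def
  proof (rule restrict_ext)
    fix y assume y: "y \<in> carrier N"
    have "hmap U h1 (sect N y) \<in> carrier ?FL" "hmap U h2 (sect N y) \<in> carrier ?FL"
      using hmap_closed[OF U _ \<sigma>c[OF y]] that(2,3) by simp_all
    then show "counit N (hmap U h (sect N y)) = (\<lambda>y\<in>carrier N. counit N (hmap U h1 (sect N y))) y \<oplus>\<^bsub>N\<^esub>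
        (\<lambda>y\<in>carrier N. counit N (hmap U h2 (sect N y))) y"
      using lhom_add[OF \<epsilon>] hmap_plus[OF U \<sigma>c[OF y] that(1)] y by (simp del: hom_mod_simps)
  qed
  have \<kappa>_l: "\<kappa> (\<lambda>z. hmap V e (h z)) = compose (carrier N) e (\<kappa> h)" if "e \<in> lmod_hom S N N" "lhom R ?L ?L h" for e h
    unfolding \<kappa>_def compose_def
    using counit_natural[OF N N lmod_homD[OF that(1)] hmap_closed[OF U that(2) \<sigma>c]]
    by (auto simp: hmap_comp intro!: restrict_ext)
  have \<kappa>_r: "\<kappa> (\<lambda>z. h (hmap V e z)) = compose (carrier N) (\<kappa> h) e" if "e \<in> lmod_hom S N N" for e h
    unfolding \<kappa>_def compose_def
    using sect_natural[OF lmod_homD[OF that]] lmod_hom_closed[OF that]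
    by (auto simp: hmap_comp[symmetric] intro!: restrict_ext)
  have wf: "lhom R ?L ?L (\<lambda>z. w (f z))" if "w \<in> lmod_hom R M ?L" "f \<in> lmod_hom R ?L M" for w f
    by (rule lhom_comp[OF lmod_homD[OF that(2)] lmod_homD[OF that(1)]])
  \<comment> \<open>By additivity the sum is the trace of \<Sum> \<beta>_j \<alpha>_j, which is the
    identity of G N.\<close>
  have one: "finsum ?E (\<lambda>j. \<kappa> (\<lambda>z. \<beta> j (\<alpha> j z))) {..<m'} = \<one>\<^bsub>?E\<^esub>"
  proof (rule lmod_hom_eqI[of _ S N N])
    have "finsum ?E (\<lambda>j. \<kappa> (\<lambda>z. \<beta> j (\<alpha> j z))) {..<m'} \<in> carrier ?E"
      by (rule abelian_monoid.finsum_closed[OF abelian_group.axioms(1)[OF ring.is_abelian_group[OF rE]]]) (use \<kappa>[OF \<beta>\<alpha>l] in auto)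
    then show "finsum ?E (\<lambda>j. \<kappa> (\<lambda>z. \<beta> j (\<alpha> j z))) {..<m'} \<in> lmod_hom S N N" by simp
    show "\<one>\<^bsub>?E\<^esub> \<in> lmod_hom S N N" using monoid.one_closed[OF ring.is_monoid[OF rE]] by simp
    fix y assume y: "y \<in> carrier N"
    let ?s = "sect N y"
    have c: "hmap U (\<lambda>z. \<beta> j (\<alpha> j z)) ?s \<in> carrier ?FL" if "j < m'" for j
      using hmap_closed[OF U \<beta>\<alpha>l[OF that] \<sigma>c[OF y]] by simp
    have "finsum ?E (\<lambda>j. \<kappa> (\<lambda>z. \<beta> j (\<alpha> j z))) {..<m'} y = finsum N (\<lambda>j. \<kappa> (\<lambda>z. \<beta> j (\<alpha> j z)) y) {..<m'}"
      by (rule finsum_End_apply[OF N _ y]) (use \<kappa>[OF \<beta>\<alpha>l] in auto)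
    also have "\<dots> = finsum N (\<lambda>j. counit N (hmap U (\<lambda>z. \<beta> j (\<alpha> j z)) ?s)) {..<m'}"
      by (rule N.finsum_cong') (use y lhom_closed[OF \<epsilon> c] in \<open>auto simp: \<kappa>_def\<close>)
    also have "\<dots> = counit N (finsum ?FL (\<lambda>j. hmap U (\<lambda>z. \<beta> j (\<alpha> j z)) ?s) {..<m'})"
      by (rule lhom_finsum[OF lFL N \<epsilon>, symmetric]) (use c in auto)
    also have "finsum ?FL (\<lambda>j. hmap U (\<lambda>z. \<beta> j (\<alpha> j z)) ?s) {..<m'} = hmap U (\<lambda>z. finsum ?L (\<lambda>j. \<beta> j (\<alpha> j z)) {..<m'}) ?s"
      by (rule hmap_finsum[OF U S.ring_axioms lL lL \<sigma>c[OF y]]) (use \<beta>\<alpha>l in simp)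
    also have "\<dots> = ?s" by (rule hmap_id[OF \<sigma>c[OF y] \<beta>\<alpha>])
    also have "counit N ?s = y" by (rule counit_sect[OF N y])
    finally show "finsum ?E (\<lambda>j. \<kappa> (\<lambda>z. \<beta> j (\<alpha> j z))) {..<m'} y = \<one>\<^bsub>?E\<^esub> y" using y by simp
  qed
  have sp: "split_dual_pair ?G ?E ?Y ?W ?b m' \<alpha> \<beta> (\<lambda>w f. \<kappa> (\<lambda>z. w (f z)))"
  proof (intro split_dual_pair.intro paired_dual_pair.intro dp paired_dual_pair_axioms.intro split_dual_pair_axioms.intro one)
    fix w f assume wf0: "w \<in> carrier ?W" "f \<in> carrier ?Y"
    then have w: "w \<in> lmod_hom R M ?L" and f: "f \<in> lmod_hom R ?L M" by simp_all
    note fz = mc[OF f]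
    show "\<kappa> (\<lambda>z. w (f z)) \<in> carrier ?E" using \<kappa>[OF wf[OF w f]] by simp
    show "\<kappa> (\<lambda>z. (w \<oplus>\<^bsub>?W\<^esub> w') (f z)) = \<kappa> (\<lambda>z. w (f z)) \<oplus>\<^bsub>?E\<^esub> \<kappa> (\<lambda>z. w' (f z))" if "w' \<in> carrier ?W" for w'
      using \<kappa>_add[of "\<lambda>z. (w \<oplus>\<^bsub>?W\<^esub> w') (f z)", OF _ wf[OF w f] wf[of w', OF _ f]] that fz by (simp del: hom_mod_simps)
    show "\<kappa> (\<lambda>z. w ((f \<oplus>\<^bsub>?Y\<^esub> f') z)) = \<kappa> (\<lambda>z. w (f z)) \<oplus>\<^bsub>?E\<^esub> \<kappa> (\<lambda>z. w (f' z))" if "f' \<in> carrier ?Y" for f'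
      using \<kappa>_add[of "\<lambda>z. w ((f \<oplus>\<^bsub>?Y\<^esub> f') z)", OF _ wf[OF w f] wf[of w f', OF w]] that fz
      by (simp add: lhom_add[OF lmod_homD[OF w]] mc del: hom_mod_simps)
    show "\<kappa> (\<lambda>z. (e \<odot>\<^bsub>?W\<^esub> w) (f z)) = e \<otimes>\<^bsub>?E\<^esub> \<kappa> (\<lambda>z. w (f z))" if "e \<in> carrier ?E" for e
      using \<kappa>_l[of e, OF _ wf[OF w f]] \<kappa>_cong[of "\<lambda>z. (e \<odot>\<^bsub>?W\<^esub> w) (f z)" "\<lambda>z. hmap V e (w (f z))"] that fz
      by (simp del: hom_mod_simps)
    show "\<kappa> (\<lambda>z. w (rsmult ?Y f e z)) = \<kappa> (\<lambda>z. w (f z)) \<otimes>\<^bsub>?E\<^esub> e" if "e \<in> carrier ?E" for e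
      using \<kappa>_r[of e "\<lambda>z. w (f z)"] \<kappa>_cong[of "\<lambda>z. w (rsmult ?Y f e z)" "\<lambda>z. w (f (hmap V e z))"] that
      by (simp del: hom_mod_simps)
    show "\<kappa> (\<lambda>z. rsmult ?W w g (f z)) = \<kappa> (\<lambda>z. w ((g \<odot>\<^bsub>?Y\<^esub> f) z))" if "g \<in> carrier ?G" for g
      by (rule \<kappa>_cong) (use fz in \<open>simp del: hom_mod_simps\<close>)
  qed
  \<comment> \<open>Hom_R(M, G N) is Hom_S(F M, N) by adjunction, and F M \<in> add(N) makes the
    latter finitely generated projective over End(N). The coordinate \<open>c l\<close> transposes w
    and precomposes with \<delta>_l; the generator \<open>y l\<close> is the transpose of
    \<gamma>_l.\<close>
  define c where "c = (\<lambda>l w. \<lambda>y\<in>carrier N. counit N (hmap U w (\<delta> l y)))"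
  define y where "y = (\<lambda>l. \<lambda>x\<in>carrier M. hmap V (\<gamma> l) (unit M x))"
  have \<delta>c: "\<delta> l z \<in> lmod_hom R U M" if "l < n" "z \<in> carrier N" for l z using lhom_closed[OF \<delta>[OF that(1)] that(2)] by simp
  have hw: "hmap U w \<phi> \<in> carrier ?FL" if "w \<in> lmod_hom R M ?L" "\<phi> \<in> lmod_hom R U M" for w \<phi>
    using hmap_closed[OF U lmod_homD[OF that(1)] that(2)] by simp
  have cc: "c l w \<in> lmod_hom S N N" if "l < n" "w \<in> lmod_hom R M ?L" for l w
    unfolding c_def
    by (rule restrict_lmod_hom[OF N lhom_comp[OF lhom_comp[OF \<delta>[OF that(1)] lhom_hmap[OF U lmod_homD[OF that(2)]]] \<epsilon>]])
  have yc: "y l \<in> lmod_hom R M ?L" if "l < n" for l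
    unfolding y_def by (rule restrict_lmod_hom[OF M lhom_comp[OF lhom_unit[OF M] lhom_hmap[OF V \<gamma>[OF that]]]])
  have db: "dual_basis ?E ?W {..<n} c y"
    unfolding dual_basis_iff
  proof (intro conjI ballI)
    fix l assume "l \<in> {..<n}"
    then have l: "l < n" by simp
    show "y l \<in> carrier ?W" using yc[OF l] by simp
    show "lhom ?E ?W (regular_bimod ?E) (c l)"
    proof (rule lhomI)
      fix w assume "w \<in> carrier ?W"
      then have w: "w \<in> lmod_hom R M ?L" by simp
      show "c l w \<in> carrier (regular_bimod ?E)" using cc[OF l w] by simp
      show "c l (w \<oplus>\<^bsub>?W\<^esub> w') = c l w \<oplus>\<^bsub>regular_bimod ?E\<^esub> c l w'" if "w' \<in> carrier ?W" for w'
      proof -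
        have w': "w' \<in> lmod_hom R M ?L" using that by simp
        have "hmap U (w \<oplus>\<^bsub>?W\<^esub> w') (\<delta> l z) = hmap U w (\<delta> l z) \<oplus>\<^bsub>?FL\<^esub> hmap U w' (\<delta> l z)" if "z \<in> carrier N" for z
          by (rule hmap_plus[OF U \<delta>c[OF l that]]) (simp del: hom_mod_simps)
        then show ?thesis
          using lhom_add[OF \<epsilon> hw[OF w \<delta>c[OF l]] hw[OF w' \<delta>c[OF l]]]
          by (auto simp: c_def simp del: hom_mod_simps hom_bimod_simps intro!: restrict_ext)
      qed
      show "c l (e \<odot>\<^bsub>?W\<^esub> w) = e \<odot>\<^bsub>regular_bimod ?E\<^esub> c l w" if "e \<in> carrier ?E" for e
      proof -
        have e: "e \<in> lmod_hom S N N" using that by simp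
        have "hmap U (e \<odot>\<^bsub>?W\<^esub> w) (\<delta> l z) = hmap U (hmap V e) (hmap U w (\<delta> l z))" if "z \<in> carrier N" for z
          unfolding hmap_comp by (rule hmap_cong[OF _ \<delta>c[OF l that]]) simp
        then show ?thesis
          using counit_natural[OF N N lmod_homD[OF e] hmap_closed[OF U lmod_homD[OF w] \<delta>c[OF l]]]
          by (auto simp: c_def compose_def simp del: hom_mod_simps hom_bimod_simps intro!: restrict_ext)
      qed
    qed
  next
    fix w assume "w \<in> carrier ?W"
    then have w: "w \<in> lmod_hom R M ?L" by simp
    show "finite {l \<in> {..<n}. c l w \<noteq> \<zero>\<^bsub>?E\<^esub>}" by simp
    have sc: "c l w \<odot>\<^bsub>?W\<^esub> y l \<in> lmod_hom R M ?L" if "l < n" for l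
      using left_module.smult_closed[OF bimodule_left[OF bW], of "c l w" "y l"] cc[OF that w] yc[OF that] by simp
    have "supp_sum ?E ?W {..<n} (\<lambda>l. c l w) y = finsum ?W (\<lambda>l. c l w \<odot>\<^bsub>?W\<^esub> y l) {..<n}"
      by (rule supp_sum_eq[OF bimodule_left[OF bW]]) (use cc[OF _ w] yc in auto)
    also have "\<dots> = w"
    proof (rule finsum_hom_bimod_eq[OF Wcx _ w])
      fix x assume x: "x \<in> carrier M"
      have u: "unit M x \<in> lmod_hom S V ?FM" by (rule unit_closed[OF M x])
      have t: "(c l w \<odot>\<^bsub>?W\<^esub> y l) x = hmap V (\<lambda>\<phi>. c l w (\<gamma> l \<phi>)) (unit M x)" for l
        using x by (simp add: y_def hmap_comp)
      have "finsum ?L (\<lambda>l. (c l w \<odot>\<^bsub>?W\<^esub> y l) x) {..<n} = hmap V (\<lambda>\<phi>. finsum N (\<lambda>l. c l w (\<gamma> l \<phi>)) {..<n}) (unit M x)"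
        unfolding t by (rule hmap_finsum[OF V R.ring_axioms lFM N u]) (use lhom_comp[OF \<gamma> lmod_homD[OF cc[OF _ w]]] in simp)
      also have "\<dots> = hmap V (\<lambda>\<phi>. counit N (hmap U w \<phi>)) (unit M x)"
      proof (rule hmap_cong[OF _ u])
        fix \<phi> assume \<phi>: "\<phi> \<in> carrier ?FM"
        have wl: "lhom S ?FM N (\<lambda>\<phi>. counit N (hmap U w \<phi>))" by (rule lhom_comp[OF lhom_hmap[OF U lmod_homD[OF w]] \<epsilon>])
        have "finsum N (\<lambda>l. c l w (\<gamma> l \<phi>)) {..<n} = finsum N (\<lambda>l. counit N (hmap U w (\<delta> l (\<gamma> l \<phi>)))) {..<n}"
        proof (rule N.finsum_cong')
          show "(\<lambda>l. counit N (hmap U w (\<delta> l (\<gamma> l \<phi>)))) \<in> {..<n} \<rightarrow> carrier N"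
            using lhom_closed[OF wl lhom_closed[OF \<delta> lhom_closed[OF \<gamma> \<phi>]]] by simp
          show "c l w (\<gamma> l \<phi>) = counit N (hmap U w (\<delta> l (\<gamma> l \<phi>)))" if "l \<in> {..<n}" for l
            using lhom_closed[OF \<gamma> \<phi>] that by (simp add: c_def)
        qed simp
        also have "\<dots> = counit N (hmap U w \<phi>)"
          by (rule finsum_lhom_eq[OF lFM N wl]) (use lhom_closed[OF \<delta> lhom_closed[OF \<gamma> \<phi>]] \<gamma>\<delta>(2) \<phi> in auto)
        finally show "finsum N (\<lambda>l. c l w (\<gamma> l \<phi>)) {..<n} = counit N (hmap U w \<phi>)" .
      qed
      also have "\<dots> = hmap V (counit N) (hmap V (hmap U w) (unit M x))" by (simp only: hmap_comp)
      also have "hmap V (hmap U w) (unit M x) = unit ?L (w x)" by (rule unit_natural[OF M lL lmod_homD[OF w] x])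
      also have "hmap V (counit N) (unit ?L (w x)) = w x" by (rule triangle[OF N]) (use wc[OF w x] in simp)
      finally show "finsum ?L (\<lambda>l. (c l w \<odot>\<^bsub>?W\<^esub> y l) x) {..<n} = w x" .
    qed (use sc in blast)
    finally show "supp_sum ?E ?W {..<n} (\<lambda>l. c l w) y = w" .
  qed
  show ?thesis by (rule split_dual_pair.gldim_le[OF sp inf db])
qed

section \<open>Duality over Artinian commutative rings\<close>

text \<open>The chain condition is imposed on submodules of M inside a set W, so that kernels and
  preimages can be handled without forming new modules.\<close>

definition artin :: "('r, 'q) ring_scheme \<Rightarrow> ('r, 'x, 'm) module_scheme \<Rightarrow> 'x set \<Rightarrow> bool"
  where "artin R M W \<longleftrightarrow> (\<forall>S :: nat \<Rightarrow> 'x set.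
    (\<forall>n. lsub R M (S n) \<and> S n \<subseteq> W \<and> S (Suc n) \<subseteq> S n) \<longrightarrow> (\<exists>n. \<forall>m\<ge>n. S m = S n))"

lemma artin_mono: "artin R M W \<Longrightarrow> W' \<subseteq> W \<Longrightarrow> artin R M W'"
  unfolding artin_def by (meson order_trans)

lemma artin_min:
  assumes a: "artin R M W" and ne: "X \<in> \<S>" and sub: "\<And>S. S \<in> \<S> \<Longrightarrow> lsub R M S \<and> S \<subseteq> W"
  shows "\<exists>S\<in>\<S>. \<forall>T\<in>\<S>. T \<subseteq> S \<longrightarrow> T = S"
proof (rule ccontr)
  assume "\<not> ?thesis"
  then have "\<forall>S. \<exists>T. S \<in> \<S> \<longrightarrow> T \<in> \<S> \<and> T \<subset> S" by blast
  then obtain t where t: "\<And>S. S \<in> \<S> \<Longrightarrow> t S \<in> \<S> \<and> t S \<subset> S" by metis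
  define f where "f = rec_nat X (\<lambda>_. t)"
  have f: "f n \<in> \<S>" for n by (induction n) (auto simp: f_def ne t)
  have d: "f (Suc n) \<subset> f n" for n using t[OF f[of n]] by (simp add: f_def)
  then have "\<forall>n. lsub R M (f n) \<and> f n \<subseteq> W \<and> f (Suc n) \<subseteq> f n" using sub[OF f] by blast
  then have "\<exists>n. \<forall>m\<ge>n. f m = f n" using a unfolding artin_def by blast
  then obtain n where n: "\<forall>m\<ge>n. f m = f n" by blast
  have "f (Suc n) = f n" using n[rule_format, of "Suc n"] by simp
  then show False using d[of n] by simp
qed

text \<open>The Artinian property is closed under extensions: a descending chain becomes stationary
  once its parts in the kernel of f and its images under f have done so.\<close>

lemma artin_step:
  assumes lm: "left_module R M" "left_module R N" and f: "lhom R M N f"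
    and K: "artin R M {x \<in> W. f x = \<zero>\<^bsub>N\<^esub>}" and V: "artin R N V" "f ` W \<subseteq> V"
  shows "artin R M W"
  unfolding artin_def
proof (intro allI impI)
  fix S :: "nat \<Rightarrow> 'c set" assume S: "\<forall>n. lsub R M (S n) \<and> S n \<subseteq> W \<and> S (Suc n) \<subseteq> S n"
  interpret M: left_module R M by fact
  interpret N: left_module R N by fact
  have anti: "S m \<subseteq> S n" if "n \<le> m" for n m using lift_Suc_antimono_le[of S n m] S that by blast
  have Sl: "lsub R M (S n)" for n using S by blast
  have k: "lsub R M {x \<in> S n. f x = \<zero>\<^bsub>N\<^esub>}" for n
    using lsub_vimage[OF lm f Sl lsub_null[OF lm(2)]] by simp
  have "\<exists>n. \<forall>m\<ge>n. {x \<in> S m. f x = \<zero>\<^bsub>N\<^esub>} = {x \<in> S n. f x = \<zero>\<^bsub>N\<^esub>}"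
    by (rule K[unfolded artin_def, rule_format, of "\<lambda>n. {x \<in> S n. f x = \<zero>\<^bsub>N\<^esub>}"]) (use k S in auto)
  then obtain n1 where n1: "\<And>m. m \<ge> n1 \<Longrightarrow> {x \<in> S m. f x = \<zero>\<^bsub>N\<^esub>} = {x \<in> S n1. f x = \<zero>\<^bsub>N\<^esub>}" by blast
  have "\<exists>n. \<forall>m\<ge>n. f ` S m = f ` S n"
    by (rule V(1)[unfolded artin_def, rule_format, of "\<lambda>n. f ` S n"])
      (use S V(2) lsub_image[OF lm f Sl] in blast)
  then obtain n2 where n2: "\<And>m. m \<ge> n2 \<Longrightarrow> f ` S m = f ` S n2" by blast
  show "\<exists>n. \<forall>m\<ge>n. S m = S n"
  proof (intro exI allI impI)
    fix m assume m: "max n1 n2 \<le> m"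
    show "S m = S (max n1 n2)"
    proof
      show "S m \<subseteq> S (max n1 n2)" by (rule anti[OF m])
      show "S (max n1 n2) \<subseteq> S m"
      proof
        fix x assume x: "x \<in> S (max n1 n2)"
        have "f ` S (max n1 n2) = f ` S m" using n2[of m] n2[of "max n1 n2"] m by simp
        then obtain y where y: "y \<in> S m" "f y = f x" using x by (metis imageE imageI)
        have xM: "x \<in> carrier M" and yM: "y \<in> carrier M" using x y lsub_subset[OF Sl] by auto
        have "x \<ominus>\<^bsub>M\<^esub> y \<in> S (max n1 n2)" using lsub_minus[OF lm(1) Sl x] y anti[OF m] by blast
        moreover have "f (x \<ominus>\<^bsub>M\<^esub> y) = \<zero>\<^bsub>N\<^esub>"
          using y xM yM lhom_closed[OF f xM] by (simp add: lhom_minus[OF lm f], simp add: a_minus_def N.r_neg)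
        ultimately have "x \<ominus>\<^bsub>M\<^esub> y \<in> {x \<in> S m. f x = \<zero>\<^bsub>N\<^esub>}"
          using n1[of m] n1[of "max n1 n2"] m by auto
        then have "(x \<ominus>\<^bsub>M\<^esub> y) \<oplus>\<^bsub>M\<^esub> y \<in> S m" using lsub_add[OF Sl _ y(1)] by blast
        then show "x \<in> S m" using xM yM by (simp add: a_minus_def M.M.a_assoc M.M.l_neg)
      qed
    qed
  qed
qed

lemma lsub_cyclic:
  assumes "left_module R M" "x \<in> carrier M"
  shows "lsub R M ((\<lambda>c. c \<odot>\<^bsub>M\<^esub> x) ` carrier R)"
proof -
  interpret M: left_module R M by fact
  have "lhom R (regular_bimod R) M (\<lambda>c. c \<odot>\<^bsub>M\<^esub> x)"
    using assms(2) by (intro lhomI) (auto simp: M.smult_closed M.smult_l_distr M.smult_assoc)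
  from lsub_image[OF left_module_regular[OF M.R.ring_axioms] assms(1) this lsub_carrier[OF left_module_regular[OF M.R.ring_axioms]]]
  show ?thesis by simp
qed

lemma cyclic_mem: "left_module R M \<Longrightarrow> x \<in> carrier M \<Longrightarrow> x \<in> (\<lambda>c. c \<odot>\<^bsub>M\<^esub> x) ` carrier R"
proof -
  assume "left_module R M" and x: "x \<in> carrier M"
  then interpret M: left_module R M by simp
  show ?thesis using x M.smult_one M.R.one_closed by (metis imageI)
qed

lemma lsub_sum:
  assumes lm: "left_module R M" and S: "lsub R M S" and T: "lsub R M T"
  shows "lsub R M {s \<oplus>\<^bsub>M\<^esub> t | s t. s \<in> S \<and> t \<in> T}"
proof -
  interpret M: left_module R M by fact
  note sc = lsub_subset[OF S] and tc = lsub_subset[OF T]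
  show ?thesis
  proof (rule lsubI)
    show "{s \<oplus>\<^bsub>M\<^esub> t | s t. s \<in> S \<and> t \<in> T} \<subseteq> carrier M" using sc tc by auto
    have "\<zero>\<^bsub>M\<^esub> = \<zero>\<^bsub>M\<^esub> \<oplus>\<^bsub>M\<^esub> \<zero>\<^bsub>M\<^esub>" by simp
    then show "\<zero>\<^bsub>M\<^esub> \<in> {s \<oplus>\<^bsub>M\<^esub> t | s t. s \<in> S \<and> t \<in> T}" using lsub_zero[OF S] lsub_zero[OF T] by blast
    fix x assume "x \<in> {s \<oplus>\<^bsub>M\<^esub> t | s t. s \<in> S \<and> t \<in> T}"
    then obtain s t where x: "x = s \<oplus>\<^bsub>M\<^esub> t" "s \<in> S" "t \<in> T" by blast
    have "r \<odot>\<^bsub>M\<^esub> x = r \<odot>\<^bsub>M\<^esub> s \<oplus>\<^bsub>M\<^esub> r \<odot>\<^bsub>M\<^esub> t" if "r \<in> carrier R" for r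
      using x sc tc that by (simp add: M.smult_r_distr)
    then show "r \<odot>\<^bsub>M\<^esub> x \<in> {s \<oplus>\<^bsub>M\<^esub> t | s t. s \<in> S \<and> t \<in> T}" if "r \<in> carrier R" for r
      using lsub_smult[OF S that x(2)] lsub_smult[OF T that x(3)] that by blast
    fix y assume "y \<in> {s \<oplus>\<^bsub>M\<^esub> t | s t. s \<in> S \<and> t \<in> T}"
    then obtain s' t' where y: "y = s' \<oplus>\<^bsub>M\<^esub> t'" "s' \<in> S" "t' \<in> T" by blast
    have "x \<oplus>\<^bsub>M\<^esub> y = (s \<oplus>\<^bsub>M\<^esub> s') \<oplus>\<^bsub>M\<^esub> (t \<oplus>\<^bsub>M\<^esub> t')" using x y sc tc by (simp add: M.M.a_ac)
    then show "x \<oplus>\<^bsub>M\<^esub> y \<in> {s \<oplus>\<^bsub>M\<^esub> t | s t. s \<in> S \<and> t \<in> T}"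
      using lsub_add[OF S x(2) y(2)] lsub_add[OF T x(3) y(3)] by blast
  qed
qed

lemma lsub_sum_incl:
  assumes "left_module R M" "lsub R M S" "lsub R M T"
  shows "S \<subseteq> {s \<oplus>\<^bsub>M\<^esub> t | s t. s \<in> S \<and> t \<in> T}" "T \<subseteq> {s \<oplus>\<^bsub>M\<^esub> t | s t. s \<in> S \<and> t \<in> T}"
proof -
  interpret M: left_module R M by fact
  have "s = s \<oplus>\<^bsub>M\<^esub> \<zero>\<^bsub>M\<^esub>" if "s \<in> S" for s using lsub_subset[OF assms(2) that] by simp
  then show "S \<subseteq> {s \<oplus>\<^bsub>M\<^esub> t | s t. s \<in> S \<and> t \<in> T}" using lsub_zero[OF assms(3)] by blast
  have "t = \<zero>\<^bsub>M\<^esub> \<oplus>\<^bsub>M\<^esub> t" if "t \<in> T" for t using lsub_subset[OF assms(3) that] by simp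
  then show "T \<subseteq> {s \<oplus>\<^bsub>M\<^esub> t | s t. s \<in> S \<and> t \<in> T}" using lsub_zero[OF assms(2)] by blast
qed

lemma lsub_Union_chain:
  assumes "C \<noteq> {}" and C: "\<And>S. S \<in> C \<Longrightarrow> lsub R M S"
    and tot: "\<And>S T. S \<in> C \<Longrightarrow> T \<in> C \<Longrightarrow> S \<subseteq> T \<or> T \<subseteq> S"
  shows "lsub R M (\<Union>C)"
proof (rule lsubI)
  show "\<Union>C \<subseteq> carrier M" using lsub_subset[OF C] by blast
  obtain S0 where "S0 \<in> C" using assms(1) by blast
  then show "\<zero>\<^bsub>M\<^esub> \<in> \<Union>C" using lsub_zero[OF C] by blast
  show "r \<odot>\<^bsub>M\<^esub> y \<in> \<Union>C" if r: "r \<in> carrier R" and y: "y \<in> \<Union>C" for r y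
  proof -
    obtain Y where Y: "Y \<in> C" "y \<in> Y" using y by blast
    show ?thesis using lsub_smult[OF C[OF Y(1)] r Y(2)] Y(1) by blast
  qed
  show "y \<oplus>\<^bsub>M\<^esub> z \<in> \<Union>C" if y: "y \<in> \<Union>C" and z: "z \<in> \<Union>C" for y z
  proof -
    obtain Y where Y: "Y \<in> C" "y \<in> Y" using y by blast
    obtain Z where Z: "Z \<in> C" "z \<in> Z" using z by blast
    obtain W where W: "W \<in> C" "y \<in> W" "z \<in> W" using tot[OF Y(1) Z(1)] Y Z by blast
    show ?thesis using lsub_add[OF C[OF W(1)] W(2,3)] W(1) by blast
  qed
qed

lemma a_inv_regular: "x \<in> carrier R \<Longrightarrow> \<ominus>\<^bsub>regular_bimod R\<^esub> x = \<ominus>\<^bsub>R\<^esub> x"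
  by (simp add: a_inv_def m_inv_def)

lemma lsub_ideal:
  assumes "cring k" "lsub k (regular_bimod k) I"
  shows "ideal I k"
proof (rule idealI)
  interpret cring k by fact
  note I = assms(2)
  have Ic: "x \<in> carrier k" if "x \<in> I" for x using lsub_subset[OF I that] by simp
  show "ring k" by unfold_locales
  show "subgroup I (add_monoid k)"
  proof (rule subgroup.intro)
    show "inv\<^bsub>add_monoid k\<^esub> x \<in> I" if "x \<in> I" for x
      using lsub_neg[OF left_module_regular[OF ring_axioms] I that] a_inv_regular[OF Ic[OF that]]
      by (simp add: a_inv_def)
  qed (use Ic lsub_zero[OF I] lsub_add[OF I] in auto)
  show l: "x \<otimes>\<^bsub>k\<^esub> a \<in> I" if "a \<in> I" "x \<in> carrier k" for a x using lsub_smult[OF I, of x a] that by simp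
  show "a \<otimes>\<^bsub>k\<^esub> x \<in> I" if "a \<in> I" "x \<in> carrier k" for a x using l that Ic m_comm by metis
qed

section \<open>Ideals of a commutative Artinian ring\<close>

locale comm_artinian = cring k for k :: "('k, 'q) ring_scheme" (structure) +
  assumes dcc: "artin k (regular_bimod k) (carrier k)"
begin

abbreviation idl :: "'k set \<Rightarrow> bool" where "idl I \<equiv> lsub k (regular_bimod k) I"

lemma reg: "left_module k (regular_bimod k)"
  by (rule left_module_regular) unfold_locales

lemma idl_sub: "idl I \<Longrightarrow> c \<in> I \<Longrightarrow> c \<in> carrier k"
  using lsub_subset by fastforce

lemma idl_carrier: "idl I \<Longrightarrow> I \<subseteq> carrier k"
  using idl_sub by blast

lemma idl_min:
  assumes "X \<in> \<S>" "\<And>I. I \<in> \<S> \<Longrightarrow> idl I"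
  obtains I where "I \<in> \<S>" "\<And>I'. I' \<in> \<S> \<Longrightarrow> I' \<subseteq> I \<Longrightarrow> I' = I"
  using artin_min[OF dcc assms(1)] assms(2) idl_carrier by metis

lemma idl_ideal: "idl I \<Longrightarrow> ideal I k"
  by (rule lsub_ideal) unfold_locales

lemma ideal_idl: "ideal I k \<Longrightarrow> idl I"
proof -
  assume "ideal I k"
  then interpret I: ideal I k .
  show ?thesis by (rule lsubI) (auto simp: I.I_l_closed)
qed

lemma idl_add: "idl I \<Longrightarrow> c \<in> I \<Longrightarrow> d \<in> I \<Longrightarrow> c \<oplus> d \<in> I"
  using lsub_add by fastforce

lemma idl_mult: "idl I \<Longrightarrow> c \<in> carrier k \<Longrightarrow> d \<in> I \<Longrightarrow> c \<otimes> d \<in> I"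
  using lsub_smult by fastforce

lemma idl_principal: "x \<in> carrier k \<Longrightarrow> idl ((\<lambda>c. c \<otimes> x) ` carrier k)"
  using lsub_cyclic[OF reg] by simp

lemma idl_one: "idl I \<Longrightarrow> \<one> \<in> I \<Longrightarrow> I = carrier k"
proof
  assume I: "idl I" "\<one> \<in> I"
  show "I \<subseteq> carrier k" by (rule idl_carrier[OF I(1)])
  show "carrier k \<subseteq> I"
  proof
    fix c assume "c \<in> carrier k"
    then show "c \<in> I" using idl_mult[OF I(1) _ I(2)] by fastforce
  qed
qed

end

lemma comm_artinianI: "artinian_cring k \<Longrightarrow> comm_artinian k"
proof -
  assume a: "artinian_cring k"
  then interpret cring k by (simp add: artinian_cring_def)
  have reg: "left_module k (regular_bimod k)" by (rule left_module_regular) unfold_locales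
  show ?thesis
  proof unfold_locales
    show "artin k (regular_bimod k) (carrier k)"
      unfolding artin_def
    proof (intro allI impI)
      fix S :: "nat \<Rightarrow> 'a set"
      assume S: "\<forall>n. lsub k (regular_bimod k) (S n) \<and> S n \<subseteq> carrier k \<and> S (Suc n) \<subseteq> S n"
      have "ideal (S n) k" for n
        by (rule lsub_ideal) (use S is_cring in auto)
      then show "\<exists>n. \<forall>m\<ge>n. S m = S n" using a S unfolding artinian_cring_def by blast
    qed
  qed
qed

text \<open>Injectivity of J is known only against test modules in 'u. The bound on k puts a copy of
  the regular module and of its ideals among them, which is what Baer's criterion consumes.\<close>

locale duality = comm_artinian k for k :: "('k, 'q) ring_scheme" (structure) +
  fixes J :: "('k, 'j, 'n) module_scheme" and U :: "'u itself"
  assumes J: "duality_module U k J" and k_small: "carrier k \<lesssim> (UNIV :: 'u set)"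
begin

lemma J_left: "left_module k J" and J_inj: "injective U k J"
  using J by (auto simp: duality_module_def injective_envelope_def)

sublocale J: left_module k J by (rule J_left)

lemma rad_idl: "idl (jacobson_rad k)"
proof (rule lsubI)
  have id: "idl I" if "maximalideal I k" for I
    using ideal_idl[OF maximalideal.axioms(1)[OF that]] .
  show "jacobson_rad k \<subseteq> carrier (regular_bimod k)" by (auto simp: jacobson_rad_def)
  show "\<zero>\<^bsub>regular_bimod k\<^esub> \<in> jacobson_rad k" using lsub_zero[OF id] by (auto simp: jacobson_rad_def)
  show "x \<oplus>\<^bsub>regular_bimod k\<^esub> y \<in> jacobson_rad k" if "x \<in> jacobson_rad k" "y \<in> jacobson_rad k" for x y
    using that idl_add[OF id] by (auto simp: jacobson_rad_def)
  show "r \<odot>\<^bsub>regular_bimod k\<^esub> x \<in> jacobson_rad k" if "r \<in> carrier k" "x \<in> jacobson_rad k" for r x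
    using that idl_mult[OF id] by (auto simp: jacobson_rad_def)
qed

text \<open>\<open>w\<close> is the image of the coset of 1 in k/rad k. Its annihilator is the
  radical because the embedding into J is injective, and every nonzero submodule meets k w because
  the envelope is essential.\<close>

lemma socle_generator:
  obtains w where "w \<in> carrier J" "\<And>c. c \<in> carrier k \<Longrightarrow> c \<odot>\<^bsub>J\<^esub> w = \<zero>\<^bsub>J\<^esub> \<longleftrightarrow> c \<in> jacobson_rad k"
    "\<And>N. lsub k J N \<Longrightarrow> N \<noteq> {\<zero>\<^bsub>J\<^esub>} \<Longrightarrow> \<exists>c\<in>carrier k. c \<odot>\<^bsub>J\<^esub> w \<in> N \<and> c \<odot>\<^bsub>J\<^esub> w \<noteq> \<zero>\<^bsub>J\<^esub>"
proof -
  let ?r = "jacobson_rad k"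
  let ?Q = "quot_lmod k ?r"
  interpret r: ideal ?r k by (rule idl_ideal[OF rad_idl])
  interpret Q: ring "k Quot ?r" by (rule r.quotient_is_ring)
  obtain j where j: "j \<in> lmod_hom k ?Q J" "inj_on j (carrier ?Q)"
    "\<And>N. submodule N k J \<Longrightarrow> N \<noteq> {\<zero>\<^bsub>J\<^esub>} \<Longrightarrow> N \<inter> j ` carrier ?Q \<noteq> {\<zero>\<^bsub>J\<^esub>}"
    using J unfolding duality_module_def injective_envelope_def by blast
  have jl: "lhom k ?Q J j" by (rule lmod_homD[OF j(1)])
  have Qc: "carrier ?Q = (\<lambda>c. ?r +> c) ` carrier k"
    by (auto simp: quot_lmod_def FactRing_def A_RCOSETS_def')
  have Qz: "?r \<in> carrier ?Q" using Q.zero_closed by (simp add: quot_lmod_def FactRing_def)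
  have Qa: "?r \<oplus>\<^bsub>?Q\<^esub> ?r = ?r" using Q.r_zero[OF Q.zero_closed] by (simp add: quot_lmod_def FactRing_def)
  have j0: "j ?r = \<zero>\<^bsub>J\<^esub>"
    using lhom_add[OF jl Qz Qz] lhom_closed[OF jl Qz] unfolding Qa by (metis J.M.add.l_cancel_one)
  have Qs: "c \<odot>\<^bsub>?Q\<^esub> (?r +> d) = ?r +> (c \<otimes> d)" if "c \<in> carrier k" "d \<in> carrier k" for c d
    using that by (simp add: quot_lmod_def FactRing_def r.rcoset_mult_add)
  define w where "w = j (?r +> \<one>)"
  have oneQ: "?r +> \<one> \<in> carrier ?Q" using Qc by blast
  have cw: "c \<odot>\<^bsub>J\<^esub> w = j (?r +> c)" if "c \<in> carrier k" for c
    using lhom_smult[OF jl that oneQ] Qs[OF that one_closed] that by (simp add: w_def)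
  show thesis
  proof (rule that[of w])
    show "w \<in> carrier J" unfolding w_def by (rule lhom_closed[OF jl oneQ])
    fix c assume c: "c \<in> carrier k"
    have "?r +> c \<in> carrier ?Q" using Qc c by blast
    then have "j (?r +> c) = \<zero>\<^bsub>J\<^esub> \<longleftrightarrow> ?r +> c = ?r" using j0 inj_onD[OF j(2)] Qz by metis
    also have "\<dots> \<longleftrightarrow> c \<in> ?r" using c a_coset_join1 a_coset_join2 r.a_subgroup by metis
    finally show "c \<odot>\<^bsub>J\<^esub> w = \<zero>\<^bsub>J\<^esub> \<longleftrightarrow> c \<in> ?r" using cw[OF c] by simp
  next
    fix N assume N: "lsub k J N" "N \<noteq> {\<zero>\<^bsub>J\<^esub>}"
    have "submodule N k J"
    proof (intro submodule.intro subgroup.intro submodule_axioms.intro)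
      show "inv\<^bsub>add_monoid J\<^esub> x \<in> N" if "x \<in> N" for x
        using lsub_neg[OF J_left N(1) that] by (simp add: a_inv_def)
    qed (use N(1) lsub_subset[OF N(1)] lsub_zero[OF N(1)] lsub_add[OF N(1)] lsub_smult[OF N(1)] in auto)
    then have "N \<inter> j ` carrier ?Q \<noteq> {\<zero>\<^bsub>J\<^esub>}" using j(3) N(2) by blast
    moreover have "\<zero>\<^bsub>J\<^esub> \<in> N \<inter> j ` carrier ?Q" using lsub_zero[OF N(1)] j0 Qz by (metis IntI imageI)
    ultimately obtain y where y: "y \<in> N" "y \<in> j ` carrier ?Q" "y \<noteq> \<zero>\<^bsub>J\<^esub>" by blast
    then obtain c where c: "c \<in> carrier k" "y = j (?r +> c)" unfolding Qc by blast
    then show "\<exists>c\<in>carrier k. c \<odot>\<^bsub>J\<^esub> w \<in> N \<and> c \<odot>\<^bsub>J\<^esub> w \<noteq> \<zero>\<^bsub>J\<^esub>"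
      using y cw[OF c(1)] by (intro bexI[of _ c]) auto
  qed
qed

text \<open>The chain is pulled back to a chain of ideals along c \<mapsto> c x and recovered from
  it by taking images.\<close>

lemma artin_cyclic:
  assumes M: "left_module k M" "x \<in> carrier M"
  shows "artin k M ((\<lambda>c. c \<odot>\<^bsub>M\<^esub> x) ` carrier k)"
  unfolding artin_def
proof (intro allI impI)
  interpret M: left_module k M by fact
  fix S assume S: "\<forall>n. lsub k M (S n) \<and> S n \<subseteq> (\<lambda>c. c \<odot>\<^bsub>M\<^esub> x) ` carrier k \<and> S (Suc n) \<subseteq> S n"
  let ?T = "\<lambda>n. {c \<in> carrier k. c \<odot>\<^bsub>M\<^esub> x \<in> S n}"
  have l: "lhom k (regular_bimod k) M (\<lambda>c. c \<odot>\<^bsub>M\<^esub> x)"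
    using M(2) by (intro lhomI) (auto simp: M.smult_closed M.smult_l_distr M.smult_assoc)
  have "idl (?T n)" for n
    using lsub_vimage[OF reg M(1) l lsub_carrier[OF reg]] S by simp
  then have "\<forall>n. idl (?T n) \<and> ?T n \<subseteq> carrier k \<and> ?T (Suc n) \<subseteq> ?T n" using S by blast
  then have "\<exists>n. \<forall>m\<ge>n. ?T m = ?T n" using dcc[unfolded artin_def, rule_format, of ?T] by blast
  then obtain n where n: "\<And>m. m \<ge> n \<Longrightarrow> ?T m = ?T n" by blast
  have eq: "S m = (\<lambda>c. c \<odot>\<^bsub>M\<^esub> x) ` ?T m" for m using S by blast
  show "\<exists>n. \<forall>m\<ge>n. S m = S n"
  proof (intro exI allI impI)
    fix m assume "n \<le> m"
    then have "?T m = ?T n" by (rule n)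
    then show "S m = S n" using eq[of m] eq[of n] by simp
  qed
qed

text \<open>Baer's criterion, with Zorn's lemma applied to the graphs of partial extensions.\<close>

lemma baer_step:
  assumes "idl I" and g: "lhom k (regular_bimod k\<lparr>carrier := I\<rparr>) J g"
  shows "\<exists>z\<in>carrier J. \<forall>c\<in>I. g c = c \<odot>\<^bsub>J\<^esub> z"
proof -
  \<comment> \<open>The extension problem from I to k is posed on a copy \<open>T\<close> of the
    regular module in 'u. The scalar action of I on the image of 1 then gives z.\<close>
  obtain f where f: "inj_on (f :: 'k \<Rightarrow> 'u) (carrier (regular_bimod k))" using k_small unfolding lepoll_def by auto
  obtain T :: "('k, 'u) module" and h where T: "left_module k T" "carrier T = f ` carrier (regular_bimod k)"
    "lhom k (regular_bimod k) T f" "lhom k T (regular_bimod k) h"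
    "\<And>x. x \<in> carrier (regular_bimod k) \<Longrightarrow> h (f x) = x" "\<And>y. y \<in> carrier T \<Longrightarrow> f (h y) = y"
    using lmod_transport[OF reg f] by metis
  have fI: "lsub k T (f ` I)" by (rule lsub_image[OF reg T(1,3) assms(1)])
  let ?X = "T\<lparr>carrier := f ` I\<rparr>"
  have lX: "left_module k ?X" by (rule left_module_lsub[OF T(1) fI])
  have Ik: "c \<in> carrier k" if "c \<in> I" for c using idl_sub[OF assms(1) that] .
  have gh: "lhom k ?X J (\<lambda>x. g (h x))"
  proof (rule lhom_comp[OF _ g], rule lhomI)
    fix x assume "x \<in> carrier ?X"
    then obtain c where c: "c \<in> I" "x = f c" by auto
    show "h x \<in> carrier (regular_bimod k\<lparr>carrier := I\<rparr>)" using c Ik T(5) by simp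
    have xT: "x \<in> carrier T" using c Ik T(2) by auto
    show "h (r \<odot>\<^bsub>?X\<^esub> x) = r \<odot>\<^bsub>regular_bimod k\<lparr>carrier := I\<rparr>\<^esub> h x" if "r \<in> carrier k" for r
      using lhom_smult[OF T(4) that xT] by simp
    fix y assume "y \<in> carrier ?X"
    then have "y \<in> carrier T" using Ik T(2) by auto
    then show "h (x \<oplus>\<^bsub>?X\<^esub> y) = h x \<oplus>\<^bsub>regular_bimod k\<lparr>carrier := I\<rparr>\<^esub> h y"
      using lhom_add[OF T(4) xT] by simp
  qed
  let ?i = "\<lambda>x\<in>carrier ?X. x"
  have i: "?i \<in> lmod_hom k ?X T" by (rule restrict_lmod_hom[OF lX lhom_incl[OF fI]])
  have "inj_on ?i (carrier ?X)" by (auto simp: inj_on_def)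
  then obtain e where e: "e \<in> lmod_hom k T J" "\<And>x. x \<in> carrier ?X \<Longrightarrow> e (?i x) = (\<lambda>x\<in>carrier ?X. g (h x)) x"
    using J_inj[unfolded injective_def, rule_format, OF lX T(1) i _ restrict_lmod_hom[OF lX gh]] by blast
  have one: "f \<one> \<in> carrier T" using T(2) by auto
  show ?thesis
  proof (intro bexI ballI)
    show "e (f \<one>) \<in> carrier J" by (rule lmod_hom_closed[OF e(1) one])
    fix c assume c: "c \<in> I"
    have "g c = e (f c)" using e(2)[of "f c"] c T(5) Ik by simp
    also have "f c = c \<odot>\<^bsub>T\<^esub> f \<one>" using lhom_smult[OF T(3), of c \<one>] Ik[OF c] by simp
    also have "e \<dots> = c \<odot>\<^bsub>J\<^esub> e (f \<one>)" by (rule lhom_smult[OF lmod_homD[OF e(1)] Ik[OF c] one])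
    finally show "g c = c \<odot>\<^bsub>J\<^esub> e (f \<one>)" .
  qed
qed

text \<open>Carries injectivity of J from test modules in 'u to modules of any type. A partial
  extension is a submodule of Y \<oplus> J; being single-valued means that it contains (0, z) only
  for z = 0.\<close>

lemma lhom_extend:
  fixes Y :: "('k, 'y, 'o) module_scheme"
  assumes Y: "left_module k Y" and S: "lsub k Y S" and g: "lhom k (Y\<lparr>carrier := S\<rparr>) J g"
  shows "\<exists>h. lhom k Y J h \<and> (\<forall>s\<in>S. h s = g s)"
proof -
  interpret Y: left_module k Y by fact
  let ?YJ = "lmod_sum Y J"
  note YJ = left_module_lmod_sum[OF Y J_left]
  interpret YJ: left_module k ?YJ by (rule YJ)
  have S': "left_module k (Y\<lparr>carrier := S\<rparr>)" by (rule left_module_lsub[OF Y S])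
  let ?G0 = "(\<lambda>s. (s, g s)) ` S"
  let ?Z = "{G. lsub k ?YJ G \<and> ?G0 \<subseteq> G \<and> (\<forall>z. (\<zero>\<^bsub>Y\<^esub>, z) \<in> G \<longrightarrow> z = \<zero>\<^bsub>J\<^esub>)}"
  have sc: "s \<in> carrier Y" if "s \<in> S" for s using lsub_subset[OF S that] .
  have "lhom k (Y\<lparr>carrier := S\<rparr>) ?YJ (\<lambda>s. (s, g s))"
    using lhom_closed[OF g] lhom_add[OF g] lhom_smult[OF g] sc by (intro lhomI) (auto simp: lmod_sum_def)
  from lsub_image[OF S' YJ this lsub_carrier[OF S']]
  have G0: "lsub k ?YJ ?G0" by simp
  have g0: "g \<zero>\<^bsub>Y\<^esub> = \<zero>\<^bsub>J\<^esub>" using lhom_zero[OF S' J_left g] by simp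
  have "?G0 \<in> ?Z" using G0 g0 by auto
  have "\<exists>G\<in>?Z. \<forall>K\<in>?Z. G \<subseteq> K \<longrightarrow> K = G"
  proof (rule subset_Zorn_nonempty)
    show "?Z \<noteq> {}" using \<open>?G0 \<in> ?Z\<close> by blast
    fix C assume C: "C \<noteq> {}" "subset.chain ?Z C"
    have CZ: "\<And>G. G \<in> C \<Longrightarrow> G \<in> ?Z" using C(2) unfolding subset.chain_def by (rule subsetD[OF conjunct1])
    have tot: "X \<subseteq> Y \<or> Y \<subseteq> X" if X: "X \<in> C" "Y \<in> C" for X Y
      using C(2) X unfolding subset_chain_def by blast
    have "lsub k ?YJ (\<Union>C)" using C(1) CZ tot by (intro lsub_Union_chain) auto
    moreover have "?G0 \<subseteq> \<Union>C" using C(1) CZ by blast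
    moreover have "\<forall>z. (\<zero>\<^bsub>Y\<^esub>, z) \<in> \<Union>C \<longrightarrow> z = \<zero>\<^bsub>J\<^esub>" using CZ by blast
    ultimately show "\<Union>C \<in> ?Z" by blast
  qed
  then obtain G where GZ: "G \<in> ?Z" and Gm: "\<forall>K\<in>?Z. G \<subseteq> K \<longrightarrow> K = G" by (elim bexE)
  have G: "lsub k ?YJ G" "?G0 \<subseteq> G" "\<And>z. (\<zero>\<^bsub>Y\<^esub>, z) \<in> G \<Longrightarrow> z = \<zero>\<^bsub>J\<^esub>" using GZ by auto
  have Gc: "y \<in> carrier Y" "z \<in> carrier J" if "(y, z) \<in> G" for y z
    using lsub_subset[OF G(1) that] by (auto simp: lmod_sum_def)
  have Ga: "(y \<oplus>\<^bsub>Y\<^esub> y', z \<oplus>\<^bsub>J\<^esub> z') \<in> G" if "(y, z) \<in> G" "(y', z') \<in> G" for y z y' z'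
    using lsub_add[OF G(1) that] by (simp add: lmod_sum_def)
  have Gs: "(c \<odot>\<^bsub>Y\<^esub> y, c \<odot>\<^bsub>J\<^esub> z) \<in> G" if "c \<in> carrier k" "(y, z) \<in> G" for c y z
    using lsub_smult[OF G(1) that] by (simp add: lmod_sum_def)
  have uniq: "z = z'" if "(y, z) \<in> G" "(y, z') \<in> G" for y z z'
  proof -
    have "((\<ominus> \<one>) \<odot>\<^bsub>Y\<^esub> y, (\<ominus> \<one>) \<odot>\<^bsub>J\<^esub> z') \<in> G" by (rule Gs[OF _ that(2)]) simp
    then have "(\<ominus>\<^bsub>Y\<^esub> y, \<ominus>\<^bsub>J\<^esub> z') \<in> G"
      using Gc[OF that(2)] by (simp add: Y.smult_l_minus J.smult_l_minus Y.smult_one J.smult_one)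
    from Ga[OF that(1) this] have "(\<zero>\<^bsub>Y\<^esub>, z \<oplus>\<^bsub>J\<^esub> \<ominus>\<^bsub>J\<^esub> z') \<in> G" using Gc[OF that(1)] by (simp add: Y.M.r_neg)
    then have "z \<oplus>\<^bsub>J\<^esub> \<ominus>\<^bsub>J\<^esub> z' = \<zero>\<^bsub>J\<^esub>" by (rule G(3))
    moreover have "z = (z \<oplus>\<^bsub>J\<^esub> \<ominus>\<^bsub>J\<^esub> z') \<oplus>\<^bsub>J\<^esub> z'"
      using Gc(2)[OF that(1)] Gc(2)[OF that(2)] by (simp add: J.M.a_assoc J.M.l_neg)
    ultimately show ?thesis using Gc(2)[OF that(2)] by simp
  qed
  have total: "\<exists>z. (y, z) \<in> G" if y: "y \<in> carrier Y" for y
  proof -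
    \<comment> \<open>If y is outside the domain of a maximal graph, the scalars that move it into
      the domain form an ideal, and the graph defines a map \<phi> on this ideal. Baer's criterion
      writes \<phi> as multiplication into some z, the value to be assigned to y.\<close>
    define I where "I = {c \<in> carrier k. \<exists>z. (c \<odot>\<^bsub>Y\<^esub> y, z) \<in> G}"
    define \<phi> where "\<phi> = (\<lambda>c. THE z. (c \<odot>\<^bsub>Y\<^esub> y, z) \<in> G)"
    have \<phi>: "(c \<odot>\<^bsub>Y\<^esub> y, \<phi> c) \<in> G" if c: "c \<in> I" for c
    proof -
      obtain z where "(c \<odot>\<^bsub>Y\<^esub> y, z) \<in> G" using c by (auto simp: I_def)
      then show ?thesis unfolding \<phi>_def by (rule theI) (rule uniq[OF _ \<open>(c \<odot>\<^bsub>Y\<^esub> y, z) \<in> G\<close>])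
    qed
    have Ia: "c \<oplus> d \<in> I" "\<phi> (c \<oplus> d) = \<phi> c \<oplus>\<^bsub>J\<^esub> \<phi> d" if "c \<in> I" "d \<in> I" for c d
    proof -
      have m: "((c \<oplus> d) \<odot>\<^bsub>Y\<^esub> y, \<phi> c \<oplus>\<^bsub>J\<^esub> \<phi> d) \<in> G"
        using Ga[OF \<phi>[OF that(1)] \<phi>[OF that(2)]] that y by (simp add: I_def Y.smult_l_distr)
      then show i: "c \<oplus> d \<in> I" using that by (auto simp: I_def)
      show "\<phi> (c \<oplus> d) = \<phi> c \<oplus>\<^bsub>J\<^esub> \<phi> d" by (rule uniq[OF \<phi>[OF i] m])
    qed
    have Is: "r \<otimes> c \<in> I" "\<phi> (r \<otimes> c) = r \<odot>\<^bsub>J\<^esub> \<phi> c" if "r \<in> carrier k" "c \<in> I" for r c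
    proof -
      have m: "((r \<otimes> c) \<odot>\<^bsub>Y\<^esub> y, r \<odot>\<^bsub>J\<^esub> \<phi> c) \<in> G"
        using Gs[OF that(1) \<phi>[OF that(2)]] that y by (simp add: I_def Y.smult_assoc)
      then show i: "r \<otimes> c \<in> I" using that by (auto simp: I_def)
      show "\<phi> (r \<otimes> c) = r \<odot>\<^bsub>J\<^esub> \<phi> c" by (rule uniq[OF \<phi>[OF i] m])
    qed
    have "(\<zero> \<odot>\<^bsub>Y\<^esub> y, \<zero>\<^bsub>J\<^esub>) \<in> G" using lsub_zero[OF G(1)] y by (simp add: lmod_sum_def)
    then have "\<zero> \<in> I" by (auto simp: I_def)
    then have I: "idl I" using Ia(1) Is(1) by (intro lsubI) (auto simp: I_def)
    have "lhom k (regular_bimod k\<lparr>carrier := I\<rparr>) J \<phi>"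
      using Ia(2) Is(2) Gc(2)[OF \<phi>] by (intro lhomI) auto
    from baer_step[OF I this] obtain z where z: "z \<in> carrier J" "\<And>c. c \<in> I \<Longrightarrow> \<phi> c = c \<odot>\<^bsub>J\<^esub> z" by blast
    let ?yz = "(y, z)"
    have yz: "?yz \<in> carrier ?YJ" using y z by (simp add: lmod_sum_def)
    let ?C = "(\<lambda>c. c \<odot>\<^bsub>?YJ\<^esub> ?yz) ` carrier k"
    have C: "lsub k ?YJ ?C" by (rule lsub_cyclic[OF YJ yz])
    let ?G' = "{s \<oplus>\<^bsub>?YJ\<^esub> t | s t. s \<in> G \<and> t \<in> ?C}"
    have G': "lsub k ?YJ ?G'" by (rule lsub_sum[OF YJ G(1) C])
    have GG': "G \<subseteq> ?G'" by (rule lsub_sum_incl(1)[OF YJ G(1) C])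
    have "?G' \<in> ?Z"
    proof (intro CollectI conjI allI impI)
      show "lsub k ?YJ ?G'" by (rule G')
      show "?G0 \<subseteq> ?G'" using G(2) GG' by (rule order_trans)
      fix x assume "(\<zero>\<^bsub>Y\<^esub>, x) \<in> ?G'"
      then obtain s t c where st: "(s, t) \<in> G" "c \<in> carrier k" "(\<zero>\<^bsub>Y\<^esub>, x) = (s \<oplus>\<^bsub>Y\<^esub> c \<odot>\<^bsub>Y\<^esub> y, t \<oplus>\<^bsub>J\<^esub> c \<odot>\<^bsub>J\<^esub> z)"
        by (auto simp: lmod_sum_def)
      have sY: "s \<in> carrier Y" "t \<in> carrier J" using Gc[OF st(1)] by auto
      have cy: "c \<odot>\<^bsub>Y\<^esub> y \<in> carrier Y" using st(2) y by (rule Y.smult_closed)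
      \<comment> \<open>An element (0, x) of the larger graph is (s, t) + c (y, z) with c y = -s in
        the old domain. So c lies in \<open>I\<close>, where c z is the value prescribed by G, and
        (0, x) already belongs to G.\<close>
      have s0: "s \<oplus>\<^bsub>Y\<^esub> c \<odot>\<^bsub>Y\<^esub> y = \<zero>\<^bsub>Y\<^esub>" using st(3) by simp
      have "((\<ominus> \<one>) \<odot>\<^bsub>Y\<^esub> s, (\<ominus> \<one>) \<odot>\<^bsub>J\<^esub> t) \<in> G" by (rule Gs[OF _ st(1)]) simp
      then have m: "(\<ominus>\<^bsub>Y\<^esub> s, \<ominus>\<^bsub>J\<^esub> t) \<in> G" using sY by (simp add: Y.smult_l_minus J.smult_l_minus Y.smult_one J.smult_one)
      have "\<ominus>\<^bsub>Y\<^esub> s = c \<odot>\<^bsub>Y\<^esub> y" using s0 sY cy by (metis Y.M.a_comm Y.M.minus_equality)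
      then have cI: "c \<in> I" using m st(2) by (auto simp: I_def)
      have "(c \<odot>\<^bsub>Y\<^esub> y, c \<odot>\<^bsub>J\<^esub> z) \<in> G" using \<phi>[OF cI] z(2)[OF cI] by simp
      from Ga[OF st(1) this] have "(\<zero>\<^bsub>Y\<^esub>, x) \<in> G" using st(3) by simp
      then show "x = \<zero>\<^bsub>J\<^esub>" by (rule G(3))
    qed
    then have "?G' = G" using Gm GG' by simp
    moreover have "?yz \<in> ?G'"
      by (rule subsetD[OF lsub_sum_incl(2)[OF YJ G(1) C] cyclic_mem[OF YJ yz]])
    ultimately show ?thesis by blast
  qed
  define h where "h = (\<lambda>y. THE z. (y, z) \<in> G)"
  have h: "(y, h y) \<in> G" if y: "y \<in> carrier Y" for y
  proof -
    obtain z where "(y, z) \<in> G" using total[OF y] by blast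
    then show ?thesis unfolding h_def by (rule theI) (rule uniq[OF _ \<open>(y, z) \<in> G\<close>])
  qed
  have "lhom k Y J h"
  proof (rule lhomI)
    fix y assume y: "y \<in> carrier Y"
    show "h y \<in> carrier J" using Gc(2)[OF h[OF y]] .
    show "h (y \<oplus>\<^bsub>Y\<^esub> y') = h y \<oplus>\<^bsub>J\<^esub> h y'" if "y' \<in> carrier Y" for y'
      by (rule uniq[OF h Ga[OF h[OF y] h[OF that]]]) (use y that in simp)
    show "h (c \<odot>\<^bsub>Y\<^esub> y) = c \<odot>\<^bsub>J\<^esub> h y" if "c \<in> carrier k" for c
      by (rule uniq[OF h Gs[OF that h[OF y]]]) (rule Y.smult_closed[OF that y])
  qed
  moreover have "h s = g s" if "s \<in> S" for s
    by (rule uniq[OF h[OF sc[OF that]]]) (use G(2) that in auto)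
  ultimately show ?thesis by blast
qed

text \<open>Some multiple y of y0 generates a simple module k/m, and J contains a copy of k/m. Both
  facts are drawn from minimal ideals. Mapping y to a generator of the copy and extending by
  injectivity gives h with h(y) nonzero, hence h(y0) nonzero.\<close>

lemma cogenerator:
  assumes Y: "left_module k Y" "y0 \<in> carrier Y" "y0 \<noteq> \<zero>\<^bsub>Y\<^esub>"
  shows "\<exists>h. lhom k Y J h \<and> h y0 \<noteq> \<zero>\<^bsub>J\<^esub>"
proof -
  interpret Y: left_module k Y by fact
  obtain w where w: "w \<in> carrier J" "\<And>c. c \<in> carrier k \<Longrightarrow> c \<odot>\<^bsub>J\<^esub> w = \<zero>\<^bsub>J\<^esub> \<longleftrightarrow> c \<in> jacobson_rad k"
    using socle_generator by metis
  define a where "a = {c \<in> carrier k. c \<odot>\<^bsub>Y\<^esub> y0 = \<zero>\<^bsub>Y\<^esub>}"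
  have a1: "\<one> \<notin> a" using Y by (simp add: a_def Y.smult_one)
  have yl: "lhom k (regular_bimod k) Y (\<lambda>c. c \<odot>\<^bsub>Y\<^esub> y)" if "y \<in> carrier Y" for y
    using that by (intro lhomI) (auto simp: Y.smult_closed Y.smult_l_distr Y.smult_assoc)
  have a: "idl a" using lsub_ker[OF reg Y(1) yl[OF Y(2)]] by (simp add: a_def)
  \<comment> \<open>Take D minimal among the ideals that do not kill y0, and d \<in> D with d y0
    nonzero. Minimality gives D = k c d whenever c d y0 is nonzero, so the annihilator m of d y0 is
    a maximal ideal.\<close>
  let ?S = "{D. idl D \<and> \<not> D \<subseteq> a}"
  obtain D where DS: "D \<in> ?S" and Dm: "\<And>D'. D' \<in> ?S \<Longrightarrow> D' \<subseteq> D \<Longrightarrow> D' = D"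
    by (rule idl_min[of "carrier k" ?S]) (use a1 lsub_carrier[OF reg] in auto)
  then obtain d where d: "d \<in> D" "d \<notin> a" by blast
  have D: "idl D" using DS by simp
  have dk: "d \<in> carrier k" by (rule idl_sub[OF D d(1)])
  define m where "m = {c \<in> carrier k. c \<otimes> d \<in> a}"
  have "lhom k (regular_bimod k) (regular_bimod k) (\<lambda>c. c \<otimes> d)"
    using dk by (intro lhomI) (auto simp: l_distr m_assoc)
  from lsub_vimage[OF reg reg this lsub_carrier[OF reg] a] have m: "idl m" by (simp add: m_def)
  have m1: "\<one> \<notin> m" using d dk by (simp add: m_def)
  have minv: "\<exists>e\<in>carrier k. \<one> \<ominus> e \<otimes> c \<in> m" if c: "c \<in> carrier k" "c \<notin> m" for c
  proof -
    have cd: "c \<otimes> d \<notin> a" using c by (simp add: m_def)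
    let ?P = "(\<lambda>e. e \<otimes> (c \<otimes> d)) ` carrier k"
    have cdk: "c \<otimes> d \<in> carrier k" using c dk by simp
    have "?P = D"
    proof (rule Dm)
      have "c \<otimes> d \<in> ?P" by (rule image_eqI[of _ _ \<one>]) (use cdk in auto)
      then show "?P \<in> ?S" using idl_principal[OF cdk] cd by blast
      show "?P \<subseteq> D" using idl_mult[OF D] c(1) d(1) by blast
    qed
    then obtain e where e: "e \<in> carrier k" "d = e \<otimes> (c \<otimes> d)" using d(1) by blast
    have "(\<one> \<ominus> e \<otimes> c) \<otimes> d = d \<ominus> e \<otimes> (c \<otimes> d)"
      using e(1) c(1) dk by (simp add: a_minus_def l_distr l_minus m_assoc)
    also have "\<dots> = \<zero>" using e(2) dk by (simp add: a_minus_def r_neg)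
    finally have "(\<one> \<ominus> e \<otimes> c) \<otimes> d \<in> a" using lsub_zero[OF a] by simp
    then have "\<one> \<ominus> e \<otimes> c \<in> m" using e(1) c(1) by (simp add: m_def)
    then show ?thesis using e(1) by blast
  qed
  have max: "K = carrier k" if K: "idl K" "m \<subseteq> K" "c \<in> K" "c \<notin> m" for K c
  proof (rule idl_one[OF K(1)])
    have ck: "c \<in> carrier k" by (rule idl_sub[OF K(1,3)])
    obtain e where e: "e \<in> carrier k" "\<one> \<ominus> e \<otimes> c \<in> m" using minv[OF ck K(4)] by blast
    have "(\<one> \<ominus> e \<otimes> c) \<oplus> e \<otimes> c \<in> K"
      using K(2) e idl_mult[OF K(1) e(1) K(3)] by (intro idl_add[OF K(1)]) auto
    then show "\<one> \<in> K" using e(1) ck by (simp add: a_minus_def a_assoc l_neg)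
  qed
  have mm: "maximalideal m k"
  proof (rule maximalidealI)
    show "ideal m k" by (rule idl_ideal[OF m])
    show "carrier k \<noteq> m" using m1 by auto
    fix K assume K: "ideal K k" "m \<subseteq> K" "K \<subseteq> carrier k"
    show "K = m \<or> K = carrier k" using max[OF ideal_idl[OF K(1)] K(2)] K(2) by blast
  qed
  have prime: "c \<otimes> e \<notin> m" if c: "c \<in> carrier k" "c \<notin> m" and e: "e \<in> carrier k" "e \<notin> m" for c e
  proof
    assume ce: "c \<otimes> e \<in> m"
    obtain f where f: "f \<in> carrier k" "\<one> \<ominus> f \<otimes> c \<in> m" using minv[OF c] by blast
    have "e \<otimes> (\<one> \<ominus> f \<otimes> c) \<oplus> f \<otimes> (c \<otimes> e) \<in> m"
      by (rule idl_add[OF m idl_mult[OF m e(1) f(2)] idl_mult[OF m f(1) ce]])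
    moreover have "e \<otimes> (\<one> \<ominus> f \<otimes> c) \<oplus> f \<otimes> (c \<otimes> e) = e"
      using c e f(1) by (simp add: a_minus_def r_distr r_minus a_assoc m_ac l_neg)
    ultimately show False using e(2) by simp
  qed
  \<comment> \<open>An ideal minimal among those not inside m lies in every other maximal ideal:
    intersecting with such an ideal keeps it outside m, by primality. For e in it and outside m, the
    ideal m e is therefore in the radical while e is not, so e w is nonzero and killed by m.\<close>
  let ?S2 = "{D. idl D \<and> \<not> D \<subseteq> m}"
  obtain D2 where D2S: "D2 \<in> ?S2" and D2m: "\<And>D'. D' \<in> ?S2 \<Longrightarrow> D' \<subseteq> D2 \<Longrightarrow> D' = D2"
    by (rule idl_min[of "carrier k" ?S2]) (use m1 lsub_carrier[OF reg] in auto)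
  then obtain e where e: "e \<in> D2" "e \<notin> m" by blast
  have D2: "idl D2" using D2S by simp
  have ek: "e \<in> carrier k" by (rule idl_sub[OF D2 e(1)])
  have erad: "c \<otimes> e \<in> jacobson_rad k" if c: "c \<in> m" for c
    unfolding jacobson_rad_def
  proof (intro CollectI conjI allI impI)
    have ck: "c \<in> carrier k" by (rule idl_sub[OF m c])
    show "c \<otimes> e \<in> carrier k" using ck ek by simp
    fix m' assume m': "maximalideal m' k"
    have m'i: "idl m'" by (rule ideal_idl[OF maximalideal.axioms(1)[OF m']])
    show "c \<otimes> e \<in> m'"
    proof (cases "m' \<subseteq> m")
      case True
      then have "m = m'" using maximalideal.I_maximal[OF m' idl_ideal[OF m] True idl_carrier[OF m]] m1 by auto
      then show ?thesis using idl_mult[OF m ek c] ck ek by (simp add: m_comm)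
    next
      case False
      then obtain c' where c': "c' \<in> m'" "c' \<notin> m" by blast
      have c'k: "c' \<in> carrier k" by (rule idl_sub[OF m'i c'(1)])
      have "c' \<otimes> e \<in> D2 \<inter> m'" using idl_mult[OF D2 c'k e(1)] idl_mult[OF m'i ek c'(1)] c'k ek by (simp add: m_comm)
      moreover have "c' \<otimes> e \<notin> m" by (rule prime[OF c'k c'(2) ek e(2)])
      ultimately have "D2 \<inter> m' = D2" using lsub_Int[OF D2 m'i] by (intro D2m) auto
      then show ?thesis using idl_mult[OF m'i ck] e(1) by blast
    qed
  qed
  define z where "z = e \<odot>\<^bsub>J\<^esub> w"
  have z: "z \<in> carrier J" using ek w(1) by (simp add: z_def J.smult_closed)
  have "e \<notin> jacobson_rad k" using e(2) mm by (auto simp: jacobson_rad_def)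
  then have znz: "z \<noteq> \<zero>\<^bsub>J\<^esub>" using w(2)[OF ek] by (simp add: z_def)
  have mz: "c \<odot>\<^bsub>J\<^esub> z = \<zero>\<^bsub>J\<^esub>" if "c \<in> m" for c
    using w(2)[of "c \<otimes> e"] erad[OF that] idl_sub[OF m that] ek w(1) by (simp add: z_def J.smult_assoc)
  define y where "y = d \<odot>\<^bsub>Y\<^esub> y0"
  have y: "y \<in> carrier Y" using dk Y(2) by (simp add: y_def Y.smult_closed)
  have ym: "c \<in> m" if "c \<in> carrier k" "c \<odot>\<^bsub>Y\<^esub> y = \<zero>\<^bsub>Y\<^esub>" for c
    using that dk Y(2) by (simp add: y_def m_def a_def Y.smult_assoc)
  let ?C = "(\<lambda>c. c \<odot>\<^bsub>Y\<^esub> y) ` carrier k"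
  have C: "lsub k Y ?C" by (rule lsub_cyclic[OF Y(1) y])
  \<comment> \<open>The choice of c does not matter: two choices differ by an element that
    annihilates y, hence lies in m and kills z.\<close>
  define g where "g = (\<lambda>x. (SOME c. c \<in> carrier k \<and> x = c \<odot>\<^bsub>Y\<^esub> y) \<odot>\<^bsub>J\<^esub> z)"
  have g: "g (c \<odot>\<^bsub>Y\<^esub> y) = c \<odot>\<^bsub>J\<^esub> z" if c: "c \<in> carrier k" for c
  proof -
    define c' where "c' = (SOME c'. c' \<in> carrier k \<and> c \<odot>\<^bsub>Y\<^esub> y = c' \<odot>\<^bsub>Y\<^esub> y)"
    have c': "c' \<in> carrier k \<and> c \<odot>\<^bsub>Y\<^esub> y = c' \<odot>\<^bsub>Y\<^esub> y" unfolding c'_def by (rule someI[of _ c]) (use c in simp)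
    have "(c' \<ominus> c) \<odot>\<^bsub>Y\<^esub> y = c' \<odot>\<^bsub>Y\<^esub> y \<oplus>\<^bsub>Y\<^esub> \<ominus>\<^bsub>Y\<^esub> (c \<odot>\<^bsub>Y\<^esub> y)"
      using c c' y by (simp only: a_minus_def Y.smult_l_distr Y.smult_l_minus a_inv_closed)
    also have "\<dots> = \<zero>\<^bsub>Y\<^esub>" using c' c y Y.smult_closed by (metis Y.M.r_neg)
    finally have "c' \<ominus> c \<in> m" using c c' by (intro ym) auto
    then have "(c' \<ominus> c) \<odot>\<^bsub>J\<^esub> z = \<zero>\<^bsub>J\<^esub>" by (rule mz)
    moreover have "(c' \<ominus> c) \<odot>\<^bsub>J\<^esub> z = c' \<odot>\<^bsub>J\<^esub> z \<oplus>\<^bsub>J\<^esub> \<ominus>\<^bsub>J\<^esub> (c \<odot>\<^bsub>J\<^esub> z)"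
      using c c' z by (simp only: a_minus_def J.smult_l_distr J.smult_l_minus a_inv_closed)
    ultimately have "c' \<odot>\<^bsub>J\<^esub> z = c \<odot>\<^bsub>J\<^esub> z"
      using c c' z J.smult_closed by (metis J.M.minus_equality J.M.minus_minus J.M.a_inv_closed)
    then show ?thesis by (simp add: g_def c'_def)
  qed
  have "lhom k (Y\<lparr>carrier := ?C\<rparr>) J g"
  proof (rule lhomI)
    fix x assume "x \<in> carrier (Y\<lparr>carrier := ?C\<rparr>)"
    then obtain c where c: "c \<in> carrier k" "x = c \<odot>\<^bsub>Y\<^esub> y" by auto
    show "g x \<in> carrier J" using c z g by (simp add: J.smult_closed)
    show "g (r \<odot>\<^bsub>Y\<lparr>carrier := ?C\<rparr>\<^esub> x) = r \<odot>\<^bsub>J\<^esub> g x" if "r \<in> carrier k" for r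
      using g[of "r \<otimes> c"] g[OF c(1)] that c y z by (simp add: Y.smult_assoc J.smult_assoc)
    fix x' assume "x' \<in> carrier (Y\<lparr>carrier := ?C\<rparr>)"
    then obtain c' where c': "c' \<in> carrier k" "x' = c' \<odot>\<^bsub>Y\<^esub> y" by auto
    show "g (x \<oplus>\<^bsub>Y\<lparr>carrier := ?C\<rparr>\<^esub> x') = g x \<oplus>\<^bsub>J\<^esub> g x'"
      using g[of "c \<oplus> c'"] g[OF c(1)] g[OF c'(1)] c c' y z by (simp add: Y.smult_l_distr J.smult_l_distr)
  qed
  from lhom_extend[OF Y(1) C this] obtain h where h: "lhom k Y J h" "\<And>s. s \<in> ?C \<Longrightarrow> h s = g s" by blast
  have "h y = z" using h(2)[OF cyclic_mem[OF Y(1) y]] g[of \<one>] y z by (simp add: Y.smult_one J.smult_one)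
  moreover have "h y = d \<odot>\<^bsub>J\<^esub> h y0" unfolding y_def by (rule lhom_smult[OF h(1) dk Y(2)])
  ultimately have "h y0 \<noteq> \<zero>\<^bsub>J\<^esub>" using znz dk by auto
  then show ?thesis using h(1) by blast
qed

end

text \<open>For an injective D, a map that vanishes on the joint kernel of the h_i is a combination
  of them. The induction runs on the kernel of h_n, which is why V varies; it works inside Z and
  never forms the power of Z into which the h_i would map V.\<close>

lemma factor_through_jointly_injective:
  fixes Z :: "('r, 'z, 'o) module_scheme" and D :: "('r, 'd, 'e) module_scheme"
  assumes Z: "left_module R Z" and D: "left_module R D"
    and ext: "\<And>S g. lsub R Z S \<Longrightarrow> lhom R (Z\<lparr>carrier := S\<rparr>) D g \<Longrightarrow> \<exists>h. lhom R Z D h \<and> (\<forall>s\<in>S. h s = g s)"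
  shows "\<lbrakk>left_module R V; lhom R V D f; \<And>i. i < (n::nat) \<Longrightarrow> lhom R V Z (h i);
      \<And>v. v \<in> carrier V \<Longrightarrow> \<forall>i<n. h i v = \<zero>\<^bsub>Z\<^esub> \<Longrightarrow> f v = \<zero>\<^bsub>D\<^esub>\<rbrakk> \<Longrightarrow>
    \<exists>g. (\<forall>i<n. lhom R Z D (g i)) \<and> (\<forall>v\<in>carrier V. f v = finsum D (\<lambda>i. g i (h i v)) {..<n})"
proof (induction n arbitrary: V f)
  case 0
  interpret D: left_module R D by fact
  show ?case using 0(4) by auto
next
  case (Suc n)
  interpret D: left_module R D by fact
  interpret Z: left_module R Z by fact
  interpret V: left_module R V by fact
  note V = Suc.prems(1) and f = Suc.prems(2) and h = Suc.prems(3)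
  let ?K = "kermod V Z (h n)"
  have hn: "lhom R V Z (h n)" by (rule h) simp
  have K: "left_module R ?K" by (rule left_module_kermod[OF V Z hn])
  have "\<exists>g. (\<forall>i<n. lhom R Z D (g i)) \<and> (\<forall>v\<in>carrier ?K. f v = finsum D (\<lambda>i. g i (h i v)) {..<n})"
  proof (rule Suc.IH[OF K lhom_from_lsub[OF f] lhom_from_lsub])
    show "lhom R V Z (h i)" if "i < n" for i using h that by simp
    show "f v = \<zero>\<^bsub>D\<^esub>" if "v \<in> carrier ?K" "\<forall>i<n. h i v = \<zero>\<^bsub>Z\<^esub>" for v
      using Suc.prems(4)[of v] that by (auto simp: less_Suc_eq)
  qed auto
  then obtain g where g: "\<And>i. i < n \<Longrightarrow> lhom R Z D (g i)"
    "\<And>v. v \<in> carrier V \<Longrightarrow> h n v = \<zero>\<^bsub>Z\<^esub> \<Longrightarrow> f v = finsum D (\<lambda>i. g i (h i v)) {..<n}" by auto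
  let ?s = "\<lambda>v. finsum D (\<lambda>i. g i (h i v)) {..<n}"
  have gh: "lhom R V D (\<lambda>v. g i (h i v))" if "i < n" for i
    by (rule lhom_comp[OF h g(1)]) (use that in auto)
  have s: "lhom R V D ?s" by (rule lhom_finsum_fun[OF V D]) (use gh in simp)
  \<comment> \<open>What remains after subtracting the combination found on the kernel of h_n. It
    vanishes on that kernel, so it is defined on the image of h_n and extends from there to
    Z.\<close>
  define e where "e = (\<lambda>v. f v \<oplus>\<^bsub>D\<^esub> \<ominus>\<^bsub>D\<^esub> ?s v)"
  have e: "lhom R V D e" unfolding e_def by (rule lhom_plus[OF V D f lhom_uminus[OF V D s]])
  note fc = lhom_closed[OF f] and scl = lhom_closed[OF s] and ec = lhom_closed[OF e]
  have ez: "e v = \<zero>\<^bsub>D\<^esub>" if "v \<in> carrier V" "h n v = \<zero>\<^bsub>Z\<^esub>" for v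
    using g(2)[OF that] scl[OF that(1)] by (simp add: e_def D.r_neg)
  have ew: "e v = e w" if vw: "v \<in> carrier V" "w \<in> carrier V" "h n v = h n w" for v w
  proof -
    have "h n (v \<ominus>\<^bsub>V\<^esub> w) = \<zero>\<^bsub>Z\<^esub>"
      using vw lhom_closed[OF hn] by (simp add: lhom_minus[OF V Z hn], simp add: a_minus_def Z.r_neg)
    then have "e v \<oplus>\<^bsub>D\<^esub> \<ominus>\<^bsub>D\<^esub> e w = \<zero>\<^bsub>D\<^esub>"
      using ez[of "v \<ominus>\<^bsub>V\<^esub> w"] vw by (simp add: lhom_minus[OF V D e] a_minus_def[of D])
    moreover have "e v = (e v \<oplus>\<^bsub>D\<^esub> \<ominus>\<^bsub>D\<^esub> e w) \<oplus>\<^bsub>D\<^esub> e w" using ec vw by (simp add: D.a_assoc D.l_neg)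
    ultimately show ?thesis using ec vw by simp
  qed
  let ?S = "h n ` carrier V"
  define g0 where "g0 = (\<lambda>z. e (SOME v. v \<in> carrier V \<and> h n v = z))"
  have g0: "g0 (h n v) = e v" if v: "v \<in> carrier V" for v
  proof -
    have "(SOME w. w \<in> carrier V \<and> h n w = h n v) \<in> carrier V \<and> h n (SOME w. w \<in> carrier V \<and> h n w = h n v) = h n v"
      by (rule someI[of _ v]) (use v in simp)
    then show ?thesis unfolding g0_def using ew v by blast
  qed
  have "lhom R (Z\<lparr>carrier := ?S\<rparr>) D g0"
  proof (rule lhomI)
    fix z assume "z \<in> carrier (Z\<lparr>carrier := ?S\<rparr>)"
    then obtain v where v: "v \<in> carrier V" "z = h n v" by auto
    show "g0 z \<in> carrier D" using v g0 ec by simp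
    show "g0 (r \<odot>\<^bsub>Z\<lparr>carrier := ?S\<rparr>\<^esub> z) = r \<odot>\<^bsub>D\<^esub> g0 z" if "r \<in> carrier R" for r
      using that v g0[of "r \<odot>\<^bsub>V\<^esub> v"] by (simp add: lhom_smult[OF hn] lhom_smult[OF e] g0 V.smult_closed)
    fix z' assume "z' \<in> carrier (Z\<lparr>carrier := ?S\<rparr>)"
    then obtain v' where v': "v' \<in> carrier V" "z' = h n v'" by auto
    show "g0 (z \<oplus>\<^bsub>Z\<lparr>carrier := ?S\<rparr>\<^esub> z') = g0 z \<oplus>\<^bsub>D\<^esub> g0 z'"
      using v v' g0[of "v \<oplus>\<^bsub>V\<^esub> v'"] by (simp add: lhom_add[OF hn] lhom_add[OF e] g0)
  qed
  from ext[OF lsub_image[OF V Z hn lsub_carrier[OF V]] this]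
  obtain gn where gn: "lhom R Z D gn" "\<And>v. v \<in> carrier V \<Longrightarrow> gn (h n v) = e v" using g0 by auto
  show ?case
  proof (intro exI[of _ "g(n := gn)"] conjI ballI allI impI)
    show "lhom R Z D ((g(n := gn)) i)" if "i < Suc n" for i using that g(1) gn(1) by (auto simp: less_Suc_eq)
    fix v assume v: "v \<in> carrier V"
    have "finsum D (\<lambda>i. (g(n := gn)) i (h i v)) {..<Suc n} = e v \<oplus>\<^bsub>D\<^esub> finsum D (\<lambda>i. (g(n := gn)) i (h i v)) {..<n}"
      using v gn(2) ec lhom_closed[OF gh v] by (simp add: lessThan_Suc)
    also have "finsum D (\<lambda>i. (g(n := gn)) i (h i v)) {..<n} = ?s v"
      by (rule D.finsum_cong') (use lhom_closed[OF gh v] in auto)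
    also have "e v \<oplus>\<^bsub>D\<^esub> ?s v = f v" using fc[OF v] scl[OF v] by (simp add: e_def D.a_assoc D.l_neg)
    finally show "f v = finsum D (\<lambda>i. (g(n := gn)) i (h i v)) {..<Suc n}" by simp
  qed
qed

section \<open>The module D(A) of an Artin algebra\<close>

locale algebra_duality = duality k J U
  for k :: "('k, 'q) ring_scheme" (structure) and J :: "('k, 'j, 'n) module_scheme" and U :: "'u itself" +
  fixes A :: "('k, 'a, 'm) module_scheme"
  assumes alg: "artin_algebra k A"
begin

lemma A_left: "left_module k A" and A_ring: "ring A" and A_fin_gen: "fin_gen k A"
  and alg_mult: "\<lbrakk>c \<in> carrier k; x \<in> carrier A; y \<in> carrier A\<rbrakk> \<Longrightarrow> (c \<odot>\<^bsub>A\<^esub> x) \<otimes>\<^bsub>A\<^esub> y = c \<odot>\<^bsub>A\<^esub> (x \<otimes>\<^bsub>A\<^esub> y)"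
    "\<lbrakk>c \<in> carrier k; x \<in> carrier A; y \<in> carrier A\<rbrakk> \<Longrightarrow> x \<otimes>\<^bsub>A\<^esub> (c \<odot>\<^bsub>A\<^esub> y) = c \<odot>\<^bsub>A\<^esub> (x \<otimes>\<^bsub>A\<^esub> y)"
  using alg by (auto simp: artin_algebra_def)

sublocale A: ring A by (rule A_ring)

abbreviation D :: "('a, 'a \<Rightarrow> 'j) module" where "D \<equiv> dual_of_algebra k J A"

text \<open>A as a k-A-bimodule, so that D(A) = Hom_k(A, J) becomes an instance of
  \<open>hom_mod\<close>.\<close>

definition bimod :: "('k, 'a, 'a) bimodule"
  where "bimod = \<lparr>carrier = carrier A, monoid.mult = undefined, monoid.one = undefined,
    ring.zero = \<zero>\<^bsub>A\<^esub>, add = add A, smult = smult A, rsmult = monoid.mult A\<rparr>"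

lemma D_hom_mod: "D = hom_mod k bimod J"
  by (simp add: dual_of_algebra_def hom_mod_def bimod_def lmod_hom_def)

lemma bimod: "is_bimodule k A bimod"
proof -
  interpret M: left_module k A by (rule A_left)
  have ag: "abelian_group N" if "carrier N = carrier A" "add N = add A" "\<zero>\<^bsub>N\<^esub> = \<zero>\<^bsub>A\<^esub>" for N :: "('l, 'a, 'o) module_scheme"
    by (rule abelian_group_cong[OF A.abelian_group_axioms that])
  show ?thesis
    unfolding is_bimodule_def
  proof (intro conjI ballI)
    show "left_module k bimod"
      by (rule left_moduleI) (auto simp: bimod_def M.smult_closed M.smult_l_distr M.smult_r_distr
          M.smult_assoc M.smult_one intro!: ag ring_axioms)
    show "left_module (opp_ring A) (right_part bimod)"
      by (rule left_moduleI[OF ring_opp[OF A_ring]])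
        (auto simp: bimod_def right_part_def opp_ring_def A.m_assoc A.l_distr A.r_distr intro!: ag)
  qed (auto simp: bimod_def alg_mult)
qed

lemma D_left: "left_module A D"
  unfolding D_hom_mod by (rule left_module_hom_mod[OF bimod A_ring J_left])

sublocale D: left_module A D by (rule D_left)

lemma D_simps:
  "carrier D = lmod_hom k A J" "\<zero>\<^bsub>D\<^esub> = (\<lambda>x\<in>carrier A. \<zero>\<^bsub>J\<^esub>)" "f \<oplus>\<^bsub>D\<^esub> g = (\<lambda>x\<in>carrier A. f x \<oplus>\<^bsub>J\<^esub> g x)"
  "a \<odot>\<^bsub>D\<^esub> f = (\<lambda>x\<in>carrier A. f (x \<otimes>\<^bsub>A\<^esub> a))"
  by (auto simp: dual_of_algebra_def)

text \<open>The structure map from k to the centre of A; \<open>restr\<close> is restriction of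
  scalars along it.\<close>

definition sc :: "'k \<Rightarrow> 'a" where "sc c = c \<odot>\<^bsub>A\<^esub> \<one>\<^bsub>A\<^esub>"

definition restr :: "('a, 'v, 'o) module_scheme \<Rightarrow> ('k, 'v) module"
  where "restr V = \<lparr>carrier = carrier V, monoid.mult = undefined, monoid.one = undefined,
    ring.zero = \<zero>\<^bsub>V\<^esub>, add = add V, smult = (\<lambda>c. smult V (sc c))\<rparr>"

lemma restr_simps [simp]:
  "carrier (restr V) = carrier V" "\<zero>\<^bsub>restr V\<^esub> = \<zero>\<^bsub>V\<^esub>" "add (restr V) = add V"
  "c \<odot>\<^bsub>restr V\<^esub> x = sc c \<odot>\<^bsub>V\<^esub> x"
  by (auto simp: restr_def)

lemma sc_closed: "c \<in> carrier k \<Longrightarrow> sc c \<in> carrier A"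
  and sc_mult: "c \<in> carrier k \<Longrightarrow> x \<in> carrier A \<Longrightarrow> sc c \<otimes>\<^bsub>A\<^esub> x = c \<odot>\<^bsub>A\<^esub> x"
  and mult_sc: "c \<in> carrier k \<Longrightarrow> x \<in> carrier A \<Longrightarrow> x \<otimes>\<^bsub>A\<^esub> sc c = c \<odot>\<^bsub>A\<^esub> x"
  using left_module.smult_closed[OF A_left] by (auto simp: sc_def alg_mult)

lemma restr_left:
  assumes "left_module A V"
  shows "left_module k (restr V)"
proof -
  interpret V: left_module A V by fact
  interpret M: left_module k A by (rule A_left)
  have sl: "sc (c \<oplus> d) = sc c \<oplus>\<^bsub>A\<^esub> sc d" "sc (c \<otimes> d) = sc c \<otimes>\<^bsub>A\<^esub> sc d" "sc \<one> = \<one>\<^bsub>A\<^esub>"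
    if "c \<in> carrier k" "d \<in> carrier k" for c d
    using that by (auto simp: sc_mult sc_closed, auto simp: sc_def M.smult_l_distr M.smult_assoc M.smult_one)
  have "abelian_group (restr V)"
    by (rule abelian_group_cong[OF V.M_ag]) auto
  then show ?thesis
    using sl[OF one_closed one_closed]
    by (intro left_moduleI ring_axioms) (auto simp: sl sc_closed V.smult_closed V.smult_l_distr V.smult_r_distr V.smult_assoc V.smult_one)
qed

lemma restr_lsub: "lsub A V S \<Longrightarrow> lsub k (restr V) S"
  by (auto simp: lsub_def sc_closed)

text \<open>One direction of the adjunction between restriction and coinduction, Hom_k(V, J) =
  Hom_A(V, Hom_k(A, J)). The other direction evaluates at 1.\<close>

lemma lhom_dual:
  assumes V: "left_module A V" and h: "lhom k (restr V) J h"
  shows "lhom A V D (\<lambda>v. \<lambda>x\<in>carrier A. h (x \<odot>\<^bsub>V\<^esub> v))"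
proof -
  interpret V: left_module A V by fact
  note hc = lhom_closed[OF h, simplified] and ha = lhom_add[OF h, simplified]
    and hs = lhom_smult[OF h, simplified]
  show ?thesis
  proof (rule lhomI)
    fix v assume v: "v \<in> carrier V"
    have "lhom k A J (\<lambda>x. h (x \<odot>\<^bsub>V\<^esub> v))"
    proof (rule lhomI)
      fix c x assume "c \<in> carrier k" "x \<in> carrier A"
      then show "h ((c \<odot>\<^bsub>A\<^esub> x) \<odot>\<^bsub>V\<^esub> v) = c \<odot>\<^bsub>J\<^esub> h (x \<odot>\<^bsub>V\<^esub> v)"
        using v hs[of c "x \<odot>\<^bsub>V\<^esub> v"] by (simp add: sc_mult[symmetric] V.smult_assoc sc_closed V.smult_closed)
    qed (use v in \<open>auto simp: hc ha V.smult_closed V.smult_l_distr\<close>)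
    then show "(\<lambda>x\<in>carrier A. h (x \<odot>\<^bsub>V\<^esub> v)) \<in> carrier D"
      unfolding D_simps by (rule restrict_lmod_hom[OF A_left])
  qed (auto simp: D_simps ha V.smult_closed V.smult_r_distr V.smult_assoc intro!: restrict_ext)
qed

text \<open>Injectivity of D over A comes from injectivity of J over k: evaluate g at 1, extend over
  k, and transpose back.\<close>

lemma D_extend:
  assumes V: "left_module A V" and S: "lsub A V S" and g: "lhom A (V\<lparr>carrier := S\<rparr>) D g"
  shows "\<exists>h. lhom A V D h \<and> (\<forall>s\<in>S. h s = g s)"
proof -
  interpret V: left_module A V by fact
  note gc = lhom_closed[OF g, simplified] and ga = lhom_add[OF g, simplified] and gs = lhom_smult[OF g, simplified]
  have gl: "lhom k A J (g s)" if "s \<in> S" for s using gc[OF that] by (simp add: D_simps lmod_homD)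
  have gx: "g (x \<odot>\<^bsub>V\<^esub> s) \<one>\<^bsub>A\<^esub> = g s x" if "x \<in> carrier A" "s \<in> S" for x s
    using that by (simp add: gs D_simps)
  have "lhom k (restr V\<lparr>carrier := S\<rparr>) J (\<lambda>s. g s \<one>\<^bsub>A\<^esub>)"
  proof (rule lhomI)
    fix c s assume "c \<in> carrier k" "s \<in> carrier (restr V\<lparr>carrier := S\<rparr>)"
    then show "g (c \<odot>\<^bsub>restr V\<lparr>carrier := S\<rparr>\<^esub> s) \<one>\<^bsub>A\<^esub> = c \<odot>\<^bsub>J\<^esub> g s \<one>\<^bsub>A\<^esub>"
      using lhom_smult[OF gl, of s c "\<one>\<^bsub>A\<^esub>"] by (simp add: gx sc_closed, simp add: sc_def)
  qed (auto simp: ga D_simps lhom_closed[OF gl])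
  from lhom_extend[OF restr_left[OF V] restr_lsub[OF S] this]
  obtain h where h: "lhom k (restr V) J h" "\<And>s. s \<in> S \<Longrightarrow> h s = g s \<one>\<^bsub>A\<^esub>" by blast
  have "(\<lambda>x\<in>carrier A. h (x \<odot>\<^bsub>V\<^esub> s)) = g s" if s: "s \<in> S" for s
    using gc[OF s] h(2)[OF lsub_smult[OF S _ s]] gx[OF _ s]
    by (intro extensionalityI[of _ "carrier A"]) (auto simp: D_simps lmod_hom_iff)
  then show ?thesis using lhom_dual[OF V h(1)] by blast
qed

lemma D_cogenerator:
  assumes V: "left_module A V" "v \<in> carrier V" "v \<noteq> \<zero>\<^bsub>V\<^esub>"
  shows "\<exists>h. lhom A V D h \<and> h v \<noteq> \<zero>\<^bsub>D\<^esub>"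
proof -
  interpret V: left_module A V by fact
  obtain h where h: "lhom k (restr V) J h" "h v \<noteq> \<zero>\<^bsub>J\<^esub>"
    using cogenerator[OF restr_left[OF V(1)]] V(2,3) by auto
  let ?h = "\<lambda>v. \<lambda>x\<in>carrier A. h (x \<odot>\<^bsub>V\<^esub> v)"
  have "?h v \<one>\<^bsub>A\<^esub> \<noteq> \<zero>\<^bsub>D\<^esub> \<one>\<^bsub>A\<^esub>" using h(2) V(2) by (simp add: D_simps V.smult_one)
  then have "?h v \<noteq> \<zero>\<^bsub>D\<^esub>" by metis
  then show ?thesis using lhom_dual[OF V(1) h(1)] by blast
qed

text \<open>
  \<open>D\<close> embeds into a finite power of \<open>J\<close> by evaluation at generators of \<open>A\<close>.  As the socle of \<open>J\<close> is
  essential, the functions with values in the socle form an essential Artinian submodule.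
\<close>

lemma D_socle:
  obtains W where "artin k (restr D) W" "lsub k (restr D) W"
    "\<And>N. lsub k (restr D) N \<Longrightarrow> N \<inter> W \<subseteq> {\<zero>\<^bsub>D\<^esub>} \<Longrightarrow> N \<subseteq> {\<zero>\<^bsub>D\<^esub>}"
proof -
  obtain w where w: "w \<in> carrier J"
    "\<And>N. lsub k J N \<Longrightarrow> N \<noteq> {\<zero>\<^bsub>J\<^esub>} \<Longrightarrow> \<exists>c\<in>carrier k. c \<odot>\<^bsub>J\<^esub> w \<in> N \<and> c \<odot>\<^bsub>J\<^esub> w \<noteq> \<zero>\<^bsub>J\<^esub>"
    using socle_generator by metis
  let ?K = "(\<lambda>c. c \<odot>\<^bsub>J\<^esub> w) ` carrier k"
  have K: "lsub k J ?K" by (rule lsub_cyclic[OF J_left w(1)])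
  obtain X where X: "finite X" "X \<subseteq> carrier A" "\<And>S. lsub k A S \<Longrightarrow> X \<subseteq> S \<Longrightarrow> S = carrier A"
    using A_fin_gen unfolding fin_gen_iff[OF A_left] by blast
  note rl = restr_left[OF D_left]
  have ev: "lhom k (restr D) J (\<lambda>f. f z)" if z: "z \<in> carrier A" for z
  proof (rule lhomI)
    fix c f assume "c \<in> carrier k" "f \<in> carrier (restr D)"
    then show "(c \<odot>\<^bsub>restr D\<^esub> f) z = c \<odot>\<^bsub>J\<^esub> f z"
      using z lhom_smult[of k A J f c z] by (simp add: D_simps lmod_homD mult_sc)
  qed (use z in \<open>auto simp: D_simps lmod_hom_closed\<close>)
  have zero: "f = \<zero>\<^bsub>D\<^esub>" if f: "f \<in> carrier D" "\<And>x. x \<in> X \<Longrightarrow> f x = \<zero>\<^bsub>J\<^esub>" for f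
  proof -
    have fl: "lhom k A J f" "f \<in> extensional (carrier A)" using f(1) by (auto simp: D_simps lmod_hom_iff)
    have "{x \<in> carrier A. f x = \<zero>\<^bsub>J\<^esub>} = carrier A"
      by (rule X(3)[OF lsub_ker[OF A_left J_left fl(1)]]) (use f(2) X(2) in auto)
    then show ?thesis using fl(2) by (intro extensionalityI[of _ "carrier A"]) (auto simp: D_simps)
  qed
  \<comment> \<open>On the generators X, these functions take values in the socle k w and vanish on
    Y. For Y = X only zero is left. Releasing one generator z from Y enlarges W by at most a
    submodule of k w, seen through evaluation at z.\<close>
  define W where "W = (\<lambda>Y. {f \<in> carrier D. (\<forall>x\<in>X. f x \<in> ?K) \<and> (\<forall>x\<in>Y. f x = \<zero>\<^bsub>J\<^esub>)})"
  have "artin k (restr D) (W (X - Z))" if "finite Z" "Z \<subseteq> X" for Z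
    using that
  proof induction
    case empty
    have W0: "W X \<subseteq> {\<zero>\<^bsub>restr D\<^esub>}" using zero by (auto simp: W_def)
    show ?case
      unfolding artin_def Diff_empty
    proof (intro allI impI exI)
      fix S n m assume S: "\<forall>n. lsub k (restr D) (S n) \<and> S n \<subseteq> W X \<and> S (Suc n) \<subseteq> S n"
      have "S n = {\<zero>\<^bsub>restr D\<^esub>}" for n
      proof
        show "S n \<subseteq> {\<zero>\<^bsub>restr D\<^esub>}" using S W0 by (meson order_trans)
        show "{\<zero>\<^bsub>restr D\<^esub>} \<subseteq> S n" using S lsub_zero by (metis empty_subsetI insert_subset)
      qed
      then show "S m = S 0" by simp
    qed
  next
    case (insert z Z)
    have z: "z \<in> carrier A" using insert.prems X(2) by blast
    show ?case
    proof (rule artin_step[OF rl J_left ev[OF z]])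
      show "artin k (restr D) {f \<in> W (X - insert z Z). f z = \<zero>\<^bsub>J\<^esub>}"
        by (rule artin_mono[OF insert.IH]) (use insert.prems in \<open>auto simp: W_def\<close>)
      show "(\<lambda>f. f z) ` W (X - insert z Z) \<subseteq> ?K" using insert.prems by (auto simp: W_def)
    qed (rule artin_cyclic[OF J_left w(1)])
  qed
  from this[OF X(1) order_refl] have art: "artin k (restr D) (W {})" by simp
  have sub: "lsub k (restr D) (W {})"
  proof (rule lsubI)
    show "\<zero>\<^bsub>restr D\<^esub> \<in> W {}" using X(2) lsub_zero[OF K] D.zero_closed by (auto simp: W_def D_simps)
    fix f assume f: "f \<in> W {}"
    show "c \<odot>\<^bsub>restr D\<^esub> f \<in> W {}" if "c \<in> carrier k" for c
      using f that lhom_smult[OF ev that, of _ f] lsub_smult[OF K that] X(2) D.smult_closed[OF sc_closed]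
      by (auto simp: W_def simp del: restr_simps(4) simp add: restr_simps(4)[symmetric])
    show "f \<oplus>\<^bsub>restr D\<^esub> g \<in> W {}" if "g \<in> W {}" for g
      using f that lhom_add[OF ev, of _ f g] lsub_add[OF K] X(2) by (auto simp: W_def)
  qed (auto simp: W_def)
  have "N \<subseteq> {\<zero>\<^bsub>D\<^esub>}" if N: "lsub k (restr D) N" and NW: "N \<inter> W {} \<subseteq> {\<zero>\<^bsub>D\<^esub>}" for N
  proof (rule ccontr)
    assume nz: "\<not> N \<subseteq> {\<zero>\<^bsub>D\<^esub>}"
    \<comment> \<open>Generators are treated one at a time: as k w is essential, f is multiplied by
      a scalar that brings its value at z into k w without killing it. The values already in k w
      stay there.\<close>
    have "\<exists>f\<in>N. f \<noteq> \<zero>\<^bsub>D\<^esub> \<and> (\<forall>x\<in>Y. f x \<in> ?K)" if "finite Y" "Y \<subseteq> X" for Y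
      using that
    proof induction
      case empty
      then show ?case using nz by blast
    next
      case (insert z Y)
      then obtain f where f: "f \<in> N" "f \<noteq> \<zero>\<^bsub>D\<^esub>" "\<And>x. x \<in> Y \<Longrightarrow> f x \<in> ?K" by blast
      have z: "z \<in> carrier A" and YA: "Y \<subseteq> carrier A" using insert.prems X(2) by auto
      have fD: "f \<in> carrier (restr D)" using lsub_subset[OF N f(1)] .
      have fz: "f z \<in> carrier J" using lhom_closed[OF ev[OF z] fD] .
      show ?case
      proof (cases "f z = \<zero>\<^bsub>J\<^esub>")
        case True
        then show ?thesis using f lsub_zero[OF K] by auto
      next
        case False
        then have "(\<lambda>c. c \<odot>\<^bsub>J\<^esub> f z) ` carrier k \<noteq> {\<zero>\<^bsub>J\<^esub>}" using cyclic_mem[OF J_left fz] by blast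
        then obtain c d where c: "c \<in> carrier k" "d \<in> carrier k" "c \<odot>\<^bsub>J\<^esub> w = d \<odot>\<^bsub>J\<^esub> f z" "c \<odot>\<^bsub>J\<^esub> w \<noteq> \<zero>\<^bsub>J\<^esub>"
          using w(2)[OF lsub_cyclic[OF J_left fz]] by blast
        let ?f = "d \<odot>\<^bsub>restr D\<^esub> f"
        have e: "?f x = d \<odot>\<^bsub>J\<^esub> f x" if "x \<in> carrier A" for x by (rule lhom_smult[OF ev[OF that] c(2) fD])
        have "?f z \<noteq> \<zero>\<^bsub>D\<^esub> z" using e[OF z] c(3,4) z by (simp add: D_simps)
        then have "?f \<noteq> \<zero>\<^bsub>D\<^esub>" by metis
        moreover have "?f x \<in> ?K" if x: "x \<in> insert z Y" for x
        proof (cases "x = z")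
          case True
          then show ?thesis using e[OF z] c(1,3) by (metis image_eqI)
        next
          case False
          then have "x \<in> Y" using x by simp
          then show ?thesis using e[of x] YA lsub_smult[OF K c(2) f(3)] by auto
        qed
        ultimately show ?thesis using lsub_smult[OF N c(2) f(1)] by blast
      qed
    qed
    from this[OF X(1) order_refl] obtain f where "f \<in> N" "f \<noteq> \<zero>\<^bsub>D\<^esub>" "\<forall>x\<in>X. f x \<in> ?K" by blast
    moreover have "f \<in> carrier D" using lsub_subset[OF N \<open>f \<in> N\<close>] by simp
    ultimately show False using NW by (auto simp: W_def)
  qed
  from that[OF art sub this] show thesis .
qed

text \<open>Consider joint kernels of finitely many maps D \<rightarrow> Z, intersected with the
  essential Artinian W. A minimal intersection is zero, since a nonzero element in it would be
  detected by one more map. So finitely many maps are jointly injective on D, and injectivity of D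
  splits the resulting embedding into a power of Z.\<close>

lemma in_add_of_cogenerating:
  assumes Z: "left_module A Z"
    and cog: "\<And>x. x \<in> carrier D \<Longrightarrow> x \<noteq> \<zero>\<^bsub>D\<^esub> \<Longrightarrow> \<exists>h. lhom A D Z h \<and> h x \<noteq> \<zero>\<^bsub>Z\<^esub>"
  shows "in_add A Z D"
proof -
  obtain W where W: "artin k (restr D) W" "lsub k (restr D) W"
    "\<And>N. lsub k (restr D) N \<Longrightarrow> N \<inter> W \<subseteq> {\<zero>\<^bsub>D\<^esub>} \<Longrightarrow> N \<subseteq> {\<zero>\<^bsub>D\<^esub>}"
    by (rule D_socle) (rule that, assumption+)
  define ker where "ker = (\<lambda>(n::nat) h. {x \<in> carrier D. \<forall>i<n. h i x = \<zero>\<^bsub>Z\<^esub>})"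
  let ?S = "{ker n h \<inter> W | n h. \<forall>i<n. lhom A D Z (h i)}"
  have ks: "ker (Suc n) (h(n := f)) = ker n h \<inter> {x \<in> carrier D. f x = \<zero>\<^bsub>Z\<^esub>}" for n h f
    by (auto simp: ker_def less_Suc_eq)
  have lk: "lsub A D (ker n h)" if "\<forall>i<n. lhom A D Z (h i)" for n h
    using that
  proof (induction n)
    case 0
    then show ?case using lsub_carrier[OF D_left] by (simp add: ker_def)
  next
    case (Suc n)
    then show ?case
      using lsub_Int[OF Suc.IH lsub_ker[OF D_left Z, of "h n"]] ks[of n h "h n"] by simp
  qed
  have "\<exists>K\<in>?S. \<forall>T\<in>?S. T \<subseteq> K \<longrightarrow> T = K"
  proof (rule artin_min[OF W(1)])
    show "ker 0 (\<lambda>_. undefined) \<inter> W \<in> ?S" by blast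
    fix K assume "K \<in> ?S"
    then obtain n h where K: "K = ker n h \<inter> W" "\<forall>i<n. lhom A D Z (h i)" by blast
    show "lsub k (restr D) K \<and> K \<subseteq> W" unfolding K(1) using lsub_Int[OF restr_lsub[OF lk[OF K(2)]] W(2)] by simp
  qed
  then obtain K where K: "K \<in> ?S" and mK: "\<forall>T\<in>?S. T \<subseteq> K \<longrightarrow> T = K" by (elim bexE)
  from K obtain n h where h: "\<forall>i<n. lhom A D Z (h i)" and Kn: "K = ker n h \<inter> W" by blast
  have "x = \<zero>\<^bsub>D\<^esub>" if x: "x \<in> ker n h \<inter> W" for x
  proof (rule ccontr)
    assume "x \<noteq> \<zero>\<^bsub>D\<^esub>"
    moreover have "x \<in> carrier D" using x by (simp add: ker_def)
    ultimately obtain f where f: "lhom A D Z f" "f x \<noteq> \<zero>\<^bsub>Z\<^esub>" using cog by blast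
    have "\<forall>i<Suc n. lhom A D Z ((h(n := f)) i)" using h f(1) by (simp add: less_Suc_eq)
    then have m: "ker (Suc n) (h(n := f)) \<inter> W \<in> ?S" by blast
    have "ker (Suc n) (h(n := f)) \<inter> W = K" by (rule bspec[OF mK m, rule_format]) (auto simp: ks Kn)
    then show False using x f(2) by (auto simp: ks Kn)
  qed
  then have "ker n h \<inter> W \<subseteq> {\<zero>\<^bsub>D\<^esub>}" by blast
  from W(3)[OF restr_lsub[OF lk[OF h]] this] have k0: "ker n h \<subseteq> {\<zero>\<^bsub>D\<^esub>}" .
  have "\<exists>g. (\<forall>i<n. lhom A Z D (g i)) \<and> (\<forall>v\<in>carrier D. v = finsum D (\<lambda>i. g i (h i v)) {..<n})"
  proof (rule factor_through_jointly_injective[OF Z D_left D_extend[OF Z] D_left lhom_id])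
    show "v = \<zero>\<^bsub>D\<^esub>" if "v \<in> carrier D" "\<forall>i<n. h i v = \<zero>\<^bsub>Z\<^esub>" for v using k0 that by (auto simp: ker_def)
  qed (use h in auto)
  then obtain g where g: "\<And>i. i < n \<Longrightarrow> lhom A Z D (g i)"
    "\<And>v. v \<in> carrier D \<Longrightarrow> v = finsum D (\<lambda>i. g i (h i v)) {..<n}" by blast
  have "fac A Z D D (\<lambda>v. finsum D (\<lambda>i. g i (h i v)) {..<n})"
    by (rule fac_finsum[OF D_left D_left]) (use h g(1) in auto)
  then show ?thesis unfolding in_add_def by (rule fac_cong) (use g(2) in simp)
qed

end

text \<open>As 1 is a finite sum of values b(t_i, s_i), a nonzero x in D(R) has some s_i \<otimes> x
  nonzero in Hom_R(U, D(R)). Since D(S) cogenerates, a map into D(S) detects this element, and its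
  transpose D(R) \<rightarrow> Hom_S(V, D(S)) detects x.\<close>

lemma in_add_dual:
  fixes R :: "('k, 'r, 'a) module_scheme" and S :: "('l, 's, 'b) module_scheme"
  assumes "dual_pair R S U V b m u v" and dR: "algebra_duality kR JR W R" and dS: "algebra_duality kS JS W' S"
    and st: "\<And>i. i < n \<Longrightarrow> t i \<in> carrier U \<and> s i \<in> carrier V"
    and one: "finsum R (\<lambda>i. b (t i) (s i)) {..<n::nat} = \<one>\<^bsub>R\<^esub>"
  shows "in_add R (hom_mod S V (dual_of_algebra kS JS S)) (dual_of_algebra kR JR R)"
proof -
  interpret dual_pair R S U V b m u v by fact
  interpret DR: algebra_duality kR JR W R by (rule dR)
  interpret DS: algebra_duality kS JS W' S by (rule dS)
  have GD: "left_module R (hom_mod S V DS.D)" by (rule left_module_G[OF DS.D_left])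
  have FD: "left_module S (hom_mod R U DR.D)" by (rule left_module_F[OF DR.D_left])
  show ?thesis
  proof (rule DR.in_add_of_cogenerating[OF GD])
    fix x assume x: "x \<in> carrier DR.D" "x \<noteq> \<zero>\<^bsub>DR.D\<^esub>"
    have "\<exists>i<n. unit DR.D x (s i) \<noteq> \<zero>\<^bsub>hom_mod R U DR.D\<^esub>"
    proof (rule ccontr)
      assume no: "\<not> ?thesis"
      have z: "b (t i) (s i) \<odot>\<^bsub>DR.D\<^esub> x = \<zero>\<^bsub>DR.D\<^esub>" if "i < n" for i
      proof -
        have "unit DR.D x (s i) (t i) = \<zero>\<^bsub>hom_mod R U DR.D\<^esub> (t i)" using no that by auto
        then show ?thesis using st[OF that] by (simp add: tens_apply)
      qed
      have "x = finsum R (\<lambda>i. b (t i) (s i)) {..<n} \<odot>\<^bsub>DR.D\<^esub> x" using x by (simp add: one DR.D.smult_one)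
      also have "\<dots> = finsum DR.D (\<lambda>i. b (t i) (s i) \<odot>\<^bsub>DR.D\<^esub> x) {..<n}"
        by (rule DR.D.smult_finsum_l) (use x st b_closed in auto)
      also have "\<dots> = finsum DR.D (\<lambda>i. \<zero>\<^bsub>DR.D\<^esub>) {..<n}" by (rule DR.D.finsum_cong') (use z in auto)
      also have "\<dots> = \<zero>\<^bsub>DR.D\<^esub>" by simp
      finally show False using x(2) by simp
    qed
    then obtain i where i: "i < n" "unit DR.D x (s i) \<noteq> \<zero>\<^bsub>hom_mod R U DR.D\<^esub>" by blast
    have "unit DR.D x (s i) \<in> carrier (hom_mod R U DR.D)"
      using tens_closed[OF DR.D_left x(1)] st[OF i(1)] by simp
    from DS.D_cogenerator[OF FD this i(2)]
    obtain h where h: "lhom S (hom_mod R U DR.D) DS.D h" "h (unit DR.D x (s i)) \<noteq> \<zero>\<^bsub>DS.D\<^esub>" by blast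
    have "lhom R DR.D (hom_mod S V DS.D) (\<lambda>x. hmap V h (unit DR.D x))"
      by (rule lhom_comp[OF lhom_unit[OF DR.D_left] lhom_hmap[OF V h(1)]])
    moreover have "hmap V h (unit DR.D x) (s i) \<noteq> \<zero>\<^bsub>hom_mod S V DS.D\<^esub> (s i)"
      using h(2) st[OF i(1)] by simp
    then have "hmap V h (unit DR.D x) \<noteq> \<zero>\<^bsub>hom_mod S V DS.D\<^esub>" by metis
    ultimately show "\<exists>h. lhom R DR.D (hom_mod S V DS.D) h \<and> h x \<noteq> \<zero>\<^bsub>hom_mod S V DS.D\<^esub>" by blast
  qed
qed

section \<open>Tensor products\<close>

definition balanced ::
  "('s, 'q) ring_scheme \<Rightarrow> ('r, 'p, 's, 'm) bimodule_scheme \<Rightarrow> ('s, 'x, 'n) module_scheme \<Rightarrow>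
   ('z, 'o) ring_scheme \<Rightarrow> ('p \<Rightarrow> 'x \<Rightarrow> 'z) \<Rightarrow> bool"
  where "balanced S P X Z \<beta> \<longleftrightarrow>
    (\<forall>p\<in>carrier P. addhom X Z (\<beta> p)) \<and> (\<forall>x\<in>carrier X. addhom P Z (\<lambda>p. \<beta> p x)) \<and>
    (\<forall>p\<in>carrier P. \<forall>s\<in>carrier S. \<forall>x\<in>carrier X. \<beta> (rsmult P p s) x = \<beta> p (s \<odot>\<^bsub>X\<^esub> x))"

locale tensor_pair =
  fixes R :: "('r, 'q1) ring_scheme" and S :: "('s, 'q2) ring_scheme"
    and P :: "('r, 'p, 's, 'm) bimodule_scheme" and X :: "('s, 'x, 'n) module_scheme"
  assumes P: "is_bimodule R S P" and X: "left_module S X"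
begin

sublocale P: left_module R P by (rule bimodule_left[OF P])
sublocale X: left_module S X by (rule X)

abbreviation "Fr \<equiv> free_Abelian_group (carrier P \<times> carrier X)"
abbreviation "N \<equiv> tensor_null S P X"
abbreviation "T \<equiv> tensor_group S P X"
abbreviation "pt \<equiv> pure_tensor S P X"

sublocale Fr: comm_group Fr by (rule abelian_free_Abelian_group)

lemma rels_sub: "tensor_rels S P X \<subseteq> carrier Fr"
proof -
  have 3: "frag_of a - frag_of b - frag_of c \<in> carrier Fr" if "{a, b, c} \<subseteq> carrier P \<times> carrier X" for a b c
    using that keys_diff[of "frag_of a" "frag_of b"] keys_diff[of "frag_of a - frag_of b" "frag_of c"] by auto
  have 2: "frag_of a - frag_of b \<in> carrier Fr" if "{a, b} \<subseteq> carrier P \<times> carrier X" for a b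
    using that keys_diff[of "frag_of a" "frag_of b"] by auto
  show ?thesis
    unfolding tensor_rels_def using rsmult_closed[OF P] X.smult_closed
    by (intro Un_least subsetI) (elim CollectE exE conjE, simp only:, rule 2 3, simp)+
qed

lemma N_sub: "subgroup N Fr"
  unfolding tensor_null_def by (rule Fr.generate_is_subgroup[OF rels_sub])

sublocale N: normal N Fr by (rule Fr.subgroup_imp_normal[OF N_sub])

lemma T_simps:
  "carrier T = (\<lambda>c. N #>\<^bsub>Fr\<^esub> c) ` carrier Fr" "\<zero>\<^bsub>T\<^esub> = N #>\<^bsub>Fr\<^esub> 0"
  "\<lbrakk>c \<in> carrier Fr; d \<in> carrier Fr\<rbrakk> \<Longrightarrow> (N #>\<^bsub>Fr\<^esub> c) \<oplus>\<^bsub>T\<^esub> (N #>\<^bsub>Fr\<^esub> d) = N #>\<^bsub>Fr\<^esub> (c + d)"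
  using Fr.coset_mult_one[OF N.subset] N.rcos_sum[of c d]
  by (auto simp: tensor_group_def Let_def carrier_FactGroup)

lemma minus_closed: "c \<in> carrier Fr \<Longrightarrow> - c \<in> carrier Fr"
  by simp

lemma coset_eq:
  assumes "a \<in> carrier Fr" "b \<in> carrier Fr" "a - b \<in> N"
  shows "N #>\<^bsub>Fr\<^esub> a = N #>\<^bsub>Fr\<^esub> b"
  using Fr.coset_mult_assoc[OF N.subset N.mem_carrier[OF assms(3)] assms(2)]
    Fr.coset_join2[OF N.mem_carrier[OF assms(3)] N_sub assms(3)] by simp

lemma T_ag: "abelian_group T"
proof (rule abelian_groupI)
  fix v assume v: "v \<in> carrier T"
  then obtain c where c: "c \<in> carrier Fr" "v = N #>\<^bsub>Fr\<^esub> c" by (auto simp: T_simps)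
  have zc: "(0 :: ('p \<times> 'x) \<Rightarrow>\<^sub>0 int) \<in> carrier Fr" by simp
  show "\<zero>\<^bsub>T\<^esub> \<oplus>\<^bsub>T\<^esub> v = v" unfolding c(2) T_simps(2) T_simps(3)[OF zc c(1)] by simp
  show "\<exists>w\<in>carrier T. w \<oplus>\<^bsub>T\<^esub> v = \<zero>\<^bsub>T\<^esub>"
  proof
    show "N #>\<^bsub>Fr\<^esub> (- c) \<in> carrier T" unfolding T_simps by (rule imageI) (rule minus_closed[OF c(1)])
    show "(N #>\<^bsub>Fr\<^esub> (- c)) \<oplus>\<^bsub>T\<^esub> v = \<zero>\<^bsub>T\<^esub>"
      unfolding c(2) T_simps(2) T_simps(3)[OF minus_closed[OF c(1)] c(1)] by simp
  qed
  fix w assume "w \<in> carrier T"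
  then obtain d where d: "d \<in> carrier Fr" "w = N #>\<^bsub>Fr\<^esub> d" by (auto simp: T_simps)
  note cd = Fr.m_closed[OF c(1) d(1), simplified mult_free_Abelian_group]
  show "v \<oplus>\<^bsub>T\<^esub> w \<in> carrier T" unfolding c(2) d(2) T_simps(3)[OF c(1) d(1)] using cd by (auto simp: T_simps(1))
  show "v \<oplus>\<^bsub>T\<^esub> w = w \<oplus>\<^bsub>T\<^esub> v"
    unfolding c(2) d(2) T_simps(3)[OF c(1) d(1)] T_simps(3)[OF d(1) c(1)] by (simp add: add.commute)
  fix u assume "u \<in> carrier T"
  then obtain e where e: "e \<in> carrier Fr" "u = N #>\<^bsub>Fr\<^esub> e" by (auto simp: T_simps)
  note de = Fr.m_closed[OF d(1) e(1), simplified mult_free_Abelian_group]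
  show "v \<oplus>\<^bsub>T\<^esub> w \<oplus>\<^bsub>T\<^esub> u = v \<oplus>\<^bsub>T\<^esub> (w \<oplus>\<^bsub>T\<^esub> u)"
    unfolding c(2) d(2) e(2) T_simps(3)[OF c(1) d(1)] T_simps(3)[OF d(1) e(1)] T_simps(3)[OF cd e(1)]
      T_simps(3)[OF c(1) de] by (simp add: add.assoc)
next
  show "\<zero>\<^bsub>T\<^esub> \<in> carrier T" unfolding T_simps by (rule imageI) simp
qed

sublocale T: abelian_group T by (rule T_ag)

lemma fr: "p \<in> carrier P \<Longrightarrow> x \<in> carrier X \<Longrightarrow> frag_of (p, x) \<in> carrier Fr"
  by simp

lemma pt_closed: "p \<in> carrier P \<Longrightarrow> x \<in> carrier X \<Longrightarrow> pt p x \<in> carrier T"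
  unfolding pure_tensor_def T_simps by (rule imageI) (rule fr)

lemma pt_sum:
  assumes "a \<in> carrier P \<times> carrier X" "b \<in> carrier P \<times> carrier X" "c \<in> carrier P \<times> carrier X"
    and "frag_of a - frag_of b - frag_of c \<in> tensor_rels S P X"
  shows "N #>\<^bsub>Fr\<^esub> frag_of a = (N #>\<^bsub>Fr\<^esub> frag_of b) \<oplus>\<^bsub>T\<^esub> (N #>\<^bsub>Fr\<^esub> frag_of c)"
proof -
  have f: "frag_of a \<in> carrier Fr" "frag_of b \<in> carrier Fr" "frag_of c \<in> carrier Fr" using assms by auto
  have "frag_of a - (frag_of b + frag_of c) \<in> N"
    unfolding tensor_null_def using generate.incl[OF assms(4), of Fr] by (simp add: algebra_simps)
  then show ?thesis unfolding T_simps(3)[OF f(2,3)]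
    by (intro coset_eq f Fr.m_closed[OF f(2,3), simplified mult_free_Abelian_group])
qed

lemma pt_add_l: "\<lbrakk>p \<in> carrier P; p' \<in> carrier P; x \<in> carrier X\<rbrakk> \<Longrightarrow> pt (p \<oplus>\<^bsub>P\<^esub> p') x = pt p x \<oplus>\<^bsub>T\<^esub> pt p' x"
  unfolding pure_tensor_def by (rule pt_sum) (auto simp: tensor_rels_def)

lemma pt_add_r: "\<lbrakk>p \<in> carrier P; x \<in> carrier X; x' \<in> carrier X\<rbrakk> \<Longrightarrow> pt p (x \<oplus>\<^bsub>X\<^esub> x') = pt p x \<oplus>\<^bsub>T\<^esub> pt p x'"
  unfolding pure_tensor_def by (rule pt_sum) (auto simp: tensor_rels_def)

lemma pt_balanced:
  assumes "p \<in> carrier P" "s \<in> carrier S" "x \<in> carrier X"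
  shows "pt (rsmult P p s) x = pt p (s \<odot>\<^bsub>X\<^esub> x)"
  unfolding pure_tensor_def
proof (intro coset_eq fr)
  have "frag_of (rsmult P p s, x) - frag_of (p, s \<odot>\<^bsub>X\<^esub> x) \<in> tensor_rels S P X"
    unfolding tensor_rels_def using assms by blast
  then show "frag_of (rsmult P p s, x) - frag_of (p, s \<odot>\<^bsub>X\<^esub> x) \<in> N"
    unfolding tensor_null_def by (rule generate.incl)
qed (use assms rsmult_closed[OF P] X.smult_closed in auto)

lemma pt_addhoms:
  "p \<in> carrier P \<Longrightarrow> addhom X T (pt p)" "x \<in> carrier X \<Longrightarrow> addhom P T (\<lambda>p. pt p x)"
  by (auto intro!: addhomI simp: pt_closed pt_add_l pt_add_r)

lemma pt_neg: "p \<in> carrier P \<Longrightarrow> x \<in> carrier X \<Longrightarrow> pt (\<ominus>\<^bsub>P\<^esub> p) x = \<ominus>\<^bsub>T\<^esub> pt p x"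
  using addhom_neg[OF P.M_ag T_ag pt_addhoms(2)] .

text \<open>Induction on the free abelian group produces differences. Strengthening the claim to c
  and -c, and absorbing signs by -(p \<otimes> x) = (-p) \<otimes> x, leaves only zero, pure tensors
  and sums to the user.\<close>

lemma tensor_induct [consumes 1, case_names zero pure add]:
  assumes w: "w \<in> carrier T" and zero: "Q \<zero>\<^bsub>T\<^esub>"
    and pure: "\<And>p x. p \<in> carrier P \<Longrightarrow> x \<in> carrier X \<Longrightarrow> Q (pt p x)"
    and add: "\<And>v w. \<lbrakk>v \<in> carrier T; w \<in> carrier T; Q v; Q w\<rbrakk> \<Longrightarrow> Q (v \<oplus>\<^bsub>T\<^esub> w)"
  shows "Q w"
proof -
  have cT: "N #>\<^bsub>Fr\<^esub> c \<in> carrier T" if "c \<in> carrier Fr" for c using that by (auto simp: T_simps(1))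
  have inv: "N #>\<^bsub>Fr\<^esub> (- c) = \<ominus>\<^bsub>T\<^esub> (N #>\<^bsub>Fr\<^esub> c)" if c: "c \<in> carrier Fr" for c
  proof -
    have "(N #>\<^bsub>Fr\<^esub> (- c)) \<oplus>\<^bsub>T\<^esub> (N #>\<^bsub>Fr\<^esub> c) = \<zero>\<^bsub>T\<^esub>"
      unfolding T_simps(2) T_simps(3)[OF minus_closed[OF c] c] by simp
    then show ?thesis using cT c minus_closed T.minus_equality by metis
  qed
  have "Q (N #>\<^bsub>Fr\<^esub> c) \<and> Q (N #>\<^bsub>Fr\<^esub> (- c))" if c: "Poly_Mapping.keys c \<subseteq> carrier P \<times> carrier X" for c
    using c
  proof (rule free_Abelian_group_induct)
    show "Q (N #>\<^bsub>Fr\<^esub> 0) \<and> Q (N #>\<^bsub>Fr\<^esub> (- 0))" using zero by (simp add: T_simps(2))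
  next
    fix c d assume 2: "Poly_Mapping.keys c \<subseteq> carrier P \<times> carrier X" "Poly_Mapping.keys d \<subseteq> carrier P \<times> carrier X"
      "Q (N #>\<^bsub>Fr\<^esub> c) \<and> Q (N #>\<^bsub>Fr\<^esub> (- c))" "Q (N #>\<^bsub>Fr\<^esub> d) \<and> Q (N #>\<^bsub>Fr\<^esub> (- d))"
    have m: "Q (N #>\<^bsub>Fr\<^esub> (c - d))" if "Poly_Mapping.keys c \<subseteq> carrier P \<times> carrier X"
      "Poly_Mapping.keys d \<subseteq> carrier P \<times> carrier X" "Q (N #>\<^bsub>Fr\<^esub> c)" "Q (N #>\<^bsub>Fr\<^esub> (- d))" for c d
    proof -
      have cd: "c \<in> carrier Fr" "- d \<in> carrier Fr" using that by auto
      show ?thesis using add[OF cT[OF cd(1)] cT[OF cd(2)] that(3,4)] unfolding T_simps(3)[OF cd] by simp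
    qed
    show "Q (N #>\<^bsub>Fr\<^esub> (c - d)) \<and> Q (N #>\<^bsub>Fr\<^esub> (- (c - d)))" using m[OF 2(1,2)] m[OF 2(2,1)] 2(3,4) by simp
  next
    fix a assume "a \<in> carrier P \<times> carrier X"
    then obtain p x where px: "a = (p, x)" "p \<in> carrier P" "x \<in> carrier X" by auto
    have "N #>\<^bsub>Fr\<^esub> (- frag_of a) = pt (\<ominus>\<^bsub>P\<^esub> p) x"
      unfolding pt_neg[OF px(2,3)] px(1) inv[OF fr[OF px(2,3)]] by (simp add: pure_tensor_def)
    then show "Q (N #>\<^bsub>Fr\<^esub> frag_of a) \<and> Q (N #>\<^bsub>Fr\<^esub> (- frag_of a))" using pure[OF px(2,3)] pure[of "\<ominus>\<^bsub>P\<^esub> p" x] px by (simp add: pure_tensor_def)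
  qed
  then show ?thesis using w by (auto simp: T_simps(1))
qed

lemma tensor_sum:
  assumes "w \<in> carrier T"
  shows "\<exists>(n::nat) p x. (\<forall>i<n. p i \<in> carrier P \<and> x i \<in> carrier X) \<and> w = finsum T (\<lambda>i. pt (p i) (x i)) {..<n}"
  using assms
proof (induction rule: tensor_induct)
  case zero
  show ?case by (intro exI[of _ 0]) simp
next
  case (pure p x)
  then show ?case
    by (intro exI[of _ "Suc 0"] exI[of _ "\<lambda>_. p"] exI[of _ "\<lambda>_. x"]) (simp add: lessThan_Suc pt_closed)
next
  case (add v w)
  obtain n :: nat and p x where v: "\<And>i. i < n \<Longrightarrow> p i \<in> carrier P \<and> x i \<in> carrier X"
    "v = finsum T (\<lambda>i. pt (p i) (x i)) {..<n}" using add.IH(1) by blast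
  obtain m :: nat and q y where w: "\<And>i. i < m \<Longrightarrow> q i \<in> carrier P \<and> y i \<in> carrier X"
    "w = finsum T (\<lambda>i. pt (q i) (y i)) {..<m}" using add.IH(2) by blast
  let ?p = "\<lambda>i. if i < n then p i else q (i - n)" and ?x = "\<lambda>i. if i < n then x i else y (i - n)"
  have cl: "?p i \<in> carrier P \<and> ?x i \<in> carrier X" if "i < n + m" for i using that v(1) w(1) by auto
  have vT: "pt (p i) (x i) \<in> carrier T" if "i < n" for i using pt_closed v(1)[OF that] by blast
  have wT: "pt (q i) (y i) \<in> carrier T" if "i < m" for i using pt_closed w(1)[OF that] by blast
  have "finsum T (\<lambda>i. pt (?p i) (?x i)) ({..<n} \<union> (\<lambda>i. n + i) ` {..<m}) = v \<oplus>\<^bsub>T\<^esub> w"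
  proof (subst T.finsum_Un_disjoint)
    have "finsum T (\<lambda>i. pt (?p i) (?x i)) {..<n} = v"
      unfolding v(2) by (rule T.finsum_cong') (use vT in auto)
    moreover have "finsum T (\<lambda>i. pt (?p i) (?x i)) ((\<lambda>i. n + i) ` {..<m}) = w"
      unfolding w(2) by (subst T.finsum_reindex) (use wT in \<open>auto simp: inj_on_def\<close>)
    ultimately show "finsum T (\<lambda>i. pt (?p i) (?x i)) {..<n} \<oplus>\<^bsub>T\<^esub>
      finsum T (\<lambda>i. pt (?p i) (?x i)) ((\<lambda>i. n + i) ` {..<m}) = v \<oplus>\<^bsub>T\<^esub> w" by simp
  qed (use vT wT in auto)
  moreover have "{..<n} \<union> (\<lambda>i. n + i) ` {..<m} = {..<n + m}"
    using image_add_atLeastLessThan[of n 0 m] by (auto simp: lessThan_atLeast0)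
  ultimately show ?case using cl by (intro exI[of _ "n + m"] exI[of _ ?p] exI[of _ ?x]) simp
qed

lemma addhom_eq:
  assumes "abelian_group Z" "addhom T Z f" "addhom T Z g" "w \<in> carrier T"
    and "\<And>p x. p \<in> carrier P \<Longrightarrow> x \<in> carrier X \<Longrightarrow> f (pt p x) = g (pt p x)"
  shows "f w = g w"
  using assms(4)
  by (induction rule: tensor_induct)
    (simp_all add: assms(5) addhom_zero[OF T_ag assms(1,2)] addhom_zero[OF T_ag assms(1,3)]
      addhom_add[OF assms(2)] addhom_add[OF assms(3)])

context
  fixes Z :: "('z, 'o) ring_scheme" and \<beta> :: "'p \<Rightarrow> 'x \<Rightarrow> 'z"
  assumes Z: "abelian_group Z" and \<beta>: "balanced S P X Z \<beta>"
begin

interpretation Z: abelian_group Z by (rule Z)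

text \<open>The value on a representative, as it occurs in \<open>tensor_lift\<close>.
  \<open>val_null\<close> makes it constant on cosets, so that \<open>the_elem\<close> there is
  applied to a singleton.\<close>

definition val :: "('p \<times> 'x \<Rightarrow>\<^sub>0 int) \<Rightarrow> 'z"
  where "val c = finsum Z (\<lambda>t. [Poly_Mapping.lookup c t] \<cdot>\<^bsub>Z\<^esub> \<beta> (fst t) (snd t)) (Poly_Mapping.keys c)"

lemma \<beta>_closed: "p \<in> carrier P \<Longrightarrow> x \<in> carrier X \<Longrightarrow> \<beta> p x \<in> carrier Z"
  using \<beta> addhom_closed unfolding balanced_def by metis

lemma term_closed: "t \<in> carrier P \<times> carrier X \<Longrightarrow> [(i::int)] \<cdot>\<^bsub>Z\<^esub> \<beta> (fst t) (snd t) \<in> carrier Z"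
  by (rule Z.add.int_pow_closed) (auto simp: \<beta>_closed)

lemma val_superset:
  assumes "finite B" "Poly_Mapping.keys c \<subseteq> B" "B \<subseteq> carrier P \<times> carrier X"
  shows "val c = finsum Z (\<lambda>t. [Poly_Mapping.lookup c t] \<cdot>\<^bsub>Z\<^esub> \<beta> (fst t) (snd t)) B"
  unfolding val_def
proof (rule Z.add.finprod_mono_neutral_cong_left[OF assms(1,2)])
  show "[Poly_Mapping.lookup c t] \<cdot>\<^bsub>Z\<^esub> \<beta> (fst t) (snd t) = \<zero>\<^bsub>Z\<^esub>" if "t \<in> B - Poly_Mapping.keys c" for t
    using that by (simp add: in_keys_iff add_pow_def)
qed (use assms term_closed in blast)+

lemma val_add:
  assumes "c \<in> carrier Fr" "d \<in> carrier Fr"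
  shows "val (c + d) = val c \<oplus>\<^bsub>Z\<^esub> val d"
proof -
  let ?B = "Poly_Mapping.keys c \<union> Poly_Mapping.keys d"
  let ?t = "\<lambda>c t. [Poly_Mapping.lookup c t] \<cdot>\<^bsub>Z\<^esub> \<beta> (fst t) (snd t)"
  have B: "finite ?B" "?B \<subseteq> carrier P \<times> carrier X" using assms by auto
  have "val (c + d) = finsum Z (?t (c + d)) ?B" by (rule val_superset[OF B(1) keys_add B(2)])
  also have "\<dots> = finsum Z (\<lambda>t. ?t c t \<oplus>\<^bsub>Z\<^esub> ?t d t) ?B"
  proof (rule Z.finsum_cong')
    show "(\<lambda>t. ?t c t \<oplus>\<^bsub>Z\<^esub> ?t d t) \<in> ?B \<rightarrow> carrier Z" using B(2) term_closed by blast
    show "?t (c + d) t = ?t c t \<oplus>\<^bsub>Z\<^esub> ?t d t" if t: "t \<in> ?B" for t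
    proof -
      have "t \<in> carrier P \<times> carrier X" using t B(2) by blast
      then have "\<beta> (fst t) (snd t) \<in> carrier Z" by (simp add: mem_Times_iff \<beta>_closed)
      then show ?thesis by (simp add: lookup_add Z.add.int_pow_mult)
    qed
  qed simp
  also have "\<dots> = finsum Z (?t c) ?B \<oplus>\<^bsub>Z\<^esub> finsum Z (?t d) ?B"
    by (rule Z.finsum_addf) (use B(2) term_closed in blast)+
  also have "\<dots> = val c \<oplus>\<^bsub>Z\<^esub> val d"
    using val_superset[OF B(1) _ B(2), of c] val_superset[OF B(1) _ B(2), of d] by simp
  finally show ?thesis .
qed

lemma val_closed: "c \<in> carrier Fr \<Longrightarrow> val c \<in> carrier Z"
  unfolding val_def by (rule Z.finsum_closed) (use term_closed in \<open>simp add: Pi_iff subsetD\<close>)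

lemma val_frag: "t \<in> carrier P \<times> carrier X \<Longrightarrow> val (frag_of t) = \<beta> (fst t) (snd t)"
  using \<beta>_closed by (auto simp: val_def)

lemma val_zero: "val 0 = \<zero>\<^bsub>Z\<^esub>"
  by (simp add: val_def)

lemma val_neg: "c \<in> carrier Fr \<Longrightarrow> val (- c) = \<ominus>\<^bsub>Z\<^esub> val c"
  using val_add[OF minus_closed, of c c] val_closed minus_closed Z.minus_equality val_zero by (metis add.left_inverse)

lemma val_diff: "c \<in> carrier Fr \<Longrightarrow> d \<in> carrier Fr \<Longrightarrow> val (c - d) = val c \<oplus>\<^bsub>Z\<^esub> \<ominus>\<^bsub>Z\<^esub> val d"
  using val_add[OF _ minus_closed, of c d] by (simp add: val_neg)

lemma val_rels: "c \<in> tensor_rels S P X \<Longrightarrow> val c = \<zero>\<^bsub>Z\<^esub>"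
proof -
  assume c: "c \<in> tensor_rels S P X"
  have d3: "val (frag_of t - frag_of t' - frag_of t'') = \<zero>\<^bsub>Z\<^esub>"
    if t: "t \<in> carrier P \<times> carrier X" "t' \<in> carrier P \<times> carrier X" "t'' \<in> carrier P \<times> carrier X"
      and e: "\<beta> (fst t) (snd t) = \<beta> (fst t') (snd t') \<oplus>\<^bsub>Z\<^esub> \<beta> (fst t'') (snd t'')" for t t' t''
  proof -
    have f: "frag_of t \<in> carrier Fr" "frag_of t' \<in> carrier Fr" "frag_of t'' \<in> carrier Fr" using t by auto
    have "frag_of t - frag_of t' - frag_of t'' = frag_of t - (frag_of t' + frag_of t'')" by (simp add: algebra_simps)
    moreover have "frag_of t' + frag_of t'' \<in> carrier Fr"
      by (rule Fr.m_closed[OF f(2,3), simplified mult_free_Abelian_group])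
    moreover have "\<beta> (fst t) (snd t) \<in> carrier Z" using t(1) \<beta>_closed by (simp add: mem_Times_iff)
    ultimately show ?thesis
      by (simp only: val_diff[OF f(1)] val_add[OF f(2,3)] val_frag[OF t(1)] val_frag[OF t(2)] val_frag[OF t(3)] e[symmetric] Z.r_neg)
  qed
  have d2: "val (frag_of t - frag_of t') = \<zero>\<^bsub>Z\<^esub>"
    if t: "t \<in> carrier P \<times> carrier X" "t' \<in> carrier P \<times> carrier X"
      and e: "\<beta> (fst t) (snd t) = \<beta> (fst t') (snd t')" for t t'
  proof -
    have f: "frag_of t \<in> carrier Fr" "frag_of t' \<in> carrier Fr" using t by auto
    have "\<beta> (fst t') (snd t') \<in> carrier Z" using t(2) \<beta>_closed by (simp add: mem_Times_iff)
    then show ?thesis by (simp only: val_diff[OF f] val_frag[OF t(1)] val_frag[OF t(2)] e Z.r_neg)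
  qed
  have b: "p \<in> carrier P \<Longrightarrow> addhom X Z (\<beta> p)" "x \<in> carrier X \<Longrightarrow> addhom P Z (\<lambda>p. \<beta> p x)"
    "\<lbrakk>p \<in> carrier P; s \<in> carrier S; x \<in> carrier X\<rbrakk> \<Longrightarrow> \<beta> (rsmult P p s) x = \<beta> p (s \<odot>\<^bsub>X\<^esub> x)" for p x s
    using \<beta> unfolding balanced_def by blast+
  from c show ?thesis unfolding tensor_rels_def Un_iff
  proof (elim disjE CollectE exE conjE)
    fix p p' x assume "c = frag_of (p \<oplus>\<^bsub>P\<^esub> p', x) - frag_of (p, x) - frag_of (p', x)"
      "p \<in> carrier P" "p' \<in> carrier P" "x \<in> carrier X"
    then show ?thesis using addhom_add[OF b(2), of x p p'] by (simp add: d3)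
  next
    fix p x x' assume "c = frag_of (p, x \<oplus>\<^bsub>X\<^esub> x') - frag_of (p, x) - frag_of (p, x')"
      "p \<in> carrier P" "x \<in> carrier X" "x' \<in> carrier X"
    then show ?thesis using addhom_add[OF b(1), of p x x'] by (simp add: d3)
  next
    fix p s x assume "c = frag_of (rsmult P p s, x) - frag_of (p, s \<odot>\<^bsub>X\<^esub> x)"
      "p \<in> carrier P" "s \<in> carrier S" "x \<in> carrier X"
    then show ?thesis using b(3)[of p s x] rsmult_closed[OF P, of p s] by (simp add: d2 X.smult_closed)
  qed
qed

lemma val_null: "c \<in> N \<Longrightarrow> val c = \<zero>\<^bsub>Z\<^esub>"
  unfolding tensor_null_def
proof (induction rule: generate.induct)
  case one
  show ?case by (simp add: val_zero)
next
  case (incl h)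
  then show ?case by (rule val_rels)
next
  case (inv h)
  then have "h \<in> carrier Fr" using rels_sub by blast
  then show ?case using val_neg[of h] val_rels[OF inv] by simp
next
  case (eng c d)
  have "c \<in> carrier Fr" "d \<in> carrier Fr" using eng(1,2) Fr.generate_in_carrier[OF rels_sub] by blast+
  then show ?case using val_add[of c d] eng.IH by simp
qed

lemma lift_coset:
  assumes c: "c \<in> carrier Fr"
  shows "tensor_lift Z \<beta> (N #>\<^bsub>Fr\<^esub> c) = val c"
proof -
  have "val d = val c" if "d \<in> N #>\<^bsub>Fr\<^esub> c" for d
  proof -
    obtain h where h: "h \<in> N" "d = h + c" using \<open>d \<in> _\<close> by (auto simp: r_coset_def)
    show ?thesis unfolding h(2) val_add[OF N.mem_carrier[OF h(1)] c] val_null[OF h(1)] using val_closed[OF c] by simp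
  qed
  then have "val ` (N #>\<^bsub>Fr\<^esub> c) = {val c}" using Fr.rcos_self[OF c N_sub] by blast
  then show ?thesis unfolding tensor_lift_def val_def by simp
qed

lemma lift_pt: "p \<in> carrier P \<Longrightarrow> x \<in> carrier X \<Longrightarrow> tensor_lift Z \<beta> (pt p x) = \<beta> p x"
  unfolding pure_tensor_def by (subst lift_coset) (auto simp: val_frag)

lemma lift_addhom: "addhom T Z (tensor_lift Z \<beta>)"
proof (rule addhomI)
  fix v assume "v \<in> carrier T"
  then obtain c where c: "c \<in> carrier Fr" "v = N #>\<^bsub>Fr\<^esub> c" by (auto simp: T_simps)
  show "tensor_lift Z \<beta> v \<in> carrier Z" unfolding c(2) lift_coset[OF c(1)] by (rule val_closed[OF c(1)])
  fix w assume "w \<in> carrier T"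
  then obtain d where d: "d \<in> carrier Fr" "w = N #>\<^bsub>Fr\<^esub> d" by (auto simp: T_simps)
  show "tensor_lift Z \<beta> (v \<oplus>\<^bsub>T\<^esub> w) = tensor_lift Z \<beta> v \<oplus>\<^bsub>Z\<^esub> tensor_lift Z \<beta> w"
    unfolding c(2) d(2) T_simps(3)[OF c(1) d(1)] lift_coset[OF c(1)] lift_coset[OF d(1)]
      lift_coset[OF Fr.m_closed[OF c(1) d(1), simplified mult_free_Abelian_group]] by (rule val_add[OF c(1) d(1)])
qed

end

abbreviation "L \<equiv> tensor_lmod S P X"

lemma L_simps [simp]: "carrier L = carrier T" "add L = add T" "\<zero>\<^bsub>L\<^esub> = \<zero>\<^bsub>T\<^esub>"
  by (auto simp: tensor_lmod_def Let_def)

lemma smult_balanced: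
  assumes "r \<in> carrier R"
  shows "balanced S P X T (\<lambda>p x. pt (r \<odot>\<^bsub>P\<^esub> p) x)"
  unfolding balanced_def
  using assms by (auto intro!: addhomI simp: pt_closed pt_add_l pt_add_r P.smult_closed P.smult_r_distr
      rsmult_smult[OF P, symmetric] rsmult_closed[OF P] X.smult_closed pt_balanced)

lemma smult_pt: "r \<in> carrier R \<Longrightarrow> p \<in> carrier P \<Longrightarrow> x \<in> carrier X \<Longrightarrow> r \<odot>\<^bsub>L\<^esub> pt p x = pt (r \<odot>\<^bsub>P\<^esub> p) x"
  using lift_pt[OF T_ag smult_balanced] by (simp add: tensor_lmod_def Let_def)

lemma smult_add: "r \<in> carrier R \<Longrightarrow> addhom T T (\<lambda>w. r \<odot>\<^bsub>L\<^esub> w)"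
  using lift_addhom[OF T_ag smult_balanced] by (simp add: tensor_lmod_def Let_def)

lemma L_left: "left_module R L"
proof (rule left_moduleI)
  show "ring R" by (rule left_module_ring[OF bimodule_left[OF P]])
  show "abelian_group L" by (rule abelian_group_cong[OF T_ag]) auto
  note sc = addhom_closed[OF smult_add] and sa = addhom_add[OF smult_add]
    and s0 = addhom_zero[OF T_ag T_ag smult_add]
  fix r w assume r: "r \<in> carrier R" and w: "w \<in> carrier L"
  then show "r \<odot>\<^bsub>L\<^esub> w \<in> carrier L" by (simp add: sc)
  from w have w: "w \<in> carrier T" by simp
  show "r \<odot>\<^bsub>L\<^esub> (w \<oplus>\<^bsub>L\<^esub> v) = r \<odot>\<^bsub>L\<^esub> w \<oplus>\<^bsub>L\<^esub> r \<odot>\<^bsub>L\<^esub> v" if "v \<in> carrier L" for v using r w that by (simp add: sa)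
  fix s assume s: "s \<in> carrier R"
  show "(r \<oplus>\<^bsub>R\<^esub> s) \<odot>\<^bsub>L\<^esub> w = r \<odot>\<^bsub>L\<^esub> w \<oplus>\<^bsub>L\<^esub> s \<odot>\<^bsub>L\<^esub> w" using w
    by (induction rule: tensor_induct)
      (use r s in \<open>simp_all add: s0 smult_pt P.smult_l_distr pt_add_l P.smult_closed sa sc T.a_ac\<close>)
  show "(r \<otimes>\<^bsub>R\<^esub> s) \<odot>\<^bsub>L\<^esub> w = r \<odot>\<^bsub>L\<^esub> (s \<odot>\<^bsub>L\<^esub> w)" using w
    by (induction rule: tensor_induct)
      (use r s in \<open>simp_all add: s0 smult_pt P.smult_assoc P.smult_closed sa sc\<close>)
next
  fix w assume "w \<in> carrier L"
  then have w: "w \<in> carrier T" by simp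
  show "\<one>\<^bsub>R\<^esub> \<odot>\<^bsub>L\<^esub> w = w" using w
    by (induction rule: tensor_induct)
      (simp_all add: addhom_zero[OF T_ag T_ag smult_add] smult_pt P.smult_one addhom_add[OF smult_add])
qed

lemma lhom_tensor:
  assumes Y: "left_module R Y" and f: "addhom T Y f"
    and s: "\<And>r p x. \<lbrakk>r \<in> carrier R; p \<in> carrier P; x \<in> carrier X\<rbrakk> \<Longrightarrow> f (pt (r \<odot>\<^bsub>P\<^esub> p) x) = r \<odot>\<^bsub>Y\<^esub> f (pt p x)"
  shows "lhom R L Y f"
proof (rule lhomI)
  interpret Y: left_module R Y by fact
  fix r w assume r: "r \<in> carrier R" and "w \<in> carrier L"
  then have "w \<in> carrier T" by simp
  then show "f (r \<odot>\<^bsub>L\<^esub> w) = r \<odot>\<^bsub>Y\<^esub> f w"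
    using addhom_eq[OF Y.M_ag addhom_comp[OF smult_add[OF r] f] addhom_comp[OF f Y.smult_addhom[OF r]]]
    by (simp add: smult_pt r s)
qed (use addhom_closed[OF f] addhom_add[OF f] in auto)

end

lemma tensor_pairI: "is_bimodule R S P \<Longrightarrow> left_module S X \<Longrightarrow> tensor_pair R S P X"
  by (rule tensor_pair.intro)

lemma addhom_cong: "abelian_group M \<Longrightarrow> addhom M N f \<Longrightarrow> (\<And>x. x \<in> carrier M \<Longrightarrow> g x = f x) \<Longrightarrow> addhom M N g"
proof (rule addhomI)
  assume "abelian_group M" "addhom M N f" "\<And>x. x \<in> carrier M \<Longrightarrow> g x = f x"
  then interpret M: abelian_group M by simp
  note f = \<open>addhom M N f\<close> and eq = \<open>\<And>x. x \<in> carrier M \<Longrightarrow> g x = f x\<close>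
  show "g x \<in> carrier N" if "x \<in> carrier M" for x using addhom_closed[OF f that] eq[OF that] by simp
  show "g (x \<oplus>\<^bsub>M\<^esub> y) = g x \<oplus>\<^bsub>N\<^esub> g y" if "x \<in> carrier M" "y \<in> carrier M" for x y
    using addhom_add[OF f that] eq that by simp
qed

lemma addhom_lmod: "addhom M (tensor_lmod S P X) = addhom M (tensor_group S P X)"
  by (rule ext) (auto simp: addhom_def tensor_lmod_def Let_def)

lemma tensor_lmod_hom_eqI:
  assumes tp: "tensor_pair R S P X" and Y: "left_module R Y"
    and f: "f \<in> lmod_hom R (tensor_lmod S P X) Y" and g: "g \<in> lmod_hom R (tensor_lmod S P X) Y"
    and eq: "\<And>p x. p \<in> carrier P \<Longrightarrow> x \<in> carrier X \<Longrightarrow> f (pure_tensor S P X p x) = g (pure_tensor S P X p x)"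
  shows "f = g"
proof -
  interpret tensor_pair R S P X by (rule tp)
  have ah: "addhom T Y h" if "h \<in> lmod_hom R L Y" for h
    using lhom_addhom[OF lmod_homD[OF that]] by (simp add: addhom_def)
  show ?thesis
    by (rule lmod_hom_eqI[OF f g], rule addhom_eq[OF left_module_ag[OF Y] ah[OF f] ah[OF g]]) (simp_all add: eq)
qed

lemma
  assumes tp: "tensor_pair R S P X" and Y: "left_module S Y" and g: "lhom S X Y g"
  shows lhom_tensor_map: "lhom R (tensor_lmod S P X) (tensor_lmod S P Y) (tensor_map S P X Y g)"
    and tensor_map_pure: "p \<in> carrier P \<Longrightarrow> x \<in> carrier X \<Longrightarrow>
      tensor_map S P X Y g (pure_tensor S P X p x) = pure_tensor S P Y p (g x)"
proof -
  interpret tensor_pair R S P X by (rule tp)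
  interpret Y: tensor_pair R S P Y by (rule tensor_pairI[OF P Y])
  let ?\<beta> = "\<lambda>p x. pure_tensor S P Y p (g x)"
  note gc = lhom_closed[OF g]
  have \<beta>: "balanced S P X Y.T ?\<beta>"
    unfolding balanced_def
    by (auto intro!: addhomI simp: gc Y.pt_closed Y.pt_add_l Y.pt_add_r lhom_add[OF g] lhom_smult[OF g] Y.pt_balanced)
  note lp = lift_pt[OF Y.T_ag \<beta>] and la = lift_addhom[OF Y.T_ag \<beta>]
  have eq: "tensor_map S P X Y g w = tensor_lift Y.T ?\<beta> w" if "w \<in> carrier T" for w
    using that by (simp add: tensor_map_def)
  show pure: "tensor_map S P X Y g (pt p x) = Y.pt p (g x)" if "p \<in> carrier P" "x \<in> carrier X" for p x
    using eq[OF pt_closed[OF that]] lp[OF that] by simp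
  show "lhom R L Y.L (tensor_map S P X Y g)"
  proof (rule lhom_tensor[OF Y.L_left])
    show "addhom T Y.L (tensor_map S P X Y g)"
      unfolding addhom_lmod by (rule addhom_cong[OF T_ag la eq])
  qed (simp add: pure gc Y.smult_pt P.smult_closed)
qed

lemma lhom_tensor_lift:
  assumes tp: "tensor_pair R S P X" and Y: "left_module R Y" and \<beta>: "balanced S P X Y \<beta>"
    and s: "\<And>r p x. \<lbrakk>r \<in> carrier R; p \<in> carrier P; x \<in> carrier X\<rbrakk> \<Longrightarrow> \<beta> (r \<odot>\<^bsub>P\<^esub> p) x = r \<odot>\<^bsub>Y\<^esub> \<beta> p x"
  shows "lhom R (tensor_lmod S P X) Y (tensor_lift Y \<beta>)"
proof -
  interpret tensor_pair R S P X by (rule tp)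
  note Yg = left_module_ag[OF Y]
  show ?thesis
    by (rule lhom_tensor[OF Y lift_addhom[OF Yg \<beta>]]) (simp add: lift_pt[OF Yg \<beta>] P.smult_closed s)
qed

section \<open>Bimodule maps from a tensor product to the ring, and the counit they define\<close>

locale tensor_form =
  fixes R :: "('r, 'q1) ring_scheme" and S :: "('s, 'q2) ring_scheme"
    and P :: "('r, 'p, 's, 'm) bimodule_scheme" and Q :: "('s, 'q, 'r, 'n) bimodule_scheme"
    and \<nu> :: "('p, 'q) tensor \<Rightarrow> 'r"
  assumes bP: "is_bimodule R S P" and bQ: "is_bimodule S R Q"
    and \<nu>: "\<nu> \<in> bimod_hom R R (tensor_bimod S P Q) (regular_bimod R)"
begin

sublocale tensor_pair R S P Q by (rule tensor_pairI[OF bP bimodule_left[OF bQ]])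

definition a :: "'p \<Rightarrow> 'q \<Rightarrow> 'r" where "a p q = \<nu> (pt p q)"

abbreviation "B \<equiv> tensor_bimod S P Q"

lemma B_simps [simp]: "carrier B = carrier T" "add B = add T" "\<zero>\<^bsub>B\<^esub> = \<zero>\<^bsub>T\<^esub>" "smult B = smult L"
  by (auto simp: tensor_bimod_def tensor_lmod_def Let_def)

lemma rsmult_balanced:
  assumes "r \<in> carrier R"
  shows "balanced S P Q T (\<lambda>p q. pt p (rsmult Q q r))"
  unfolding balanced_def
  using assms by (auto intro!: addhomI simp: pt_closed pt_add_l pt_add_r rsmult_closed[OF bQ] rsmult_add_l[OF bQ]
      rsmult_smult[OF bQ] pt_balanced)

lemma rsmult_pt: "r \<in> carrier R \<Longrightarrow> p \<in> carrier P \<Longrightarrow> q \<in> carrier Q \<Longrightarrow> rsmult B (pt p q) r = pt p (rsmult Q q r)"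
  using lift_pt[OF T_ag rsmult_balanced] by (simp add: tensor_bimod_def Let_def)

lemma rsmult_add: "r \<in> carrier R \<Longrightarrow> addhom T T (\<lambda>w. rsmult B w r)"
  using lift_addhom[OF T_ag rsmult_balanced] by (simp add: tensor_bimod_def Let_def)

lemma \<nu>_lhom: "lhom R B (regular_bimod R) \<nu>"
  using \<nu> lmod_homD by (auto simp: bimod_hom_def)

lemma \<nu>_addhom: "addhom T R \<nu>"
  using lhom_addhom[OF \<nu>_lhom] by (simp add: addhom_def)

lemma a_closed: "p \<in> carrier P \<Longrightarrow> q \<in> carrier Q \<Longrightarrow> a p q \<in> carrier R"
  unfolding a_def by (rule addhom_closed[OF \<nu>_addhom pt_closed])

lemma a_add_l: "\<lbrakk>p \<in> carrier P; p' \<in> carrier P; q \<in> carrier Q\<rbrakk> \<Longrightarrow> a (p \<oplus>\<^bsub>P\<^esub> p') q = a p q \<oplus>\<^bsub>R\<^esub> a p' q"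
  by (simp add: a_def pt_add_l addhom_add[OF \<nu>_addhom] pt_closed)

lemma a_add_r: "\<lbrakk>p \<in> carrier P; q \<in> carrier Q; q' \<in> carrier Q\<rbrakk> \<Longrightarrow> a p (q \<oplus>\<^bsub>Q\<^esub> q') = a p q \<oplus>\<^bsub>R\<^esub> a p q'"
  by (simp add: a_def pt_add_r addhom_add[OF \<nu>_addhom] pt_closed)

lemma a_smult: "\<lbrakk>r \<in> carrier R; p \<in> carrier P; q \<in> carrier Q\<rbrakk> \<Longrightarrow> a (r \<odot>\<^bsub>P\<^esub> p) q = r \<otimes>\<^bsub>R\<^esub> a p q"
  using lhom_smult[OF \<nu>_lhom, of r "pt p q"] by (simp add: a_def pt_closed smult_pt)

lemma a_rsmult: "\<lbrakk>r \<in> carrier R; p \<in> carrier P; q \<in> carrier Q\<rbrakk> \<Longrightarrow> a p (rsmult Q q r) = a p q \<otimes>\<^bsub>R\<^esub> r"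
  using \<nu> by (simp add: a_def bimod_hom_def pt_closed rsmult_pt[symmetric])

lemma a_balanced: "\<lbrakk>s \<in> carrier S; p \<in> carrier P; q \<in> carrier Q\<rbrakk> \<Longrightarrow> a (rsmult P p s) q = a p (s \<odot>\<^bsub>Q\<^esub> q)"
  by (simp add: a_def pt_balanced)

text \<open>Contraction of p against Q \<otimes> Y. As a function of p it is the balanced map behind
  \<open>counit_map\<close>; contraction against central tensors will also produce bimodule
  endomorphisms.\<close>

definition inner :: "('r, 'y, 'o) module_scheme \<Rightarrow> 'p \<Rightarrow> ('q, 'y) tensor \<Rightarrow> 'y"
  where "inner Y p = tensor_lift Y (\<lambda>q y. \<nu> (pt p q) \<odot>\<^bsub>Y\<^esub> y)"

context
  fixes Y :: "('r, 'y, 'o) module_scheme"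
  assumes Y: "left_module R Y"
begin

interpretation Y: left_module R Y by (rule Y)
interpretation QY: tensor_pair S R Q Y by (rule tensor_pairI[OF bQ Y])

lemma inner_balanced: "p \<in> carrier P \<Longrightarrow> balanced R Q Y Y (\<lambda>q y. \<nu> (pt p q) \<odot>\<^bsub>Y\<^esub> y)"
  unfolding balanced_def a_def[symmetric]
  by (auto intro!: addhomI simp: a_closed a_add_r a_rsmult Y.smult_closed Y.smult_l_distr Y.smult_r_distr Y.smult_assoc)

lemma inner_pt: "p \<in> carrier P \<Longrightarrow> q \<in> carrier Q \<Longrightarrow> y \<in> carrier Y \<Longrightarrow> inner Y p (QY.pt q y) = a p q \<odot>\<^bsub>Y\<^esub> y"
  using QY.lift_pt[OF Y.M_ag inner_balanced] by (simp add: inner_def a_def)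

lemma inner_addhom: "p \<in> carrier P \<Longrightarrow> addhom QY.T Y (inner Y p)"
  unfolding inner_def by (rule QY.lift_addhom[OF Y.M_ag inner_balanced])

lemma inner_closed: "p \<in> carrier P \<Longrightarrow> w \<in> carrier QY.T \<Longrightarrow> inner Y p w \<in> carrier Y"
  by (rule addhom_closed[OF inner_addhom])

lemma inner_add:
  assumes "p \<in> carrier P" "p' \<in> carrier P" "w \<in> carrier QY.T"
  shows "inner Y (p \<oplus>\<^bsub>P\<^esub> p') w = inner Y p w \<oplus>\<^bsub>Y\<^esub> inner Y p' w"
proof -
  have "addhom QY.T Y (\<lambda>w. inner Y p w \<oplus>\<^bsub>Y\<^esub> inner Y p' w)"
    using assms by (intro addhomI) (simp_all add: inner_closed addhom_add[OF inner_addhom] Y.M.a_ac)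
  from QY.addhom_eq[OF Y.M_ag inner_addhom this assms(3)] assms(1,2)
  show ?thesis by (simp add: inner_pt a_closed a_add_l Y.smult_l_distr)
qed

lemma inner_smult:
  assumes "r \<in> carrier R" "p \<in> carrier P" "w \<in> carrier QY.T"
  shows "inner Y (r \<odot>\<^bsub>P\<^esub> p) w = r \<odot>\<^bsub>Y\<^esub> inner Y p w"
  using QY.addhom_eq[OF Y.M_ag inner_addhom addhom_comp[OF inner_addhom Y.smult_addhom[OF assms(1)]] assms(3)] assms(1,2)
  by (simp add: inner_pt a_closed a_smult P.smult_closed Y.smult_assoc)

lemma inner_rsmult:
  assumes "s \<in> carrier S" "p \<in> carrier P" "w \<in> carrier QY.T"
  shows "inner Y (rsmult P p s) w = inner Y p (s \<odot>\<^bsub>QY.L\<^esub> w)"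
  using QY.addhom_eq[OF Y.M_ag inner_addhom addhom_comp[OF QY.smult_add[OF assms(1)] inner_addhom] assms(3)] assms(1,2)
  by (simp add: inner_pt a_balanced QY.smult_pt X.smult_closed rsmult_closed[OF bP])

lemma
  shows lhom_counit_map: "lhom R (tensor_lmod S P QY.L) Y (counit_map R S P Q \<nu> Y)"
    and counit_map_pure: "p \<in> carrier P \<Longrightarrow> w \<in> carrier QY.T \<Longrightarrow>
      counit_map R S P Q \<nu> Y (pure_tensor S P QY.L p w) = inner Y p w"
proof -
  interpret PL: tensor_pair R S P QY.L by (rule tensor_pairI[OF bP QY.L_left])
  have \<beta>: "balanced S P QY.L Y (inner Y)"
    unfolding balanced_def
    by (auto intro!: addhomI simp: inner_closed inner_add inner_rsmult addhom_add[OF inner_addhom])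
  have eq: "counit_map R S P Q \<nu> Y w = tensor_lift Y (inner Y) w" if "w \<in> carrier PL.T" for w
    using that by (simp add: counit_map_def inner_def[abs_def])
  show "counit_map R S P Q \<nu> Y (PL.pt p w) = inner Y p w" if "p \<in> carrier P" "w \<in> carrier QY.T" for p w
    using eq[OF PL.pt_closed] PL.lift_pt[OF Y.M_ag \<beta>] that by simp
  have "lhom R PL.L Y (tensor_lift Y (inner Y))"
    by (rule lhom_tensor_lift[OF PL.tensor_pair_axioms Y \<beta>]) (simp add: inner_smult)
  then show "lhom R PL.L Y (counit_map R S P Q \<nu> Y)"
    by (rule lhom_cong[OF _ _ PL.L_left]) (simp add: eq)
qed

end

text \<open>
  The dual bases are the components of \<open>w = g(1) \<in> Q \<otimes>\<^sub>R P\<close>, where \<open>g : S \<rightarrow> Q \<otimes>\<^sub>R P\<close> corresponds to the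
  canonical isomorphism \<open>P \<otimes>\<^sub>S S \<cong> P\<close> under the adjunction.  The counit gives the expansion in \<open>P\<close>, and
  naturality with respect to the maps \<open>S \<rightarrow> Q\<close> and \<open>P \<rightarrow> R\<close> defined by \<open>x \<in> Q\<close> gives the one in \<open>Q\<close>.  All
  modules involved are first moved into the type \<open>'u\<close>.
\<close>

lemma dual_pair_of_adjunction:
  fixes U :: "'u itself"
  assumes adj: "adjoint_with_counit U R S P Q \<nu>"
    and small: "carrier R \<lesssim> (UNIV :: 'u set)" "carrier S \<lesssim> (UNIV :: 'u set)"
      "carrier P \<lesssim> (UNIV :: 'u set)" "carrier Q \<lesssim> (UNIV :: 'u set)"
  shows "\<exists>n p q. dual_pair R S P Q a n p q"
proof -
  note lP = bimodule_left[OF bP] and lQ = bimodule_left[OF bQ]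
  note rR = left_module_ring[OF lP] and rS = left_module_ring[OF lQ]
  note mR = monoid.m_closed[OF ring.is_monoid[OF rR]] and mS = monoid.m_closed[OF ring.is_monoid[OF rS]]
    and eR = monoid.one_closed[OF ring.is_monoid[OF rR]] and eS = monoid.one_closed[OF ring.is_monoid[OF rS]]
    and e1 = monoid.r_one[OF ring.is_monoid[OF rR]]
  note regR = left_module_regular[OF rR] and regS = left_module_regular[OF rS]
  obtain iR :: "'r \<Rightarrow> 'u" where "inj_on iR (carrier (regular_bimod R))" using small(1) by (auto simp: lepoll_def)
  from lmod_transport[OF regR this] obtain R' :: "('r, 'u) module" and jR where R': "left_module R R'" "carrier R' = iR ` carrier (regular_bimod R)"
    "lhom R (regular_bimod R) R' iR" "lhom R R' (regular_bimod R) jR"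
    "\<And>x. x \<in> carrier (regular_bimod R) \<Longrightarrow> jR (iR x) = x" "\<And>y. y \<in> carrier R' \<Longrightarrow> iR (jR y) = y" by metis
  obtain iS :: "'s \<Rightarrow> 'u" where "inj_on iS (carrier (regular_bimod S))" using small(2) by (auto simp: lepoll_def)
  from lmod_transport[OF regS this] obtain S' :: "('s, 'u) module" and jS where S': "left_module S S'" "carrier S' = iS ` carrier (regular_bimod S)"
    "lhom S (regular_bimod S) S' iS" "lhom S S' (regular_bimod S) jS"
    "\<And>x. x \<in> carrier (regular_bimod S) \<Longrightarrow> jS (iS x) = x" "\<And>y. y \<in> carrier S' \<Longrightarrow> iS (jS y) = y" by metis
  obtain iP :: "'p \<Rightarrow> 'u" where "inj_on iP (carrier P)" using small(3) by (auto simp: lepoll_def)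
  from lmod_transport[OF lP this] obtain P' :: "('r, 'u) module" and jP where P': "left_module R P'" "carrier P' = iP ` carrier P"
    "lhom R P P' iP" "lhom R P' P jP"
    "\<And>x. x \<in> carrier P \<Longrightarrow> jP (iP x) = x" "\<And>y. y \<in> carrier P' \<Longrightarrow> iP (jP y) = y" by metis
  obtain iQ :: "'q \<Rightarrow> 'u" where "inj_on iQ (carrier Q)" using small(4) by (auto simp: lepoll_def)
  from lmod_transport[OF lQ this] obtain Q' :: "('s, 'u) module" and jQ where Q': "left_module S Q'" "carrier Q' = iQ ` carrier Q"
    "lhom S Q Q' iQ" "lhom S Q' Q jQ"
    "\<And>x. x \<in> carrier Q \<Longrightarrow> jQ (iQ x) = x" "\<And>y. y \<in> carrier Q' \<Longrightarrow> iQ (jQ y) = y" by metis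
  note icl = lhom_closed[OF R'(3), simplified] lhom_closed[OF S'(3), simplified] lhom_closed[OF P'(3)] lhom_closed[OF Q'(3)]
  note jcl = lhom_closed[OF R'(4), simplified] lhom_closed[OF S'(4), simplified] lhom_closed[OF P'(4)] lhom_closed[OF Q'(4)]
  note iadd = lhom_add[OF R'(3), simplified] lhom_add[OF S'(3), simplified] lhom_add[OF P'(3)] lhom_add[OF Q'(3)]
  note jadd = lhom_add[OF R'(4), simplified] lhom_add[OF S'(4), simplified] lhom_add[OF P'(4)] lhom_add[OF Q'(4)]
  note ism = lhom_smult[OF R'(3), simplified] lhom_smult[OF S'(3), simplified] lhom_smult[OF P'(3)] lhom_smult[OF Q'(3)]
  note jsm = lhom_smult[OF R'(4), simplified] lhom_smult[OF S'(4), simplified] lhom_smult[OF P'(4)] lhom_smult[OF Q'(4)]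
  note ji = R'(5)[simplified] S'(5)[simplified] P'(5) Q'(5)
  note rP = bimod_rules[OF bP] and rQ = bimod_rules[OF bQ]
  let ?F = "tensor_lmod S P" and ?G = "tensor_lmod R Q"
  interpret PS: tensor_pair R S P S' by (rule tensor_pairI[OF bP S'(1)])
  interpret QP: tensor_pair S R Q P' by (rule tensor_pairI[OF bQ P'(1)])
  interpret PQ: tensor_pair R S P Q' by (rule tensor_pairI[OF bP Q'(1)])
  interpret QR: tensor_pair S R Q R' by (rule tensor_pairI[OF bQ R'(1)])
  obtain \<phi> :: "('s, 'u) module \<Rightarrow> ('r, 'u) module \<Rightarrow> (('p, 'u) tensor \<Rightarrow> 'u) \<Rightarrow> 'u \<Rightarrow> ('q, 'u) tensor" where
    \<phi>1: "\<forall>X Y. left_module S X \<longrightarrow> left_module R Y \<longrightarrow>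
        bij_betw (\<phi> X Y) (lmod_hom R (?F X) Y) (lmod_hom S X (?G Y))"
    and \<phi>2: "\<forall>X X' Y. left_module S X \<longrightarrow> left_module S X' \<longrightarrow> left_module R Y \<longrightarrow>
        (\<forall>h\<in>lmod_hom S X' X. \<forall>f\<in>lmod_hom R (?F X) Y.
          \<phi> X' Y (compose (carrier (?F X')) f (tensor_map S P X' X h)) = compose (carrier X') (\<phi> X Y f) h)"
    and \<phi>3: "\<forall>X Y Y'. left_module S X \<longrightarrow> left_module R Y \<longrightarrow> left_module R Y' \<longrightarrow>
        (\<forall>h\<in>lmod_hom R Y Y'. \<forall>f\<in>lmod_hom R (?F X) Y.
          \<phi> X Y' (compose (carrier (?F X)) h f) = compose (carrier X) (tensor_map R Q Y Y' h) (\<phi> X Y f))"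
    and \<phi>4: "\<forall>X Y. left_module S X \<longrightarrow> left_module R Y \<longrightarrow> (\<forall>g\<in>lmod_hom S X (?G Y).
        \<phi> X Y (compose (carrier (?F X)) (counit_map R S P Q \<nu> Y) (tensor_map S P X (?G Y) g)) = g)"
    by (insert adj[unfolded adjoint_with_counit_def], elim exE conjE, rule that, assumption+)
  note bij = \<phi>1[rule_format] and nat1 = \<phi>2[rule_format] and nat2 = \<phi>3[rule_format] and counit = \<phi>4[rule_format]
  \<comment> \<open>The candidate inverse of \<open>\<phi> X Y\<close> given by the counit. On pure
    tensors it is a contraction, so all later identities can be computed.\<close>
  define E where "E X Y g = compose (carrier (?F X)) (counit_map R S P Q \<nu> Y) (tensor_map S P X (?G Y) g)"
    for X :: "('s, 'u) module" and Y :: "('r, 'u) module" and g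
  have E: "E X Y g \<in> lmod_hom R (?F X) Y"
    "\<And>p x. p \<in> carrier P \<Longrightarrow> x \<in> carrier X \<Longrightarrow> E X Y g (pure_tensor S P X p x) = inner Y p (g x)"
    if X: "left_module S X" and Y: "left_module R Y" and g: "g \<in> lmod_hom S X (?G Y)" for X Y g
  proof -
    interpret PX: tensor_pair R S P X by (rule tensor_pairI[OF bP X])
    interpret QY: tensor_pair S R Q Y by (rule tensor_pairI[OF bQ Y])
    note gl = lmod_homD[OF g]
    show "E X Y g \<in> lmod_hom R (?F X) Y"
      unfolding E_def compose_def
      by (rule restrict_lmod_hom[OF PX.L_left lhom_comp[OF lhom_tensor_map[OF PX.tensor_pair_axioms QY.L_left gl] lhom_counit_map[OF Y]]])
    show "E X Y g (pure_tensor S P X p x) = inner Y p (g x)" if "p \<in> carrier P" "x \<in> carrier X" for p x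
      using that lhom_closed[OF gl, of x]
      by (simp add: E_def compose_eq PX.pt_closed tensor_map_pure[OF PX.tensor_pair_axioms QY.L_left gl] counit_map_pure[OF Y])
  qed
  have E\<phi>: "E X Y (\<phi> X Y f) = f" if X: "left_module S X" and Y: "left_module R Y" and f: "f \<in> lmod_hom R (?F X) Y" for X Y f
  proof -
    have g: "\<phi> X Y f \<in> lmod_hom S X (?G Y)" by (rule bij_betw_apply[OF bij[OF X Y] f])
    show ?thesis
      by (rule inj_onD[OF bij_betw_imp_inj_on[OF bij[OF X Y]] _ E(1)[OF X Y g] f])
        (use counit[OF X Y g] in \<open>simp add: E_def\<close>)
  qed
  let ?\<beta> = "\<lambda>p x. iP (rsmult P p (jS x))"
  have \<beta>: "balanced S P S' P' ?\<beta>"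
    unfolding balanced_def by (auto intro!: addhomI simp: icl jcl iadd jadd jsm rP mS)
  define f0 where "f0 = restrict (tensor_lift P' ?\<beta>) (carrier (?F S'))"
  have f0: "f0 \<in> lmod_hom R (?F S') P'"
    unfolding f0_def
    by (rule restrict_lmod_hom[OF PS.L_left lhom_tensor_lift[OF PS.tensor_pair_axioms P'(1) \<beta>]]) (simp add: jcl rP ism)
  have f0_pt: "f0 (PS.pt p x) = iP (rsmult P p (jS x))" if "p \<in> carrier P" "x \<in> carrier S'" for p x
    using that PS.lift_pt[OF left_module_ag[OF P'(1)] \<beta> that] by (simp add: f0_def PS.pt_closed)
  define g where "g = \<phi> S' P' f0"
  have g: "g \<in> lmod_hom S S' (?G P')" unfolding g_def by (rule bij_betw_apply[OF bij[OF S'(1) P'(1)] f0])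
  have Eg: "E S' P' g = f0" unfolding g_def by (rule E\<phi>[OF S'(1) P'(1) f0])
  have one: "iS \<one>\<^bsub>S\<^esub> \<in> carrier S'" by (simp add: icl eS)
  define w where "w = g (iS \<one>\<^bsub>S\<^esub>)"
  have w: "w \<in> carrier QP.T" using lmod_hom_closed[OF g one] by (simp add: w_def)
  obtain n :: nat and q y where qy: "\<And>i. i < n \<Longrightarrow> q i \<in> carrier Q" "\<And>i. i < n \<Longrightarrow> y i \<in> carrier P'"
    "w = finsum QP.T (\<lambda>i. QP.pt (q i) (y i)) {..<n}"
    using QP.tensor_sum[OF w] by blast
  define p where "p i = jP (y i)" for i
  have p: "p i \<in> carrier P" if "i < n" for i using qy(2)[OF that] by (simp add: p_def jcl)
  have ptQP: "(\<lambda>i. QP.pt (q i) (y i)) \<in> {..<n} \<rightarrow> carrier QP.T" using qy by (auto intro: QP.pt_closed)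
  have u_expand: "finsum P (\<lambda>i. a x (q i) \<odot>\<^bsub>P\<^esub> p i) {..<n} = x" if x: "x \<in> carrier P" for x
  proof -
    have "iP x = f0 (PS.pt x (iS \<one>\<^bsub>S\<^esub>))" using f0_pt[OF x one] x by (simp add: ji rP eS)
    also have "\<dots> = inner P' x w" using E(2)[OF S'(1) P'(1) g x one] Eg by (simp add: w_def)
    also have "\<dots> = finsum P' (\<lambda>i. inner P' x (QP.pt (q i) (y i))) {..<n}"
      unfolding qy(3) by (rule addhom_finsum[OF QP.T_ag left_module_ag[OF P'(1)] inner_addhom[OF P'(1) x] ptQP])
    also have "\<dots> = finsum P' (\<lambda>i. a x (q i) \<odot>\<^bsub>P'\<^esub> y i) {..<n}"
      by (rule QP.X.finsum_cong') (use qy x in \<open>auto simp: inner_pt[OF P'(1)] a_closed QP.X.smult_closed\<close>)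
    finally have "x = jP (finsum P' (\<lambda>i. a x (q i) \<odot>\<^bsub>P'\<^esub> y i) {..<n})" using ji(3)[OF x] by simp
    also have "\<dots> = finsum P (\<lambda>i. jP (a x (q i) \<odot>\<^bsub>P'\<^esub> y i)) {..<n}"
      by (rule lhom_finsum[OF P'(1) lP P'(4)]) (use qy x in \<open>auto simp: a_closed QP.X.smult_closed\<close>)
    also have "\<dots> = finsum P (\<lambda>i. a x (q i) \<odot>\<^bsub>P\<^esub> p i) {..<n}"
      by (rule P.finsum_cong') (use qy x p in \<open>auto simp: a_closed P.smult_closed jsm p_def\<close>)
    finally show ?thesis by simp
  qed
  have oneR: "iR \<one>\<^bsub>R\<^esub> \<in> carrier R'" by (simp add: icl eR)
  \<comment> \<open>The canonical map y \<mapsto> y \<otimes> 1 from Q to Q \<otimes> R. Its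
    transpose P \<otimes> Q \<rightarrow> R is the pairing itself.\<close>
  define g1 where "g1 = (\<lambda>y\<in>carrier Q'. QR.pt (jQ y) (iR \<one>\<^bsub>R\<^esub>))"
  have g1: "g1 \<in> lmod_hom S Q' (?G R')"
    unfolding g1_def
    by (rule restrict_lmod_hom[OF Q'(1)], rule lhomI) (simp_all add: QR.pt_closed jcl oneR jadd jsm QR.pt_add_l QR.smult_pt)
  have v_expand: "finsum Q (\<lambda>i. rsmult Q (q i) (a (p i) x)) {..<n} = x" if x: "x \<in> carrier Q" for x
  proof -
    define h where "h = (\<lambda>s\<in>carrier S'. iQ (jS s \<odot>\<^bsub>Q\<^esub> x))"
    have h: "h \<in> lmod_hom S S' Q'"
      unfolding h_def using x
      by (intro restrict_lmod_hom[OF S'(1)] lhomI)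
        (simp_all add: icl jcl iadd jadd ism jsm X.smult_closed X.smult_l_distr X.smult_assoc left_module.smult_closed[OF Q'(1)])
    define k where "k = (\<lambda>y\<in>carrier P'. iR (a (jP y) x))"
    have k: "k \<in> lmod_hom R P' R'"
      unfolding k_def using x
      by (intro restrict_lmod_hom[OF P'(1)] lhomI)
        (simp_all add: icl jcl iadd jadd ism jsm a_closed a_add_l a_smult)
    note hl = lmod_homD[OF h] and kl = lmod_homD[OF k]
    let ?f1 = "E Q' R' g1"
    note f1 = E[OF Q'(1) R'(1) g1]
    \<comment> \<open>Both maps send z \<otimes> s to a(z, s x). Transposing this equality, with
      naturality in either variable, gives \<open>g1\<close> after h equal to Q \<otimes> k after g;
      at 1 this reads x \<otimes> 1 = \<Sum> q_i \<otimes> a(p_i, x).\<close>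
    have "compose (carrier (?F S')) ?f1 (tensor_map S P S' Q' h) = compose (carrier (?F S')) k f0"
    proof (rule tensor_lmod_hom_eqI[OF PS.tensor_pair_axioms R'(1)])
      show "compose (carrier (?F S')) ?f1 (tensor_map S P S' Q' h) \<in> lmod_hom R (?F S') R'"
        unfolding compose_def
        by (rule restrict_lmod_hom[OF PS.L_left lhom_comp[OF lhom_tensor_map[OF PS.tensor_pair_axioms Q'(1) hl] lmod_homD[OF f1(1)]]])
      show "compose (carrier (?F S')) k f0 \<in> lmod_hom R (?F S') R'"
        unfolding compose_def by (rule restrict_lmod_hom[OF PS.L_left lhom_comp[OF lmod_homD[OF f0] kl]])
      fix z s assume z: "z \<in> carrier P" and s: "s \<in> carrier S'"
      have js: "jS s \<odot>\<^bsub>Q\<^esub> x \<in> carrier Q" using s x by (simp add: X.smult_closed jcl)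
      have hs: "h s = iQ (jS s \<odot>\<^bsub>Q\<^esub> x)" using s by (simp add: h_def)
      have g1s: "g1 (h s) = QR.pt (jS s \<odot>\<^bsub>Q\<^esub> x) (iR \<one>\<^bsub>R\<^esub>)" using js by (simp add: g1_def hs icl ji)
      have ac: "a z (jS s \<odot>\<^bsub>Q\<^esub> x) \<in> carrier R" by (rule a_closed[OF z js])
      have "compose (carrier (?F S')) ?f1 (tensor_map S P S' Q' h) (PS.pt z s) = ?f1 (PQ.pt z (h s))"
        using z s by (simp add: compose_eq PS.pt_closed tensor_map_pure[OF PS.tensor_pair_axioms Q'(1) hl])
      also have "\<dots> = inner R' z (g1 (h s))" by (rule f1(2)[OF z lhom_closed[OF hl s]])
      also have "\<dots> = a z (jS s \<odot>\<^bsub>Q\<^esub> x) \<odot>\<^bsub>R'\<^esub> iR \<one>\<^bsub>R\<^esub>" unfolding g1s by (rule inner_pt[OF R'(1) z js oneR])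
      also have "\<dots> = iR (a z (jS s \<odot>\<^bsub>Q\<^esub> x))" using ism(1)[OF ac eR] ac by (simp add: e1)
      also have "\<dots> = k (f0 (PS.pt z s))"
        using z s x by (simp add: f0_pt k_def jcl icl rP ji a_balanced)
      finally show "compose (carrier (?F S')) ?f1 (tensor_map S P S' Q' h) (PS.pt z s) = compose (carrier (?F S')) k f0 (PS.pt z s)"
        using z s by (simp add: compose_eq PS.pt_closed)
    qed
    then have "compose (carrier S') (\<phi> Q' R' ?f1) h = compose (carrier S') (tensor_map R Q P' R' k) g"
      using nat1[OF Q'(1) S'(1) R'(1) h f1(1)] nat2[OF S'(1) P'(1) R'(1) k f0] by (simp add: g_def)
    moreover have "\<phi> Q' R' ?f1 = g1" using counit[OF Q'(1) R'(1) g1] by (simp add: E_def)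
    ultimately have "compose (carrier S') g1 h (iS \<one>\<^bsub>S\<^esub>) = compose (carrier S') (tensor_map R Q P' R' k) g (iS \<one>\<^bsub>S\<^esub>)" by simp
    then have "QR.pt x (iR \<one>\<^bsub>R\<^esub>) = tensor_map R Q P' R' k w"
      using one x by (simp add: compose_eq w_def g1_def h_def ji icl X.smult_one eS)
    also have "\<dots> = finsum QR.T (\<lambda>i. tensor_map R Q P' R' k (QP.pt (q i) (y i))) {..<n}"
      unfolding qy(3)
    proof (rule addhom_finsum[OF QP.T_ag QR.T_ag _ ptQP])
      show "addhom QP.T QR.T (tensor_map R Q P' R' k)"
        using lhom_addhom[OF lhom_tensor_map[OF QP.tensor_pair_axioms R'(1) kl]] by (simp add: addhom_def)
    qed
    also have "\<dots> = finsum QR.T (\<lambda>i. QR.pt (q i) (iR (a (p i) x))) {..<n}"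
    proof (rule QR.T.finsum_cong')
      show "(\<lambda>i. QR.pt (q i) (iR (a (p i) x))) \<in> {..<n} \<rightarrow> carrier QR.T"
        using qy(1) p x by (auto intro!: QR.pt_closed icl a_closed)
      show "tensor_map R Q P' R' k (QP.pt (q i) (y i)) = QR.pt (q i) (iR (a (p i) x))" if "i \<in> {..<n}" for i
        using that qy(1,2) by (simp add: tensor_map_pure[OF QP.tensor_pair_axioms R'(1) kl], simp add: k_def p_def)
    qed simp
    finally have eq: "QR.pt x (iR \<one>\<^bsub>R\<^esub>) = finsum QR.T (\<lambda>i. QR.pt (q i) (iR (a (p i) x))) {..<n}" .
    \<comment> \<open>The canonical map Q \<otimes> R \<rightarrow> Q turns the equation between
      tensors into the expansion of x.\<close>
    let ?\<gamma> = "\<lambda>q r. rsmult Q q (jR r)"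
    have \<gamma>: "balanced R Q R' Q ?\<gamma>"
      unfolding balanced_def by (auto intro!: addhomI simp: jcl jadd jsm rQ mR)
    note lp = QR.lift_pt[OF X.M_ag \<gamma>]
    have "x = tensor_lift Q ?\<gamma> (QR.pt x (iR \<one>\<^bsub>R\<^esub>))" using lp[OF x oneR] x by (simp add: ji rQ eR)
    also have "\<dots> = finsum Q (\<lambda>i. tensor_lift Q ?\<gamma> (QR.pt (q i) (iR (a (p i) x)))) {..<n}"
      unfolding eq by (rule addhom_finsum[OF QR.T_ag X.M_ag QR.lift_addhom[OF X.M_ag \<gamma>]])
        (use qy p x in \<open>auto simp: QR.pt_closed icl a_closed\<close>)
    also have "\<dots> = finsum Q (\<lambda>i. rsmult Q (q i) (a (p i) x)) {..<n}"
      by (rule X.finsum_cong') (use qy p x in \<open>auto simp: lp icl a_closed ji rQ\<close>)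
    finally show ?thesis by simp
  qed
  have "dual_pair R S P Q a n p q"
    by (intro dual_pair.intro[OF rR rS] dual_pair_axioms.intro)
      (simp_all add: bP bQ a_closed a_add_l a_add_r a_smult a_rsmult a_balanced p qy(1) u_expand v_expand)
  then show ?thesis by blast
qed

end

section \<open>Split epimorphisms and central projectivity\<close>

text \<open>Joins the dual pair obtained from one counit \<mu> on U \<otimes> V with the opposite
  counit \<nu> on V \<otimes> U. The section of \<nu> and the central elements live in V \<otimes>
  U.\<close>

locale form_pair = dual_pair R S U V "tensor_form.a S U V \<mu>" m u v + M: tensor_form R S U V \<mu> + N: tensor_form S R V U \<nu>
  for R :: "('r, 'a) ring_scheme" and S :: "('s, 'b) ring_scheme"
    and U :: "('r, 'u, 's, 'm) bimodule_scheme" and V :: "('s, 'v, 'r, 'n) bimodule_scheme"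
    and \<mu> \<nu> m u v
begin

lemma inner_rsmult_right:
  assumes x: "x \<in> carrier U" and w: "w \<in> carrier N.T" and s: "s \<in> carrier S"
  shows "M.inner U x (rsmult N.B w s) = rsmult U (M.inner U x w) s"
proof -
  note ih = M.inner_addhom[OF U_left x]
  have rs: "addhom U U (\<lambda>z. rsmult U z s)" using s by (intro addhomI) (simp_all add: bimod_rules[OF U])
  show ?thesis
    using N.addhom_eq[OF left_module_ag[OF U_left] addhom_comp[OF N.rsmult_add[OF s] ih] addhom_comp[OF ih rs] w] x s
    by (simp add: N.rsmult_pt M.inner_pt[OF U_left] bimod_rules[OF U] M.a_closed)
qed

definition central :: "('v, 'u) tensor \<Rightarrow> bool"
  where "central w \<longleftrightarrow> w \<in> carrier N.T \<and> (\<forall>s\<in>carrier S. s \<odot>\<^bsub>N.L\<^esub> w = rsmult N.B w s)"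

text \<open>Contraction against w is R-linear in x. It turns x s into the left action of s on w and
  a right action on w into one on the value, so centrality of w gives an endomorphism of the
  bimodule U.\<close>

lemma inner_central:
  assumes w: "central w"
  shows "lhom R U U (\<lambda>x. M.inner U x w)"
    and "x \<in> carrier U \<Longrightarrow> s \<in> carrier S \<Longrightarrow> M.inner U (rsmult U x s) w = rsmult U (M.inner U x w) s"
proof -
  have wT: "w \<in> carrier N.T" using w by (simp add: central_def)
  show "lhom R U U (\<lambda>x. M.inner U x w)"
    using wT by (intro lhomI) (simp_all add: M.inner_closed[OF U_left] M.inner_add[OF U_left] M.inner_smult[OF U_left])
  show "M.inner U (rsmult U x s) w = rsmult U (M.inner U x w) s" if "x \<in> carrier U" "s \<in> carrier S"
    using w that wT by (simp add: M.inner_rsmult[OF U_left] central_def inner_rsmult_right)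
qed

text \<open>The section supplies a central element t with \<nu>(t) = 1, whereas a split dual pair
  requires value 1 at \<Sum> v_j \<otimes> u_j. Twisting by the endomorphism \<tau> = contraction
  with t repairs this: \<pi>(y, x) = \<nu>(y \<otimes> \<tau>(x)) has total value \<nu>(t). The
  second claim comes from writing t as a sum of pure tensors.\<close>

lemma split_of_section:
  assumes \<sigma>: "\<sigma> \<in> bimod_hom S S (regular_bimod S) N.B" "\<And>s. s \<in> carrier S \<Longrightarrow> \<nu> (\<sigma> s) = s"
  shows "\<exists>\<pi>. split_dual_pair R S U V M.a m u v \<pi>"
    and "\<exists>n c d. (\<forall>i<(n::nat). c i \<in> carrier V \<and> d i \<in> carrier U) \<and> finsum S (\<lambda>i. N.a (c i) (d i)) {..<n} = \<one>\<^bsub>S\<^esub>"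
proof -
  define t where "t = \<sigma> \<one>\<^bsub>S\<^esub>"
  have \<sigma>l: "lhom S (regular_bimod S) N.B \<sigma>" using \<sigma>(1) lmod_homD by (auto simp: bimod_hom_def)
  have t: "t \<in> carrier N.T" using lhom_closed[OF \<sigma>l, of "\<one>\<^bsub>S\<^esub>"] by (simp add: t_def)
  have \<nu>t: "\<nu> t = \<one>\<^bsub>S\<^esub>" by (simp add: t_def \<sigma>(2))
  have ct: "central t"
    unfolding central_def
  proof (intro conjI ballI t)
    fix s assume s: "s \<in> carrier S"
    have \<sigma>r: "\<sigma> (x \<otimes>\<^bsub>S\<^esub> s) = rsmult N.B (\<sigma> x) s" if "x \<in> carrier S" for x
      using \<sigma>(1) s that by (simp add: bimod_hom_def)
    have "s \<odot>\<^bsub>N.L\<^esub> t = \<sigma> s" using lhom_smult[OF \<sigma>l s, of "\<one>\<^bsub>S\<^esub>"] s by (simp add: t_def)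
    moreover have "rsmult N.B t s = \<sigma> s" using \<sigma>r[of "\<one>\<^bsub>S\<^esub>"] s by (simp add: t_def)
    ultimately show "s \<odot>\<^bsub>N.L\<^esub> t = rsmult N.B t s" by simp
  qed
  define \<tau> where "\<tau> = (\<lambda>x. M.inner U x t)"
  have \<tau>l: "lhom R U U \<tau>" and \<tau>r: "\<And>x s. x \<in> carrier U \<Longrightarrow> s \<in> carrier S \<Longrightarrow> \<tau> (rsmult U x s) = rsmult U (\<tau> x) s"
    unfolding \<tau>_def by (rule inner_central(1)[OF ct], rule inner_central(2)[OF ct])
  note \<tau>c = lhom_closed[OF \<tau>l]
  \<comment> \<open>This is \<nu> of \<Sum> v_j \<otimes> (contraction of u_j with w). That sum is w
    again, by expansion in the v_j, so h agrees with \<nu> on pure tensors and hence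
    everywhere.\<close>
  define h where "h = (\<lambda>w. finsum S (\<lambda>j. N.a (v j) (M.inner U (u j) w)) {..<m})"
  have hc: "N.a (v j) (M.inner U (u j) w) \<in> carrier S" if "j < m" "w \<in> carrier N.T" for j w
    using that by (intro N.a_closed v_closed M.inner_closed[OF U_left] u_closed)
  have "h t = \<nu> t"
  proof (rule N.addhom_eq[OF _ _ N.\<nu>_addhom t])
    show "abelian_group S" by (rule S.abelian_group_axioms)
    show "addhom N.T S h"
    proof (rule addhomI)
      show "h w \<in> carrier S" if "w \<in> carrier N.T" for w
        unfolding h_def using that hc by (intro S.finsum_closed) auto
      fix w w' assume w: "w \<in> carrier N.T" "w' \<in> carrier N.T"
      have "h (w \<oplus>\<^bsub>N.T\<^esub> w') = finsum S (\<lambda>j. N.a (v j) (M.inner U (u j) w) \<oplus>\<^bsub>S\<^esub> N.a (v j) (M.inner U (u j) w')) {..<m}"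
        unfolding h_def
        by (rule S.finsum_cong')
          (use w hc in \<open>auto simp: addhom_add[OF M.inner_addhom[OF U_left]] u_closed v_closed N.a_add_r M.inner_closed[OF U_left]\<close>)
      also have "\<dots> = h w \<oplus>\<^bsub>S\<^esub> h w'"
        unfolding h_def by (rule S.finsum_addf) (use w hc in auto)
      finally show "h (w \<oplus>\<^bsub>N.T\<^esub> w') = h w \<oplus>\<^bsub>S\<^esub> h w'" .
    qed
    fix y x assume y: "y \<in> carrier V" and x: "x \<in> carrier U"
    have yl: "addhom V S (\<lambda>y. N.a y x)" using x by (intro addhomI) (simp_all add: N.a_closed N.a_add_l)
    have vc: "rsmult V (v j) (M.a (u j) y) \<in> carrier V" if "j < m" for j
      using that y by (intro rsmult_closed[OF V] v_closed M.a_closed u_closed)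
    have "h (N.pt y x) = finsum S (\<lambda>j. N.a (rsmult V (v j) (M.a (u j) y)) x) {..<m}"
      unfolding h_def
      by (rule S.finsum_cong')
        (use x y vc in \<open>auto simp: M.inner_pt[OF U_left] u_closed v_closed N.a_closed N.a_balanced M.a_closed left_module.smult_closed[OF U_left]\<close>)
    also have "\<dots> = N.a (finsum V (\<lambda>j. rsmult V (v j) (M.a (u j) y)) {..<m}) x"
      by (rule addhom_finsum[OF left_module_ag[OF V_left] S.abelian_group_axioms yl, symmetric]) (use vc in auto)
    also have "\<dots> = \<nu> (N.pt y x)" by (simp add: v_expand[OF y] N.a_def)
    finally show "h (N.pt y x) = \<nu> (N.pt y x)" .
  qed
  then have one: "finsum S (\<lambda>j. N.a (v j) (\<tau> (u j))) {..<m} = \<one>\<^bsub>S\<^esub>" by (simp add: h_def \<tau>_def \<nu>t)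
  have "split_dual_pair R S U V M.a m u v (\<lambda>y x. N.a y (\<tau> x))"
    by (intro split_dual_pair.intro paired_dual_pair.intro dual_pair_axioms paired_dual_pair_axioms.intro split_dual_pair_axioms.intro one)
      (simp_all add: N.a_closed \<tau>c N.a_add_l N.a_add_r lhom_add[OF \<tau>l] N.a_smult N.a_rsmult \<tau>r N.a_balanced lhom_smult[OF \<tau>l])
  then show "\<exists>\<pi>. split_dual_pair R S U V M.a m u v \<pi>" by blast
  obtain n :: nat and c d where cd: "\<forall>i<n. c i \<in> carrier V \<and> d i \<in> carrier U"
    "t = finsum N.T (\<lambda>i. N.pt (c i) (d i)) {..<n}" using N.tensor_sum[OF t] by blast
  have "\<nu> t = finsum S (\<lambda>i. \<nu> (N.pt (c i) (d i))) {..<n}"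
    unfolding cd(2) by (rule addhom_finsum[OF N.T_ag S.abelian_group_axioms N.\<nu>_addhom]) (use cd(1) N.pt_closed in auto)
  then show "\<exists>n c d. (\<forall>i<(n::nat). c i \<in> carrier V \<and> d i \<in> carrier U) \<and> finsum S (\<lambda>i. N.a (c i) (d i)) {..<n} = \<one>\<^bsub>S\<^esub>"
    using cd(1) \<nu>t by (intro exI[of _ n] exI[of _ c] exI[of _ d]) (simp add: N.a_def)
qed

text \<open>The embedding of V \<otimes> U into S^n has coordinates \<gamma>_r, and preimages of the
  unit vectors give central elements e_r with z = \<Sum> \<gamma>_r(z) e_r. Contracting x against
  this expansion of y \<otimes> w gives the equation of \<open>central_add\<close>, with \<tau>_r
  the contraction against e_r and \<alpha>_r(y, w) = \<gamma>_r(y \<otimes> w).\<close>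

lemma central_add_of_centrally_projective:
  assumes "centrally_projective S N.B"
  shows "central_add"
proof -
  obtain n :: nat and N' :: "('s, nat \<Rightarrow> 's, 's) bimodule" and f where N': "is_bimodule S S N'"
    and f: "f \<in> bimod_hom S S (bimod_sum N.B N') (bimod_power n (regular_bimod S))"
      "bij_betw f (carrier (bimod_sum N.B N')) (carrier (bimod_power n (regular_bimod S)))"
    using assms unfolding centrally_projective_def in_add_bimod_def bimod_iso_def by blast
  let ?Z = "bimod_sum N.B N'" and ?W = "bimod_power n (regular_bimod S)"
  interpret N': left_module S N' by (rule bimodule_left[OF N'])
  have Z [simp]: "carrier ?Z = carrier N.T \<times> carrier N'" "x \<oplus>\<^bsub>?Z\<^esub> y = (fst x \<oplus>\<^bsub>N.T\<^esub> fst y, snd x \<oplus>\<^bsub>N'\<^esub> snd y)"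
    "s \<odot>\<^bsub>?Z\<^esub> x = (s \<odot>\<^bsub>N.L\<^esub> fst x, s \<odot>\<^bsub>N'\<^esub> snd x)" "rsmult ?Z x s = (rsmult N.B (fst x) s, rsmult N' (snd x) s)" for x y s
    by (auto simp: bimod_sum_def)
  have W [simp]: "carrier ?W = {..<n} \<rightarrow>\<^sub>E carrier S" "x \<oplus>\<^bsub>?W\<^esub> y = (\<lambda>i\<in>{..<n}. x i \<oplus>\<^bsub>S\<^esub> y i)"
    "s \<odot>\<^bsub>?W\<^esub> x = (\<lambda>i\<in>{..<n}. s \<otimes>\<^bsub>S\<^esub> x i)" "rsmult ?W x s = (\<lambda>i\<in>{..<n}. x i \<otimes>\<^bsub>S\<^esub> s)" for x y s
    by (auto simp: bimod_power_def)
  have Zag: "abelian_group ?Z"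
    by (rule abelian_group_cong[OF left_module_ag[OF left_module_lmod_sum[OF N.L_left bimodule_left[OF N']]]])
      (auto simp: bimod_sum_def lmod_sum_def)
  have fl: "lhom S ?Z ?W f" using f(1) lmod_homD by (auto simp: bimod_hom_def)
  have fr: "f (rsmult ?Z z s) = rsmult ?W (f z) s" if "z \<in> carrier ?Z" "s \<in> carrier S" for z s
    using f(1) that unfolding bimod_hom_def by blast
  have fc: "f z i \<in> carrier S" if "z \<in> carrier ?Z" "i < n" for z i
    using lhom_closed[OF fl that(1)] that(2) by auto
  have rz: "rsmult N' \<zero>\<^bsub>N'\<^esub> s = \<zero>\<^bsub>N'\<^esub>" if "s \<in> carrier S" for s
    using addhom_zero[OF N'.M_ag N'.M_ag, of "\<lambda>x. rsmult N' x s"] that by (simp add: addhom_def bimod_rules[OF N'])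
  define \<gamma> where "\<gamma> r z = f (z, \<zero>\<^bsub>N'\<^esub>) r" for r z
  have \<gamma>c: "\<gamma> r z \<in> carrier S" if "r < n" "z \<in> carrier N.T" for r z using fc that by (simp add: \<gamma>_def)
  have \<gamma>a: "\<gamma> r (z \<oplus>\<^bsub>N.T\<^esub> z') = \<gamma> r z \<oplus>\<^bsub>S\<^esub> \<gamma> r z'" if "r < n" "z \<in> carrier N.T" "z' \<in> carrier N.T" for r z z'
    using lhom_add[OF fl, of "(z, \<zero>\<^bsub>N'\<^esub>)" "(z', \<zero>\<^bsub>N'\<^esub>)"] that by (simp add: \<gamma>_def)
  have \<gamma>s: "\<gamma> r (s \<odot>\<^bsub>N.L\<^esub> z) = s \<otimes>\<^bsub>S\<^esub> \<gamma> r z" if "r < n" "z \<in> carrier N.T" "s \<in> carrier S" for r s z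
    using lhom_smult[OF fl that(3), of "(z, \<zero>\<^bsub>N'\<^esub>)"] that by (simp add: \<gamma>_def)
  have \<gamma>r: "\<gamma> r (rsmult N.B z s) = \<gamma> r z \<otimes>\<^bsub>S\<^esub> s" if "r < n" "z \<in> carrier N.T" "s \<in> carrier S" for r s z
    using fr[OF _ that(3), of "(z, \<zero>\<^bsub>N'\<^esub>)"] that by (simp add: \<gamma>_def rz)
  let ?\<delta> = "\<lambda>r. \<lambda>i\<in>{..<n}. if i = r then \<one>\<^bsub>S\<^esub> else \<zero>\<^bsub>S\<^esub>"
  \<comment> \<open>Unit vectors of S^n are central, and injectivity of f transfers this to their
    preimages; projecting to V \<otimes> U keeps it.\<close>
  define e where "e r = (SOME z. z \<in> carrier ?Z \<and> f z = ?\<delta> r)" for r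
  have "e r \<in> carrier ?Z \<and> f (e r) = ?\<delta> r" for r
  proof -
    have "?\<delta> r \<in> carrier ?W" by simp
    then have "?\<delta> r \<in> f ` carrier ?Z" unfolding bij_betw_imp_surj_on[OF f(2)] .
    then obtain z where z: "?\<delta> r = f z" "z \<in> carrier ?Z" by (rule imageE)
    show ?thesis unfolding e_def by (rule someI[of _ z]) (intro conjI z(2) z(1)[symmetric])
  qed
  then have e: "\<And>r. e r \<in> carrier ?Z" "\<And>r. f (e r) = ?\<delta> r" by simp_all
  have eT: "fst (e r) \<in> carrier N.T" "snd (e r) \<in> carrier N'" for r using e(1)[of r] by auto
  have sT: "s \<odot>\<^bsub>N.L\<^esub> z \<in> carrier N.T" if "s \<in> carrier S" "z \<in> carrier N.T" for s z
    using addhom_closed[OF N.smult_add] that .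
  have rT: "rsmult N.B z s \<in> carrier N.T" if "s \<in> carrier S" "z \<in> carrier N.T" for s z
    using addhom_closed[OF N.rsmult_add] that .
  have c: "central (fst (e r))" for r
    unfolding central_def
  proof (intro conjI ballI eT)
    fix s assume s: "s \<in> carrier S"
    have "f (s \<odot>\<^bsub>?Z\<^esub> e r) = f (rsmult ?Z (e r) s)"
      unfolding lhom_smult[OF fl s e(1)] fr[OF e(1) s] e(2) using s by (auto intro!: restrict_ext)
    then have "s \<odot>\<^bsub>?Z\<^esub> e r = rsmult ?Z (e r) s"
      by (rule inj_onD[OF bij_betw_imp_inj_on[OF f(2)]])
        (use s eT in \<open>simp_all add: sT rT N'.smult_closed rsmult_closed[OF N']\<close>)
    then show "s \<odot>\<^bsub>N.L\<^esub> fst (e r) = rsmult N.B (fst (e r)) s" by simp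
  qed
  have expand: "z = finsum N.T (\<lambda>r. \<gamma> r z \<odot>\<^bsub>N.L\<^esub> fst (e r)) {..<n}" if z: "z \<in> carrier N.T" for z
  proof -
    let ?g = "\<lambda>r. \<gamma> r z \<odot>\<^bsub>?Z\<^esub> e r"
    have g: "?g \<in> {..<n} \<rightarrow> carrier ?Z" using \<gamma>c[OF _ z] eT by (simp add: sT N'.smult_closed)
    have gZ: "finsum ?Z ?g {..<n} \<in> carrier ?Z" by (rule abelian_monoid.finsum_closed[OF abelian_group.axioms(1)[OF Zag] g])
    have "f (finsum ?Z ?g {..<n}) i = f (z, \<zero>\<^bsub>N'\<^esub>) i" if i: "i < n" for i
    proof -
      have fi: "addhom ?Z S (\<lambda>z. f z i)"
        using fc[OF _ i] lhom_add[OF fl] i by (intro addhomI) auto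
      have "f (finsum ?Z ?g {..<n}) i = finsum S (\<lambda>r. f (?g r) i) {..<n}"
        by (rule addhom_finsum[OF Zag S.abelian_group_axioms fi g])
      also have "\<dots> = f (?g i) i"
        by (rule S.finsum_delta)
          (use i \<gamma>c[OF _ z] in \<open>auto simp del: Z simp: lhom_smult[OF fl _ e(1)] e(2)\<close>)
      also have "\<dots> = \<gamma> i z" using i \<gamma>c[OF i z] by (simp del: Z add: lhom_smult[OF fl _ e(1)] e(2))
      finally show ?thesis by (simp add: \<gamma>_def)
    qed
    then have "f (finsum ?Z ?g {..<n}) = f (z, \<zero>\<^bsub>N'\<^esub>)"
      using lhom_closed[OF fl gZ] lhom_closed[OF fl, of "(z, \<zero>\<^bsub>N'\<^esub>)"] z
      by (intro PiE_ext[of _ "{..<n}" "\<lambda>_. carrier S"]) auto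
    then have eq: "finsum ?Z ?g {..<n} = (z, \<zero>\<^bsub>N'\<^esub>)"
      by (rule inj_onD[OF bij_betw_imp_inj_on[OF f(2)] _ gZ]) (use z in simp)
    have "addhom ?Z N.T fst" by (rule addhomI) auto
    from addhom_finsum[OF Zag N.T_ag this g] show ?thesis unfolding eq by simp
  qed
  have p: "paired_dual_pair R S U V M.a m u v (\<lambda>y w. \<gamma> r (N.pt y w))" if r: "r < n" for r
    by (intro paired_dual_pair.intro dual_pair_axioms paired_dual_pair_axioms.intro)
      (use r in \<open>simp_all add: \<gamma>c N.pt_closed N.pt_add_l N.pt_add_r \<gamma>a \<gamma>s[symmetric] \<gamma>r[symmetric] N.smult_pt N.rsmult_pt N.pt_balanced\<close>)
  have s: "finsum U (\<lambda>r. rsmult U (M.inner U x (fst (e r))) (\<gamma> r (N.pt y w))) {..<n} = M.a x y \<odot>\<^bsub>U\<^esub> w"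
    if x: "x \<in> carrier U" and y: "y \<in> carrier V" and w: "w \<in> carrier U" for x y w
  proof -
    interpret Um: left_module R U by (rule U_left)
    let ?z = "N.pt y w"
    have z: "?z \<in> carrier N.T" by (rule N.pt_closed[OF y w])
    note ih = M.inner_addhom[OF U_left x]
    have "M.a x y \<odot>\<^bsub>U\<^esub> w = M.inner U x ?z" using x y w by (simp add: M.inner_pt[OF U_left])
    also have "\<dots> = M.inner U x (finsum N.T (\<lambda>r. \<gamma> r ?z \<odot>\<^bsub>N.L\<^esub> fst (e r)) {..<n})" using expand[OF z] by simp
    also have "\<dots> = finsum U (\<lambda>r. M.inner U x (\<gamma> r ?z \<odot>\<^bsub>N.L\<^esub> fst (e r))) {..<n}"
      by (rule addhom_finsum[OF N.T_ag left_module_ag[OF U_left] ih]) (use \<gamma>c[OF _ z] eT sT in auto)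
    also have "\<dots> = finsum U (\<lambda>r. rsmult U (M.inner U x (fst (e r))) (\<gamma> r ?z)) {..<n}"
    proof (rule abelian_monoid.finsum_cong'[OF abelian_group.axioms(1)[OF left_module_ag[OF U_left]]])
      show "(\<lambda>r. rsmult U (M.inner U x (fst (e r))) (\<gamma> r ?z)) \<in> {..<n} \<rightarrow> carrier U"
        using \<gamma>c[OF _ z] eT x by (auto intro!: rsmult_closed[OF U] M.inner_closed[OF U_left])
      show "M.inner U x (\<gamma> r ?z \<odot>\<^bsub>N.L\<^esub> fst (e r)) = rsmult U (M.inner U x (fst (e r))) (\<gamma> r ?z)" if "r \<in> {..<n}" for r
        using c[of r] \<gamma>c[OF _ z, of r] that inner_rsmult_right[OF x eT(1)] by (simp add: central_def)
    qed simp
    finally show ?thesis by simp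
  qed
  show ?thesis
    unfolding central_add_def
  proof (intro exI conjI allI impI ballI)
    fix r assume "r < n"
    show "lhom R U U ((\<lambda>r x. M.inner U x (fst (e r))) r)" using inner_central(1)[OF c] by simp
    show "((\<lambda>r x. M.inner U x (fst (e r))) r) (rsmult U x s) = rsmult U (((\<lambda>r x. M.inner U x (fst (e r))) r) x) s"
      if "s \<in> carrier S" "x \<in> carrier U" for s x using inner_central(2)[OF c] that by simp
    show "paired_dual_pair R S U V M.a m u v ((\<lambda>r y w. \<gamma> r (N.pt y w)) r)" using p[OF \<open>r < n\<close>] by simp
  next
    fix x y w assume "x \<in> carrier U" "y \<in> carrier V" "w \<in> carrier U"
    then show "finsum U (\<lambda>r. rsmult U ((\<lambda>r x. M.inner U x (fst (e r))) r x) ((\<lambda>r y w. \<gamma> r (N.pt y w)) r y w)) {..<n} = M.a x y \<odot>\<^bsub>U\<^esub> w"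
      using s by simp
  qed
qed

end

section \<open>Representation dimension\<close>

lemma dual_in_add:
  fixes R :: "('k, 'r, 'a) module_scheme" and S :: "('l, 's, 'b) module_scheme"
  assumes dp: "dual_pair R S U V b m u v" and ca: "dual_pair.central_add R S U V b m u v"
    and dR: "algebra_duality kR JR W R" and dS: "algebra_duality kS JS W' S"
    and st: "\<forall>i<n. t i \<in> carrier U \<and> s i \<in> carrier V"
    and one: "finsum R (\<lambda>i. b (t i) (s i)) {..<n::nat} = \<one>\<^bsub>R\<^esub>"
  shows "in_add S (dual_of_algebra kS JS S) (hom_mod R U (dual_of_algebra kR JR R))"
proof -
  interpret dual_pair R S U V b m u v by (rule dp)
  interpret DR: algebra_duality kR JR W R by (rule dR)
  interpret DS: algebra_duality kS JS W' S by (rule dS)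
  have "in_add R (hom_mod S V DS.D) DR.D" by (rule in_add_dual[OF dp dR dS _ one]) (use st in blast)
  then have "in_add S (hom_mod R U (hom_mod S V DS.D)) (hom_mod R U DR.D)"
    by (rule in_add_hom_mod[OF U S.ring_axioms DR.D_left])
  then show ?thesis
    by (rule in_add_trans[OF DS.D_left left_module_F[OF left_module_G[OF DS.D_left]] left_module_F[OF DR.D_left]
          in_add_FG[OF ca DS.D_left]])
qed

lemma in_add_summands:
  assumes lm: "left_module R M" "left_module R N" and Y: "left_module R Y"
  shows "in_add R M Y \<Longrightarrow> in_add R (lmod_sum M N) Y" "in_add R N Y \<Longrightarrow> in_add R (lmod_sum M N) Y"
proof -
  interpret M: left_module R M by fact
  interpret N: left_module R N by fact
  note S = left_module_lmod_sum[OF lm] and sm = lhom_sum_maps[OF lm]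
  have "in_add R (lmod_sum M N) M" by (rule retr_in_add[OF lm(1)]) (auto simp: retr_def intro: sm)
  then show "in_add R M Y \<Longrightarrow> in_add R (lmod_sum M N) Y" by (rule in_add_trans[OF S lm(1) Y])
  have "in_add R (lmod_sum M N) N" by (rule retr_in_add[OF lm(2)]) (auto simp: retr_def intro: sm)
  then show "in_add R N Y \<Longrightarrow> in_add R (lmod_sum M N) Y" by (rule in_add_trans[OF S lm(2) Y])
qed

lemma in_add_hom_mod_generator:
  assumes P: "is_bimodule R S P" and S: "ring S"
    and M: "left_module R M1" "left_module R M2" "left_module R M3"
    and N: "left_module S N1" "left_module S N2" "left_module S N3"
    and i: "in_add S N1 (hom_mod R P M1)" "in_add S N2 (hom_mod R P M2)" "in_add S N3 (hom_mod R P M3)"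
  shows "in_add S (lmod_sum N1 (lmod_sum N2 N3)) (hom_mod R P (lmod_sum M1 (lmod_sum M2 M3)))"
proof -
  note lN = left_module_lmod_sum[OF N(2,3)] and F = left_module_hom_mod[OF P S]
  note s = in_add_summands[OF N(1) lN] and s' = in_add_summands[OF N(2,3)]
  show ?thesis
    by (rule in_add_hom_mod_sum[OF P S M(1) left_module_lmod_sum[OF M(2,3)] left_module_lmod_sum[OF N(1) lN]
          s(1)[OF F[OF M(1)] i(1)] in_add_hom_mod_sum[OF P S M(2,3) left_module_lmod_sum[OF N(1) lN]
          s(2)[OF F[OF M(2)] s'(1)[OF F[OF M(2)] i(2)]] s(2)[OF F[OF M(3)] s'(2)[OF F[OF M(3)] i(3)]]]])
qed

text \<open>A module X competing for B is matched by a copy X' in 'u of Hom_B(Q, X), which is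
  finitely generated because P is. The two generators then satisfy the hypotheses of
  \<open>gldim_End_le\<close> summand by summand.\<close>

lemma repdim_le:
  fixes A :: "('k, 'a, 'm1) module_scheme" and B :: "('l, 'b, 'm2) module_scheme"
    and J\<^sub>k :: "('k, 'j1, 'n1) module_scheme" and J\<^sub>l :: "('l, 'j2, 'n2) module_scheme"
    and P :: "('a, 'p, 'b, 'm3) bimodule_scheme" and Q :: "('b, 'q, 'a, 'm4) bimodule_scheme"
  assumes inf: "infinite (UNIV :: 'u set)"
    and dA: "algebra_duality k J\<^sub>k W A" and dB: "algebra_duality l J\<^sub>l W' B"
    and sp: "split_dual_pair B A Q P b m u v \<pi>" and dp: "dual_pair A B P Q a n p q"
    and ca: "dual_pair.central_add A B P Q a n p q" and fg: "fin_gen A P"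
    and iA: "in_add A (dual_of_algebra k J\<^sub>k A) (hom_mod B Q (dual_of_algebra l J\<^sub>l B))"
    and iB: "in_add B (dual_of_algebra l J\<^sub>l B) (hom_mod A P (dual_of_algebra k J\<^sub>k A))"
  shows "repdim TYPE('u) k J\<^sub>k A \<le> repdim TYPE('u) l J\<^sub>l B"
proof -
  interpret DA: algebra_duality k J\<^sub>k W A by (rule dA)
  interpret DB: algebra_duality l J\<^sub>l W' B by (rule dB)
  interpret BA: split_dual_pair B A Q P b m u v \<pi> by (rule sp)
  interpret AB: dual_pair A B P Q a n p q by (rule dp)
  note rA = left_module_regular[OF DA.A_ring] and rB = left_module_regular[OF DB.A_ring]
  have ex: "\<exists>X' :: ('a, 'u) module. left_module A X' \<and> fin_gen A X' \<and>
      gldim TYPE('u) (End_ring A (lmod_sum (regular_bimod A) (lmod_sum DA.D X'))) \<le>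
      gldim TYPE('u) (End_ring B (lmod_sum (regular_bimod B) (lmod_sum DB.D X)))"
    if X: "left_module B X" "fin_gen B X" for X :: "('b, 'u) module"
  proof -
    note FX = BA.left_module_F[OF X(1)]
    have "carrier (hom_mod B Q X) \<lesssim> (UNIV :: 'u set)"
      by (rule BA.lepoll_hom_mod[OF X(1) subset_imp_lepoll[OF subset_UNIV] inf])
    then obtain f :: "('q \<Rightarrow> 'u) \<Rightarrow> 'u" where f: "inj_on f (carrier (hom_mod B Q X))" by (auto simp: lepoll_def)
    obtain X' :: "('a, 'u) module" and g where X': "left_module A X'" "carrier X' = f ` carrier (hom_mod B Q X)"
      "lhom A (hom_mod B Q X) X' f" "lhom A X' (hom_mod B Q X) g"
      "\<And>x. x \<in> carrier (hom_mod B Q X) \<Longrightarrow> g (f x) = x" "\<And>y. y \<in> carrier X' \<Longrightarrow> f (g y) = y"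
      using lmod_transport[OF FX f] by metis
    have fgX': "fin_gen A X'"
      by (rule fin_gen_surj[OF FX X'(1,3) X'(2)[symmetric] BA.fin_gen_hom_mod[OF X fg]])
    have FXX': "in_add A X' (hom_mod B Q X)"
      by (rule retr_in_add[OF FX]) (use X'(3-5) in \<open>auto simp: retr_def\<close>)
    have "in_add A (hom_mod B Q X) X'"
      by (rule retr_in_add[OF X'(1)]) (use X'(3,4,6) in \<open>auto simp: retr_def\<close>)
    \<comment> \<open>Applying G = Hom_A(P, -) to F X \<in> add(X') and composing with G F X \<in>
      add(X) shows G X' \<in> add(X): the copy behaves like F X in both directions.\<close>
    then have "in_add B (hom_mod A P (hom_mod B Q X)) (hom_mod A P X')"
      by (rule in_add_hom_mod[OF AB.U DB.A_ring X'(1)])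
    then have GX': "in_add B X (hom_mod A P X')"
      by (rule in_add_trans[OF X(1) AB.left_module_F[OF FX] AB.left_module_F[OF X'(1)] AB.in_add_FG[OF ca X(1)]])
    have "gldim TYPE('u) (End_ring A (lmod_sum (regular_bimod A) (lmod_sum DA.D X'))) \<le>
      gldim TYPE('u) (End_ring B (lmod_sum (regular_bimod B) (lmod_sum DB.D X)))"
    proof (rule BA.gldim_End_le[OF inf])
      show "in_add A (lmod_sum (regular_bimod A) (lmod_sum DA.D X'))
          (hom_mod B Q (lmod_sum (regular_bimod B) (lmod_sum DB.D X)))"
        by (rule in_add_hom_mod_generator[OF BA.U DA.A_ring rB DB.D_left X(1) rA DA.D_left X'(1)
              BA.in_add_regular_dual[OF dp] iA FXX'])
      show "in_add B (lmod_sum (regular_bimod B) (lmod_sum DB.D X))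
          (hom_mod A P (lmod_sum (regular_bimod A) (lmod_sum DA.D X')))"
        by (rule in_add_hom_mod_generator[OF AB.U DB.A_ring rA DA.D_left X'(1) rB DB.D_left X(1)
              AB.in_add_regular_dual[OF BA.dual_pair_axioms] iB GX'])
    qed (intro left_module_lmod_sum rA rB DA.D_left DB.D_left X(1) X'(1))+
    then show ?thesis using X'(1) fgX' by blast
  qed
  show ?thesis
    unfolding repdim_def[of _ l]
  proof (rule Inf_greatest)
    fix y assume "y \<in> {gldim TYPE('u) (End_ring B (lmod_sum (regular_bimod B) (lmod_sum DB.D X))) | X :: ('b, 'u) module.
        left_module B X \<and> fin_gen B X}"
    then obtain X :: "('b, 'u) module" where X: "left_module B X" "fin_gen B X"
      "y = gldim TYPE('u) (End_ring B (lmod_sum (regular_bimod B) (lmod_sum DB.D X)))" by blast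
    obtain X' :: "('a, 'u) module" where X': "left_module A X'" "fin_gen A X'"
      "gldim TYPE('u) (End_ring A (lmod_sum (regular_bimod A) (lmod_sum DA.D X'))) \<le> y"
      using ex[OF X(1,2)] unfolding X(3) by blast
    show "repdim TYPE('u) k J\<^sub>k A \<le> y"
      unfolding repdim_def by (rule Inf_lower2[OF _ X'(3)]) (use X'(1,2) in blast)
  qed
qed

theorem theorem1p2:
  fixes k :: "('k, 'q1) ring_scheme" and A :: "('k, 'a, 'm1) module_scheme"
    and l :: "('l, 'q2) ring_scheme" and B :: "('l, 'b, 'm2) module_scheme"
    and J\<^sub>k :: "('k, 'j1, 'n1) module_scheme" and J\<^sub>l :: "('l, 'j2, 'n2) module_scheme"
    and P :: "('a, 'p, 'b, 'm3) bimodule_scheme" and Q :: "('b, 'q, 'a, 'm4) bimodule_scheme"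
  assumes universe: "infinite (UNIV :: 'u set)"
      "carrier k \<lesssim> (UNIV :: 'u set)" "carrier l \<lesssim> (UNIV :: 'u set)"
      "carrier A \<lesssim> (UNIV :: 'u set)" "carrier B \<lesssim> (UNIV :: 'u set)"
    and A: "artin_algebra k A" and B: "artin_algebra l B"
    and J\<^sub>k: "duality_module TYPE('u) k J\<^sub>k" and J\<^sub>l: "duality_module TYPE('u) l J\<^sub>l"
    and equiv: "symmetric_separably_equivalent_by TYPE('u) A B P Q"
    and PQ: "centrally_projective A (tensor_bimod B P Q)"
    and QP: "centrally_projective B (tensor_bimod A Q P)"
  shows "repdim TYPE('u) k J\<^sub>k A = repdim TYPE('u) l J\<^sub>l B"
proof -
  obtain \<nu> \<mu> where \<nu>: "separably_divides_by A B P Q \<nu>" "adjoint_with_counit TYPE('u) A B P Q \<nu>"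
    and \<mu>: "separably_divides_by B A Q P \<mu>" "adjoint_with_counit TYPE('u) B A Q P \<mu>"
    using equiv unfolding symmetric_separably_equivalent_by_def symmetric_separably_divides_by_def by blast
  have bP: "is_bimodule A B P" and bQ: "is_bimodule B A Q" and fP: "fin_gen A P" and fQ: "fin_gen B Q"
    using \<nu>(1) by (auto simp: separably_divides_by_def fin_gen_proj_both_sides_def)
  have F\<nu>: "tensor_form A B P Q \<nu>" and F\<mu>: "tensor_form B A Q P \<mu>"
    using \<nu>(1) \<mu>(1) by (auto simp: separably_divides_by_def intro: tensor_form.intro)
  obtain \<sigma> where \<sigma>: "\<sigma> \<in> bimod_hom A A (regular_bimod A) (tensor_bimod B P Q)" "\<And>x. x \<in> carrier A \<Longrightarrow> \<nu> (\<sigma> x) = x"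
    using \<nu>(1) unfolding separably_divides_by_def by blast
  obtain \<rho> where \<rho>: "\<rho> \<in> bimod_hom B B (regular_bimod B) (tensor_bimod A Q P)" "\<And>x. x \<in> carrier B \<Longrightarrow> \<mu> (\<rho> x) = x"
    using \<mu>(1) unfolding separably_divides_by_def by blast
  \<comment> \<open>The adjunctions can be evaluated at P and Q only if these fit into 'u; finite
    generation over A and B ensures it.\<close>
  have cP: "carrier P \<lesssim> (UNIV :: 'u set)" by (rule fin_gen_lepoll[OF bimodule_left[OF bP] fP universe(4,1)])
  have cQ: "carrier Q \<lesssim> (UNIV :: 'u set)" by (rule fin_gen_lepoll[OF bimodule_left[OF bQ] fQ universe(5,1)])
  let ?a = "tensor_form.a B P Q \<nu>" and ?b = "tensor_form.a A Q P \<mu>"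
  obtain n p q where AB: "dual_pair A B P Q ?a n p q"
    using tensor_form.dual_pair_of_adjunction[OF F\<nu> \<nu>(2) universe(4,5) cP cQ] by blast
  obtain m u v where BA: "dual_pair B A Q P ?b m u v"
    using tensor_form.dual_pair_of_adjunction[OF F\<mu> \<mu>(2) universe(5,4) cQ cP] by blast
  interpret BA: form_pair B A Q P \<mu> \<nu> m u v by (intro form_pair.intro BA F\<mu> F\<nu>)
  interpret AB: form_pair A B P Q \<nu> \<mu> n p q by (intro form_pair.intro AB F\<mu> F\<nu>)
  have dA: "algebra_duality k J\<^sub>k TYPE('u) A" and dB: "algebra_duality l J\<^sub>l TYPE('u) B"
    using A B comm_artinianI J\<^sub>k J\<^sub>l universe(2,3)
    by (auto simp: artin_algebra_def intro!: algebra_duality.intro duality.intro duality_axioms.intro algebra_duality_axioms.intro)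
  \<comment> \<open>In \<open>BA\<close> the part of R is played by B, with U = Q and V = P, so its
    bimodule V \<otimes> U is P \<otimes> Q; in \<open>AB\<close> it is Q \<otimes> P.\<close>
  note caA = BA.central_add_of_centrally_projective[OF PQ] and caB = AB.central_add_of_centrally_projective[OF QP]
  obtain \<pi> where sA: "split_dual_pair B A Q P ?b m u v \<pi>" using BA.split_of_section(1)[OF \<sigma>] by blast
  obtain \<pi>' where sB: "split_dual_pair A B P Q ?a n p q \<pi>'" using AB.split_of_section(1)[OF \<rho>] by blast
  obtain i c d where oneA: "\<forall>j<(i::nat). c j \<in> carrier P \<and> d j \<in> carrier Q"
    "finsum A (\<lambda>j. ?a (c j) (d j)) {..<i} = \<one>\<^bsub>A\<^esub>" using BA.split_of_section(2)[OF \<sigma>] by blast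
  obtain i' c' d' where oneB: "\<forall>j<(i'::nat). c' j \<in> carrier Q \<and> d' j \<in> carrier P"
    "finsum B (\<lambda>j. ?b (c' j) (d' j)) {..<i'} = \<one>\<^bsub>B\<^esub>" using AB.split_of_section(2)[OF \<rho>] by blast
  \<comment> \<open>Each dual pair uses both sections: that of \<nu> makes \<open>BA\<close> split,
    while that of \<mu> writes 1 in B as a sum of values of the pairing of \<open>BA\<close>. For
    \<open>AB\<close> the roles are exchanged.\<close>
  note iA = dual_in_add[OF BA caA dB dA oneB] and iB = dual_in_add[OF AB caB dA dB oneA]
  show ?thesis
  proof (rule antisym)
    show "repdim TYPE('u) k J\<^sub>k A \<le> repdim TYPE('u) l J\<^sub>l B"
      by (rule repdim_le[OF universe(1) dA dB sA AB caB fP iA iB])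
    show "repdim TYPE('u) l J\<^sub>l B \<le> repdim TYPE('u) k J\<^sub>k A"
      by (rule repdim_le[OF universe(1) dB dA sB BA caA fQ iB iA])
  qed
qed

end
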